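(* Let $R$ be a ring and let $\sigma: R \to S$ be a ring morphism into a right artinian ring $S$. If $M \in S\text{-}\mathbf{Mod}$ is an fp-faithfully flat $S$-module, then $\mathrm{length}_{\sigma}$ detects being zero at $M_{|\sigma}$, i.e. for all $\mathcal{G} \in R\text{-}\mathbf{mod}\text{-}\mathbf{mod}$: $\mathrm{length}_{\sigma}(\mathcal{G}) = 0$ if and only if $\mathcal{G}(M_{|\sigma}) \cong 0$. In particular, $\mathrm{length}_{\sigma}$ detects being zero at $S_{|\sigma} \in R\text{-}\mathbf{Mod}$, i.e. at $S$ regarded as a left $R$-module via $\sigma$.
   Context: For a ring $R$, $R\text{-}\mathbf{Mod}$ (resp. $R\text{-}\mathbf{mod}$, $\mathbf{mod}\text{-}R$) denotes the category of all left (resp. finitely presented left, finitely presented right) $R$-modules. $R\text{-}\mathbf{mod}\text{-}\mathbf{mod}$ is the abelian category of finitely presented functors: additive functors $\mathcal{G}: R\text{-}\mathbf{mod} \to \mathbf{Ab}$ for which there is a morphism $\alpha: M \to N$ in $R\text{-}\mathbf{mod}$ and an exact sequence $\mathrm{Hom}(N,-) \xrightarrow{\mathrm{Hom}(\alpha,-)} \mathrm{Hom}(M,-) \to \mathcal{G} \to 0$ (a presentation of $\mathcal{G}$ given by $\alpha$). Such $\mathcal{G}$ is evaluated at an arbitrary $X \in R\text{-}\mathbf{Mod}$ by $\mathcal{G}(X) := \mathrm{coker}(\mathrm{Hom}_R(N,X) \to \mathrm{Hom}_R(M,X))$. For $M \in S\text{-}\mathbf{Mod}$, $M_{|\sigma}$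 is the left $R$-module obtained by restriction of scalars along $\sigma$. A module $M \in S\text{-}\mathbf{Mod}$ is fp-faithfully flat if it is flat and $(-\otimes_S M)$ is faithful on the category $\mathbf{mod}\text{-}S$ of finitely presented right $S$-modules. For a right coherent ring $S$, $\mathrm{Covdefect}: S\text{-}\mathbf{mod}\text{-}\mathbf{mod} \to \mathbf{mod}\text{-}S$ is the (up to natural isomorphism unique) exact functor with $(N \otimes_S -) \mapsto N$ naturally in $N \in \mathbf{mod}\text{-}S$. The exact functor $\sigma_{\ast}: R\text{-}\mathbf{mod}\text{-}\mathbf{mod} \to S\text{-}\mathbf{mod}\text{-}\mathbf{mod}$ sends a functor with presentation given by $\alpha: M \to N$ to the functor with presentation given by $S \otimes_R \alpha$. For $S$ right artinian (hence right coherent, and all finitely presented right $S$-modules have finite length) define $\mathrm{length}_{\sigma}(\mathcal{G}) := \mathrm{length}_S(\mathrm{Covdefect}(\sigma_{\ast}(\mathcal{G}))) \in \mathbb{Z}$; this is an additive invariant of $R\text{-}\mathbf{mod}\text{-}\mathbf{mod}$ (additive on short exact sequences). *)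

theory Defs
  imports "HOL-Algebra.Module" "HOL-Algebra.Free_Abelian_Groups" "HOL-Library.Extended_Nat"
begin

section \<open>Modules over noncommutative rings\<close>

text \<open>
  The record of \<^theory>\<open>HOL-Algebra.Module\<close> is reused; its locale assumes a commutative ring.
  A right module over \<open>R\<close> is a left module over the opposite ring, so that
  \<open>a \<odot> x\<close> is to be read as \<open>x \<cdot> a\<close>. The fields \<open>mult\<close> and \<open>one\<close> of a module record carry
  no meaning.
\<close>

locale left_module = R?: ring R + M?: abelian_group M
  for R :: "('a, 'e) ring_scheme" (structure) and M :: "('a, 'b, 'c) module_scheme" (structure) +
  assumes smult_closed:
      "\<lbrakk>a \<in> carrier R; x \<in> carrier M\<rbrakk> \<Longrightarrow> a \<odot>\<^bsub>M\<^esub> x \<in> carrier M"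
    and smult_l_distr:
      "\<lbrakk>a \<in> carrier R; b \<in> carrier R; x \<in> carrier M\<rbrakk> \<Longrightarrow>
        (a \<oplus>\<^bsub>R\<^esub> b) \<odot>\<^bsub>M\<^esub> x = a \<odot>\<^bsub>M\<^esub> x \<oplus>\<^bsub>M\<^esub> b \<odot>\<^bsub>M\<^esub> x"
    and smult_r_distr:
      "\<lbrakk>a \<in> carrier R; x \<in> carrier M; y \<in> carrier M\<rbrakk> \<Longrightarrow>
        a \<odot>\<^bsub>M\<^esub> (x \<oplus>\<^bsub>M\<^esub> y) = a \<odot>\<^bsub>M\<^esub> x \<oplus>\<^bsub>M\<^esub> a \<odot>\<^bsub>M\<^esub> y"
    and smult_assoc:
      "\<lbrakk>a \<in> carrier R; b \<in> carrier R; x \<in> carrier M\<rbrakk> \<Longrightarrow>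
        (a \<otimes>\<^bsub>R\<^esub> b) \<odot>\<^bsub>M\<^esub> x = a \<odot>\<^bsub>M\<^esub> (b \<odot>\<^bsub>M\<^esub> x)"
    and smult_one:
      "x \<in> carrier M \<Longrightarrow> \<one>\<^bsub>R\<^esub> \<odot>\<^bsub>M\<^esub> x = x"

definition opp :: "('a, 'e) ring_scheme \<Rightarrow> ('a, 'e) ring_scheme"
  where "opp R = R\<lparr>mult := \<lambda>a b. b \<otimes>\<^bsub>R\<^esub> a\<rparr>"

definition mk_module :: "'b set \<Rightarrow> ('b \<Rightarrow> 'b \<Rightarrow> 'b) \<Rightarrow> 'b \<Rightarrow> ('a \<Rightarrow> 'b \<Rightarrow> 'b) \<Rightarrow> ('a, 'b) module"
  where "mk_module A pl z sm =
    \<lparr>carrier = A, monoid.mult = undefined, monoid.one = undefined, ring.zero = z, ring.add = pl, smult = sm\<rparr>"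

definition regular_module :: "('a, 'e) ring_scheme \<Rightarrow> ('a, 'a) module"
  where "regular_module R = mk_module (carrier R) (ring.add R) \<zero>\<^bsub>R\<^esub> (monoid.mult R)"

definition free_module :: "('a, 'e) ring_scheme \<Rightarrow> nat \<Rightarrow> ('a, nat \<Rightarrow> 'a) module"
  where "free_module R n = mk_module ({..<n} \<rightarrow>\<^sub>E carrier R)
    (\<lambda>v w. \<lambda>i\<in>{..<n}. v i \<oplus>\<^bsub>R\<^esub> w i) (\<lambda>i\<in>{..<n}. \<zero>\<^bsub>R\<^esub>) (\<lambda>a v. \<lambda>i\<in>{..<n}. a \<otimes>\<^bsub>R\<^esub> v i)"

definition restrict_scalars :: "('r \<Rightarrow> 's) \<Rightarrow> ('s, 'b) module \<Rightarrow> ('r, 'b) module"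
  where "restrict_scalars \<sigma> M =
    mk_module (carrier M) (ring.add M) \<zero>\<^bsub>M\<^esub> (\<lambda>r x. \<sigma> r \<odot>\<^bsub>M\<^esub> x)"

text \<open>Morphisms are extensional functions, so that equality of morphisms is equality in HOL.\<close>

definition lin_hom :: "('a, 'e) ring_scheme \<Rightarrow> ('a, 'm) module \<Rightarrow> ('a, 'n) module \<Rightarrow> ('m \<Rightarrow> 'n) set"
  where "lin_hom R M N = {f \<in> carrier M \<rightarrow>\<^sub>E carrier N.
    (\<forall>x\<in>carrier M. \<forall>y\<in>carrier M. f (x \<oplus>\<^bsub>M\<^esub> y) = f x \<oplus>\<^bsub>N\<^esub> f y) \<and>
    (\<forall>a\<in>carrier R. \<forall>x\<in>carrier M. f (a \<odot>\<^bsub>M\<^esub> x) = a \<odot>\<^bsub>N\<^esub> f x)}"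

definition fin_presented :: "('a, 'e) ring_scheme \<Rightarrow> ('a, 'm) module \<Rightarrow> bool"
  where "fin_presented R M \<longleftrightarrow> left_module R M \<and>
    (\<exists>a b. \<exists>\<phi>\<in>lin_hom R (free_module R a) (free_module R b). \<exists>\<pi>\<in>lin_hom R (free_module R b) M.
      \<pi> ` carrier (free_module R b) = carrier M \<and>
      \<phi> ` carrier (free_module R a) = {v \<in> carrier (free_module R b). \<pi> v = \<zero>\<^bsub>M\<^esub>})"

definition right_artinian :: "('a, 'e) ring_scheme \<Rightarrow> bool"
  where "right_artinian S \<longleftrightarrow> ring S \<and>
    (\<forall>I :: nat \<Rightarrow> 'a set.
      (\<forall>n. submodule (I n) (opp S) (regular_module (opp S)) \<and> I (Suc n) \<subseteq> I n) \<longrightarrow>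
      (\<exists>n. \<forall>m\<ge>n. I m = I n))"

definition module_length :: "('a, 'e) ring_scheme \<Rightarrow> ('a, 'm) module \<Rightarrow> enat"
  where "module_length R M = (SUP n\<in>{n. \<exists>U :: nat \<Rightarrow> 'm set.
    (\<forall>i\<le>n. submodule (U i) R M) \<and> (\<forall>i<n. U i \<subset> U (Suc i))}. enat n)"

section \<open>Tensor products\<close>

text \<open>\<open>A\<close> is a right and \<open>M\<close> a left \<open>R\<close>-module; \<open>a \<odot>\<^bsub>A\<^esub> x\<close> is \<open>x \<cdot> a\<close>.\<close>

definition tensor_rel ::
  "('a, 'e) ring_scheme \<Rightarrow> ('a, 'p) module \<Rightarrow> ('a, 'm) module \<Rightarrow> (('p \<times> 'm) \<Rightarrow>\<^sub>0 int) set"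
  where "tensor_rel R A M = generate (free_Abelian_group (carrier A \<times> carrier M))
    ({frag_of (x \<oplus>\<^bsub>A\<^esub> y, m) - frag_of (x, m) - frag_of (y, m) | x y m.
        x \<in> carrier A \<and> y \<in> carrier A \<and> m \<in> carrier M} \<union>
     {frag_of (x, m \<oplus>\<^bsub>M\<^esub> n) - frag_of (x, m) - frag_of (x, n) | x m n.
        x \<in> carrier A \<and> m \<in> carrier M \<and> n \<in> carrier M} \<union>
     {frag_of (a \<odot>\<^bsub>A\<^esub> x, m) - frag_of (x, a \<odot>\<^bsub>M\<^esub> m) | a x m.
        a \<in> carrier R \<and> x \<in> carrier A \<and> m \<in> carrier M})"

definition tensor ::
  "('a, 'e) ring_scheme \<Rightarrow> ('a, 'p) module \<Rightarrow> ('a, 'm) module \<Rightarrow> (('p \<times> 'm) \<Rightarrow>\<^sub>0 int) set monoid"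
  where "tensor R A M = free_Abelian_group (carrier A \<times> carrier M) Mod tensor_rel R A M"

text \<open>\<open>f \<otimes> g : A \<otimes> M \<rightarrow> B \<otimes> N\<close>, sending the coset of \<open>z\<close> to the coset of the image of \<open>z\<close>.\<close>

definition tensor_map ::
  "('a, 'e) ring_scheme \<Rightarrow> ('a, 'p) module \<Rightarrow> ('a, 'm) module \<Rightarrow> ('a, 'q) module \<Rightarrow> ('a, 'n) module \<Rightarrow>
    ('p \<Rightarrow> 'q) \<Rightarrow> ('m \<Rightarrow> 'n) \<Rightarrow> (('p \<times> 'm) \<Rightarrow>\<^sub>0 int) set \<Rightarrow> (('q \<times> 'n) \<Rightarrow>\<^sub>0 int) set"
  where "tensor_map R A M B N f g = (\<lambda>c\<in>carrier (tensor R A M).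
    tensor_rel R B N <#>\<^bsub>free_Abelian_group (carrier B \<times> carrier N)\<^esub>
      frag_extend (\<lambda>(x, m). frag_of (f x, g m)) ` c)"

text \<open>\<open>S\<close> as a right \<open>R\<close>-module via \<open>\<sigma>\<close>, and \<open>S \<otimes>\<^sub>R M\<close> as a left \<open>S\<close>-module.\<close>

abbreviation right_via :: "('s, 'f) ring_scheme \<Rightarrow> ('r \<Rightarrow> 's) \<Rightarrow> ('r, 's) module"
  where "right_via S \<sigma> \<equiv> restrict_scalars \<sigma> (regular_module (opp S))"

definition extend_scalars ::
  "('r, 'e) ring_scheme \<Rightarrow> ('s, 'f) ring_scheme \<Rightarrow> ('r \<Rightarrow> 's) \<Rightarrow> ('r, 'm) module \<Rightarrow>
    ('s, (('s \<times> 'm) \<Rightarrow>\<^sub>0 int) set) module"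
  where "extend_scalars R S \<sigma> M = (let T = tensor R (right_via S \<sigma>) M in
    mk_module (carrier T) (monoid.mult T) \<one>\<^bsub>T\<^esub>
      (\<lambda>s. tensor_map R (right_via S \<sigma>) M (right_via S \<sigma>) M (\<lambda>t. s \<otimes>\<^bsub>S\<^esub> t) (\<lambda>m. m)))"

definition extend_scalars_map ::
  "('r, 'e) ring_scheme \<Rightarrow> ('s, 'f) ring_scheme \<Rightarrow> ('r \<Rightarrow> 's) \<Rightarrow>
    ('r, 'm) module \<Rightarrow> ('r, 'n) module \<Rightarrow> ('m \<Rightarrow> 'n) \<Rightarrow>
    (('s \<times> 'm) \<Rightarrow>\<^sub>0 int) set \<Rightarrow> (('s \<times> 'n) \<Rightarrow>\<^sub>0 int) set"
  where "extend_scalars_map R S \<sigma> M N \<alpha> =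
    tensor_map R (right_via S \<sigma>) M (right_via S \<sigma>) N (\<lambda>t. t) \<alpha>"

section \<open>Preadditive categories and exact functors\<close>

text \<open>\<open>cComp \<C> A B D g f\<close> is the composite of \<open>f : A \<rightarrow> B\<close> and \<open>g : B \<rightarrow> D\<close>.\<close>

record ('o, 'a) preadd_cat =
  cObj :: "'o set"
  cHom :: "'o \<Rightarrow> 'o \<Rightarrow> 'a set"
  cId :: "'o \<Rightarrow> 'a"
  cComp :: "'o \<Rightarrow> 'o \<Rightarrow> 'o \<Rightarrow> 'a \<Rightarrow> 'a \<Rightarrow> 'a"
  cAdd :: "'o \<Rightarrow> 'o \<Rightarrow> 'a \<Rightarrow> 'a \<Rightarrow> 'a"
  cZero :: "'o \<Rightarrow> 'o \<Rightarrow> 'a"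

record ('o, 'a, 'p, 'b) funct =
  fObj :: "'o \<Rightarrow> 'p"
  fArr :: "'o \<Rightarrow> 'o \<Rightarrow> 'a \<Rightarrow> 'b"

definition cat_iso :: "('o, 'a) preadd_cat \<Rightarrow> 'o \<Rightarrow> 'o \<Rightarrow> 'a \<Rightarrow> bool"
  where "cat_iso \<C> A B f \<longleftrightarrow> f \<in> cHom \<C> A B \<and>
    (\<exists>g\<in>cHom \<C> B A. cComp \<C> A B A g f = cId \<C> A \<and> cComp \<C> B A B f g = cId \<C> B)"

definition cat_kernel :: "('o, 'a) preadd_cat \<Rightarrow> 'o \<Rightarrow> 'o \<Rightarrow> 'o \<Rightarrow> 'a \<Rightarrow> 'a \<Rightarrow> bool"
  where "cat_kernel \<C> A B D f g \<longleftrightarrow> cComp \<C> A B D g f = cZero \<C> A D \<and>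
    (\<forall>T\<in>cObj \<C>. \<forall>t\<in>cHom \<C> T B. cComp \<C> T B D g t = cZero \<C> T D \<longrightarrow>
      (\<exists>!u. u \<in> cHom \<C> T A \<and> cComp \<C> T A B f u = t))"

definition cat_cokernel :: "('o, 'a) preadd_cat \<Rightarrow> 'o \<Rightarrow> 'o \<Rightarrow> 'o \<Rightarrow> 'a \<Rightarrow> 'a \<Rightarrow> bool"
  where "cat_cokernel \<C> A B D f g \<longleftrightarrow> cComp \<C> A B D g f = cZero \<C> A D \<and>
    (\<forall>T\<in>cObj \<C>. \<forall>t\<in>cHom \<C> B T. cComp \<C> A B T t f = cZero \<C> A T \<longrightarrow>
      (\<exists>!u. u \<in> cHom \<C> D T \<and> cComp \<C> B D T u g = t))"

definition short_exact :: "('o, 'a) preadd_cat \<Rightarrow> 'o \<Rightarrow> 'o \<Rightarrow> 'o \<Rightarrow> 'a \<Rightarrow> 'a \<Rightarrow> bool"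
  where "short_exact \<C> A B D f g \<longleftrightarrow>
    A \<in> cObj \<C> \<and> B \<in> cObj \<C> \<and> D \<in> cObj \<C> \<and> f \<in> cHom \<C> A B \<and> g \<in> cHom \<C> B D \<and>
    cat_kernel \<C> A B D f g \<and> cat_cokernel \<C> A B D f g"

definition additive_functor ::
  "('o, 'a) preadd_cat \<Rightarrow> ('p, 'b) preadd_cat \<Rightarrow> ('o, 'a, 'p, 'b) funct \<Rightarrow> bool"
  where "additive_functor \<C> \<D> F \<longleftrightarrow>
    (\<forall>A\<in>cObj \<C>. fObj F A \<in> cObj \<D> \<and> fArr F A A (cId \<C> A) = cId \<D> (fObj F A)) \<and>
    (\<forall>A\<in>cObj \<C>. \<forall>B\<in>cObj \<C>. \<forall>f\<in>cHom \<C> A B. fArr F A B f \<in> cHom \<D> (fObj F A) (fObj F B)) \<and>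
    (\<forall>A\<in>cObj \<C>. \<forall>B\<in>cObj \<C>. \<forall>D\<in>cObj \<C>. \<forall>f\<in>cHom \<C> A B. \<forall>g\<in>cHom \<C> B D.
      fArr F A D (cComp \<C> A B D g f) =
        cComp \<D> (fObj F A) (fObj F B) (fObj F D) (fArr F B D g) (fArr F A B f)) \<and>
    (\<forall>A\<in>cObj \<C>. \<forall>B\<in>cObj \<C>. \<forall>f\<in>cHom \<C> A B. \<forall>g\<in>cHom \<C> A B.
      fArr F A B (cAdd \<C> A B f g) =
        cAdd \<D> (fObj F A) (fObj F B) (fArr F A B f) (fArr F A B g))"

definition exact_functor ::
  "('o, 'a) preadd_cat \<Rightarrow> ('p, 'b) preadd_cat \<Rightarrow> ('o, 'a, 'p, 'b) funct \<Rightarrow> bool"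
  where "exact_functor \<C> \<D> F \<longleftrightarrow> additive_functor \<C> \<D> F \<and>
    (\<forall>A B D f g. short_exact \<C> A B D f g \<longrightarrow>
      short_exact \<D> (fObj F A) (fObj F B) (fObj F D) (fArr F A B f) (fArr F B D g))"

section \<open>The categories of the statement\<close>

text \<open>
  Every finitely presented module over a ring on \<open>'a\<close> is isomorphic to a quotient of some
  \<open>R\<^sup>n\<close>, whose elements are subsets of \<open>nat \<Rightarrow> 'a\<close>. Taking all finitely presented
  modules with elements in \<open>(nat \<Rightarrow> 'a) set\<close> therefore gives a category equivalent to that
  of all finitely presented modules.
\<close>

type_synonym 'a univ = "(nat \<Rightarrow> 'a) set"
type_synonym 'a umodule = "('a, 'a univ) module"
type_synonym 'a umap = "'a univ \<Rightarrow> 'a univ"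

definition fp_mod :: "('a, 'e) ring_scheme \<Rightarrow> ('a umodule, 'a umap) preadd_cat"
  where "fp_mod R = \<lparr>cObj = {M. fin_presented R M}, cHom = lin_hom R,
    cId = (\<lambda>M. \<lambda>x\<in>carrier M. x),
    cComp = (\<lambda>M N P g f. compose (carrier M) g f),
    cAdd = (\<lambda>M N f g. \<lambda>x\<in>carrier M. f x \<oplus>\<^bsub>N\<^esub> g x),
    cZero = (\<lambda>M N. \<lambda>x\<in>carrier M. \<zero>\<^bsub>N\<^esub>)\<rparr>"

abbreviation right_fp_mod :: "('a, 'e) ring_scheme \<Rightarrow> ('a umodule, 'a umap) preadd_cat"
  where "right_fp_mod S \<equiv> fp_mod (opp S)"

definition Ab :: "('g monoid, 'g \<Rightarrow> 'g) preadd_cat"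
  where "Ab = \<lparr>cObj = {G. comm_group G},
    cHom = (\<lambda>G H. hom G H \<inter> extensional (carrier G)),
    cId = (\<lambda>G. \<lambda>x\<in>carrier G. x),
    cComp = (\<lambda>G H K g f. compose (carrier G) g f),
    cAdd = (\<lambda>G H f g. \<lambda>x\<in>carrier G. f x \<otimes>\<^bsub>H\<^esub> g x),
    cZero = (\<lambda>G H. \<lambda>x\<in>carrier G. \<one>\<^bsub>H\<^esub>)\<rparr>"

type_synonym ('a, 'g) mod_functor = "('a umodule, 'a umap, 'g monoid, 'g \<Rightarrow> 'g) funct"

definition hom_group ::
  "('a, 'e) ring_scheme \<Rightarrow> ('a, 'm) module \<Rightarrow> ('a, 'x) module \<Rightarrow> ('m \<Rightarrow> 'x) monoid"
  where "hom_group R M X = \<lparr>carrier = lin_hom R M X,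
    monoid.mult = (\<lambda>f g. \<lambda>x\<in>carrier M. f x \<oplus>\<^bsub>X\<^esub> g x), monoid.one = (\<lambda>x\<in>carrier M. \<zero>\<^bsub>X\<^esub>)\<rparr>"

text \<open>The image of \<open>Hom(\<alpha>, X) : Hom(N, X) \<rightarrow> Hom(M, X)\<close> for \<open>\<alpha> : M \<rightarrow> N\<close>.\<close>

definition hom_image ::
  "('a, 'e) ring_scheme \<Rightarrow> ('a, 'm) module \<Rightarrow> ('a, 'n) module \<Rightarrow> ('m \<Rightarrow> 'n) \<Rightarrow> ('a, 'x) module \<Rightarrow>
    ('m \<Rightarrow> 'x) set"
  where "hom_image R M N \<alpha> X = (\<lambda>h. compose (carrier M) h \<alpha>) ` lin_hom R N X"

text \<open>There is an exact sequence \<open>Hom(N,-) \<rightarrow> Hom(M,-) \<rightarrow> \<G> \<rightarrow> 0\<close> of functors, with second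
  map \<open>\<pi>\<close>. The modules \<open>M\<close> and \<open>N\<close> may have any element type.\<close>

definition presents ::
  "('a, 'e) ring_scheme \<Rightarrow> ('a, 'm) module \<Rightarrow> ('a, 'n) module \<Rightarrow> ('m \<Rightarrow> 'n) \<Rightarrow>
    ('a, 'g) mod_functor \<Rightarrow> bool"
  where "presents R M N \<alpha> \<G> \<longleftrightarrow> \<alpha> \<in> lin_hom R M N \<and>
    (\<exists>\<pi>. (\<forall>X\<in>cObj (fp_mod R).
        \<pi> X \<in> hom (hom_group R M X) (fObj \<G> X) \<and>
        \<pi> X ` lin_hom R M X = carrier (fObj \<G> X) \<and>
        kernel (hom_group R M X) (fObj \<G> X) (\<pi> X) = hom_image R M N \<alpha> X) \<and>
      (\<forall>X\<in>cObj (fp_mod R). \<forall>Y\<in>cObj (fp_mod R). \<forall>f\<in>lin_hom R X Y. \<forall>h\<in>lin_hom R M X.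
        fArr \<G> X Y f (\<pi> X h) = \<pi> Y (compose (carrier M) f h)))"

definition fp_functors :: "('a, 'e) ring_scheme \<Rightarrow> ('a, 'g) mod_functor set"
  where "fp_functors R = {\<G>. additive_functor (fp_mod R) Ab \<G> \<and>
    (\<exists>M\<in>cObj (fp_mod R). \<exists>N\<in>cObj (fp_mod R). \<exists>\<alpha>. presents R M N \<alpha> \<G>)}"

definition nat_trans ::
  "('a, 'e) ring_scheme \<Rightarrow> ('a, 'g) mod_functor \<Rightarrow> ('a, 'g) mod_functor \<Rightarrow>
    ('a umodule \<Rightarrow> 'g \<Rightarrow> 'g) set"
  where "nat_trans R F G = {\<eta> \<in> extensional (cObj (fp_mod R)).
    (\<forall>X\<in>cObj (fp_mod R). \<eta> X \<in> cHom Ab (fObj F X) (fObj G X)) \<and>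
    (\<forall>X\<in>cObj (fp_mod R). \<forall>Y\<in>cObj (fp_mod R). \<forall>f\<in>lin_hom R X Y.
      cComp Ab (fObj F X) (fObj F Y) (fObj G Y) (\<eta> Y) (fArr F X Y f) =
      cComp Ab (fObj F X) (fObj G X) (fObj G Y) (fArr G X Y f) (\<eta> X))}"

text \<open>
  The category of finitely presented functors. The value groups of the objects have elements of the
  type below. It is the type of elements of \<open>N \<otimes>\<^sub>S X\<close>, and a map \<open>h\<close> between modules
  can be encoded in it by the set of all \<open>frag_of (x, h x)\<close>; hence every finitely presented
  functor is isomorphic to one with such values.
\<close>

type_synonym 'a uval = "(('a univ \<times> 'a univ) \<Rightarrow>\<^sub>0 int) set"

definition fp_functor_cat ::
  "('a, 'e) ring_scheme \<Rightarrow>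
    (('a, 'a uval) mod_functor, 'a umodule \<Rightarrow> 'a uval \<Rightarrow> 'a uval) preadd_cat"
  where "fp_functor_cat R = \<lparr>cObj = fp_functors R, cHom = nat_trans R,
    cId = (\<lambda>F. \<lambda>X\<in>cObj (fp_mod R). cId Ab (fObj F X)),
    cComp = (\<lambda>F G H \<theta> \<eta>. \<lambda>X\<in>cObj (fp_mod R).
      cComp Ab (fObj F X) (fObj G X) (fObj H X) (\<theta> X) (\<eta> X)),
    cAdd = (\<lambda>F G \<theta> \<eta>. \<lambda>X\<in>cObj (fp_mod R). cAdd Ab (fObj F X) (fObj G X) (\<theta> X) (\<eta> X)),
    cZero = (\<lambda>F G. \<lambda>X\<in>cObj (fp_mod R). cZero Ab (fObj F X) (fObj G X))\<rparr>"

section \<open>Covdefect, scalar extension of functors, and the length\<close>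

definition tensor_functor ::
  "('a, 'e) ring_scheme \<Rightarrow> 'a umodule \<Rightarrow> ('a, 'a uval) mod_functor"
  where "tensor_functor S N =
    \<lparr>fObj = (\<lambda>X. tensor S N X), fArr = (\<lambda>X Y f. tensor_map S N X N Y (\<lambda>n. n) f)\<rparr>"

definition tensor_trans ::
  "('a, 'e) ring_scheme \<Rightarrow> 'a umodule \<Rightarrow> 'a umodule \<Rightarrow> 'a umap \<Rightarrow>
    'a umodule \<Rightarrow> 'a uval \<Rightarrow> 'a uval"
  where "tensor_trans S N N' f =
    (\<lambda>X\<in>cObj (fp_mod S). tensor_map S N X N' X f (\<lambda>x. x))"

type_synonym 'a covdefect_functor =
  "(('a, 'a uval) mod_functor, 'a umodule \<Rightarrow> 'a uval \<Rightarrow> 'a uval, 'a umodule, 'a umap) funct"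

text \<open>
  The defining property of Covdefect, which determines it up to natural isomorphism. For right
  coherent \<open>S\<close> it is satisfied by \<open>F \<mapsto> F(S)\<close>.
\<close>

definition is_Covdefect :: "('a, 'e) ring_scheme \<Rightarrow> 'a covdefect_functor \<Rightarrow> bool"
  where "is_Covdefect S C \<longleftrightarrow> exact_functor (fp_functor_cat S) (right_fp_mod S) C \<and>
    (\<exists>\<theta>. (\<forall>N\<in>cObj (right_fp_mod S).
        cat_iso (right_fp_mod S) (fObj C (tensor_functor S N)) N (\<theta> N)) \<and>
      (\<forall>N\<in>cObj (right_fp_mod S). \<forall>N'\<in>cObj (right_fp_mod S). \<forall>f\<in>cHom (right_fp_mod S) N N'.
        cComp (right_fp_mod S) (fObj C (tensor_functor S N)) (fObj C (tensor_functor S N')) N'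
          (\<theta> N') (fArr C (tensor_functor S N) (tensor_functor S N') (tensor_trans S N N' f)) =
        cComp (right_fp_mod S) (fObj C (tensor_functor S N)) N N' f (\<theta> N)))"

text \<open>
  Evaluation at arbitrary modules and \<open>\<sigma>\<^sub>*\<close> are defined through a presentation, and are
  independent of its choice up to isomorphism.
\<close>

definition presentation_of ::
  "('a, 'e) ring_scheme \<Rightarrow> ('a, 'g) mod_functor \<Rightarrow> 'a umodule \<times> 'a umodule \<times> 'a umap"
  where "presentation_of R \<G> = (SOME (M, N, \<alpha>).
    M \<in> cObj (fp_mod R) \<and> N \<in> cObj (fp_mod R) \<and> presents R M N \<alpha> \<G>)"

definition fp_eval ::
  "('a, 'e) ring_scheme \<Rightarrow> ('a, 'g) mod_functor \<Rightarrow> ('a, 'x) module \<Rightarrow>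
    ('a univ \<Rightarrow> 'x) set monoid"
  where "fp_eval R \<G> X = (case presentation_of R \<G> of
    (M, N, \<alpha>) \<Rightarrow> hom_group R M X Mod hom_image R M N \<alpha> X)"

definition sigma_star ::
  "('r, 'e) ring_scheme \<Rightarrow> ('s, 'f) ring_scheme \<Rightarrow> ('r \<Rightarrow> 's) \<Rightarrow> ('r, 'g) mod_functor \<Rightarrow>
    ('s, 's uval) mod_functor"
  where "sigma_star R S \<sigma> \<G> = (case presentation_of R \<G> of
    (M, N, \<alpha>) \<Rightarrow> SOME \<H>. \<H> \<in> fp_functors S \<and>
      presents S (extend_scalars R S \<sigma> M) (extend_scalars R S \<sigma> N)
        (extend_scalars_map R S \<sigma> M N \<alpha>) \<H>)"

definition length_sigma ::
  "('r, 'e) ring_scheme \<Rightarrow> ('s, 'f) ring_scheme \<Rightarrow> ('r \<Rightarrow> 's) \<Rightarrow> 's covdefect_functor \<Rightarrow>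
    ('r, 'g) mod_functor \<Rightarrow> enat"
  where "length_sigma R S \<sigma> C \<G> = module_length (opp S) (fObj C (sigma_star R S \<sigma> \<G>))"

definition detects_zero_at ::
  "('r, 'e) ring_scheme \<Rightarrow> (('r, 'g) mod_functor \<Rightarrow> enat) \<Rightarrow> ('r, 'x) module \<Rightarrow> bool"
  where "detects_zero_at R len X \<longleftrightarrow>
    (\<forall>\<G>\<in>fp_functors R. len \<G> = 0 \<longleftrightarrow> trivial_group (fp_eval R \<G> X))"

section \<open>fp-faithfully flat modules\<close>

text \<open>
  The right modules tested for flatness have elements in \<open>(nat \<Rightarrow> 'a) set\<close>. This includes
  copies of all inclusions of finitely generated right ideals into the ring, which suffice for
  flatness.
\<close>

definition flat :: "('a, 'e) ring_scheme \<Rightarrow> ('a, 'm) module \<Rightarrow> bool"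
  where "flat S M \<longleftrightarrow> left_module S M \<and>
    (\<forall>(A :: 'a umodule) (B :: 'a umodule). \<forall>f\<in>lin_hom (opp S) A B.
      left_module (opp S) A \<and> left_module (opp S) B \<and> inj_on f (carrier A) \<longrightarrow>
      inj_on (tensor_map S A M B M f (\<lambda>m. m)) (carrier (tensor S A M)))"

definition fp_faithfully_flat :: "('a, 'e) ring_scheme \<Rightarrow> ('a, 'm) module \<Rightarrow> bool"
  where "fp_faithfully_flat S M \<longleftrightarrow> flat S M \<and>
    (\<forall>A\<in>cObj (right_fp_mod S). \<forall>B\<in>cObj (right_fp_mod S).
      \<forall>f\<in>cHom (right_fp_mod S) A B. \<forall>g\<in>cHom (right_fp_mod S) A B.
      tensor_map S A M B M f (\<lambda>m. m) = tensor_map S A M B M g (\<lambda>m. m) \<longrightarrow> f = g)"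

end

theory Submission
  imports Defs "HOL-Algebra.Elementary_Groups" "HOL-Library.Nat_Bijection"
begin

text \<open>
  Presentations of the modules and of \<open>\<alpha>\<close> by matrices over \<open>R\<close> turn \<open>\<sigma>\<^sub>* \<G>\<close> into the functor
  \<open>H X = {x \<in> X\<^sup>n. a x = 0} / L {x \<in> X\<^bsup>n'\<^esup>. b x = 0}\<close> for matrices \<open>a\<close>, \<open>b\<close>, \<open>L\<close> over \<open>S\<close>, and
  \<open>\<G> (M|\<sigma>) = 0\<close> says that \<open>{a x = 0} \<subseteq> L {b x = 0}\<close> on the \<open>S\<close>-module \<open>M\<close>. Let \<open>C\<close> be Covdefect. The
  functor \<open>X \<mapsto> {x \<in> X\<^sup>n. a x = 0}\<close> is the kernel of \<open>S\<^sup>n \<otimes> - \<rightarrow> S\<^sup>m \<otimes> -\<close>, so \<open>C\<close>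
  sends it to the right module of solutions \<open>A = {v \<in> S\<^sup>n. a v = 0}\<close>; likewise for \<open>b\<close>, with
  solutions \<open>B\<close>, and \<open>C H\<close> is the cokernel of \<open>L : B \<rightarrow> A\<close>. Over a flat module \<open>M\<close>, every
  solution of a linear system is a sum of elements \<open>v y\<close> with \<open>v\<close> a solution over \<open>S\<close> and \<open>y \<in> M\<close>.
  Hence \<open>C H = 0\<close> implies \<open>{a x = 0} \<subseteq> L {b x = 0}\<close> on \<open>M\<close>. Conversely, this inclusion
  makes \<open>(A \<rightarrow> C H) \<otimes> M\<close> zero, and faithfulness gives \<open>C H = 0\<close>, since \<open>A \<rightarrow> C H\<close> is epi.
\<close>

section \<open>Modules, tuples and matrices\<close>

lemma mk_module_simps [simp]:
  "carrier (mk_module A pl z sm) = A" "ring.zero (mk_module A pl z sm) = z"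
  "ring.add (mk_module A pl z sm) = pl" "module.smult (mk_module A pl z sm) = sm"
  by (simp_all add: mk_module_def)

lemma regular_module_simps [simp]:
  "carrier (regular_module R) = carrier R" "ring.zero (regular_module R) = ring.zero R"
  "ring.add (regular_module R) = ring.add R" "module.smult (regular_module R) = monoid.mult R"
  by (simp_all add: regular_module_def)

lemma restrict_scalars_simps [simp]:
  "carrier (restrict_scalars \<sigma> M) = carrier M" "ring.zero (restrict_scalars \<sigma> M) = ring.zero M"
  "ring.add (restrict_scalars \<sigma> M) = ring.add M" "module.smult (restrict_scalars \<sigma> M) = (\<lambda>r. smult M (\<sigma> r))"
  by (simp_all add: restrict_scalars_def)

lemma opp_simps [simp]:
  "carrier (opp R) = carrier R" "ring.zero (opp R) = ring.zero R" "monoid.one (opp R) = monoid.one R"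
  "ring.add (opp R) = ring.add R" "monoid.mult (opp R) = (\<lambda>a b. b \<otimes>\<^bsub>R\<^esub> a)"
  by (simp_all add: opp_def)

lemma ring_opp: "ring R \<Longrightarrow> ring (opp R)"
proof -
  assume "ring R"
  then interpret ring R .
  show ?thesis
  proof (rule ringI)
    show "abelian_group (opp R)"
      by (rule abelian_groupI)
        (auto simp: a_ac l_neg intro: bexI[of _ "\<ominus>\<^bsub>R\<^esub> _"])
    show "monoid (opp R)" by (rule monoidI) (auto simp: m_assoc)
  qed (auto simp: l_distr r_distr)
qed

lemma left_module_regular: "ring R \<Longrightarrow> left_module R (regular_module R)"
proof -
  assume "ring R"
  then interpret ring R .
  have "abelian_group (regular_module R)"
    by (rule abelian_groupI) (auto simp: a_ac l_neg intro: bexI[of _ "\<ominus>\<^bsub>R\<^esub> _"])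
  then show ?thesis
    by (intro left_module.intro left_module_axioms.intro)
      (auto simp: l_distr r_distr m_assoc ring_axioms)
qed

lemma left_module_restrict_scalars:
  assumes "ring R" "\<sigma> \<in> ring_hom R S" "left_module S M"
  shows "left_module R (restrict_scalars \<sigma> M)"
proof -
  interpret M: left_module S M by fact
  have "abelian_group (restrict_scalars \<sigma> M)"
    by (rule abelian_groupI) (auto simp: M.M.a_ac M.M.l_neg intro: bexI[of _ "\<ominus>\<^bsub>M\<^esub> _"])
  then show ?thesis using assms(1,2)
    by (intro left_module.intro left_module_axioms.intro)
      (auto simp: M.smult_closed M.smult_l_distr M.smult_r_distr M.smult_assoc M.smult_one
        ring_hom_closed ring_hom_add ring_hom_mult ring_hom_one)
qed

lemma left_module_submodule:
  assumes "left_module R M" "submodule N R M"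
  shows "left_module R (M\<lparr>carrier := N\<rparr>)"
proof -
  interpret M: left_module R M by fact
  interpret N: submodule N R M by fact
  have sub: "N \<subseteq> carrier M" using N.subset by simp
  have inv: "\<exists>y\<in>N. y \<oplus>\<^bsub>M\<^esub> x = \<zero>\<^bsub>M\<^esub>" if "x \<in> N" for x
  proof
    show "\<ominus>\<^bsub>M\<^esub> x \<in> N" using N.m_inv_closed[OF that] by (simp add: a_inv_def)
    show "\<ominus>\<^bsub>M\<^esub> x \<oplus>\<^bsub>M\<^esub> x = \<zero>\<^bsub>M\<^esub>" using that sub by (auto intro: M.M.l_neg)
  qed
  have "abelian_group (M\<lparr>carrier := N\<rparr>)"
    by (rule abelian_groupI)
      (use sub N.m_closed N.one_closed inv in \<open>auto simp: subset_iff M.M.a_ac\<close>)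
  then show ?thesis using sub N.smult_closed
    by (intro left_module.intro left_module_axioms.intro)
      (auto simp: subset_iff M.smult_l_distr M.smult_r_distr M.smult_assoc M.smult_one M.R.ring_axioms)
qed

lemma lin_homI:
  assumes "f \<in> carrier M \<rightarrow>\<^sub>E carrier N"
    "\<And>x y. x \<in> carrier M \<Longrightarrow> y \<in> carrier M \<Longrightarrow> f (x \<oplus>\<^bsub>M\<^esub> y) = f x \<oplus>\<^bsub>N\<^esub> f y"
    "\<And>a x. a \<in> carrier R \<Longrightarrow> x \<in> carrier M \<Longrightarrow> f (a \<odot>\<^bsub>M\<^esub> x) = a \<odot>\<^bsub>N\<^esub> f x"
  shows "f \<in> lin_hom R M N"
  using assms by (simp add: lin_hom_def)

lemma
  assumes "f \<in> lin_hom R M N"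
  shows lin_hom_PiE: "f \<in> carrier M \<rightarrow>\<^sub>E carrier N"
    and lin_hom_closed: "x \<in> carrier M \<Longrightarrow> f x \<in> carrier N"
    and lin_hom_add: "x \<in> carrier M \<Longrightarrow> y \<in> carrier M \<Longrightarrow> f (x \<oplus>\<^bsub>M\<^esub> y) = f x \<oplus>\<^bsub>N\<^esub> f y"
    and lin_hom_smult: "a \<in> carrier R \<Longrightarrow> x \<in> carrier M \<Longrightarrow> f (a \<odot>\<^bsub>M\<^esub> x) = a \<odot>\<^bsub>N\<^esub> f x"
  using assms by (auto simp: lin_hom_def)

lemma lin_hom_compose:
  assumes "f \<in> lin_hom R M N" "g \<in> lin_hom R N P" "left_module R M"
  shows "compose (carrier M) g f \<in> lin_hom R M P"
proof -
  interpret M: left_module R M by fact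
  show ?thesis
    by (rule lin_homI) (use assms(1,2) in \<open>auto simp: compose_def lin_hom_closed lin_hom_add lin_hom_smult M.smult_closed\<close>)
qed

lemma lin_hom_zero:
  assumes "f \<in> lin_hom R M N" "left_module R M" "left_module R N"
  shows "f \<zero>\<^bsub>M\<^esub> = \<zero>\<^bsub>N\<^esub>"
proof -
  interpret M: left_module R M by fact
  interpret N: left_module R N by fact
  have c: "f \<zero>\<^bsub>M\<^esub> \<in> carrier N" using assms(1) by (auto intro: lin_hom_closed)
  have "f \<zero>\<^bsub>M\<^esub> \<oplus>\<^bsub>N\<^esub> f \<zero>\<^bsub>M\<^esub> = f \<zero>\<^bsub>M\<^esub>"
    using lin_hom_add[OF assms(1), of "\<zero>\<^bsub>M\<^esub>" "\<zero>\<^bsub>M\<^esub>"] by simp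
  then show ?thesis using c by simp
qed

lemma lin_hom_id: "left_module R M \<Longrightarrow> (\<lambda>x\<in>carrier M. x) \<in> lin_hom R M M"
proof -
  assume "left_module R M"
  then interpret M: left_module R M .
  show ?thesis by (rule lin_homI) (auto simp: M.smult_closed)
qed

lemma lin_hom_const_zero:
  assumes "left_module R M" "left_module R N"
  shows "(\<lambda>x\<in>carrier M. \<zero>\<^bsub>N\<^esub>) \<in> lin_hom R M N"
proof -
  interpret M: left_module R M by fact
  interpret N: left_module R N by fact
  have "a \<odot>\<^bsub>N\<^esub> \<zero>\<^bsub>N\<^esub> = \<zero>\<^bsub>N\<^esub>" if "a \<in> carrier R" for a
    using N.smult_r_distr[OF that, of "\<zero>\<^bsub>N\<^esub>" "\<zero>\<^bsub>N\<^esub>"] N.smult_closed[OF that, of "\<zero>\<^bsub>N\<^esub>"] by simp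
  then show ?thesis by (intro lin_homI) (auto simp: M.smult_closed)
qed

definition lincomb :: "('a, 'x, 'c) module_scheme \<Rightarrow> nat \<Rightarrow> (nat \<Rightarrow> 'a) \<Rightarrow> (nat \<Rightarrow> 'x) \<Rightarrow> 'x"
  where "lincomb X n c x = (\<Oplus>\<^bsub>X\<^esub>j\<in>{..<n}. c j \<odot>\<^bsub>X\<^esub> x j)"

definition tuples :: "('a, 'x, 'c) module_scheme \<Rightarrow> nat \<Rightarrow> (nat \<Rightarrow> 'x) set"
  where "tuples X n = ({..<n} \<rightarrow>\<^sub>E carrier X)"

definition tmap :: "nat \<Rightarrow> ('x \<Rightarrow> 'y) \<Rightarrow> (nat \<Rightarrow> 'x) \<Rightarrow> (nat \<Rightarrow> 'y)"
  where "tmap n f x = (\<lambda>i\<in>{..<n}. f (x i))"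

definition tadd :: "('a, 'x, 'c) module_scheme \<Rightarrow> nat \<Rightarrow> (nat \<Rightarrow> 'x) \<Rightarrow> (nat \<Rightarrow> 'x) \<Rightarrow> (nat \<Rightarrow> 'x)"
  where "tadd X n x y = (\<lambda>i\<in>{..<n}. x i \<oplus>\<^bsub>X\<^esub> y i)"

definition tzero :: "('a, 'x, 'c) module_scheme \<Rightarrow> nat \<Rightarrow> (nat \<Rightarrow> 'x)"
  where "tzero X n = (\<lambda>i\<in>{..<n}. \<zero>\<^bsub>X\<^esub>)"

definition tuple_group :: "('a, 'x, 'c) module_scheme \<Rightarrow> nat \<Rightarrow> (nat \<Rightarrow> 'x) set \<Rightarrow> (nat \<Rightarrow> 'x) monoid"
  where "tuple_group X n P = \<lparr>carrier = P, monoid.mult = tadd X n, monoid.one = tzero X n\<rparr>"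

definition mat_app :: "('a, 'x, 'c) module_scheme \<Rightarrow> nat \<Rightarrow> nat \<Rightarrow> (nat \<Rightarrow> nat \<Rightarrow> 'a) \<Rightarrow> (nat \<Rightarrow> 'x) \<Rightarrow> (nat \<Rightarrow> 'x)"
  where "mat_app X m n a x = (\<lambda>i\<in>{..<m}. lincomb X n (a i) x)"

definition sols :: "('a, 'x, 'c) module_scheme \<Rightarrow> nat \<Rightarrow> nat \<Rightarrow> (nat \<Rightarrow> nat \<Rightarrow> 'a) \<Rightarrow> (nat \<Rightarrow> 'x) set"
  where "sols X m n a = {x \<in> tuples X n. \<forall>i<m. lincomb X n (a i) x = \<zero>\<^bsub>X\<^esub>}"

lemma tuple_group_simps [simp]:
  "carrier (tuple_group X n P) = P" "monoid.mult (tuple_group X n P) = tadd X n"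
  "monoid.one (tuple_group X n P) = tzero X n"
  by (simp_all add: tuple_group_def)

lemma tuplesD: "x \<in> tuples X n \<Longrightarrow> j < n \<Longrightarrow> x j \<in> carrier X"
  by (auto simp: tuples_def)

lemma tuples_Pi: "x \<in> tuples X n \<Longrightarrow> x \<in> {..<n} \<rightarrow> carrier X"
  by (auto simp: tuples_def)

lemma tuples_eqI:
  assumes "x \<in> tuples X n" "y \<in> tuples Y n" "\<And>j. j < n \<Longrightarrow> x j = y j"
  shows "x = y"
  using assms unfolding tuples_def by (intro extensionalityI[of _ "{..<n}"]) (auto simp: PiE_def)

lemma sols_tuples: "x \<in> sols X m n a \<Longrightarrow> x \<in> tuples X n"
  by (simp add: sols_def)

lemma sols_0 [simp]: "sols X 0 n a = tuples X n"
  by (simp add: sols_def)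

lemma tmap_apply [simp]: "j < n \<Longrightarrow> tmap n f x j = f (x j)"
  by (simp add: tmap_def)

lemma mat_app_apply [simp]: "j < m \<Longrightarrow> mat_app X m n a x j = lincomb X n (a j) x"
  by (simp add: mat_app_def)

lemma tadd_apply [simp]: "j < n \<Longrightarrow> tadd X n x y j = x j \<oplus>\<^bsub>X\<^esub> y j"
  by (simp add: tadd_def)

lemma tzero_apply [simp]: "j < n \<Longrightarrow> tzero X n j = \<zero>\<^bsub>X\<^esub>"
  by (simp add: tzero_def)

lemma tmap_tuples:
  assumes "f \<in> carrier X \<rightarrow> carrier Y" "x \<in> tuples X n"
  shows "tmap n f x \<in> tuples Y n"
  using assms by (auto simp: tuples_def tmap_def)

context left_module
begin

lemma smult_zero_left [simp]: "x \<in> carrier M \<Longrightarrow> \<zero>\<^bsub>R\<^esub> \<odot>\<^bsub>M\<^esub> x = \<zero>\<^bsub>M\<^esub>"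
  using smult_l_distr[of "\<zero>\<^bsub>R\<^esub>" "\<zero>\<^bsub>R\<^esub>" x] smult_closed[of "\<zero>\<^bsub>R\<^esub>" x] by simp

lemma smult_zero_right [simp]: "a \<in> carrier R \<Longrightarrow> a \<odot>\<^bsub>M\<^esub> \<zero>\<^bsub>M\<^esub> = \<zero>\<^bsub>M\<^esub>"
  using smult_r_distr[of a "\<zero>\<^bsub>M\<^esub>" "\<zero>\<^bsub>M\<^esub>"] smult_closed[of a "\<zero>\<^bsub>M\<^esub>"] by simp

lemma lincomb_0 [simp]: "lincomb M 0 c x = \<zero>\<^bsub>M\<^esub>"
  by (simp add: lincomb_def)

lemma lincomb_Suc:
  assumes "c \<in> UNIV \<rightarrow> carrier R" "x \<in> {..<Suc n} \<rightarrow> carrier M"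
  shows "lincomb M (Suc n) c x = lincomb M n c x \<oplus>\<^bsub>M\<^esub> c n \<odot>\<^bsub>M\<^esub> x n"
proof -
  have "lincomb M (Suc n) c x = c n \<odot>\<^bsub>M\<^esub> x n \<oplus>\<^bsub>M\<^esub> lincomb M n c x"
    unfolding lincomb_def lessThan_Suc
    by (rule M.finsum_insert) (use assms in \<open>auto intro!: smult_closed\<close>)
  also have "\<dots> = lincomb M n c x \<oplus>\<^bsub>M\<^esub> c n \<odot>\<^bsub>M\<^esub> x n"
    by (rule M.a_comm) (use assms in \<open>auto simp: lincomb_def intro!: smult_closed M.finsum_closed\<close>)
  finally show ?thesis .
qed

lemma lincomb_closed:
  assumes "c \<in> UNIV \<rightarrow> carrier R" "x \<in> {..<n} \<rightarrow> carrier M"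
  shows "lincomb M n c x \<in> carrier M"
  using assms by (auto simp: lincomb_def intro!: smult_closed M.finsum_closed)

lemma lincomb_cong:
  assumes "c \<in> UNIV \<rightarrow> carrier R" "x \<in> {..<n} \<rightarrow> carrier M"
    "\<And>j. j < n \<Longrightarrow> c j = d j" "\<And>j. j < n \<Longrightarrow> x j = y j"
  shows "lincomb M n c x = lincomb M n d y"
  unfolding lincomb_def
  by (rule M.finsum_cong'[symmetric]) (use assms in \<open>auto intro!: smult_closed\<close>)

lemma lincomb_add_right:
  assumes c: "c \<in> UNIV \<rightarrow> carrier R" and "x \<in> {..<n} \<rightarrow> carrier M" "y \<in> {..<n} \<rightarrow> carrier M"
  shows "lincomb M n c (\<lambda>j. x j \<oplus>\<^bsub>M\<^esub> y j) = lincomb M n c x \<oplus>\<^bsub>M\<^esub> lincomb M n c y"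
proof -
  have "lincomb M n c (\<lambda>j. x j \<oplus>\<^bsub>M\<^esub> y j) = (\<Oplus>\<^bsub>M\<^esub>j\<in>{..<n}. c j \<odot>\<^bsub>M\<^esub> x j \<oplus>\<^bsub>M\<^esub> c j \<odot>\<^bsub>M\<^esub> y j)"
    unfolding lincomb_def
    by (rule M.finsum_cong') (use assms in \<open>auto intro!: smult_closed smult_r_distr simp: Pi_iff\<close>)
  also have "\<dots> = lincomb M n c x \<oplus>\<^bsub>M\<^esub> lincomb M n c y"
    unfolding lincomb_def
    by (rule M.finsum_addf) (use assms in \<open>auto intro!: smult_closed\<close>)
  finally show ?thesis .
qed

lemma lincomb_add_left:
  assumes "c \<in> UNIV \<rightarrow> carrier R" "d \<in> UNIV \<rightarrow> carrier R" "x \<in> {..<n} \<rightarrow> carrier M"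
  shows "lincomb M n (\<lambda>j. c j \<oplus>\<^bsub>R\<^esub> d j) x = lincomb M n c x \<oplus>\<^bsub>M\<^esub> lincomb M n d x"
proof -
  have "lincomb M n (\<lambda>j. c j \<oplus>\<^bsub>R\<^esub> d j) x = (\<Oplus>\<^bsub>M\<^esub>j\<in>{..<n}. c j \<odot>\<^bsub>M\<^esub> x j \<oplus>\<^bsub>M\<^esub> d j \<odot>\<^bsub>M\<^esub> x j)"
    unfolding lincomb_def
    by (rule M.finsum_cong') (use assms in \<open>auto intro!: smult_closed smult_l_distr simp: Pi_iff\<close>)
  also have "\<dots> = lincomb M n c x \<oplus>\<^bsub>M\<^esub> lincomb M n d x"
    unfolding lincomb_def
    by (rule M.finsum_addf) (use assms in \<open>auto intro!: smult_closed\<close>)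
  finally show ?thesis .
qed

lemma lincomb_smult:
  assumes "r \<in> carrier R" "c \<in> UNIV \<rightarrow> carrier R" "x \<in> {..<n} \<rightarrow> carrier M"
  shows "lincomb M n (\<lambda>j. r \<otimes>\<^bsub>R\<^esub> c j) x = r \<odot>\<^bsub>M\<^esub> lincomb M n c x"
  using assms(3)
proof (induction n)
  case 0 then show ?case using assms by simp
next
  case (Suc n)
  have "x \<in> {..<n} \<rightarrow> carrier M" using Suc.prems by auto
  then have IH: "lincomb M n (\<lambda>j. r \<otimes>\<^bsub>R\<^esub> c j) x = r \<odot>\<^bsub>M\<^esub> lincomb M n c x" by (rule Suc.IH)
  have 1: "lincomb M n c x \<in> carrier M" "c n \<in> carrier R" "x n \<in> carrier M"
    using Suc.prems assms by (auto intro!: lincomb_closed)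
  have 2: "(\<lambda>j. r \<otimes>\<^bsub>R\<^esub> c j) \<in> UNIV \<rightarrow> carrier R" using assms by auto
  show ?case
    unfolding lincomb_Suc[OF 2 Suc.prems] lincomb_Suc[OF assms(2) Suc.prems] IH
    using 1 assms by (simp add: smult_r_distr smult_assoc smult_closed)
qed

lemma lincomb_zero_left:
  assumes "x \<in> {..<n} \<rightarrow> carrier M"
  shows "lincomb M n (\<lambda>j. \<zero>\<^bsub>R\<^esub>) x = \<zero>\<^bsub>M\<^esub>"
proof -
  have "lincomb M n (\<lambda>j. \<zero>\<^bsub>R\<^esub>) x = (\<Oplus>\<^bsub>M\<^esub>j\<in>{..<n}. \<zero>\<^bsub>M\<^esub>)"
    unfolding lincomb_def by (rule M.finsum_cong') (use assms in \<open>auto simp: Pi_iff\<close>)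
  then show ?thesis by simp
qed

lemma lincomb_zero_right:
  assumes "c \<in> UNIV \<rightarrow> carrier R"
  shows "lincomb M n c (\<lambda>j. \<zero>\<^bsub>M\<^esub>) = \<zero>\<^bsub>M\<^esub>"
proof -
  have "lincomb M n c (\<lambda>j. \<zero>\<^bsub>M\<^esub>) = (\<Oplus>\<^bsub>M\<^esub>j\<in>{..<n}. \<zero>\<^bsub>M\<^esub>)"
    unfolding lincomb_def by (rule M.finsum_cong') (use assms in \<open>auto simp: Pi_iff\<close>)
  then show ?thesis by simp
qed

lemma lincomb_delta:
  assumes "x \<in> {..<n} \<rightarrow> carrier M" "i < n"
  shows "lincomb M n (\<lambda>j. if j = i then \<one>\<^bsub>R\<^esub> else \<zero>\<^bsub>R\<^esub>) x = x i"
proof -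
  have "lincomb M n (\<lambda>j. if j = i then \<one>\<^bsub>R\<^esub> else \<zero>\<^bsub>R\<^esub>) x = (\<Oplus>\<^bsub>M\<^esub>j\<in>{..<n}. if i = j then x j else \<zero>\<^bsub>M\<^esub>)"
    unfolding lincomb_def by (rule M.finsum_cong') (use assms in \<open>auto simp: Pi_iff smult_one\<close>)
  also have "\<dots> = x i" by (rule M.add.finprod_singleton) (use assms in auto)
  finally show ?thesis .
qed

lemma lincomb_regular_closed:
  assumes "s \<in> UNIV \<rightarrow> carrier R" "c \<in> {..<m} \<rightarrow> carrier R"
  shows "lincomb (regular_module R) m s c \<in> carrier R"
proof -
  interpret reg: left_module R "regular_module R" by (rule left_module_regular) (rule R.ring_axioms)
  show ?thesis using reg.lincomb_closed[of s c] assms by simp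
qed

lemma lincomb_lincomb:
  assumes s: "s \<in> UNIV \<rightarrow> carrier R" and a: "a \<in> UNIV \<rightarrow> UNIV \<rightarrow> carrier R" and x: "x \<in> {..<n} \<rightarrow> carrier M"
  shows "lincomb M n (\<lambda>j. lincomb (regular_module R) m s (\<lambda>i. a i j)) x =
    lincomb M m s (\<lambda>i. lincomb M n (a i) x)"
proof (induction m)
  interpret reg: left_module R "regular_module R" by (rule left_module_regular) (rule R.ring_axioms)
  {
    case 0 then show ?case using x by (simp add: lincomb_zero_left)
  next
    case (Suc m)
    have 1: "lincomb (regular_module R) (Suc m) s (\<lambda>i. a i j) =
        lincomb (regular_module R) m s (\<lambda>i. a i j) \<oplus>\<^bsub>R\<^esub> s m \<otimes>\<^bsub>R\<^esub> a m j" for j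
      using reg.lincomb_Suc[of s "\<lambda>i. a i j" m] s a by (auto simp: Pi_iff)
    have c1: "(\<lambda>j. lincomb (regular_module R) m s (\<lambda>i. a i j)) \<in> UNIV \<rightarrow> carrier R"
      using s a by (auto intro!: lincomb_regular_closed)
    have c2: "(\<lambda>j. s m \<otimes>\<^bsub>R\<^esub> a m j) \<in> UNIV \<rightarrow> carrier R" using s a by (auto simp: Pi_iff)
    have am: "a m \<in> UNIV \<rightarrow> carrier R" "s m \<in> carrier R" using s a by auto
    have c3: "(\<lambda>i. lincomb M n (a i) x) \<in> {..<Suc m} \<rightarrow> carrier M"
      using a x by (auto intro!: lincomb_closed)
    show ?case
      unfolding 1 lincomb_add_left[OF c1 c2 x] lincomb_Suc[OF s c3] Suc.IH
        lincomb_smult[OF am(2,1) x] ..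
  }
qed

lemma lincomb_smult_vector:
  assumes "c \<in> UNIV \<rightarrow> carrier R" "v \<in> {..<n} \<rightarrow> carrier R" "y \<in> carrier M"
  shows "lincomb M n c (\<lambda>j. v j \<odot>\<^bsub>M\<^esub> y) = lincomb (regular_module R) n c v \<odot>\<^bsub>M\<^esub> y"
  using assms(2)
proof (induction n)
  interpret reg: left_module R "regular_module R" by (rule left_module_regular) (rule R.ring_axioms)
  {
    case 0 then show ?case using assms by simp
  next
    case (Suc n)
    have v: "v \<in> {..<n} \<rightarrow> carrier R" "v n \<in> carrier R" "c n \<in> carrier R" using Suc.prems assms by auto
    have 1: "(\<lambda>j. v j \<odot>\<^bsub>M\<^esub> y) \<in> {..<Suc n} \<rightarrow> carrier M"
      using Suc.prems assms by (auto intro!: smult_closed)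
    have 2: "v \<in> {..<Suc n} \<rightarrow> carrier (regular_module R)" using Suc.prems by simp
    show ?case
      unfolding lincomb_Suc[OF assms(1) 1] reg.lincomb_Suc[OF assms(1) 2] Suc.IH[OF v(1)]
      using v assms by (simp add: smult_l_distr smult_assoc lincomb_regular_closed)
  }
qed

lemma comm_group_tuples: "comm_group (tuple_group M n (tuples M n))"
proof (rule comm_groupI)
  fix x assume "x \<in> carrier (tuple_group M n (tuples M n))"
  then have x: "x \<in> tuples M n" by simp
  then have "tmap n (\<lambda>x. \<ominus>\<^bsub>M\<^esub> x) x \<in> tuples M n" by (auto intro!: tmap_tuples)
  moreover have "tadd M n (tmap n (\<lambda>x. \<ominus>\<^bsub>M\<^esub> x) x) x = tzero M n"
    using tuplesD[OF x] by (auto simp: tadd_def tzero_def fun_eq_iff M.l_neg)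
  ultimately show "\<exists>y\<in>carrier (tuple_group M n (tuples M n)).
      y \<otimes>\<^bsub>tuple_group M n (tuples M n)\<^esub> x = \<one>\<^bsub>tuple_group M n (tuples M n)\<^esub>"
    by auto
qed (auto simp: tadd_def tzero_def tuples_def fun_eq_iff M.a_ac PiE_iff extensional_def)

lemma tadd_tuples: "x \<in> tuples M n \<Longrightarrow> y \<in> tuples M n \<Longrightarrow> tadd M n x y \<in> tuples M n"
  by (auto simp: tadd_def tuples_def)

lemma tzero_tuples: "tzero M n \<in> tuples M n"
  by (auto simp: tzero_def tuples_def)

lemma subgroup_tuplesI:
  assumes sub: "P \<subseteq> tuples M n" and z: "tzero M n \<in> P"
    and add: "\<And>x y. x \<in> P \<Longrightarrow> y \<in> P \<Longrightarrow> tadd M n x y \<in> P"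
    and inv: "\<And>x. x \<in> P \<Longrightarrow> tmap n (\<lambda>x. \<ominus>\<^bsub>M\<^esub> x) x \<in> P"
  shows "subgroup P (tuple_group M n (tuples M n))"
proof -
  interpret G: comm_group "tuple_group M n (tuples M n)" by (rule comm_group_tuples)
  have "inv\<^bsub>tuple_group M n (tuples M n)\<^esub> x = tmap n (\<lambda>x. \<ominus>\<^bsub>M\<^esub> x) x" if "x \<in> P" for x
  proof (rule G.inv_equality)
    have x: "x \<in> tuples M n" using that sub by auto
    then show "tmap n (\<lambda>x. \<ominus>\<^bsub>M\<^esub> x) x \<otimes>\<^bsub>tuple_group M n (tuples M n)\<^esub> x = \<one>\<^bsub>tuple_group M n (tuples M n)\<^esub>"
      using tuplesD[OF x] by (auto simp: tadd_def tzero_def fun_eq_iff M.l_neg)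
    show "x \<in> carrier (tuple_group M n (tuples M n))" using x by simp
    show "tmap n (\<lambda>x. \<ominus>\<^bsub>M\<^esub> x) x \<in> carrier (tuple_group M n (tuples M n))"
      using x by (auto intro!: tmap_tuples)
  qed
  then show ?thesis
    by (intro G.subgroupI) (use assms in auto)
qed

lemma lincomb_tadd:
  assumes "c \<in> UNIV \<rightarrow> carrier R" "x \<in> tuples M n" "y \<in> tuples M n"
  shows "lincomb M n c (tadd M n x y) = lincomb M n c x \<oplus>\<^bsub>M\<^esub> lincomb M n c y"
proof -
  have "lincomb M n c (tadd M n x y) = lincomb M n c (\<lambda>j. x j \<oplus>\<^bsub>M\<^esub> y j)"
    by (rule lincomb_cong) (use assms tadd_tuples in \<open>auto intro!: tuples_Pi\<close>)
  then show ?thesis using assms by (simp add: lincomb_add_right tuples_Pi)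
qed

lemma lincomb_tzero: "c \<in> UNIV \<rightarrow> carrier R \<Longrightarrow> lincomb M n c (tzero M n) = \<zero>\<^bsub>M\<^esub>"
  by (subst lincomb_cong[where d=c and y="\<lambda>j. \<zero>\<^bsub>M\<^esub>"]) (auto intro!: tuples_Pi tzero_tuples lincomb_zero_right)

lemma lincomb_tneg:
  assumes "c \<in> UNIV \<rightarrow> carrier R" "x \<in> tuples M n"
  shows "lincomb M n c (tmap n (\<lambda>x. \<ominus>\<^bsub>M\<^esub> x) x) = \<ominus>\<^bsub>M\<^esub> lincomb M n c x"
proof -
  let ?y = "tmap n (\<lambda>x. \<ominus>\<^bsub>M\<^esub> x) x"
  have y: "?y \<in> tuples M n" using assms by (auto intro!: tmap_tuples)
  have "tadd M n ?y x = tzero M n"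
    using tuplesD[OF assms(2)] by (auto simp: tadd_def tzero_def fun_eq_iff M.l_neg)
  then have "lincomb M n c ?y \<oplus>\<^bsub>M\<^esub> lincomb M n c x = \<zero>\<^bsub>M\<^esub>"
    using lincomb_tadd[OF assms(1) y assms(2)] lincomb_tzero[OF assms(1)] by simp
  then show ?thesis
    using M.minus_equality[of "lincomb M n c ?y" "lincomb M n c x"] assms y by (simp add: lincomb_closed tuples_Pi)
qed

lemma subgroup_sols:
  assumes "a \<in> UNIV \<rightarrow> UNIV \<rightarrow> carrier R"
  shows "subgroup (sols M m n a) (tuple_group M n (tuples M n))"
proof -
  have "a i \<in> UNIV \<rightarrow> carrier R" for i using assms by auto
  then show ?thesis
    by (intro subgroup_tuplesI)
      (auto simp: sols_def lincomb_tadd lincomb_tzero lincomb_tneg tadd_tuples tzero_tuples intro!: tmap_tuples)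
qed

lemma mat_app_tuples:
  assumes "a \<in> UNIV \<rightarrow> UNIV \<rightarrow> carrier R" "x \<in> tuples M n"
  shows "mat_app M m n a x \<in> tuples M m"
proof -
  have "a i \<in> UNIV \<rightarrow> carrier R" for i using assms by auto
  then show ?thesis using assms by (auto simp: mat_app_def tuples_def intro!: lincomb_closed)
qed

lemma mat_app_tadd:
  assumes "a \<in> UNIV \<rightarrow> UNIV \<rightarrow> carrier R" "x \<in> tuples M n" "y \<in> tuples M n"
  shows "mat_app M m n a (tadd M n x y) = tadd M m (mat_app M m n a x) (mat_app M m n a y)"
proof -
  have "a i \<in> UNIV \<rightarrow> carrier R" for i using assms by auto
  then show ?thesis using assms by (auto simp: mat_app_def tadd_def[of M m] lincomb_tadd fun_eq_iff)
qed

lemma subgroup_mat_app_image: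
  assumes a: "a \<in> UNIV \<rightarrow> UNIV \<rightarrow> carrier R" and P: "subgroup P (tuple_group M n (tuples M n))"
  shows "subgroup (mat_app M m n a ` P) (tuple_group M m (tuples M m))"
proof -
  interpret G: comm_group "tuple_group M n (tuples M n)" by (rule comm_group_tuples)
  interpret H: comm_group "tuple_group M m (tuples M m)" by (rule comm_group_tuples)
  have "group_hom (tuple_group M n (tuples M n)) (tuple_group M m (tuples M m)) (mat_app M m n a)"
    by (intro group_hom.intro group_hom_axioms.intro homI G.is_group H.is_group)
      (auto simp: mat_app_tuples[OF a] mat_app_tadd[OF a])
  then show ?thesis using P by (rule group_hom.subgroup_img_is_subgroup)
qed

lemma mat_app_delta:
  assumes "x \<in> tuples M n"
  shows "mat_app M n n (\<lambda>i j. if j = i then \<one>\<^bsub>R\<^esub> else \<zero>\<^bsub>R\<^esub>) x = x"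
  by (rule tuples_eqI[OF mat_app_tuples assms]) (use assms in \<open>auto simp: lincomb_delta tuples_Pi\<close>)

end

lemma lincomb_lin_hom:
  assumes "f \<in> lin_hom R M N" "left_module R M" "left_module R N" "c \<in> UNIV \<rightarrow> carrier R" "x \<in> {..<n} \<rightarrow> carrier M"
  shows "f (lincomb M n c x) = lincomb N n c (\<lambda>j. f (x j))"
  using assms(5)
proof (induction n)
  interpret M: left_module R M by fact
  interpret N: left_module R N by fact
  {
    case 0
    then show ?case using assms by (simp add: lin_hom_zero M.left_module_axioms)
  next
    case (Suc n)
    have 1: "(\<lambda>j. f (x j)) \<in> {..<Suc n} \<rightarrow> carrier N"
      using Suc.prems lin_hom_closed[OF assms(1)] by auto
    have 2: "x \<in> {..<n} \<rightarrow> carrier M" "x n \<in> carrier M" "c n \<in> carrier R" using Suc.prems assms by auto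
    show ?case
      unfolding M.lincomb_Suc[OF assms(4) Suc.prems] N.lincomb_Suc[OF assms(4) 1] Suc.IH[OF 2(1), symmetric]
      using 2 assms by (simp add: lin_hom_add[OF assms(1)] lin_hom_smult[OF assms(1)] M.lincomb_closed M.smult_closed)
  }
qed

lemma tmap_mat_app:
  assumes "f \<in> lin_hom R M N" "left_module R M" "left_module R N" "a \<in> UNIV \<rightarrow> UNIV \<rightarrow> carrier R" "x \<in> tuples M n"
  shows "tmap m f (mat_app M m n a x) = mat_app N m n a (tmap n f x)"
proof -
  interpret M: left_module R M by fact
  interpret N: left_module R N by fact
  have *: "a i \<in> UNIV \<rightarrow> carrier R" for i using assms by auto
  have "lincomb N n (a i) (\<lambda>j. f (x j)) = lincomb N n (a i) (tmap n f x)" for i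
    by (rule N.lincomb_cong) (use * assms in \<open>auto intro!: lin_hom_closed[OF assms(1)] tuplesD\<close>)
  then show ?thesis using assms *
    by (auto simp: tmap_def[of m] mat_app_def fun_eq_iff lincomb_lin_hom tuples_Pi)
qed

lemma tmap_sols:
  assumes "f \<in> lin_hom R M N" "left_module R M" "left_module R N" "a \<in> UNIV \<rightarrow> UNIV \<rightarrow> carrier R" "x \<in> sols M m n a"
  shows "tmap n f x \<in> sols N m n a"
proof -
  interpret M: left_module R M by fact
  interpret N: left_module R N by fact
  have x: "x \<in> tuples M n" using assms(5) by (rule sols_tuples)
  have "lincomb N n (a i) (tmap n f x) = f (lincomb M n (a i) x)" if "i < m" for i
    using fun_cong[OF tmap_mat_app[OF assms(1-4) x, of m], of i] that by simp
  then show ?thesis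
    using assms x by (auto simp: sols_def lin_hom_zero[OF assms(1) M.left_module_axioms]
        intro!: tmap_tuples lin_hom_closed[OF assms(1)])
qed

section \<open>Quotients and finite presentations\<close>

definition image_module :: "('a, 'x) module \<Rightarrow> ('x \<Rightarrow> 'y) \<Rightarrow> ('a, 'y) module"
  where "image_module M q = (let r = inv_into (carrier M) q in
    mk_module (q ` carrier M) (\<lambda>A B. q (r A \<oplus>\<^bsub>M\<^esub> r B)) (q \<zero>\<^bsub>M\<^esub>) (\<lambda>a A. q (a \<odot>\<^bsub>M\<^esub> r A)))"

definition image_group :: "'x monoid \<Rightarrow> ('x \<Rightarrow> 'y) \<Rightarrow> 'y monoid"
  where "image_group G q = (let r = inv_into (carrier G) q in
    \<lparr>carrier = q ` carrier G, monoid.mult = (\<lambda>A B. q (r A \<otimes>\<^bsub>G\<^esub> r B)), monoid.one = q \<one>\<^bsub>G\<^esub>\<rparr>)"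

lemma image_module_simps [simp]:
  "carrier (image_module M q) = q ` carrier M" "\<zero>\<^bsub>image_module M q\<^esub> = q \<zero>\<^bsub>M\<^esub>"
  by (simp_all add: image_module_def Let_def)

lemma image_group_simps [simp]:
  "carrier (image_group G q) = q ` carrier G" "\<one>\<^bsub>image_group G q\<^esub> = q \<one>\<^bsub>G\<^esub>"
  by (simp_all add: image_group_def Let_def)

lemma image_group_mult:
  assumes "\<And>x x' y y'. \<lbrakk>x \<in> carrier G; x' \<in> carrier G; y \<in> carrier G; y' \<in> carrier G; q x = q x'; q y = q y'\<rbrakk>
      \<Longrightarrow> q (x \<otimes>\<^bsub>G\<^esub> y) = q (x' \<otimes>\<^bsub>G\<^esub> y')"
    and "x \<in> carrier G" "y \<in> carrier G"
  shows "q x \<otimes>\<^bsub>image_group G q\<^esub> q y = q (x \<otimes>\<^bsub>G\<^esub> y)"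
  unfolding image_group_def Let_def
  using assms(2,3) by (simp, intro assms(1)) (auto intro: f_inv_into_f inv_into_into)

lemma comm_group_image_group:
  assumes "comm_group G"
    and q: "\<And>x x' y y'. \<lbrakk>x \<in> carrier G; x' \<in> carrier G; y \<in> carrier G; y' \<in> carrier G; q x = q x'; q y = q y'\<rbrakk>
      \<Longrightarrow> q (x \<otimes>\<^bsub>G\<^esub> y) = q (x' \<otimes>\<^bsub>G\<^esub> y')"
  shows "comm_group (image_group G q)"
proof -
  interpret G: comm_group G by fact
  note m = image_group_mult[of G q, OF q]
  show ?thesis
  proof (rule comm_groupI)
    fix A assume "A \<in> carrier (image_group G q)"
    then obtain x where "x \<in> carrier G" "A = q x" by auto
    then show "\<exists>B\<in>carrier (image_group G q). B \<otimes>\<^bsub>image_group G q\<^esub> A = \<one>\<^bsub>image_group G q\<^esub>"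
      by (auto intro!: bexI[of _ "inv\<^bsub>G\<^esub> x"] simp: m)
  qed (auto simp: m G.m_ac)
qed

lemma
  assumes "left_module R M"
    and q: "\<And>x x' y y'. \<lbrakk>x \<in> carrier M; x' \<in> carrier M; y \<in> carrier M; y' \<in> carrier M; q x = q x'; q y = q y'\<rbrakk>
      \<Longrightarrow> q (x \<oplus>\<^bsub>M\<^esub> y) = q (x' \<oplus>\<^bsub>M\<^esub> y')"
    and qs: "\<And>a x x'. \<lbrakk>a \<in> carrier R; x \<in> carrier M; x' \<in> carrier M; q x = q x'\<rbrakk> \<Longrightarrow> q (a \<odot>\<^bsub>M\<^esub> x) = q (a \<odot>\<^bsub>M\<^esub> x')"
  shows left_module_image_module: "left_module R (image_module M q)"
    and image_module_hom: "restrict q (carrier M) \<in> lin_hom R M (image_module M q)"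
proof -
  interpret M: left_module R M by fact
  have m: "q x \<oplus>\<^bsub>image_module M q\<^esub> q y = q (x \<oplus>\<^bsub>M\<^esub> y)" if "x \<in> carrier M" "y \<in> carrier M" for x y
    unfolding image_module_def Let_def using that
    by (simp, intro q) (auto intro: f_inv_into_f inv_into_into)
  have s: "a \<odot>\<^bsub>image_module M q\<^esub> q x = q (a \<odot>\<^bsub>M\<^esub> x)" if "a \<in> carrier R" "x \<in> carrier M" for a x
    unfolding image_module_def Let_def using that
    by (simp, intro qs) (auto intro: f_inv_into_f inv_into_into)
  have "abelian_group (image_module M q)"
  proof (rule abelian_groupI)
    fix A assume "A \<in> carrier (image_module M q)"
    then obtain x where "x \<in> carrier M" "A = q x" by auto
    then show "\<exists>B\<in>carrier (image_module M q). B \<oplus>\<^bsub>image_module M q\<^esub> A = \<zero>\<^bsub>image_module M q\<^esub>"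
      by (auto intro!: bexI[of _ "\<ominus>\<^bsub>M\<^esub> x"] simp: m M.M.l_neg)
  qed (auto simp: m M.M.a_ac)
  then show "left_module R (image_module M q)"
    by (intro left_module.intro left_module_axioms.intro)
      (auto simp: m s M.smult_closed M.smult_l_distr M.smult_r_distr M.smult_assoc M.smult_one M.R.ring_axioms)
  show "restrict q (carrier M) \<in> lin_hom R M (image_module M q)"
    by (rule lin_homI) (auto simp: m s M.smult_closed)
qed

lemma (in comm_group) r_coset_eq_iff:
  assumes "subgroup N G" "x \<in> carrier G" "y \<in> carrier G"
  shows "N #> x = N #> y \<longleftrightarrow> x \<otimes> inv y \<in> N"
proof
  assume eq: "N #> x = N #> y"
  have "x \<in> N #> y" using rcos_self[OF assms(2,1)] eq by simp
  then obtain h where "h \<in> N" "x = h \<otimes> y" by (auto simp: r_coset_def)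
  then show "x \<otimes> inv y \<in> N"
    using assms subgroup.mem_carrier[OF assms(1)] by (simp add: m_assoc)
next
  assume h: "x \<otimes> inv y \<in> N"
  have "x = (x \<otimes> inv y) \<otimes> y" using assms by (simp add: m_assoc)
  then have "x \<in> N #> y" using h by (auto simp: r_coset_def)
  then show "N #> x = N #> y"
    using repr_independence[of x N y] assms by auto
qed

lemma (in comm_group) r_coset_cong:
  assumes N: "subgroup N G" and "x \<in> carrier G" "x' \<in> carrier G" "y \<in> carrier G" "y' \<in> carrier G"
    "N #> x = N #> x'" "N #> y = N #> y'"
  shows "N #> (x \<otimes> y) = N #> (x' \<otimes> y')"
proof -
  note sum = normal.rcos_sum[OF subgroup_imp_normal[OF N]]
  show ?thesis using sum[of x y] sum[of x' y'] assms by simp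
qed

definition quotient_module :: "('a, 'x) module \<Rightarrow> 'x set \<Rightarrow> ('a, 'x set) module"
  where "quotient_module M U = image_module M (\<lambda>x. U #>\<^bsub>add_monoid M\<^esub> x)"

lemma quotient_module:
  assumes "left_module R M" "submodule U R M"
  shows left_module_quotient: "left_module R (quotient_module M U)"
    and quotient_module_hom: "(\<lambda>x\<in>carrier M. U #>\<^bsub>add_monoid M\<^esub> x) \<in> lin_hom R M (quotient_module M U)"
    and quotient_module_zero: "x \<in> carrier M \<Longrightarrow> U #>\<^bsub>add_monoid M\<^esub> x = \<zero>\<^bsub>quotient_module M U\<^esub> \<longleftrightarrow> x \<in> U"
    and quotient_module_carrier: "carrier (quotient_module M U) = (\<lambda>x. U #>\<^bsub>add_monoid M\<^esub> x) ` carrier M"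
proof -
  interpret M: left_module R M by fact
  interpret U: submodule U R M by fact
  let ?q = "\<lambda>x. U #>\<^bsub>add_monoid M\<^esub> x"
  have qe: "?q x = ?q y \<longleftrightarrow> x \<oplus>\<^bsub>M\<^esub> (\<ominus>\<^bsub>M\<^esub> y) \<in> U" if "x \<in> carrier M" "y \<in> carrier M" for x y
    using comm_group.r_coset_eq_iff[OF M.a_comm_group U.subgroup_axioms] that by (simp add: a_inv_def)
  have 1: "?q (x \<oplus>\<^bsub>M\<^esub> y) = ?q (x' \<oplus>\<^bsub>M\<^esub> y')"
    if "x \<in> carrier M" "x' \<in> carrier M" "y \<in> carrier M" "y' \<in> carrier M" "?q x = ?q x'" "?q y = ?q y'" for x x' y y'
    using comm_group.r_coset_cong[OF M.a_comm_group U.subgroup_axioms, unfolded monoid_record_simps, OF that] .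
  have 2: "?q (a \<odot>\<^bsub>M\<^esub> x) = ?q (a \<odot>\<^bsub>M\<^esub> x')"
    if "a \<in> carrier R" "x \<in> carrier M" "x' \<in> carrier M" "?q x = ?q x'" for a x x'
  proof -
    have "a \<odot>\<^bsub>M\<^esub> (\<ominus>\<^bsub>M\<^esub> x') \<oplus>\<^bsub>M\<^esub> a \<odot>\<^bsub>M\<^esub> x' = \<zero>\<^bsub>M\<^esub>"
      using that M.smult_r_distr[of a "\<ominus>\<^bsub>M\<^esub> x'" x'] by (simp add: M.M.l_neg)
    then have n: "\<ominus>\<^bsub>M\<^esub> (a \<odot>\<^bsub>M\<^esub> x') = a \<odot>\<^bsub>M\<^esub> (\<ominus>\<^bsub>M\<^esub> x')"
      using that by (intro M.M.minus_equality) (auto simp: M.smult_closed)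
    have "a \<odot>\<^bsub>M\<^esub> (x \<oplus>\<^bsub>M\<^esub> (\<ominus>\<^bsub>M\<^esub> x')) \<in> U" using that qe by (auto intro: U.smult_closed)
    then show ?thesis using that by (simp add: qe M.smult_closed M.smult_r_distr n)
  qed
  show "left_module R (quotient_module M U)" unfolding quotient_module_def
    by (rule left_module_image_module[OF assms(1) 1 2])
  show "(\<lambda>x\<in>carrier M. U #>\<^bsub>add_monoid M\<^esub> x) \<in> lin_hom R M (quotient_module M U)" unfolding quotient_module_def
    by (rule image_module_hom[OF assms(1) 1 2])
  show "x \<in> carrier M \<Longrightarrow> U #>\<^bsub>add_monoid M\<^esub> x = \<zero>\<^bsub>quotient_module M U\<^esub> \<longleftrightarrow> x \<in> U"
  proof -
    assume x: "x \<in> carrier M"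
    have "\<ominus>\<^bsub>M\<^esub> \<zero>\<^bsub>M\<^esub> = \<zero>\<^bsub>M\<^esub>" by (rule M.M.minus_equality) auto
    then have "x \<oplus>\<^bsub>M\<^esub> (\<ominus>\<^bsub>M\<^esub> \<zero>\<^bsub>M\<^esub>) = x" using x by (metis M.M.r_zero)
    then show ?thesis using qe[OF x, of "\<zero>\<^bsub>M\<^esub>"] unfolding quotient_module_def by (simp only: image_module_simps M.M.zero_closed)
  qed
  show "carrier (quotient_module M U) = (\<lambda>x. U #>\<^bsub>add_monoid M\<^esub> x) ` carrier M"
    unfolding quotient_module_def by simp
qed

lemma free_module_simps [simp]:
  "carrier (free_module R n) = tuples (regular_module R) n" "\<zero>\<^bsub>free_module R n\<^esub> = tzero (regular_module R) n"
  "ring.add (free_module R n) = tadd (regular_module R) n"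
  by (auto simp: free_module_def tuples_def tzero_def tadd_def fun_eq_iff)

lemma free_module_smult: "a \<odot>\<^bsub>free_module R n\<^esub> v = tmap n (\<lambda>x. a \<otimes>\<^bsub>R\<^esub> x) v"
  by (simp add: free_module_def tmap_def)

lemma left_module_free:
  assumes "ring R"
  shows "left_module R (free_module R n)"
proof -
  interpret ring R by fact
  interpret reg: left_module R "regular_module R" using assms by (rule left_module_regular)
  interpret G: comm_group "tuple_group (regular_module R) n (tuples (regular_module R) n)"
    by (rule reg.comm_group_tuples)
  have "abelian_group (free_module R n)"
    by (rule abelian_groupI)
      (use G.m_assoc G.m_comm G.l_one G.l_inv_ex G.m_closed G.one_closed in \<open>auto\<close>)
  moreover have "left_module_axioms R (free_module R n)"
    by (rule left_module_axioms.intro)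
      (auto simp: free_module_smult tmap_def tadd_def tuples_def fun_eq_iff l_distr r_distr m_assoc PiE_iff extensional_def)
  ultimately show ?thesis by (intro left_module.intro assms)
qed

definition unit_tuple :: "('a, 'e) ring_scheme \<Rightarrow> nat \<Rightarrow> nat \<Rightarrow> nat \<Rightarrow> 'a"
  where "unit_tuple R n i = (\<lambda>j\<in>{..<n}. if j = i then \<one>\<^bsub>R\<^esub> else \<zero>\<^bsub>R\<^esub>)"

definition extend_zero :: "('a, 'e) ring_scheme \<Rightarrow> nat \<Rightarrow> (nat \<Rightarrow> 'a) \<Rightarrow> nat \<Rightarrow> 'a"
  where "extend_zero R n v = (\<lambda>j. if j < n then v j else \<zero>\<^bsub>R\<^esub>)"

lemma extend_zero_closed:
  assumes "ring R" "v \<in> {..<n} \<rightarrow> carrier R"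
  shows "extend_zero R n v \<in> UNIV \<rightarrow> carrier R"
proof -
  interpret ring R by fact
  show ?thesis using assms by (auto simp: extend_zero_def)
qed

lemma extend_zero_apply [simp]: "j < n \<Longrightarrow> extend_zero R n v j = v j"
  by (simp add: extend_zero_def)

lemma unit_tuple_closed: "ring R \<Longrightarrow> unit_tuple R n i \<in> tuples (regular_module R) n"
proof -
  assume "ring R"
  then interpret ring R .
  show ?thesis by (auto simp: unit_tuple_def tuples_def)
qed

lemma lincomb_free_module:
  assumes "ring R" "c \<in> UNIV \<rightarrow> carrier R" "v \<in> {..<k} \<rightarrow> tuples (regular_module R) n" "j < n"
  shows "lincomb (free_module R n) k c v j = lincomb (regular_module R) k c (\<lambda>i. v i j)"
  using assms(3)
proof (induction k)
  interpret F: left_module R "free_module R n" using assms(1) by (rule left_module_free)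
  interpret reg: left_module R "regular_module R" using assms(1) by (rule left_module_regular)
  {
    case 0 then show ?case using assms by simp
  next
    case (Suc k)
    have 1: "v \<in> {..<Suc k} \<rightarrow> carrier (free_module R n)" using Suc.prems by simp
    have 2: "(\<lambda>i. v i j) \<in> {..<Suc k} \<rightarrow> carrier (regular_module R)"
      using Suc.prems assms(4) by (auto intro!: tuplesD[of _ "regular_module R", simplified])
    have 3: "v \<in> {..<k} \<rightarrow> tuples (regular_module R) n" using Suc.prems by auto
    show ?case
      unfolding F.lincomb_Suc[OF assms(2) 1] reg.lincomb_Suc[OF assms(2) 2]
      using Suc.IH[OF 3] assms(4) by (simp add: free_module_smult)
  }
qed

lemma free_module_expand:
  assumes "ring R" "v \<in> tuples (regular_module R) n"
  shows "v = lincomb (free_module R n) n (extend_zero R n v) (unit_tuple R n)"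
proof -
  interpret R: ring R by fact
  interpret F: left_module R "free_module R n" using assms(1) by (rule left_module_free)
  interpret reg: left_module R "regular_module R" using assms(1) by (rule left_module_regular)
  have v: "extend_zero R n v \<in> UNIV \<rightarrow> carrier R"
    using assms tuples_Pi[OF assms(2)] by (intro extend_zero_closed) auto
  have c: "lincomb (free_module R n) n (extend_zero R n v) (unit_tuple R n) \<in> tuples (regular_module R) n"
    using F.lincomb_closed[of "extend_zero R n v" "unit_tuple R n" n] v assms unit_tuple_closed by auto
  show ?thesis
  proof (rule tuples_eqI[OF assms(2) c])
    fix j assume j: "j < n"
    have "lincomb (free_module R n) n (extend_zero R n v) (unit_tuple R n) j =
      lincomb (regular_module R) n (extend_zero R n v) (\<lambda>i. unit_tuple R n i j)"
      by (rule lincomb_free_module) (use assms v j unit_tuple_closed in auto)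
    also have "\<dots> = (\<Oplus>\<^bsub>regular_module R\<^esub>i\<in>{..<n}. if j = i then v i else \<zero>\<^bsub>regular_module R\<^esub>)"
      unfolding lincomb_def
      by (rule reg.M.finsum_cong') (use j tuplesD[OF assms(2)] in \<open>auto simp: unit_tuple_def Pi_iff\<close>)
    also have "\<dots> = v j" using reg.M.add.finprod_singleton[of j "{..<n}" v] j tuples_Pi[OF assms(2)] by simp
    finally show "v j = lincomb (free_module R n) n (extend_zero R n v) (unit_tuple R n) j" by simp
  qed
qed

lemma lin_hom_free_expand:
  assumes "ring R" "left_module R N" "f \<in> lin_hom R (free_module R n) N" "v \<in> tuples (regular_module R) n"
  shows "f v = lincomb N n (extend_zero R n v) (\<lambda>i. f (unit_tuple R n i))"
proof -
  have v: "extend_zero R n v \<in> UNIV \<rightarrow> carrier R"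
    using assms tuples_Pi[OF assms(4)] by (intro extend_zero_closed) auto
  have "f v = f (lincomb (free_module R n) n (extend_zero R n v) (unit_tuple R n))"
    using free_module_expand[OF assms(1,4)] by simp
  also have "\<dots> = lincomb N n (extend_zero R n v) (\<lambda>i. f (unit_tuple R n i))"
    by (rule lincomb_lin_hom[OF assms(3) left_module_free assms(2) v]) (use assms unit_tuple_closed in auto)
  finally show ?thesis .
qed

lemma lin_hom_free_of_tuple:
  assumes "left_module R M" "u \<in> {..<n} \<rightarrow> carrier M"
  shows "(\<lambda>v\<in>tuples (regular_module R) n. lincomb M n (extend_zero R n v) u) \<in> lin_hom R (free_module R n) M"
proof -
  interpret M: left_module R M by fact
  interpret F: left_module R "free_module R n" using M.R.ring_axioms by (rule left_module_free)
  have e: "extend_zero R n v \<in> UNIV \<rightarrow> carrier R" if "v \<in> tuples (regular_module R) n" for v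
    using that M.R.ring_axioms tuples_Pi[OF that] by (intro extend_zero_closed) auto
  show ?thesis
  proof (rule lin_homI)
    show "(\<lambda>v\<in>tuples (regular_module R) n. lincomb M n (extend_zero R n v) u)
        \<in> carrier (free_module R n) \<rightarrow>\<^sub>E carrier M"
      using assms by (auto intro!: M.lincomb_closed e)
  next
    fix v w assume vw: "v \<in> carrier (free_module R n)" "w \<in> carrier (free_module R n)"
    have vw': "v \<oplus>\<^bsub>free_module R n\<^esub> w \<in> carrier (free_module R n)" using vw by (rule F.M.a_closed)
    have "lincomb M n (extend_zero R n (v \<oplus>\<^bsub>free_module R n\<^esub> w)) u =
        lincomb M n (\<lambda>j. extend_zero R n v j \<oplus>\<^bsub>R\<^esub> extend_zero R n w j) u"
      by (rule M.lincomb_cong) (use vw vw' e assms in auto)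
    also have "\<dots> = lincomb M n (extend_zero R n v) u \<oplus>\<^bsub>M\<^esub> lincomb M n (extend_zero R n w) u"
      using vw e assms by (intro M.lincomb_add_left) auto
    finally show "(\<lambda>v\<in>tuples (regular_module R) n. lincomb M n (extend_zero R n v) u) (v \<oplus>\<^bsub>free_module R n\<^esub> w) =
      (\<lambda>v\<in>tuples (regular_module R) n. lincomb M n (extend_zero R n v) u) v \<oplus>\<^bsub>M\<^esub>
      (\<lambda>v\<in>tuples (regular_module R) n. lincomb M n (extend_zero R n v) u) w" using vw vw' by simp
  next
    fix a v assume av: "a \<in> carrier R" "v \<in> carrier (free_module R n)"
    have av': "a \<odot>\<^bsub>free_module R n\<^esub> v \<in> carrier (free_module R n)" using av by (rule F.smult_closed)
    have "lincomb M n (extend_zero R n (a \<odot>\<^bsub>free_module R n\<^esub> v)) u =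
        lincomb M n (\<lambda>j. a \<otimes>\<^bsub>R\<^esub> extend_zero R n v j) u"
      by (rule M.lincomb_cong) (use av av' e assms in \<open>auto simp: free_module_smult\<close>)
    also have "\<dots> = a \<odot>\<^bsub>M\<^esub> lincomb M n (extend_zero R n v) u"
      using av e assms by (intro M.lincomb_smult) auto
    finally show "(\<lambda>v\<in>tuples (regular_module R) n. lincomb M n (extend_zero R n v) u) (a \<odot>\<^bsub>free_module R n\<^esub> v) =
      a \<odot>\<^bsub>M\<^esub> (\<lambda>v\<in>tuples (regular_module R) n. lincomb M n (extend_zero R n v) u) v" using av av' by simp
  qed
qed

text \<open>\<open>M\<close> has generators \<open>u 0, \<dots>, u (n - 1)\<close> and the rows of the \<open>m \<times> n\<close>-matrix \<open>a\<close>
  generate the relations.\<close>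

definition pres_by ::
  "('a, 'e) ring_scheme \<Rightarrow> nat \<Rightarrow> nat \<Rightarrow> (nat \<Rightarrow> nat \<Rightarrow> 'a) \<Rightarrow> ('a, 'x) module \<Rightarrow> (nat \<Rightarrow> 'x) \<Rightarrow> bool"
  where "pres_by R m n a M u \<longleftrightarrow> left_module R M \<and> a \<in> UNIV \<rightarrow> UNIV \<rightarrow> carrier R \<and> u \<in> {..<n} \<rightarrow> carrier M \<and>
    (\<forall>x\<in>carrier M. \<exists>c\<in>UNIV \<rightarrow> carrier R. x = lincomb M n c u) \<and>
    (\<forall>c\<in>UNIV \<rightarrow> carrier R. lincomb M n c u = \<zero>\<^bsub>M\<^esub> \<longleftrightarrow>
      (\<exists>s\<in>UNIV \<rightarrow> carrier R. \<forall>j<n. c j = lincomb (regular_module R) m s (\<lambda>i. a i j)))"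

lemma pres_byD:
  assumes "pres_by R m n a M u"
  shows "left_module R M" "a \<in> UNIV \<rightarrow> UNIV \<rightarrow> carrier R" "u \<in> {..<n} \<rightarrow> carrier M"
    "x \<in> carrier M \<Longrightarrow> \<exists>c\<in>UNIV \<rightarrow> carrier R. x = lincomb M n c u"
    "c \<in> UNIV \<rightarrow> carrier R \<Longrightarrow> lincomb M n c u = \<zero>\<^bsub>M\<^esub> \<longleftrightarrow>
      (\<exists>s\<in>UNIV \<rightarrow> carrier R. \<forall>j<n. c j = lincomb (regular_module R) m s (\<lambda>i. a i j))"
  using assms by (auto simp: pres_by_def)

lemma fin_presented_pres_by:
  fixes M :: "('a, 'x) module"
  assumes "fin_presented R M"
  obtains m n a and u :: "nat \<Rightarrow> 'x" where "pres_by R m n a M u"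
proof -
  from assms obtain m n \<phi> \<pi> where lM: "left_module R M"
    and \<phi>: "\<phi> \<in> lin_hom R (free_module R m) (free_module R n)"
    and \<pi>: "\<pi> \<in> lin_hom R (free_module R n) M"
    and im: "\<pi> ` tuples (regular_module R) n = carrier M"
    and ker: "\<phi> ` tuples (regular_module R) m = {v \<in> tuples (regular_module R) n. \<pi> v = \<zero>\<^bsub>M\<^esub>}"
    unfolding fin_presented_def by auto
  interpret M: left_module R M by fact
  interpret F: left_module R "free_module R n" using M.R.ring_axioms by (rule left_module_free)
  interpret G: left_module R "free_module R m" using M.R.ring_axioms by (rule left_module_free)
  let ?T = "tuples (regular_module R)"
  have R: "ring R" ..
  define u where "u i = \<pi> (unit_tuple R n i)" for i
  define a where "a i = extend_zero R n (\<phi> (unit_tuple R m i))" for i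
  have e: "extend_zero R k v \<in> UNIV \<rightarrow> carrier R" if "v \<in> ?T k" for v k
    using that R tuples_Pi[OF that] by (intro extend_zero_closed) auto
  have \<phi>u: "\<phi> (unit_tuple R m i) \<in> ?T n" for i
    using lin_hom_closed[OF \<phi>] unit_tuple_closed[OF R] by auto
  have u: "u \<in> {..<n} \<rightarrow> carrier M"
    using lin_hom_closed[OF \<pi>] unit_tuple_closed[OF R] by (auto simp: u_def)
  have a: "a \<in> UNIV \<rightarrow> UNIV \<rightarrow> carrier R" using e[OF \<phi>u] by (auto simp: a_def)
  have pv: "\<pi> v = lincomb M n (extend_zero R n v) u" if "v \<in> ?T n" for v
    using lin_hom_free_expand[OF R lM \<pi> that] by (simp add: u_def[abs_def])
  have fw: "\<phi> w j = lincomb (regular_module R) m (extend_zero R m w) (\<lambda>i. a i j)" if "w \<in> ?T m" "j < n" for w j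
  proof -
    have "\<phi> w j = lincomb (free_module R n) m (extend_zero R m w) (\<lambda>i. \<phi> (unit_tuple R m i)) j"
      using lin_hom_free_expand[OF R F.left_module_axioms \<phi> that(1)] by simp
    also have "\<dots> = lincomb (regular_module R) m (extend_zero R m w) (\<lambda>i. \<phi> (unit_tuple R m i) j)"
      by (rule lincomb_free_module) (use R e that \<phi>u in auto)
    finally show ?thesis using that by (simp add: a_def)
  qed
  have ec: "lincomb M n c u = \<pi> (restrict c {..<n})" "restrict c {..<n} \<in> ?T n" if "c \<in> UNIV \<rightarrow> carrier R" for c
  proof -
    show *: "restrict c {..<n} \<in> ?T n" using that by (auto simp: tuples_def)
    show "lincomb M n c u = \<pi> (restrict c {..<n})" unfolding pv[OF *]
      by (rule M.lincomb_cong) (use that u in auto)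
  qed
  have "pres_by R m n a M u"
    unfolding pres_by_def
  proof (intro conjI ballI lM a u)
    fix x assume "x \<in> carrier M"
    then obtain v where "v \<in> ?T n" "x = \<pi> v" using im by auto
    then show "\<exists>c\<in>UNIV \<rightarrow> carrier R. x = lincomb M n c u" using pv e by metis
  next
    fix c :: "nat \<Rightarrow> 'a" assume c: "c \<in> UNIV \<rightarrow> carrier R"
    show "lincomb M n c u = \<zero>\<^bsub>M\<^esub> \<longleftrightarrow>
      (\<exists>s\<in>UNIV \<rightarrow> carrier R. \<forall>j<n. c j = lincomb (regular_module R) m s (\<lambda>i. a i j))"
    proof
      assume "lincomb M n c u = \<zero>\<^bsub>M\<^esub>"
      then have "restrict c {..<n} \<in> \<phi> ` ?T m" using ec[OF c] ker by auto
      then obtain w where w: "w \<in> ?T m" "\<phi> w = restrict c {..<n}" by auto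
      then have "\<forall>j<n. c j = lincomb (regular_module R) m (extend_zero R m w) (\<lambda>i. a i j)"
        using fw[OF w(1)] by (metis restrict_apply' lessThan_iff)
      then show "\<exists>s\<in>UNIV \<rightarrow> carrier R. \<forall>j<n. c j = lincomb (regular_module R) m s (\<lambda>i. a i j)"
        using e[OF w(1)] by blast
    next
      assume "\<exists>s\<in>UNIV \<rightarrow> carrier R. \<forall>j<n. c j = lincomb (regular_module R) m s (\<lambda>i. a i j)"
      then obtain s where s: "s \<in> UNIV \<rightarrow> carrier R"
        "\<forall>j<n. c j = lincomb (regular_module R) m s (\<lambda>i. a i j)" by auto
      let ?w = "restrict s {..<m}"
      interpret reg: left_module R "regular_module R" using R by (rule left_module_regular)
      have w: "?w \<in> ?T m" using s by (auto simp: tuples_def)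
      have "\<phi> ?w = restrict c {..<n}"
      proof (rule tuples_eqI[OF _ ec(2)[OF c]])
        show "\<phi> ?w \<in> ?T n" using lin_hom_closed[OF \<phi>] w by auto
        fix j assume j: "j < n"
        have "lincomb (regular_module R) m (extend_zero R m ?w) (\<lambda>i. a i j) = lincomb (regular_module R) m s (\<lambda>i. a i j)"
          by (rule reg.lincomb_cong) (use e[OF w] a in auto)
        then show "\<phi> ?w j = restrict c {..<n} j" using fw[OF w j] s j by simp
      qed
      then have "restrict c {..<n} \<in> {v \<in> ?T n. \<pi> v = \<zero>\<^bsub>M\<^esub>}" using ker w by (metis imageI)
      then show "lincomb M n c u = \<zero>\<^bsub>M\<^esub>" using ec[OF c] by simp
    qed
  qed
  then show thesis by (rule that)
qed

lemma pres_by_fin_presented: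
  assumes "pres_by R m n a M u"
  shows "fin_presented R M"
proof -
  note P = pres_byD[OF assms]
  interpret M: left_module R M by (rule P)
  interpret F: left_module R "free_module R n" using M.R.ring_axioms by (rule left_module_free)
  interpret reg: left_module R "regular_module R" using M.R.ring_axioms by (rule left_module_regular)
  let ?T = "tuples (regular_module R)"
  have R: "ring R" ..
  have e: "extend_zero R k v \<in> UNIV \<rightarrow> carrier R" if "v \<in> ?T k" for v k
    using that R tuples_Pi[OF that] by (intro extend_zero_closed) auto
  let ?row = "\<lambda>i. restrict (a i) {..<n}"
  have row: "?row \<in> {..<m} \<rightarrow> carrier (free_module R n)" using P(2) by (auto simp: tuples_def Pi_iff restrict_PiE_iff)
  define \<phi> where "\<phi> = (\<lambda>w\<in>?T m. lincomb (free_module R n) m (extend_zero R m w) ?row)"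
  define \<pi> where "\<pi> = (\<lambda>v\<in>?T n. lincomb M n (extend_zero R n v) u)"
  have \<phi>: "\<phi> \<in> lin_hom R (free_module R m) (free_module R n)"
    unfolding \<phi>_def by (rule lin_hom_free_of_tuple[OF F.left_module_axioms row])
  have \<pi>: "\<pi> \<in> lin_hom R (free_module R n) M"
    unfolding \<pi>_def by (rule lin_hom_free_of_tuple[OF P(1,3)])
  have fw: "\<phi> w j = lincomb (regular_module R) m (extend_zero R m w) (\<lambda>i. a i j)" if "w \<in> ?T m" "j < n" for w j
  proof -
    have "\<phi> w j = lincomb (regular_module R) m (extend_zero R m w) (\<lambda>i. ?row i j)"
      unfolding \<phi>_def using lincomb_free_module[OF R e[OF that(1)] _ that(2), of ?row] that row by simp
    then show ?thesis using that by simp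
  qed
  have "\<pi> ` ?T n = carrier M"
  proof (intro equalityI subsetI)
    fix x assume "x \<in> carrier M"
    then obtain c where c: "c \<in> UNIV \<rightarrow> carrier R" "x = lincomb M n c u" using P(4) by blast
    have v: "restrict c {..<n} \<in> ?T n" using c by (auto simp: tuples_def)
    have "lincomb M n c u = lincomb M n (extend_zero R n (restrict c {..<n})) u"
      by (rule M.lincomb_cong) (use c P in auto)
    then have "x = \<pi> (restrict c {..<n})" using c v by (simp add: \<pi>_def)
    then show "x \<in> \<pi> ` ?T n" using v by blast
  qed (use lin_hom_closed[OF \<pi>] in auto)
  moreover have "\<phi> ` ?T m = {v \<in> ?T n. \<pi> v = \<zero>\<^bsub>M\<^esub>}"
  proof (intro equalityI subsetI)
    fix v assume "v \<in> \<phi> ` ?T m"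
    then obtain w where w: "w \<in> ?T m" "v = \<phi> w" by auto
    have v: "v \<in> ?T n" using w lin_hom_closed[OF \<phi>] by auto
    have "\<pi> v = \<zero>\<^bsub>M\<^esub>"
      using P(5)[OF e[OF v]] e[OF w(1)] fw[OF w(1)] w v by (auto simp: \<pi>_def)
    then show "v \<in> {v \<in> ?T n. \<pi> v = \<zero>\<^bsub>M\<^esub>}" using v by simp
  next
    fix v assume v: "v \<in> {v \<in> ?T n. \<pi> v = \<zero>\<^bsub>M\<^esub>}"
    then obtain s where s: "s \<in> UNIV \<rightarrow> carrier R" "\<forall>j<n. v j = lincomb (regular_module R) m s (\<lambda>i. a i j)"
      using P(5)[OF e[of v n]] by (auto simp: \<pi>_def)
    have w: "restrict s {..<m} \<in> ?T m" using s by (auto simp: tuples_def)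
    have "v = \<phi> (restrict s {..<m})"
    proof (rule tuples_eqI)
      show "v \<in> ?T n" using v by simp
      show "\<phi> (restrict s {..<m}) \<in> ?T n" using lin_hom_closed[OF \<phi>] w by auto
      fix j assume j: "j < n"
      have "lincomb (regular_module R) m s (\<lambda>i. a i j) =
          lincomb (regular_module R) m (extend_zero R m (restrict s {..<m})) (\<lambda>i. a i j)"
        by (rule reg.lincomb_cong) (use s P(2) in \<open>auto simp: Pi_iff\<close>)
      then show "v j = \<phi> (restrict s {..<m}) j" using fw[OF w j] s j by simp
    qed
    then show "v \<in> \<phi> ` ?T m" using w by blast
  qed
  ultimately show ?thesis unfolding fin_presented_def using P(1) \<phi> \<pi>
    by (intro conjI exI[of _ m] exI[of _ n] bexI[of _ \<phi>] bexI[of _ \<pi>]) auto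
qed

lemma ex_pres_by:
  fixes R :: "('a, 'e) ring_scheme"
  assumes "ring R" "a \<in> UNIV \<rightarrow> UNIV \<rightarrow> carrier R"
  obtains M :: "'a umodule" and u where "pres_by R m n a M u"
proof -
  interpret F: left_module R "free_module R n" using assms(1) by (rule left_module_free)
  interpret reg: left_module R "regular_module R" using assms(1) by (rule left_module_regular)
  let ?T = "tuples (regular_module R)"
  have e: "extend_zero R k v \<in> UNIV \<rightarrow> carrier R" if "v \<in> ?T k" for v k
    using that assms(1) tuples_Pi[OF that] by (intro extend_zero_closed) auto
  define U where "U = {v \<in> ?T n. \<exists>s\<in>UNIV \<rightarrow> carrier R. \<forall>j<n. v j = lincomb (regular_module R) m s (\<lambda>i. a i j)}"
  have col: "(\<lambda>i. a i j) \<in> {..<m} \<rightarrow> carrier (regular_module R)" for j using assms by auto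
  have U: "submodule U R (free_module R n)"
  proof (rule submodule.intro)
    show "subgroup U (add_monoid (free_module R n))"
    proof (rule group.subgroupI)
      show "group (add_monoid (free_module R n))" by (rule F.a_group)
      show "U \<subseteq> carrier (add_monoid (free_module R n))" by (auto simp: U_def)
      have "tzero (regular_module R) n \<in> U"
        unfolding U_def using reg.tzero_tuples reg.lincomb_zero_left[OF col]
        by (auto intro!: bexI[of _ "\<lambda>_. \<zero>\<^bsub>R\<^esub>"])
      then show "U \<noteq> {}" by auto
    next
      fix v assume "v \<in> U"
      then obtain s where v: "v \<in> ?T n" and s: "s \<in> UNIV \<rightarrow> carrier R"
        "\<forall>j<n. v j = lincomb (regular_module R) m s (\<lambda>i. a i j)" by (auto simp: U_def)
      have o: "\<ominus>\<^bsub>R\<^esub> \<one>\<^bsub>R\<^esub> \<in> carrier R" by simp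
      let ?w = "\<ominus>\<^bsub>R\<^esub> \<one>\<^bsub>R\<^esub> \<odot>\<^bsub>free_module R n\<^esub> v"
      have w: "?w \<in> ?T n" using F.smult_closed[OF o, of v] v by simp
      have "?w \<oplus>\<^bsub>free_module R n\<^esub> v = \<zero>\<^bsub>free_module R n\<^esub>"
        using F.smult_l_distr[of "\<ominus>\<^bsub>R\<^esub> \<one>\<^bsub>R\<^esub>" "\<one>\<^bsub>R\<^esub>" v] v F.smult_one[of v] F.smult_zero_left[of v] by (simp add: F.R.l_neg)
      then have "inv\<^bsub>add_monoid (free_module R n)\<^esub> v = ?w"
        using v w by (intro group.inv_equality[OF F.a_group]) auto
      moreover have "?w \<in> U"
        unfolding U_def using s w reg.lincomb_smult[OF o s(1) col]
        by (auto intro!: bexI[of _ "\<lambda>i. \<ominus>\<^bsub>R\<^esub> \<one>\<^bsub>R\<^esub> \<otimes>\<^bsub>R\<^esub> s i"] simp: free_module_smult)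
      ultimately show "inv\<^bsub>add_monoid (free_module R n)\<^esub> v \<in> U" by simp
    next
      fix v w assume "v \<in> U" "w \<in> U"
      then obtain s t where v: "v \<in> ?T n" "w \<in> ?T n" and s: "s \<in> UNIV \<rightarrow> carrier R" "t \<in> UNIV \<rightarrow> carrier R"
        "\<forall>j<n. v j = lincomb (regular_module R) m s (\<lambda>i. a i j)"
        "\<forall>j<n. w j = lincomb (regular_module R) m t (\<lambda>i. a i j)" by (auto simp: U_def)
      then have "tadd (regular_module R) n v w \<in> U"
        unfolding U_def using reg.lincomb_add_left[OF s(1,2) col]
        by (auto intro!: bexI[of _ "\<lambda>i. s i \<oplus>\<^bsub>R\<^esub> t i"] reg.tadd_tuples)
      then show "v \<otimes>\<^bsub>add_monoid (free_module R n)\<^esub> w \<in> U" by simp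
    qed
    show "submodule_axioms U R (free_module R n)"
    proof
      fix r v assume r: "r \<in> carrier R" and "v \<in> U"
      then obtain s where v: "v \<in> ?T n" and s: "s \<in> UNIV \<rightarrow> carrier R"
        "\<forall>j<n. v j = lincomb (regular_module R) m s (\<lambda>i. a i j)" by (auto simp: U_def)
      show "r \<odot>\<^bsub>free_module R n\<^esub> v \<in> U"
        unfolding U_def using s r v reg.lincomb_smult[OF r s(1) col] F.smult_closed[OF r, of v]
        by (auto intro!: bexI[of _ "\<lambda>i. r \<otimes>\<^bsub>R\<^esub> s i"] simp: free_module_smult)
    qed
  qed
  note Q = quotient_module[OF F.left_module_axioms U]
  let ?M = "quotient_module (free_module R n) U"
  let ?q = "\<lambda>x\<in>carrier (free_module R n). U #>\<^bsub>add_monoid (free_module R n)\<^esub> x"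
  interpret M: left_module R ?M by (rule Q)
  define u where "u i = ?q (unit_tuple R n i)" for i
  have qv: "?q v = lincomb ?M n (extend_zero R n v) u" if "v \<in> ?T n" for v
    using lin_hom_free_expand[OF assms(1) Q(1) Q(2) that] unfolding u_def .
  have u: "u \<in> {..<n} \<rightarrow> carrier ?M"
    using lin_hom_closed[OF Q(2)] unit_tuple_closed[OF assms(1)] by (auto simp: u_def)
  have ec: "lincomb ?M n c u = ?q (restrict c {..<n})" "restrict c {..<n} \<in> ?T n" if "c \<in> UNIV \<rightarrow> carrier R" for c
  proof -
    show *: "restrict c {..<n} \<in> ?T n" using that by (auto simp: tuples_def)
    show "lincomb ?M n c u = ?q (restrict c {..<n})" unfolding qv[OF *]
      by (rule M.lincomb_cong) (use that u in auto)
  qed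
  have "pres_by R m n a ?M u"
    unfolding pres_by_def
  proof (intro conjI ballI Q assms u)
    fix x assume "x \<in> carrier ?M"
    then obtain v where "v \<in> ?T n" "x = ?q v" using Q(4) by auto
    then show "\<exists>c\<in>UNIV \<rightarrow> carrier R. x = lincomb ?M n c u" using qv e by metis
  next
    fix c :: "nat \<Rightarrow> 'a" assume c: "c \<in> UNIV \<rightarrow> carrier R"
    show "lincomb ?M n c u = \<zero>\<^bsub>?M\<^esub> \<longleftrightarrow>
      (\<exists>s\<in>UNIV \<rightarrow> carrier R. \<forall>j<n. c j = lincomb (regular_module R) m s (\<lambda>i. a i j))"
      using Q(3)[of "restrict c {..<n}"] ec[OF c] by (auto simp: U_def)
  qed
  then show thesis by (rule that)
qed

lemma pres_by_universal:
  assumes P: "pres_by R m n a M u" and X: "left_module R X" and x: "x \<in> sols X m n a"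
  obtains h where "h \<in> lin_hom R M X" "\<And>i. i < n \<Longrightarrow> h (u i) = x i"
proof -
  note P = pres_byD[OF P]
  interpret M: left_module R M by (rule P)
  interpret X: left_module R X by (rule X)
  have xp: "x \<in> {..<n} \<rightarrow> carrier X" using sols_tuples[OF x] by (rule tuples_Pi)
  have z: "lincomb X n c x = \<zero>\<^bsub>X\<^esub>" if c: "c \<in> UNIV \<rightarrow> carrier R" and 0: "lincomb M n c u = \<zero>\<^bsub>M\<^esub>" for c
  proof -
    obtain s where s: "s \<in> UNIV \<rightarrow> carrier R" "\<forall>j<n. c j = lincomb (regular_module R) m s (\<lambda>i. a i j)"
      using P(5)[OF c] 0 by auto
    have "lincomb X n c x = lincomb X n (\<lambda>j. lincomb (regular_module R) m s (\<lambda>i. a i j)) x"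
      by (rule X.lincomb_cong) (use c s xp in auto)
    also have "\<dots> = lincomb X m s (\<lambda>i. lincomb X n (a i) x)"
      by (rule X.lincomb_lincomb[OF s(1) P(2) xp])
    also have "\<dots> = lincomb X m s (\<lambda>i. \<zero>\<^bsub>X\<^esub>)"
      by (rule X.lincomb_cong) (use s(1) x P(2) xp in \<open>auto simp: sols_def intro!: X.lincomb_closed\<close>)
    also have "\<dots> = \<zero>\<^bsub>X\<^esub>" using s(1) by (rule X.lincomb_zero_right)
    finally show ?thesis .
  qed
  have wd: "lincomb X n c x = lincomb X n d x"
    if cd: "c \<in> UNIV \<rightarrow> carrier R" "d \<in> UNIV \<rightarrow> carrier R" "lincomb M n c u = lincomb M n d u" for c d
  proof -
    let ?o = "\<ominus>\<^bsub>R\<^esub> \<one>\<^bsub>R\<^esub>"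
    have o: "?o \<in> carrier R" by simp
    have od: "(\<lambda>j. ?o \<otimes>\<^bsub>R\<^esub> d j) \<in> UNIV \<rightarrow> carrier R" "(\<lambda>j. c j \<oplus>\<^bsub>R\<^esub> (?o \<otimes>\<^bsub>R\<^esub> d j)) \<in> UNIV \<rightarrow> carrier R"
      using cd by (auto simp: Pi_iff)
    have neg: "lincomb Y n (\<lambda>j. c j \<oplus>\<^bsub>R\<^esub> (?o \<otimes>\<^bsub>R\<^esub> d j)) y = \<zero>\<^bsub>Y\<^esub> \<longleftrightarrow> lincomb Y n c y = lincomb Y n d y"
      if "left_module R Y" "y \<in> {..<n} \<rightarrow> carrier Y" for y and Y :: "('a, 'z) module"
    proof -
      interpret Y: left_module R Y by fact
      have cl: "lincomb Y n c y \<in> carrier Y" "lincomb Y n d y \<in> carrier Y"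
        using cd that by (auto intro!: Y.lincomb_closed)
      have mo: "?o \<odot>\<^bsub>Y\<^esub> t = \<ominus>\<^bsub>Y\<^esub> t" if t: "t \<in> carrier Y" for t
      proof -
        have "?o \<odot>\<^bsub>Y\<^esub> t \<oplus>\<^bsub>Y\<^esub> t = \<zero>\<^bsub>Y\<^esub>"
          using Y.smult_l_distr[OF o _ t, of "\<one>\<^bsub>R\<^esub>"] t by (simp add: Y.smult_one M.R.l_neg)
        then show ?thesis using t by (intro Y.M.minus_equality[symmetric]) (auto intro: Y.smult_closed)
      qed
      have "lincomb Y n (\<lambda>j. c j \<oplus>\<^bsub>R\<^esub> (?o \<otimes>\<^bsub>R\<^esub> d j)) y = lincomb Y n c y \<oplus>\<^bsub>Y\<^esub> (\<ominus>\<^bsub>Y\<^esub> lincomb Y n d y)"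
        unfolding Y.lincomb_add_left[OF cd(1) od(1) that(2)] Y.lincomb_smult[OF o cd(2) that(2)] mo[OF cl(2)] ..
      then show ?thesis using Y.M.add.inv_solve_right'[OF Y.M.zero_closed cl] cl by auto
    qed
    show ?thesis using neg[OF X xp] neg[OF P(1) P(3)] z[OF od(2)] cd(3) by simp
  qed
  define c where "c y = (SOME c. c \<in> UNIV \<rightarrow> carrier R \<and> y = lincomb M n c u)" for y
  have c: "c y \<in> UNIV \<rightarrow> carrier R" "lincomb M n (c y) u = y" if "y \<in> carrier M" for y
  proof -
    have "\<exists>c. c \<in> UNIV \<rightarrow> carrier R \<and> y = lincomb M n c u" using P(4)[OF that] by blast
    from someI_ex[OF this] show "c y \<in> UNIV \<rightarrow> carrier R" "lincomb M n (c y) u = y"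
      by (auto simp: c_def)
  qed
  define h where "h = (\<lambda>y\<in>carrier M. lincomb X n (c y) x)"
  have h: "h (lincomb M n d u) = lincomb X n d x" if "d \<in> UNIV \<rightarrow> carrier R" for d
  proof -
    have "lincomb M n d u \<in> carrier M" using that P by (auto intro!: M.lincomb_closed)
    then show ?thesis using c that by (auto simp: h_def intro!: wd)
  qed
  have "h \<in> lin_hom R M X"
  proof (rule lin_homI)
    show "h \<in> carrier M \<rightarrow>\<^sub>E carrier X"
      using c xp by (auto simp: h_def intro!: X.lincomb_closed)
  next
    fix y z assume yz: "y \<in> carrier M" "z \<in> carrier M"
    have "(\<lambda>j. c y j \<oplus>\<^bsub>R\<^esub> c z j) \<in> UNIV \<rightarrow> carrier R" using c yz by (auto simp: Pi_iff)
    from h[OF this] show "h (y \<oplus>\<^bsub>M\<^esub> z) = h y \<oplus>\<^bsub>X\<^esub> h z"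
      using c[OF yz(1)] c[OF yz(2)] h[of "c y"] h[of "c z"] P(3) xp
      by (simp add: M.lincomb_add_left X.lincomb_add_left)
  next
    fix r y assume ry: "r \<in> carrier R" "y \<in> carrier M"
    have "(\<lambda>j. r \<otimes>\<^bsub>R\<^esub> c y j) \<in> UNIV \<rightarrow> carrier R" using c ry by (auto simp: Pi_iff)
    from h[OF this] show "h (r \<odot>\<^bsub>M\<^esub> y) = r \<odot>\<^bsub>X\<^esub> h y"
      using c[OF ry(2)] h[of "c y"] P(3) xp ry
      by (simp add: M.lincomb_smult X.lincomb_smult)
  qed
  moreover have "h (u i) = x i" if i: "i < n" for i
  proof -
    let ?d = "\<lambda>j. if j = i then \<one>\<^bsub>R\<^esub> else \<zero>\<^bsub>R\<^esub>"
    have "?d \<in> UNIV \<rightarrow> carrier R" by auto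
    from h[OF this] show ?thesis using M.lincomb_delta[OF P(3) i] X.lincomb_delta[OF xp i] by simp
  qed
  ultimately show thesis by (rule that)
qed

lemma pres_by_hom_eqI:
  assumes P: "pres_by R m n a M u" and X: "left_module R X"
    and "h \<in> lin_hom R M X" "k \<in> lin_hom R M X" "\<And>i. i < n \<Longrightarrow> h (u i) = k (u i)"
  shows "h = k"
proof -
  note P = pres_byD[OF P]
  interpret X: left_module R X by (rule X)
  show ?thesis
  proof (rule extensionalityI[of _ "carrier M"])
    show "h \<in> extensional (carrier M)" "k \<in> extensional (carrier M)"
      using assms(3,4)[THEN lin_hom_PiE] by (auto simp: PiE_def)
    fix y assume "y \<in> carrier M"
    then obtain c where c: "c \<in> UNIV \<rightarrow> carrier R" "y = lincomb M n c u" using P(4) by blast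
    have "lincomb X n c (\<lambda>j. h (u j)) = lincomb X n c (\<lambda>j. k (u j))"
      by (rule X.lincomb_cong) (use c P(3) assms(5) lin_hom_closed[OF assms(3)] lin_hom_closed[OF assms(4)] in \<open>auto simp: Pi_iff\<close>)
    then show "h y = k y"
      using lincomb_lin_hom[OF assms(3) P(1) X c(1) P(3)] lincomb_lin_hom[OF assms(4) P(1) X c(1) P(3)] c by simp
  qed
qed

lemma pres_by_sols:
  assumes "pres_by R m n a M u"
  shows "restrict u {..<n} \<in> sols M m n a"
proof -
  note P = pres_byD[OF assms]
  interpret M: left_module R M by (rule P)
  interpret reg: left_module R "regular_module R" using M.R.ring_axioms by (rule left_module_regular)
  have "lincomb M n (a i) u = \<zero>\<^bsub>M\<^esub>" if i: "i < m" for i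
  proof -
    let ?d = "\<lambda>j. if j = i then \<one>\<^bsub>R\<^esub> else \<zero>\<^bsub>R\<^esub>"
    have "?d \<in> UNIV \<rightarrow> carrier R" by auto
    moreover have "\<forall>j<n. a i j = lincomb (regular_module R) m ?d (\<lambda>i. a i j)"
      using reg.lincomb_delta[OF _ i] P(2) by (simp add: Pi_iff)
    ultimately show ?thesis using P(5)[of "a i"] P(2) by blast
  qed
  moreover have "lincomb M n (a i) (restrict u {..<n}) = lincomb M n (a i) u" for i
    by (rule M.lincomb_cong) (use P in auto)
  ultimately show ?thesis using P(3) by (auto simp: sols_def tuples_def)
qed

section \<open>Finitely presented functors from systems of linear equations\<close>

lemma fp_mod_simps [simp]:
  "X \<in> cObj (fp_mod R) \<longleftrightarrow> fin_presented R X" "cHom (fp_mod R) = lin_hom R"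
  "cId (fp_mod R) = (\<lambda>M. \<lambda>x\<in>carrier M. x)" "cComp (fp_mod R) = (\<lambda>M N P g f. compose (carrier M) g f)"
  "cAdd (fp_mod R) = (\<lambda>M N f g. \<lambda>x\<in>carrier M. f x \<oplus>\<^bsub>N\<^esub> g x)"
  "cZero (fp_mod R) = (\<lambda>M N. \<lambda>x\<in>carrier M. \<zero>\<^bsub>N\<^esub>)"
  by (simp_all add: fp_mod_def)

lemma Ab_simps [simp]:
  "G \<in> cObj Ab \<longleftrightarrow> comm_group G" "cHom Ab = (\<lambda>G H. hom G H \<inter> extensional (carrier G))"
  "cId Ab = (\<lambda>G. \<lambda>x\<in>carrier G. x)" "cComp Ab = (\<lambda>G H K g f. compose (carrier G) g f)"
  "cAdd Ab = (\<lambda>G H f g. \<lambda>x\<in>carrier G. f x \<otimes>\<^bsub>H\<^esub> g x)"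
  "cZero Ab = (\<lambda>G H. \<lambda>x\<in>carrier G. \<one>\<^bsub>H\<^esub>)"
  by (simp_all add: Ab_def)

abbreviation ufp :: "('a, 'e) ring_scheme \<Rightarrow> 'a umodule \<Rightarrow> bool"
  where "ufp \<equiv> fin_presented"

lemma fin_presented_left_module: "fin_presented R M \<Longrightarrow> left_module R M"
  by (simp add: fin_presented_def)

lemma lin_hom_sum:
  assumes "left_module R M" "left_module R N" "f \<in> lin_hom R M N" "g \<in> lin_hom R M N"
  shows "(\<lambda>x\<in>carrier M. f x \<oplus>\<^bsub>N\<^esub> g x) \<in> lin_hom R M N"
proof -
  interpret M: left_module R M by fact
  interpret N: left_module R N by fact
  note c = lin_hom_closed[OF assms(3)] lin_hom_closed[OF assms(4)]
  show ?thesis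
    by (rule lin_homI)
      (auto simp: c lin_hom_add[OF assms(3)] lin_hom_add[OF assms(4)] lin_hom_smult[OF assms(3)]
        lin_hom_smult[OF assms(4)] M.smult_closed N.smult_r_distr N.M.a_ac)
qed

lemma tmap_tadd:
  assumes "f \<in> lin_hom R X Y" "x \<in> tuples X n" "y \<in> tuples X n"
  shows "tmap n f (tadd X n x y) = tadd Y n (tmap n f x) (tmap n f y)"
  using tuplesD[OF assms(2)] tuplesD[OF assms(3)]
  by (auto simp: tmap_def tadd_def fun_eq_iff lin_hom_add[OF assms(1)])

lemma hom_factor:
  assumes "group A" "group B" "group C" and p: "p \<in> hom A B" "p ` carrier A = carrier B"
    and f: "f \<in> hom A C" and k: "\<And>x. x \<in> carrier A \<Longrightarrow> p x = \<one>\<^bsub>B\<^esub> \<Longrightarrow> f x = \<one>\<^bsub>C\<^esub>"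
  obtains h where "h \<in> hom B C \<inter> extensional (carrier B)" "\<And>x. x \<in> carrier A \<Longrightarrow> h (p x) = f x"
proof -
  interpret A: group A by fact
  interpret p: group_hom A B p using assms by (simp add: group_hom_def group_hom_axioms_def)
  interpret f: group_hom A C f using assms by (simp add: group_hom_def group_hom_axioms_def)
  have wd: "f x = f y" if "x \<in> carrier A" "y \<in> carrier A" "p x = p y" for x y
  proof -
    have "f (x \<otimes>\<^bsub>A\<^esub> inv\<^bsub>A\<^esub> y) = \<one>\<^bsub>C\<^esub>" using that by (intro k) auto
    then have "f x \<otimes>\<^bsub>C\<^esub> inv\<^bsub>C\<^esub> f y = \<one>\<^bsub>C\<^esub>" using that by simp
    then show ?thesis using that f.H.inv_solve_right'[of "\<one>\<^bsub>C\<^esub>" "f x" "f y"] by simp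
  qed
  define h where "h = (\<lambda>b\<in>carrier B. f (inv_into (carrier A) p b))"
  have h: "h (p x) = f x" if "x \<in> carrier A" for x
  proof -
    have "p x \<in> p ` carrier A" using that by blast
    then have "inv_into (carrier A) p (p x) \<in> carrier A" "p (inv_into (carrier A) p (p x)) = p x"
      by (auto intro: inv_into_into f_inv_into_f)
    then show ?thesis using that wd[of "inv_into (carrier A) p (p x)" x] p.hom_closed[OF that] by (simp add: h_def)
  qed
  have "h \<in> hom B C"
  proof (rule homI)
    fix b assume "b \<in> carrier B"
    then obtain x where "x \<in> carrier A" "b = p x" using p(2) by auto
    then show "h b \<in> carrier C" using h by simp
  next
    fix b c assume "b \<in> carrier B" "c \<in> carrier B"
    then obtain x y where "x \<in> carrier A" "b = p x" "y \<in> carrier A" "c = p y" using p(2) by (metis imageE)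
    then show "h (b \<otimes>\<^bsub>B\<^esub> c) = h b \<otimes>\<^bsub>C\<^esub> h c"
      using h[of "x \<otimes>\<^bsub>A\<^esub> y"] h[of x] h[of y] by simp
  qed
  then show thesis using h by (intro that[of h]) (auto simp: h_def)
qed

definition natural_subgroup ::
  "('a, 'e) ring_scheme \<Rightarrow> nat \<Rightarrow> ('a umodule \<Rightarrow> (nat \<Rightarrow> 'a univ) set) \<Rightarrow> bool"
  where "natural_subgroup R n P \<longleftrightarrow>
    (\<forall>X. ufp R X \<longrightarrow> subgroup (P X) (tuple_group X n (tuples X n))) \<and>
    (\<forall>X Y f x. ufp R X \<longrightarrow> ufp R Y \<longrightarrow> f \<in> lin_hom R X Y \<longrightarrow> x \<in> P X \<longrightarrow> tmap n f x \<in> P Y)"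

lemma natural_subgroupD:
  assumes "natural_subgroup R n P"
  shows "ufp R X \<Longrightarrow> subgroup (P X) (tuple_group X n (tuples X n))"
    and "\<lbrakk>ufp R X; ufp R Y; f \<in> lin_hom R X Y; x \<in> P X\<rbrakk> \<Longrightarrow> tmap n f x \<in> P Y"
  using assms by (auto simp: natural_subgroup_def)

lemma natural_subgroup_group:
  assumes "natural_subgroup R n P" "ufp R X"
  shows "comm_group (tuple_group X n (P X))" "P X \<subseteq> tuples X n"
    "x \<in> P X \<Longrightarrow> y \<in> P X \<Longrightarrow> tadd X n x y \<in> P X" "tzero X n \<in> P X"
proof -
  interpret X: left_module R X using assms by (auto intro: fin_presented_left_module)
  interpret G: comm_group "tuple_group X n (tuples X n)" by (rule X.comm_group_tuples)
  note s = natural_subgroupD(1)[OF assms]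
  interpret P: subgroup "P X" "tuple_group X n (tuples X n)" by (rule s)
  have e: "(tuple_group X n (tuples X n))\<lparr>carrier := P X\<rparr> = tuple_group X n (P X)"
    by (simp add: tuple_group_def)
  have "group (tuple_group X n (P X))" using P.subgroup_is_group[OF G.is_group] by (simp add: e)
  then show "comm_group (tuple_group X n (P X))"
    by (rule group.group_comm_groupI) (use P.subset G.m_comm in auto)
  show "P X \<subseteq> tuples X n" "tzero X n \<in> P X" using P.subset P.one_closed by auto
  show "x \<in> P X \<Longrightarrow> y \<in> P X \<Longrightarrow> tadd X n x y \<in> P X" using P.m_closed by auto
qed

text \<open>\<open>p\<close> is an epimorphism onto \<open>F\<close> from the functor \<open>P\<close> of \<open>n\<close>-tuples, with kernel \<open>P'\<close>.\<close>

definition tuple_functor ::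
  "('a, 'e) ring_scheme \<Rightarrow> nat \<Rightarrow> ('a umodule \<Rightarrow> (nat \<Rightarrow> 'a univ) set) \<Rightarrow> ('a umodule \<Rightarrow> (nat \<Rightarrow> 'a univ) set) \<Rightarrow>
    ('a, 'g) mod_functor \<Rightarrow> ('a umodule \<Rightarrow> (nat \<Rightarrow> 'a univ) \<Rightarrow> 'g) \<Rightarrow> bool"
  where "tuple_functor R n P P' F p \<longleftrightarrow> additive_functor (fp_mod R) Ab F \<and>
    (\<forall>X. ufp R X \<longrightarrow> p X \<in> hom (tuple_group X n (P X)) (fObj F X) \<and>
      p X ` P X = carrier (fObj F X) \<and> (\<forall>x\<in>P X. p X x = \<one>\<^bsub>fObj F X\<^esub> \<longleftrightarrow> x \<in> P' X)) \<and>
    (\<forall>X Y f x. ufp R X \<longrightarrow> ufp R Y \<longrightarrow> f \<in> lin_hom R X Y \<longrightarrow> x \<in> P X \<longrightarrow>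
      fArr F X Y f (p X x) = p Y (tmap n f x))"

lemma tuple_functorD:
  assumes "tuple_functor R n P P' F p"
  shows "additive_functor (fp_mod R) Ab F"
    "ufp R X \<Longrightarrow> p X \<in> hom (tuple_group X n (P X)) (fObj F X)"
    "ufp R X \<Longrightarrow> p X ` P X = carrier (fObj F X)"
    "ufp R X \<Longrightarrow> x \<in> P X \<Longrightarrow> p X x = \<one>\<^bsub>fObj F X\<^esub> \<longleftrightarrow> x \<in> P' X"
    "\<lbrakk>ufp R X; ufp R Y; f \<in> lin_hom R X Y; x \<in> P X\<rbrakk> \<Longrightarrow> fArr F X Y f (p X x) = p Y (tmap n f x)"
  using assms by (auto simp: tuple_functor_def)

lemma additive_functor_Ab:
  assumes "additive_functor (fp_mod R) Ab F" "ufp R X"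
  shows "comm_group (fObj F X)"
    and "ufp R Y \<Longrightarrow> f \<in> lin_hom R X Y \<Longrightarrow> fArr F X Y f \<in> hom (fObj F X) (fObj F Y)"
    and "ufp R Y \<Longrightarrow> f \<in> lin_hom R X Y \<Longrightarrow> fArr F X Y f \<in> extensional (carrier (fObj F X))"
  using assms by (auto simp: additive_functor_def)

lemma tuple_functorI:
  assumes P: "natural_subgroup R n P"
    and cg: "\<And>X. ufp R X \<Longrightarrow> comm_group (fObj F X)"
    and hom: "\<And>X. ufp R X \<Longrightarrow> p X \<in> hom (tuple_group X n (P X)) (fObj F X)"
    and surj: "\<And>X. ufp R X \<Longrightarrow> p X ` P X = carrier (fObj F X)"
    and ker: "\<And>X x. ufp R X \<Longrightarrow> x \<in> P X \<Longrightarrow> p X x = \<one>\<^bsub>fObj F X\<^esub> \<longleftrightarrow> x \<in> P' X"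
    and nat: "\<And>X Y f x. \<lbrakk>ufp R X; ufp R Y; f \<in> lin_hom R X Y; x \<in> P X\<rbrakk>
      \<Longrightarrow> fArr F X Y f (p X x) = p Y (tmap n f x)"
    and ext: "\<And>X Y f. \<lbrakk>ufp R X; ufp R Y; f \<in> lin_hom R X Y\<rbrakk>
      \<Longrightarrow> fArr F X Y f \<in> extensional (carrier (fObj F X))"
  shows "tuple_functor R n P P' F p"
proof -
  note PN = natural_subgroupD(2)[OF P]
  note PT = natural_subgroup_group(2)[OF P, THEN subsetD]
  have obt: "\<exists>x\<in>P X. c = p X x" if "ufp R X" "c \<in> carrier (fObj F X)" for X c
    using surj[OF that(1)] that(2) by blast
  have pm: "p X (tadd X n x y) = p X x \<otimes>\<^bsub>fObj F X\<^esub> p X y" if "ufp R X" "x \<in> P X" "y \<in> P X" for X x y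
    using hom_mult[OF hom[OF that(1)]] that by simp
  have pc: "p X x \<in> carrier (fObj F X)" if "ufp R X" "x \<in> P X" for X x
    using hom_in_carrier[OF hom[OF that(1)]] that by simp
  have fh: "fArr F X Y f \<in> hom (fObj F X) (fObj F Y)"
    if f: "ufp R X" "ufp R Y" "f \<in> lin_hom R X Y" for X Y f
  proof (rule homI)
    fix c assume "c \<in> carrier (fObj F X)"
    then obtain x where "x \<in> P X" "c = p X x" using obt[OF f(1)] by blast
    then show "fArr F X Y f c \<in> carrier (fObj F Y)" using f pc PN by (simp add: nat)
  next
    fix c d assume "c \<in> carrier (fObj F X)" "d \<in> carrier (fObj F X)"
    then obtain x y where xy: "x \<in> P X" "c = p X x" "y \<in> P X" "d = p X y" using obt[OF f(1)] by blast
    have "tadd X n x y \<in> P X" using natural_subgroup_group(3)[OF P f(1)] xy by simp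
    then have "fArr F X Y f (p X (tadd X n x y)) = p Y (tadd Y n (tmap n f x) (tmap n f y))"
      using nat[OF f] tmap_tadd[OF f(3)] PT[OF f(1)] xy by simp
    then show "fArr F X Y f (c \<otimes>\<^bsub>fObj F X\<^esub> d) = fArr F X Y f c \<otimes>\<^bsub>fObj F Y\<^esub> fArr F X Y f d"
      using xy pm[OF f(1) xy(1,3)] pm[OF f(2) PN[OF f xy(1)] PN[OF f xy(3)]] nat[OF f] by simp
  qed
  have id: "fArr F X X (\<lambda>x\<in>carrier X. x) = (\<lambda>x\<in>carrier (fObj F X). x)" if X: "ufp R X" for X
  proof (rule extensionalityI)
    have h: "(\<lambda>x\<in>carrier X. x) \<in> lin_hom R X X" using X by (intro lin_hom_id fin_presented_left_module)
    then show "fArr F X X (\<lambda>x\<in>carrier X. x) \<in> extensional (carrier (fObj F X))" by (rule ext[OF X X])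
    fix c assume c: "c \<in> carrier (fObj F X)"
    then obtain x where x: "x \<in> P X" "c = p X x" using obt[OF X] by blast
    have "tmap n (\<lambda>x\<in>carrier X. x) x = x"
      using PT[OF X x(1)] by (auto simp: tmap_def tuples_def fun_eq_iff PiE_iff extensional_def)
    then show "fArr F X X (\<lambda>x\<in>carrier X. x) c = (\<lambda>x\<in>carrier (fObj F X). x) c"
      using nat[OF X X h x(1)] x c by simp
  qed auto
  have comp: "fArr F X Z (compose (carrier X) g f) = compose (carrier (fObj F X)) (fArr F Y Z g) (fArr F X Y f)"
    if o: "ufp R X" "ufp R Y" "ufp R Z" and f: "f \<in> lin_hom R X Y" and g: "g \<in> lin_hom R Y Z" for X Y Z f g
  proof (rule extensionalityI)
    have h: "compose (carrier X) g f \<in> lin_hom R X Z" using f g o by (intro lin_hom_compose fin_presented_left_module)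
    then show "fArr F X Z (compose (carrier X) g f) \<in> extensional (carrier (fObj F X))" by (rule ext[OF o(1,3)])
    fix c assume c: "c \<in> carrier (fObj F X)"
    then obtain x where x: "x \<in> P X" "c = p X x" using obt[OF o(1)] by blast
    have "tmap n (compose (carrier X) g f) x = tmap n g (tmap n f x)"
      using tuplesD[OF PT[OF o(1) x(1)]] by (auto simp: tmap_def compose_def fun_eq_iff)
    then show "fArr F X Z (compose (carrier X) g f) c = compose (carrier (fObj F X)) (fArr F Y Z g) (fArr F X Y f) c"
      using nat[OF o(1,3) h x(1)] nat[OF o(1,2) f x(1)] nat[OF o(2,3) g PN[OF o(1,2) f x(1)]] x c
      by (simp add: compose_def)
  qed (auto simp: compose_def)
  have add: "fArr F X Y (\<lambda>x\<in>carrier X. f x \<oplus>\<^bsub>Y\<^esub> g x) = (\<lambda>x\<in>carrier (fObj F X). fArr F X Y f x \<otimes>\<^bsub>fObj F Y\<^esub> fArr F X Y g x)"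
    if o: "ufp R X" "ufp R Y" and f: "f \<in> lin_hom R X Y" and g: "g \<in> lin_hom R X Y" for X Y f g
  proof (rule extensionalityI)
    have h: "(\<lambda>x\<in>carrier X. f x \<oplus>\<^bsub>Y\<^esub> g x) \<in> lin_hom R X Y" using f g o by (intro lin_hom_sum fin_presented_left_module)
    then show "fArr F X Y (\<lambda>x\<in>carrier X. f x \<oplus>\<^bsub>Y\<^esub> g x) \<in> extensional (carrier (fObj F X))" by (rule ext[OF o])
    fix c assume c: "c \<in> carrier (fObj F X)"
    then obtain x where x: "x \<in> P X" "c = p X x" using obt[OF o(1)] by blast
    have "tmap n (\<lambda>x\<in>carrier X. f x \<oplus>\<^bsub>Y\<^esub> g x) x = tadd Y n (tmap n f x) (tmap n g x)"
      using tuplesD[OF PT[OF o(1) x(1)]] by (auto simp: tmap_def tadd_def fun_eq_iff)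
    then show "fArr F X Y (\<lambda>x\<in>carrier X. f x \<oplus>\<^bsub>Y\<^esub> g x) c =
      (\<lambda>x\<in>carrier (fObj F X). fArr F X Y f x \<otimes>\<^bsub>fObj F Y\<^esub> fArr F X Y g x) c"
      using nat[OF o h x(1)] nat[OF o f x(1)] nat[OF o g x(1)] x c
        pm[OF o(2) PN[OF o f x(1)] PN[OF o g x(1)]] by simp
  qed auto
  have "additive_functor (fp_mod R) Ab F"
    unfolding additive_functor_def using cg fh ext id comp add by simp
  then show ?thesis unfolding tuple_functor_def using hom surj ker nat by blast
qed

text \<open>Tuples are encoded injectively as formal sums by using the powers of 2 as coefficients: the
  coefficient of \<open>y\<close> in the encoding of \<open>x\<close> is the binary code of \<open>{i. x i = y}\<close>.\<close>

definition encode_tuple :: "nat \<Rightarrow> (nat \<Rightarrow> 'a univ) \<Rightarrow> (('a univ \<times> 'a univ) \<Rightarrow>\<^sub>0 int)"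
  where "encode_tuple n x = (\<Sum>i<n. frag_cmul (2 ^ i) (frag_of ({}, x i)))"

lemma lookup_encode_tuple:
  "Poly_Mapping.lookup (encode_tuple n x) ({}, y) = int (set_encode {i. i < n \<and> x i = y})"
proof -
  have "Poly_Mapping.lookup (encode_tuple n x) ({}, y) = (\<Sum>i<n. if x i = y then 2 ^ i else 0)"
    unfolding encode_tuple_def
    by (induction n) (auto simp: Poly_Mapping.lookup_add lookup_single when_def)
  also have "\<dots> = (\<Sum>i | i \<in> {..<n} \<and> x i = y. 2 ^ i)"
    by (subst sum.inter_filter) (auto intro!: sum.cong)
  finally show ?thesis by (simp add: set_encode_def)
qed

lemma inj_on_encode_tuple: "inj_on (encode_tuple n) (tuples X n)"
proof (rule inj_onI)
  fix x y assume x: "x \<in> tuples X n" and y: "y \<in> tuples X n" and e: "encode_tuple n x = encode_tuple n y"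
  have "{i. i < n \<and> x i = z} = {i. i < n \<and> y i = z}" for z
  proof -
    have "set_encode {i. i < n \<and> x i = z} = set_encode {i. i < n \<and> y i = z}"
      using lookup_encode_tuple[of n x z] lookup_encode_tuple[of n y z] e by simp
    then show ?thesis by (simp add: set_encode_eq)
  qed
  then show "x = y" by (intro tuples_eqI[OF x y]) blast
qed

lemma ex_tuple_functor:
  fixes R :: "('a, 'e) ring_scheme"
  assumes P: "natural_subgroup R n P" and P': "natural_subgroup R n P'"
    and sub: "\<And>X. ufp R X \<Longrightarrow> P' X \<subseteq> P X"
  obtains F :: "('a, 'a uval) mod_functor" and p where "tuple_functor R n P P' F p"
proof -
  define c where "c X x = P' X #>\<^bsub>tuple_group X n (P X)\<^esub> x" for X x
  define q where "q X x = encode_tuple n ` c X x" for X x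
  define F where "F = \<lparr>fObj = \<lambda>X. image_group (tuple_group X n (P X)) (q X),
    fArr = \<lambda>X Y f. \<lambda>d\<in>q X ` P X. q Y (tmap n f (inv_into (P X) (q X) d))\<rparr>"
  have sg: "subgroup (P' X) (tuple_group X n (P X))" if X: "ufp R X" for X
  proof -
    interpret X: left_module R X using X by (rule fin_presented_left_module)
    interpret G: comm_group "tuple_group X n (tuples X n)" by (rule X.comm_group_tuples)
    have "subgroup (P' X) ((tuple_group X n (tuples X n))\<lparr>carrier := P X\<rparr>)"
      using G.subgroup_incl[OF natural_subgroupD(1)[OF P' X] natural_subgroupD(1)[OF P X] sub[OF X]] .
    then show ?thesis by (simp add: tuple_group_def)
  qed
  have qe: "q X x = q X y \<longleftrightarrow> c X x = c X y" if X: "ufp R X" "x \<in> P X" "y \<in> P X" for X x y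
  proof -
    interpret G: comm_group "tuple_group X n (P X)" by (rule natural_subgroup_group[OF P X(1)])
    have "c X x \<subseteq> tuples X n" "c X y \<subseteq> tuples X n"
      using G.r_coset_subset_G[OF subgroup.subset[OF sg[OF X(1)]], of x]
        G.r_coset_subset_G[OF subgroup.subset[OF sg[OF X(1)]], of y] natural_subgroup_group(2)[OF P X(1)] X
      by (auto simp: c_def)
    then show ?thesis unfolding q_def by (intro inj_on_image_eq_iff[OF inj_on_encode_tuple])
  qed
  have cong: "q X (tadd X n x y) = q X (tadd X n x' y')"
    if X: "ufp R X" and xy: "x \<in> P X" "x' \<in> P X" "y \<in> P X" "y' \<in> P X" "q X x = q X x'" "q X y = q X y'"
    for X x x' y y'
  proof -
    interpret G: comm_group "tuple_group X n (P X)" by (rule natural_subgroup_group[OF P X(1)])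
    have "c X (tadd X n x y) = c X (tadd X n x' y')"
      using G.r_coset_cong[OF sg[OF X], of x x' y y'] xy qe[OF X] unfolding c_def tuple_group_simps by blast
    then show ?thesis by (simp add: q_def)
  qed
  have "tuple_functor R n P P' F q"
  proof (rule tuple_functorI[OF P])
    fix X assume X: "ufp R X"
    interpret G: comm_group "tuple_group X n (P X)" by (rule natural_subgroup_group[OF P X(1)])
    show "comm_group (fObj F X)" unfolding F_def funct.simps
      by (rule comm_group_image_group[OF G.comm_group_axioms]) (use cong[OF X] in \<open>unfold tuple_group_simps\<close>)
    show "q X \<in> hom (tuple_group X n (P X)) (fObj F X)" unfolding F_def funct.simps
    proof (rule homI)
      fix x y assume "x \<in> carrier (tuple_group X n (P X))" "y \<in> carrier (tuple_group X n (P X))"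
      then show "q X (x \<otimes>\<^bsub>tuple_group X n (P X)\<^esub> y) = q X x \<otimes>\<^bsub>image_group (tuple_group X n (P X)) (q X)\<^esub> q X y"
        by (intro sym[OF image_group_mult]) (use cong[OF X] in \<open>unfold tuple_group_simps\<close>)
    qed simp
    show "q X ` P X = carrier (fObj F X)" by (simp add: F_def)
    fix x assume x: "x \<in> P X"
    have "q X x = q X (tzero X n) \<longleftrightarrow> c X x = c X (tzero X n)"
      by (rule qe[OF X x]) (rule natural_subgroup_group(4)[OF P X])
    also have "\<dots> \<longleftrightarrow> x \<in> P' X"
      using G.r_coset_eq_iff[OF sg[OF X], of x "tzero X n"] x natural_subgroup_group(4)[OF P X] G.inv_one G.r_one[of x]
      by (simp add: c_def)
    finally show "q X x = \<one>\<^bsub>fObj F X\<^esub> \<longleftrightarrow> x \<in> P' X" by (simp add: F_def)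
  next
    fix X Y f x assume X: "ufp R X" and Y: "ufp R Y" and f: "f \<in> lin_hom R X Y" and x: "x \<in> P X"
    interpret G: comm_group "tuple_group X n (P X)" by (rule natural_subgroup_group[OF P X(1)])
    interpret H: comm_group "tuple_group Y n (P Y)" by (rule natural_subgroup_group[OF P Y])
    interpret f: group_hom "tuple_group X n (P X)" "tuple_group Y n (P Y)" "tmap n f"
    proof (unfold_locales, rule homI)
      fix x y assume "x \<in> carrier (tuple_group X n (P X))" "y \<in> carrier (tuple_group X n (P X))"
      then show "tmap n f (x \<otimes>\<^bsub>tuple_group X n (P X)\<^esub> y) = tmap n f x \<otimes>\<^bsub>tuple_group Y n (P Y)\<^esub> tmap n f y"
        using tmap_tadd[OF f] natural_subgroup_group(2)[OF P X] by (simp add: subset_iff)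
    qed (use natural_subgroupD(2)[OF P X Y f] in simp)
    let ?r = "inv_into (P X) (q X) (q X x)"
    have im: "q X x \<in> q X ` P X" using x by (rule imageI)
    have r: "?r \<in> P X" "q X ?r = q X x" using inv_into_into[OF im] f_inv_into_f[OF im] by auto
    then have "?r \<otimes>\<^bsub>tuple_group X n (P X)\<^esub> inv\<^bsub>tuple_group X n (P X)\<^esub> x \<in> P' X"
      using qe[OF X r(1) x] G.r_coset_eq_iff[OF sg[OF X], of ?r x] x by (simp add: c_def)
    then have "tmap n f (?r \<otimes>\<^bsub>tuple_group X n (P X)\<^esub> inv\<^bsub>tuple_group X n (P X)\<^esub> x) \<in> P' Y"
      by (rule natural_subgroupD(2)[OF P' X Y f])
    moreover have "inv\<^bsub>tuple_group X n (P X)\<^esub> x \<in> P X" using G.inv_closed[of x] x by simp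
    ultimately have "tmap n f ?r \<otimes>\<^bsub>tuple_group Y n (P Y)\<^esub> inv\<^bsub>tuple_group Y n (P Y)\<^esub> tmap n f x \<in> P' Y"
      using f.hom_mult[of ?r "inv\<^bsub>tuple_group X n (P X)\<^esub> x"] f.hom_inv[of x] r x by simp
    then have "c Y (tmap n f ?r) = c Y (tmap n f x)"
      using H.r_coset_eq_iff[OF sg[OF Y], of "tmap n f ?r" "tmap n f x"] natural_subgroupD(2)[OF P X Y f] r x
      by (simp add: c_def)
    then have "q Y (tmap n f ?r) = q Y (tmap n f x)" by (simp add: q_def)
    then show "fArr F X Y f (q X x) = q Y (tmap n f x)" using im by (simp add: F_def)
  next
    fix X Y f show "fArr F X Y f \<in> extensional (carrier (fObj F X))" by (simp add: F_def)
  qed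
  then show thesis by (rule that)
qed

lemma nat_transI:
  assumes "\<eta> \<in> extensional (cObj (fp_mod R))"
    "\<And>X. ufp R X \<Longrightarrow> \<eta> X \<in> hom (fObj F X) (fObj G X)"
    "\<And>X. ufp R X \<Longrightarrow> \<eta> X \<in> extensional (carrier (fObj F X))"
    "\<And>X Y f c. \<lbrakk>ufp R X; ufp R Y; f \<in> lin_hom R X Y; c \<in> carrier (fObj F X)\<rbrakk>
      \<Longrightarrow> \<eta> Y (fArr F X Y f c) = fArr G X Y f (\<eta> X c)"
  shows "\<eta> \<in> nat_trans R F G"
  using assms by (auto simp: nat_trans_def compose_def fun_eq_iff)

lemma nat_transD:
  assumes "\<eta> \<in> nat_trans R F G"
  shows "\<eta> \<in> extensional (cObj (fp_mod R))"
    "ufp R X \<Longrightarrow> \<eta> X \<in> hom (fObj F X) (fObj G X)"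
    "ufp R X \<Longrightarrow> \<eta> X \<in> extensional (carrier (fObj F X))"
    "\<lbrakk>ufp R X; ufp R Y; f \<in> lin_hom R X Y; c \<in> carrier (fObj F X)\<rbrakk>
      \<Longrightarrow> \<eta> Y (fArr F X Y f c) = fArr G X Y f (\<eta> X c)"
proof -
  show "\<eta> \<in> extensional (cObj (fp_mod R))"
    "ufp R X \<Longrightarrow> \<eta> X \<in> hom (fObj F X) (fObj G X)"
    "ufp R X \<Longrightarrow> \<eta> X \<in> extensional (carrier (fObj F X))"
    using assms by (auto simp: nat_trans_def)
  assume *: "ufp R X" "ufp R Y" "f \<in> lin_hom R X Y" "c \<in> carrier (fObj F X)"
  then have "compose (carrier (fObj F X)) (\<eta> Y) (fArr F X Y f) = compose (carrier (fObj F X)) (fArr G X Y f) (\<eta> X)"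
    using assms by (auto simp: nat_trans_def)
  from fun_cong[OF this, of c] show "\<eta> Y (fArr F X Y f c) = fArr G X Y f (\<eta> X c)" using * by (simp add: compose_def)
qed

lemma nat_trans_eqI:
  assumes "\<eta> \<in> nat_trans R F G" "\<theta> \<in> nat_trans R F G"
    "\<And>X c. ufp R X \<Longrightarrow> c \<in> carrier (fObj F X) \<Longrightarrow> \<eta> X c = \<theta> X c"
  shows "\<eta> = \<theta>"
proof (rule extensionalityI)
  show "\<eta> \<in> extensional (cObj (fp_mod R))" "\<theta> \<in> extensional (cObj (fp_mod R))"
    using assms by (auto dest: nat_transD)
  fix X assume "X \<in> cObj (fp_mod R)"
  then have X: "ufp R X" by simp
  show "\<eta> X = \<theta> X"
    by (rule extensionalityI[OF nat_transD(3)[OF assms(1) X] nat_transD(3)[OF assms(2) X] assms(3)[OF X]])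
qed

lemma ex_nat_trans:
  assumes P: "natural_subgroup R n P" and Q: "natural_subgroup R k Q"
    and F: "tuple_functor R n P P' F p" and G: "tuple_functor R k Q Q' G q"
    and t: "\<And>X x. ufp R X \<Longrightarrow> x \<in> P X \<Longrightarrow> t X x \<in> Q X"
    and t': "\<And>X x. ufp R X \<Longrightarrow> x \<in> P X \<Longrightarrow> x \<in> P' X \<Longrightarrow> t X x \<in> Q' X"
    and add: "\<And>X x y. ufp R X \<Longrightarrow> x \<in> P X \<Longrightarrow> y \<in> P X \<Longrightarrow> t X (tadd X n x y) = tadd X k (t X x) (t X y)"
    and nat: "\<And>X Y f x. \<lbrakk>ufp R X; ufp R Y; f \<in> lin_hom R X Y; x \<in> P X\<rbrakk>
      \<Longrightarrow> t Y (tmap n f x) = tmap k f (t X x)"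
  obtains \<eta> where "\<eta> \<in> nat_trans R F G" "\<And>X x. ufp R X \<Longrightarrow> x \<in> P X \<Longrightarrow> \<eta> X (p X x) = q X (t X x)"
proof -
  have "\<exists>h. h \<in> hom (fObj F X) (fObj G X) \<inter> extensional (carrier (fObj F X)) \<and> (\<forall>x\<in>P X. h (p X x) = q X (t X x))"
    if X: "ufp R X" for X
  proof -
    interpret A: comm_group "tuple_group X n (P X)" by (rule natural_subgroup_group[OF P X])
    interpret B: comm_group "fObj F X" using tuple_functorD(1)[OF F] X by (rule additive_functor_Ab)
    interpret C: comm_group "fObj G X" using tuple_functorD(1)[OF G] X by (rule additive_functor_Ab)
    note q = tuple_functorD(2)[OF G X]
    have f: "(\<lambda>x. q X (t X x)) \<in> hom (tuple_group X n (P X)) (fObj G X)"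
      using hom_in_carrier[OF q] hom_mult[OF q] t[OF X] add[OF X] by (intro homI) auto
    obtain h where "h \<in> hom (fObj F X) (fObj G X) \<inter> extensional (carrier (fObj F X))"
        "\<And>x. x \<in> carrier (tuple_group X n (P X)) \<Longrightarrow> h (p X x) = q X (t X x)"
      by (rule hom_factor[OF A.is_group B.is_group C.is_group tuple_functorD(2)[OF F X] _ f])
        (use tuple_functorD(3,4)[OF F X] tuple_functorD(4)[OF G X] t[OF X] t'[OF X] in auto)
    then show ?thesis by auto
  qed
  then obtain h where h: "\<And>X. ufp R X \<Longrightarrow> h X \<in> hom (fObj F X) (fObj G X) \<inter> extensional (carrier (fObj F X))"
    "\<And>X x. ufp R X \<Longrightarrow> x \<in> P X \<Longrightarrow> h X (p X x) = q X (t X x)" by metis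
  define \<eta> where "\<eta> = restrict h (cObj (fp_mod R))"
  have \<eta>: "\<eta> X = h X" if "ufp R X" for X using that by (simp add: \<eta>_def)
  have "\<eta> \<in> nat_trans R F G"
  proof (rule nat_transI)
    show "\<eta> \<in> extensional (cObj (fp_mod R))" by (auto simp: \<eta>_def)
    show "\<eta> X \<in> hom (fObj F X) (fObj G X)" "\<eta> X \<in> extensional (carrier (fObj F X))" if "ufp R X" for X
      using h(1)[OF that] \<eta>[OF that] by auto
    fix X Y f c assume X: "ufp R X" and Y: "ufp R Y" and f: "f \<in> lin_hom R X Y"
      and c: "c \<in> carrier (fObj F X)"
    obtain x where x: "x \<in> P X" "c = p X x" using c tuple_functorD(3)[OF F X] by blast
    show "\<eta> Y (fArr F X Y f c) = fArr G X Y f (\<eta> X c)"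
      using x tuple_functorD(5)[OF F X Y f x(1)] tuple_functorD(5)[OF G X Y f t[OF X x(1)]]
        h(2)[OF X x(1)] h(2)[OF Y natural_subgroupD(2)[OF P X Y f x(1)]] nat[OF X Y f x(1)] \<eta>[OF X] \<eta>[OF Y] by simp
  qed
  then show thesis using h \<eta> by (intro that) auto
qed

lemma fp_functor_cat_simps [simp]:
  "cObj (fp_functor_cat R) = fp_functors R" "cHom (fp_functor_cat R) = nat_trans R"
  "cComp (fp_functor_cat R) = (\<lambda>F G H \<theta> \<eta>. \<lambda>X\<in>cObj (fp_mod R).
      compose (carrier (fObj F X)) (\<theta> X) (\<eta> X))"
  "cZero (fp_functor_cat R) = (\<lambda>F G. \<lambda>X\<in>cObj (fp_mod R). \<lambda>x\<in>carrier (fObj F X). \<one>\<^bsub>fObj G X\<^esub>)"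
  by (simp_all add: fp_functor_cat_def)

lemma nat_trans_comp:
  assumes "\<eta> \<in> nat_trans R F G" "\<theta> \<in> nat_trans R G H"
    and F: "additive_functor (fp_mod R) Ab F"
  shows "(\<lambda>X\<in>cObj (fp_mod R). compose (carrier (fObj F X)) (\<theta> X) (\<eta> X)) \<in> nat_trans R F H"
proof (rule nat_transI)
  fix X assume X: "ufp R X"
  note h = nat_transD(2)[OF assms(1) X] nat_transD(2)[OF assms(2) X]
  interpret FX: comm_group "fObj F X" using F X by (rule additive_functor_Ab)
  show "(\<lambda>X\<in>cObj (fp_mod R). compose (carrier (fObj F X)) (\<theta> X) (\<eta> X)) X \<in> hom (fObj F X) (fObj H X)"
    using X hom_in_carrier[OF h(1)] hom_in_carrier[OF h(2)] hom_mult[OF h(1)] hom_mult[OF h(2)]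
    by (intro homI) (auto simp: compose_def)
  show "(\<lambda>X\<in>cObj (fp_mod R). compose (carrier (fObj F X)) (\<theta> X) (\<eta> X)) X \<in> extensional (carrier (fObj F X))"
    using X by (simp add: compose_def)
next
  fix X Y f c assume *: "ufp R X" "ufp R Y" "f \<in> lin_hom R X Y" "c \<in> carrier (fObj F X)"
  have "fArr F X Y f c \<in> carrier (fObj F Y)"
    using hom_in_carrier[OF additive_functor_Ab(2)[OF F *(1,2,3)] *(4)] .
  moreover have "\<eta> X c \<in> carrier (fObj G X)" using hom_in_carrier[OF nat_transD(2)[OF assms(1) *(1)] *(4)] .
  ultimately show "(\<lambda>X\<in>cObj (fp_mod R). compose (carrier (fObj F X)) (\<theta> X) (\<eta> X)) Y (fArr F X Y f c) =
    fArr H X Y f ((\<lambda>X\<in>cObj (fp_mod R). compose (carrier (fObj F X)) (\<theta> X) (\<eta> X)) X c)"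
    using * nat_transD(4)[OF assms(1) *] nat_transD(4)[OF assms(2) *(1-3), of "\<eta> X c"] by (simp add: compose_def)
qed (simp add: compose_def)

lemma fp_functors_additive: "F \<in> fp_functors R \<Longrightarrow> additive_functor (fp_mod R) Ab F"
  by (simp add: fp_functors_def)

lemma short_exact_pointwise:
  assumes F: "F \<in> fp_functors R" and G: "G \<in> fp_functors R" and H: "H \<in> fp_functors R"
    and \<eta>: "\<eta> \<in> nat_trans R F G" and \<zeta>: "\<zeta> \<in> nat_trans R G H"
    and inj: "\<And>X c. ufp R X \<Longrightarrow> c \<in> carrier (fObj F X) \<Longrightarrow> \<eta> X c = \<one>\<^bsub>fObj G X\<^esub> \<Longrightarrow> c = \<one>\<^bsub>fObj F X\<^esub>"
    and surj: "\<And>X. ufp R X \<Longrightarrow> \<zeta> X ` carrier (fObj G X) = carrier (fObj H X)"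
    and ex: "\<And>X c. ufp R X \<Longrightarrow> c \<in> carrier (fObj G X) \<Longrightarrow> \<zeta> X c = \<one>\<^bsub>fObj H X\<^esub> \<longleftrightarrow> c \<in> \<eta> X ` carrier (fObj F X)"
  shows "short_exact (fp_functor_cat R) F G H \<eta> \<zeta>"
proof -
  note Fa = fp_functors_additive[OF F] and Ga = fp_functors_additive[OF G] and Ha = fp_functors_additive[OF H]
  have ec: "\<eta> X c \<in> carrier (fObj G X)" if "ufp R X" "c \<in> carrier (fObj F X)" for X c
    using hom_in_carrier[OF nat_transD(2)[OF \<eta> that(1)] that(2)] .
  have zc: "\<zeta> X c \<in> carrier (fObj H X)" if "ufp R X" "c \<in> carrier (fObj G X)" for X c
    using hom_in_carrier[OF nat_transD(2)[OF \<zeta> that(1)] that(2)] .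
  have injon: "inj_on (\<eta> X) (carrier (fObj F X))" if X: "ufp R X" for X
  proof -
    interpret FX: comm_group "fObj F X" using Fa X by (rule additive_functor_Ab)
    interpret GX: comm_group "fObj G X" using Ga X by (rule additive_functor_Ab)
    interpret h: group_hom "fObj F X" "fObj G X" "\<eta> X"
      using nat_transD(2)[OF \<eta> X] by unfold_locales
    show ?thesis using h.inj_on_one_iff inj[OF X] by blast
  qed
  have zero: "cComp (fp_functor_cat R) F G H \<zeta> \<eta> = cZero (fp_functor_cat R) F H"
    using ex ec by (auto simp: compose_def fun_eq_iff)
  have "cat_kernel (fp_functor_cat R) F G H \<eta> \<zeta>"
    unfolding cat_kernel_def
  proof (intro conjI zero ballI impI)
    fix T t assume "T \<in> cObj (fp_functor_cat R)" and "t \<in> cHom (fp_functor_cat R) T G"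
      and z: "cComp (fp_functor_cat R) T G H \<zeta> t = cZero (fp_functor_cat R) T H"
    then have T: "T \<in> fp_functors R" and t: "t \<in> nat_trans R T G" by auto
    note Ta = fp_functors_additive[OF T]
    have tc: "t X c \<in> carrier (fObj G X)" if "ufp R X" "c \<in> carrier (fObj T X)" for X c
      using hom_in_carrier[OF nat_transD(2)[OF t that(1)] that(2)] .
    have tz: "\<zeta> X (t X c) = \<one>\<^bsub>fObj H X\<^esub>" if "ufp R X" "c \<in> carrier (fObj T X)" for X c
      using fun_cong[OF fun_cong[OF z, of X], of c] that by (simp add: compose_def)
    have timg: "t X c \<in> \<eta> X ` carrier (fObj F X)" if "ufp R X" "c \<in> carrier (fObj T X)" for X c
      using ex[OF that(1) tc[OF that]] tz[OF that] by blast
    define u where "u = (\<lambda>X\<in>cObj (fp_mod R). \<lambda>c\<in>carrier (fObj T X). inv_into (carrier (fObj F X)) (\<eta> X) (t X c))"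
    have u: "u X c \<in> carrier (fObj F X)" "\<eta> X (u X c) = t X c" if "ufp R X" "c \<in> carrier (fObj T X)" for X c
      using inv_into_into[OF timg[OF that]] f_inv_into_f[OF timg[OF that]] that by (auto simp: u_def)
    have un: "u \<in> nat_trans R T F"
    proof (rule nat_transI)
      show "u \<in> extensional (cObj (fp_mod R))" by (simp add: u_def)
      show "u X \<in> extensional (carrier (fObj T X))" if "ufp R X" for X using that by (simp add: u_def)
      fix X assume X: "ufp R X"
      interpret TX: comm_group "fObj T X" using Ta X by (rule additive_functor_Ab)
      interpret FX: comm_group "fObj F X" using Fa X by (rule additive_functor_Ab)
      show "u X \<in> hom (fObj T X) (fObj F X)"
      proof (rule homI)
        fix c d assume cd: "c \<in> carrier (fObj T X)" "d \<in> carrier (fObj T X)"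
        have "\<eta> X (u X (c \<otimes>\<^bsub>fObj T X\<^esub> d)) = \<eta> X (u X c \<otimes>\<^bsub>fObj F X\<^esub> u X d)"
          using u[OF X] cd hom_mult[OF nat_transD(2)[OF \<eta> X]] hom_mult[OF nat_transD(2)[OF t X]] by simp
        then show "u X (c \<otimes>\<^bsub>fObj T X\<^esub> d) = u X c \<otimes>\<^bsub>fObj F X\<^esub> u X d"
          by (rule inj_onD[OF injon[OF X]]) (use u[OF X] cd in auto)
      qed (use u[OF X] in auto)
    next
      fix X Y f c assume *: "ufp R X" "ufp R Y" "f \<in> lin_hom R X Y" "c \<in> carrier (fObj T X)"
      have fc: "fArr T X Y f c \<in> carrier (fObj T Y)"
        using hom_in_carrier[OF additive_functor_Ab(2)[OF Ta *(1,2,3)] *(4)] .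
      have fu: "fArr F X Y f (u X c) \<in> carrier (fObj F Y)"
        using hom_in_carrier[OF additive_functor_Ab(2)[OF Fa *(1,2,3)] u(1)[OF *(1,4)]] .
      have "\<eta> Y (u Y (fArr T X Y f c)) = \<eta> Y (fArr F X Y f (u X c))"
        using u[OF *(1,4)] u[OF *(2) fc] nat_transD(4)[OF t *] nat_transD(4)[OF \<eta> *(1,2,3) u(1)[OF *(1,4)]] by simp
      then show "u Y (fArr T X Y f c) = fArr F X Y f (u X c)"
        by (rule inj_onD[OF injon[OF *(2)]]) (use u[OF *(2) fc] fu in auto)
    qed
    show "\<exists>!u. u \<in> cHom (fp_functor_cat R) T F \<and> cComp (fp_functor_cat R) T F G \<eta> u = t"
    proof (rule ex1I[of _ u])
      have "cComp (fp_functor_cat R) T F G \<eta> u = t"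
        unfolding fp_functor_cat_simps
        by (rule nat_trans_eqI[OF nat_trans_comp[OF un \<eta> Ta] t]) (simp add: u compose_def)
      then show "u \<in> cHom (fp_functor_cat R) T F \<and> cComp (fp_functor_cat R) T F G \<eta> u = t" using un by simp
      fix v assume v: "v \<in> cHom (fp_functor_cat R) T F \<and> cComp (fp_functor_cat R) T F G \<eta> v = t"
      then have vn: "v \<in> nat_trans R T F" by simp
      show "v = u"
      proof (rule nat_trans_eqI[OF vn un])
        fix X c assume X: "ufp R X" and c: "c \<in> carrier (fObj T X)"
        have "\<eta> X (v X c) = t X c"
          using fun_cong[OF fun_cong[OF conjunct2[OF v], of X], of c] X c by (simp add: compose_def)
        then show "v X c = u X c"
          using inj_onD[OF injon[OF X]] u[OF X c] hom_in_carrier[OF nat_transD(2)[OF vn X] c] by simp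
      qed
    qed
  qed
  moreover have "cat_cokernel (fp_functor_cat R) F G H \<eta> \<zeta>"
    unfolding cat_cokernel_def
  proof (intro conjI zero ballI impI)
    fix T t assume "T \<in> cObj (fp_functor_cat R)" and "t \<in> cHom (fp_functor_cat R) G T"
      and z: "cComp (fp_functor_cat R) F G T t \<eta> = cZero (fp_functor_cat R) F T"
    then have T: "T \<in> fp_functors R" and t: "t \<in> nat_trans R G T" by auto
    note Ta = fp_functors_additive[OF T]
    have tz: "t X (\<eta> X c) = \<one>\<^bsub>fObj T X\<^esub>" if "ufp R X" "c \<in> carrier (fObj F X)" for X c
      using fun_cong[OF fun_cong[OF z, of X], of c] that by (simp add: compose_def)
    have "\<exists>h. h \<in> hom (fObj H X) (fObj T X) \<inter> extensional (carrier (fObj H X)) \<and> (\<forall>c\<in>carrier (fObj G X). h (\<zeta> X c) = t X c)"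
      if X: "ufp R X" for X
    proof -
      interpret A: comm_group "fObj G X" using Ga X by (rule additive_functor_Ab)
      interpret B: comm_group "fObj H X" using Ha X by (rule additive_functor_Ab)
      interpret C: comm_group "fObj T X" using Ta X by (rule additive_functor_Ab)
      obtain h where "h \<in> hom (fObj H X) (fObj T X) \<inter> extensional (carrier (fObj H X))"
          "\<And>c. c \<in> carrier (fObj G X) \<Longrightarrow> h (\<zeta> X c) = t X c"
        by (rule hom_factor[OF A.is_group B.is_group C.is_group nat_transD(2)[OF \<zeta> X] surj[OF X] nat_transD(2)[OF t X]])
          (use ex[OF X] tz[OF X] in auto)
      then show ?thesis by auto
    qed
    then obtain h where h: "\<And>X. ufp R X \<Longrightarrow> h X \<in> hom (fObj H X) (fObj T X) \<inter> extensional (carrier (fObj H X))"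
      "\<And>X c. ufp R X \<Longrightarrow> c \<in> carrier (fObj G X) \<Longrightarrow> h X (\<zeta> X c) = t X c" by metis
    define u where "u = restrict h (cObj (fp_mod R))"
    have u: "u X = h X" if "ufp R X" for X using that by (simp add: u_def)
    have un: "u \<in> nat_trans R H T"
    proof (rule nat_transI)
      show "u \<in> extensional (cObj (fp_mod R))" by (simp add: u_def)
      show "u X \<in> hom (fObj H X) (fObj T X)" "u X \<in> extensional (carrier (fObj H X))" if "ufp R X" for X
        using h(1)[OF that] u[OF that] by auto
      fix X Y f c assume X: "ufp R X" and Y: "ufp R Y" and f: "f \<in> lin_hom R X Y"
        and "c \<in> carrier (fObj H X)"
      then obtain b where b: "b \<in> carrier (fObj G X)" "c = \<zeta> X b" using surj[OF X] by blast
      have fb: "fArr G X Y f b \<in> carrier (fObj G Y)" using hom_in_carrier[OF additive_functor_Ab(2)[OF Ga X Y f] b(1)] .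
      show "u Y (fArr H X Y f c) = fArr T X Y f (u X c)"
        using b u[OF X] u[OF Y] h(2)[OF X b(1)] h(2)[OF Y fb] nat_transD(4)[OF t X Y f b(1)] nat_transD(4)[OF \<zeta> X Y f b(1)] by simp
    qed
    show "\<exists>!u. u \<in> cHom (fp_functor_cat R) H T \<and> cComp (fp_functor_cat R) G H T u \<zeta> = t"
    proof (rule ex1I[of _ u])
      have "cComp (fp_functor_cat R) G H T u \<zeta> = t"
        unfolding fp_functor_cat_simps
        by (rule nat_trans_eqI[OF nat_trans_comp[OF \<zeta> un Ga] t]) (simp add: u h compose_def)
      then show "u \<in> cHom (fp_functor_cat R) H T \<and> cComp (fp_functor_cat R) G H T u \<zeta> = t" using un by simp
      fix v assume v: "v \<in> cHom (fp_functor_cat R) H T \<and> cComp (fp_functor_cat R) G H T v \<zeta> = t"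
      then have vn: "v \<in> nat_trans R H T" by simp
      show "v = u"
      proof (rule nat_trans_eqI[OF vn un])
        fix X c assume X: "ufp R X" and "c \<in> carrier (fObj H X)"
        then obtain b where b: "b \<in> carrier (fObj G X)" "c = \<zeta> X b" using surj[OF X] by blast
        show "v X c = u X c"
          using fun_cong[OF fun_cong[OF conjunct2[OF v], of X], of b] X b h(2)[OF X b(1)] u[OF X] by (simp add: compose_def)
      qed
    qed
  qed
  ultimately show ?thesis unfolding short_exact_def using F G H \<eta> \<zeta> by simp
qed

text \<open>A natural map of tuple functors \<open>t : P \<rightarrow> Q\<close> gives the exact sequence
  \<open>0 \<rightarrow> P / ker t \<rightarrow> Q \<rightarrow> Q / im t \<rightarrow> 0\<close>.\<close>

lemma ex_short_exact:
  assumes P: "natural_subgroup R n P" and Q: "natural_subgroup R k Q"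
    and F: "tuple_functor R n P P' F p" and G: "tuple_functor R k Q (\<lambda>X. {tzero X k}) G q"
    and H: "tuple_functor R k Q R' H r"
    and fp: "F \<in> fp_functors R" "G \<in> fp_functors R" "H \<in> fp_functors R"
    and t: "\<And>X x. ufp R X \<Longrightarrow> x \<in> P X \<Longrightarrow> t X x \<in> Q X"
    and ker: "\<And>X x. ufp R X \<Longrightarrow> x \<in> P X \<Longrightarrow> t X x = tzero X k \<longleftrightarrow> x \<in> P' X"
    and im: "\<And>X. ufp R X \<Longrightarrow> t X ` P X = R' X"
    and add: "\<And>X x y. ufp R X \<Longrightarrow> x \<in> P X \<Longrightarrow> y \<in> P X \<Longrightarrow> t X (tadd X n x y) = tadd X k (t X x) (t X y)"
    and nat: "\<And>X Y f x. \<lbrakk>ufp R X; ufp R Y; f \<in> lin_hom R X Y; x \<in> P X\<rbrakk>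
      \<Longrightarrow> t Y (tmap n f x) = tmap k f (t X x)"
  obtains \<eta> \<zeta> where "short_exact (fp_functor_cat R) F G H \<eta> \<zeta>"
    "\<And>X x. ufp R X \<Longrightarrow> x \<in> P X \<Longrightarrow> \<eta> X (p X x) = q X (t X x)"
    "\<And>X x. ufp R X \<Longrightarrow> x \<in> Q X \<Longrightarrow> \<zeta> X (q X x) = r X x"
proof -
  obtain \<eta> where \<eta>: "\<eta> \<in> nat_trans R F G" and e: "\<And>X x. ufp R X \<Longrightarrow> x \<in> P X \<Longrightarrow> \<eta> X (p X x) = q X (t X x)"
    by (rule ex_nat_trans[OF P Q F G, of t]) (use t ker add nat in auto)
  obtain \<zeta> where \<zeta>: "\<zeta> \<in> nat_trans R G H" and z: "\<And>X x. ufp R X \<Longrightarrow> x \<in> Q X \<Longrightarrow> \<zeta> X (q X x) = r X x"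
  proof (rule ex_nat_trans[OF Q Q G H, of "\<lambda>X x. x"])
    fix X x assume X: "ufp R X" and "x \<in> {tzero X k}"
    interpret PX: comm_group "tuple_group X n (P X)" by (rule natural_subgroup_group[OF P X])
    interpret QX: comm_group "tuple_group X k (Q X)" by (rule natural_subgroup_group[OF Q X])
    interpret h: group_hom "tuple_group X n (P X)" "tuple_group X k (Q X)" "t X"
      by unfold_locales (use t[OF X] add[OF X] in \<open>auto intro!: homI\<close>)
    have "x = t X (tzero X n)" using h.hom_one \<open>x \<in> _\<close> by simp
    then show "x \<in> R' X" using im[OF X] natural_subgroup_group(4)[OF P X] by blast
  qed auto
  have "short_exact (fp_functor_cat R) F G H \<eta> \<zeta>"
  proof (rule short_exact_pointwise[OF fp \<eta> \<zeta>])
    fix X c assume X: "ufp R X" and c: "c \<in> carrier (fObj F X)" "\<eta> X c = \<one>\<^bsub>fObj G X\<^esub>"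
    then obtain x where x: "x \<in> P X" "c = p X x" using tuple_functorD(3)[OF F X] by blast
    then have "x \<in> P' X" using c e[OF X x(1)] tuple_functorD(4)[OF G X t[OF X x(1)]] ker[OF X x(1)] by simp
    then show "c = \<one>\<^bsub>fObj F X\<^esub>" using tuple_functorD(4)[OF F X x(1)] x by simp
  next
    fix X assume X: "ufp R X"
    have "\<zeta> X ` (q X ` Q X) = r X ` Q X" using z[OF X] by (auto simp: image_image)
    then show "\<zeta> X ` carrier (fObj G X) = carrier (fObj H X)"
      using tuple_functorD(3)[OF G X] tuple_functorD(3)[OF H X] by simp
  next
    fix X c assume X: "ufp R X" and c: "c \<in> carrier (fObj G X)"
    interpret QX: comm_group "tuple_group X k (Q X)" by (rule natural_subgroup_group[OF Q X])
    interpret GX: comm_group "fObj G X" using tuple_functorD(1)[OF G] X by (rule additive_functor_Ab)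
    interpret q: group_hom "tuple_group X k (Q X)" "fObj G X" "q X"
      using tuple_functorD(2)[OF G X] by unfold_locales
    have "inj_on (q X) (carrier (tuple_group X k (Q X)))"
      unfolding q.inj_on_one_iff using tuple_functorD(4)[OF G X] by simp
    then have qi: "inj_on (q X) (Q X)" by simp
    obtain y where y: "y \<in> Q X" "c = q X y" using c tuple_functorD(3)[OF G X] by blast
    have "\<zeta> X c = \<one>\<^bsub>fObj H X\<^esub> \<longleftrightarrow> y \<in> t X ` P X"
      using y z[OF X y(1)] tuple_functorD(4)[OF H X y(1)] im[OF X] by simp
    also have "\<dots> \<longleftrightarrow> c \<in> q X ` (t X ` P X)" using y qi t[OF X] by (auto dest: inj_onD)
    also have "q X ` (t X ` P X) = \<eta> X ` (p X ` P X)" using e[OF X] by (auto simp: image_image)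
    finally show "\<zeta> X c = \<one>\<^bsub>fObj H X\<^esub> \<longleftrightarrow> c \<in> \<eta> X ` carrier (fObj F X)"
      using tuple_functorD(3)[OF F X] by simp
  qed
  then show thesis using e z by (rule that)
qed

definition represents ::
  "('a, 'e) ring_scheme \<Rightarrow> nat \<Rightarrow> nat \<Rightarrow> (nat \<Rightarrow> nat \<Rightarrow> 'a) \<Rightarrow> ('a, 'm) module \<Rightarrow> (nat \<Rightarrow> 'm) \<Rightarrow> ('a, 'x) module \<Rightarrow> bool"
  where "represents R m n a M u X \<longleftrightarrow> bij_betw (\<lambda>h. tmap n h u) (lin_hom R M X) (sols X m n a)"

lemma pres_by_represents:
  assumes P: "pres_by R m n a M u" and X: "left_module R X"
  shows "represents R m n a M u X"
  unfolding represents_def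
proof (rule bij_betw_imageI)
  note PD = pres_byD[OF P]
  interpret M: left_module R M by (rule PD)
  interpret X: left_module R X by (rule X)
  show "inj_on (\<lambda>h. tmap n h u) (lin_hom R M X)"
  proof (rule inj_onI)
    fix h k assume hk: "h \<in> lin_hom R M X" "k \<in> lin_hom R M X" "tmap n h u = tmap n k u"
    then show "h = k" by (intro pres_by_hom_eqI[OF P X hk(1,2)]) (metis tmap_apply)
  qed
  show "(\<lambda>h. tmap n h u) ` lin_hom R M X = sols X m n a"
  proof (intro equalityI subsetI)
    fix x assume "x \<in> (\<lambda>h. tmap n h u) ` lin_hom R M X"
    then obtain h where h: "h \<in> lin_hom R M X" "x = tmap n h u" by auto
    have "tmap n h u = tmap n h (restrict u {..<n})" by (auto simp: tmap_def)
    then show "x \<in> sols X m n a" using tmap_sols[OF h(1) PD(1) X PD(2) pres_by_sols[OF P]] h by simp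
  next
    fix x assume x: "x \<in> sols X m n a"
    then obtain h where h: "h \<in> lin_hom R M X" "\<And>i. i < n \<Longrightarrow> h (u i) = x i"
      using pres_by_universal[OF P X x] by blast
    have "tmap n h u \<in> tuples X n" using h(1) PD(3) lin_hom_closed[OF h(1)] by (auto simp: tmap_def tuples_def)
    then have "x = tmap n h u" using h(2) by (intro tuples_eqI[OF sols_tuples[OF x]]) auto
    then show "x \<in> (\<lambda>h. tmap n h u) ` lin_hom R M X" using h by blast
  qed
qed

locale presentation_data =
  fixes R :: "('a, 'e) ring_scheme" and m n m' n' :: nat and a b L :: "nat \<Rightarrow> nat \<Rightarrow> 'a"
    and M :: "('a, 'm) module" and N :: "('a, 'k) module" and \<alpha> :: "'m \<Rightarrow> 'k" and u w
  assumes M: "left_module R M" and \<alpha>: "\<alpha> \<in> lin_hom R M N"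
    and u: "u \<in> {..<n} \<rightarrow> carrier M"
    and rM: "\<And>X :: 'a umodule. ufp R X \<Longrightarrow> represents R m n a M u X"
    and rN: "\<And>X :: 'a umodule. ufp R X \<Longrightarrow> represents R m' n' b N w X"
    and cp: "\<And>(X :: 'a umodule) k. ufp R X \<Longrightarrow> k \<in> lin_hom R N X \<Longrightarrow>
      tmap n (compose (carrier M) k \<alpha>) u = mat_app X n n' L (tmap n' k w)"
begin

lemma compose_sols:
  assumes X: "ufp R X"
  shows "mat_app X n n' L ` sols X m' n' b = (\<lambda>h. tmap n h u) ` hom_image R M N \<alpha> X"
    and "hom_image R M N \<alpha> X \<subseteq> lin_hom R M X" "mat_app X n n' L ` sols X m' n' b \<subseteq> sols X m n a"
proof -
  have s: "sols X m' n' b = (\<lambda>k. tmap n' k w) ` lin_hom R N X"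
    using rN[OF X] by (auto simp: represents_def bij_betw_def)
  show 1: "mat_app X n n' L ` sols X m' n' b = (\<lambda>h. tmap n h u) ` hom_image R M N \<alpha> X"
    unfolding s hom_image_def image_image using cp[OF X] by (auto intro!: image_cong)
  show 2: "hom_image R M N \<alpha> X \<subseteq> lin_hom R M X"
    using lin_hom_compose[OF \<alpha> _ M] by (auto simp: hom_image_def)
  show "mat_app X n n' L ` sols X m' n' b \<subseteq> sols X m n a"
    unfolding 1 using 2 rM[OF X] by (auto simp: represents_def bij_betw_def)
qed

lemma tuple_functor_presents:
  assumes F: "tuple_functor R n (\<lambda>X. sols X m n a) (\<lambda>X. mat_app X n n' L ` sols X m' n' b) F p"
  shows "presents R M N \<alpha> F"
  unfolding presents_def
proof (intro conjI \<alpha> exI[of _ "\<lambda>X h. p X (tmap n h u)"] ballI)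
  fix X :: "'a umodule" assume "X \<in> cObj (fp_mod R)"
  then have X: "ufp R X" by simp
  have b: "inj_on (\<lambda>h. tmap n h u) (lin_hom R M X)" "(\<lambda>h. tmap n h u) ` lin_hom R M X = sols X m n a"
    using rM[OF X] by (auto simp: represents_def bij_betw_def)
  have bs: "tmap n h u \<in> sols X m n a" if "h \<in> lin_hom R M X" for h using that b by blast
  note ph = tuple_functorD(2)[OF F X]
  show "(\<lambda>h. p X (tmap n h u)) \<in> hom (hom_group R M X) (fObj F X)"
  proof (rule homI)
    fix h assume "h \<in> carrier (hom_group R M X)"
    then show "p X (tmap n h u) \<in> carrier (fObj F X)"
      using hom_in_carrier[OF ph] bs by (simp add: hom_group_def)
  next
    fix h k assume hk: "h \<in> carrier (hom_group R M X)" "k \<in> carrier (hom_group R M X)"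
    have "tmap n (h \<otimes>\<^bsub>hom_group R M X\<^esub> k) u = tadd X n (tmap n h u) (tmap n k u)"
      using u by (auto simp: hom_group_def tmap_def tadd_def fun_eq_iff)
    then show "p X (tmap n (h \<otimes>\<^bsub>hom_group R M X\<^esub> k) u) = p X (tmap n h u) \<otimes>\<^bsub>fObj F X\<^esub> p X (tmap n k u)"
      using hom_mult[OF ph] bs hk by (simp add: hom_group_def)
  qed
  show "(\<lambda>h. p X (tmap n h u)) ` lin_hom R M X = carrier (fObj F X)"
    using tuple_functorD(3)[OF F X] b(2) by (metis image_image)
  show "kernel (hom_group R M X) (fObj F X) (\<lambda>h. p X (tmap n h u)) = hom_image R M N \<alpha> X"
  proof (intro equalityI subsetI)
    fix h assume "h \<in> kernel (hom_group R M X) (fObj F X) (\<lambda>h. p X (tmap n h u))"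
    then have h: "h \<in> lin_hom R M X" "p X (tmap n h u) = \<one>\<^bsub>fObj F X\<^esub>" by (auto simp: kernel_def hom_group_def)
    then have "tmap n h u \<in> (\<lambda>h. tmap n h u) ` hom_image R M N \<alpha> X"
      using tuple_functorD(4)[OF F X bs[OF h(1)]] compose_sols(1)[OF X] by simp
    then show "h \<in> hom_image R M N \<alpha> X" using b(1) h(1) compose_sols(2)[OF X] by (auto dest!: inj_onD)
  next
    fix h assume h: "h \<in> hom_image R M N \<alpha> X"
    then have "h \<in> lin_hom R M X" "tmap n h u \<in> mat_app X n n' L ` sols X m' n' b"
      using compose_sols(1,2)[OF X] by auto
    then show "h \<in> kernel (hom_group R M X) (fObj F X) (\<lambda>h. p X (tmap n h u))"
      using tuple_functorD(4)[OF F X bs] by (auto simp: kernel_def hom_group_def)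
  qed
next
  fix X Y :: "'a umodule" and f h assume "X \<in> cObj (fp_mod R)" "Y \<in> cObj (fp_mod R)"
    and f: "f \<in> lin_hom R X Y" and h: "h \<in> lin_hom R M X"
  then have X: "ufp R X" and Y: "ufp R Y" by auto
  have "tmap n h u \<in> sols X m n a" using h rM[OF X] by (auto simp: represents_def bij_betw_def)
  moreover have "tmap n f (tmap n h u) = tmap n (compose (carrier M) f h) u"
    using u by (auto simp: tmap_def compose_def fun_eq_iff)
  ultimately show "fArr F X Y f (p X (tmap n h u)) = p Y (tmap n (compose (carrier M) f h) u)"
    using tuple_functorD(5)[OF F X Y f] by simp
qed

lemma presents_tuple_functor:
  assumes F: "F \<in> fp_functors R" and pr: "presents R M N \<alpha> F"
  obtains p where "tuple_functor R n (\<lambda>X. sols X m n a) (\<lambda>X. mat_app X n n' L ` sols X m' n' b) F p"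
proof -
  obtain \<pi> where \<pi>': "\<forall>X\<in>cObj (fp_mod R). \<pi> X \<in> hom (hom_group R M X) (fObj F X) \<and>
        \<pi> X ` lin_hom R M X = carrier (fObj F X) \<and>
        kernel (hom_group R M X) (fObj F X) (\<pi> X) = hom_image R M N \<alpha> X"
      "\<forall>X\<in>cObj (fp_mod R). \<forall>Y\<in>cObj (fp_mod R). \<forall>f\<in>lin_hom R X Y. \<forall>h\<in>lin_hom R M X.
        fArr F X Y f (\<pi> X h) = \<pi> Y (compose (carrier M) f h)"
    using pr unfolding presents_def by (elim conjE exE) (rule that)
  have \<pi>: "\<And>X. ufp R X \<Longrightarrow> \<pi> X \<in> hom (hom_group R M X) (fObj F X)"
    "\<And>X. ufp R X \<Longrightarrow> \<pi> X ` lin_hom R M X = carrier (fObj F X)"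
    "\<And>X. ufp R X \<Longrightarrow> kernel (hom_group R M X) (fObj F X) (\<pi> X) = hom_image R M N \<alpha> X"
    "\<And>X Y f h. \<lbrakk>ufp R X; ufp R Y; f \<in> lin_hom R X Y; h \<in> lin_hom R M X\<rbrakk> \<Longrightarrow>
      fArr F X Y f (\<pi> X h) = \<pi> Y (compose (carrier M) f h)"
    using \<pi>' by simp_all
  define r where "r X x = inv_into (lin_hom R M X) (\<lambda>h. tmap n h u) x" for X :: "'a umodule" and x
  have b: "inj_on (\<lambda>h. tmap n h u) (lin_hom R M X)" "(\<lambda>h. tmap n h u) ` lin_hom R M X = sols X m n a"
    if "ufp R X" for X :: "'a umodule"
    using rM[OF that] by (auto simp: represents_def bij_betw_def)
  have r: "r X x \<in> lin_hom R M X" "tmap n (r X x) u = x" if "ufp R X" "x \<in> sols X m n a" for X x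
    using that b(2)[OF that(1)] unfolding r_def by (auto intro: inv_into_into f_inv_into_f[of x "\<lambda>h. tmap n h u"])
  have re: "r X (tmap n h u) = h" if "ufp R X" "h \<in> lin_hom R M X" for X h
    unfolding r_def using inv_into_f_f[OF b(1)[OF that(1)] that(2)] .
  have "tuple_functor R n (\<lambda>X. sols X m n a) (\<lambda>X. mat_app X n n' L ` sols X m' n' b) F (\<lambda>X x. \<pi> X (r X x))"
    unfolding tuple_functor_def
  proof (intro conjI allI impI fp_functors_additive[OF F])
    fix X :: "'a umodule" assume X: "ufp R X"
    interpret X: left_module R X using X by (rule fin_presented_left_module)
    show "(\<lambda>x. \<pi> X (r X x)) \<in> hom (tuple_group X n (sols X m n a)) (fObj F X)"
    proof (rule homI)
      fix x assume "x \<in> carrier (tuple_group X n (sols X m n a))"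
      then show "\<pi> X (r X x) \<in> carrier (fObj F X)"
        using hom_in_carrier[OF \<pi>(1)[OF X]] r[OF X] by (simp add: hom_group_def)
    next
      fix x y assume "x \<in> carrier (tuple_group X n (sols X m n a))" "y \<in> carrier (tuple_group X n (sols X m n a))"
      then have xy: "x \<in> sols X m n a" "y \<in> sols X m n a" by auto
      let ?h = "\<lambda>z\<in>carrier M. r X x z \<oplus>\<^bsub>X\<^esub> r X y z"
      have h: "?h \<in> lin_hom R M X" by (rule lin_hom_sum[OF M X.left_module_axioms r(1)[OF X xy(1)] r(1)[OF X xy(2)]])
      have "tmap n ?h u = tadd X n (tmap n (r X x) u) (tmap n (r X y) u)"
        using u by (auto simp: tmap_def tadd_def fun_eq_iff)
      then have "tmap n ?h u = tadd X n x y" using r(2)[OF X] xy by simp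
      then have "r X (tadd X n x y) = ?h" using re[OF X h] by simp
      then show "\<pi> X (r X (x \<otimes>\<^bsub>tuple_group X n (sols X m n a)\<^esub> y)) = \<pi> X (r X x) \<otimes>\<^bsub>fObj F X\<^esub> \<pi> X (r X y)"
        using hom_mult[OF \<pi>(1)[OF X], of "r X x" "r X y"] r(1)[OF X] xy by (simp add: hom_group_def)
    qed
    have "r X ` sols X m n a = lin_hom R M X"
      unfolding b(2)[OF X, symmetric] image_image using re[OF X] by auto
    then show "(\<lambda>x. \<pi> X (r X x)) ` sols X m n a = carrier (fObj F X)" using \<pi>(2)[OF X] by (metis image_image)
    show "\<forall>x\<in>sols X m n a. \<pi> X (r X x) = \<one>\<^bsub>fObj F X\<^esub> \<longleftrightarrow> x \<in> mat_app X n n' L ` sols X m' n' b"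
    proof
      fix x assume x: "x \<in> sols X m n a"
      have "\<pi> X (r X x) = \<one>\<^bsub>fObj F X\<^esub> \<longleftrightarrow> r X x \<in> hom_image R M N \<alpha> X"
        using \<pi>(3)[OF X] r(1)[OF X x] by (auto simp: kernel_def hom_group_def)
      also have "\<dots> \<longleftrightarrow> x \<in> (\<lambda>h. tmap n h u) ` hom_image R M N \<alpha> X"
      proof
        assume "r X x \<in> hom_image R M N \<alpha> X"
        then show "x \<in> (\<lambda>h. tmap n h u) ` hom_image R M N \<alpha> X" using r(2)[OF X x] by (intro image_eqI[of _ _ "r X x"]) auto
      next
        assume "x \<in> (\<lambda>h. tmap n h u) ` hom_image R M N \<alpha> X"
        then obtain h where h: "h \<in> hom_image R M N \<alpha> X" "x = tmap n h u" by auto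
        then have "r X x = h" using re[OF X] compose_sols(2)[OF X] by auto
        then show "r X x \<in> hom_image R M N \<alpha> X" using h by simp
      qed
      finally show "\<pi> X (r X x) = \<one>\<^bsub>fObj F X\<^esub> \<longleftrightarrow> x \<in> mat_app X n n' L ` sols X m' n' b"
        by (simp add: compose_sols(1)[OF X])
    qed
  next
    fix X Y :: "'a umodule" and f x assume X: "ufp R X" and Y: "ufp R Y"
      and f: "f \<in> lin_hom R X Y" and x: "x \<in> sols X m n a"
    have c: "compose (carrier M) f (r X x) \<in> lin_hom R M Y" using lin_hom_compose[OF r(1)[OF X x] f M] .
    have "tmap n (compose (carrier M) f (r X x)) u = tmap n f (tmap n (r X x) u)"
      using u by (auto simp: tmap_def compose_def fun_eq_iff)
    then have "r Y (tmap n f x) = compose (carrier M) f (r X x)" using re[OF Y c] r(2)[OF X x] by simp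
    then show "fArr F X Y f (\<pi> X (r X x)) = \<pi> Y (r Y (tmap n f x))" using \<pi>(4)[OF X Y f r(1)[OF X x]] by simp
  qed
  then show thesis by (rule that)
qed

end

lemma natural_subgroup_sols:
  assumes "a \<in> UNIV \<rightarrow> UNIV \<rightarrow> carrier R"
  shows "natural_subgroup R n (\<lambda>X. sols X m n a)"
  unfolding natural_subgroup_def
  by (auto intro: left_module.subgroup_sols[OF fin_presented_left_module assms]
      tmap_sols[OF _ fin_presented_left_module fin_presented_left_module assms])

lemma natural_subgroup_mat_app:
  assumes "L \<in> UNIV \<rightarrow> UNIV \<rightarrow> carrier R" "natural_subgroup R n P"
  shows "natural_subgroup R k (\<lambda>X. mat_app X k n L ` P X)"
  unfolding natural_subgroup_def
proof (intro conjI allI impI)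
  fix X assume X: "ufp R X"
  then interpret X: left_module R X by (rule fin_presented_left_module)
  show "subgroup (mat_app X k n L ` P X) (tuple_group X k (tuples X k))"
    using X.subgroup_mat_app_image[OF assms(1) natural_subgroupD(1)[OF assms(2) X]] .
next
  fix X Y f x assume X: "ufp R X" and Y: "ufp R Y" and f: "f \<in> lin_hom R X Y"
    and "x \<in> mat_app X k n L ` P X"
  then obtain z where z: "z \<in> P X" "x = mat_app X k n L z" by auto
  have "tmap k f x = mat_app Y k n L (tmap n f z)"
    unfolding z(2) using z(1) natural_subgroup_group(2)[OF assms(2) X]
    by (intro tmap_mat_app[OF f fin_presented_left_module[OF X] fin_presented_left_module[OF Y] assms(1)]) auto
  then show "tmap k f x \<in> mat_app Y k n L ` P Y" using natural_subgroupD(2)[OF assms(2) X Y f z(1)] by simp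
qed

lemma tuple_functor_fp:
  fixes R :: "('a, 'e) ring_scheme"
  assumes "ring R" and a: "a \<in> UNIV \<rightarrow> UNIV \<rightarrow> carrier R" and b: "b \<in> UNIV \<rightarrow> UNIV \<rightarrow> carrier R"
    and L: "L \<in> UNIV \<rightarrow> UNIV \<rightarrow> carrier R"
    and sub: "\<And>X. ufp R X \<Longrightarrow> P' X \<subseteq> sols X m n a"
    and P': "\<And>X. ufp R X \<Longrightarrow> P' X = mat_app X n n' L ` sols X m' n' b"
    and F: "tuple_functor R n (\<lambda>X. sols X m n a) P' F p"
  shows "F \<in> fp_functors R"
proof -
  obtain M :: "'a umodule" and u where PM: "pres_by R m n a M u" using ex_pres_by[OF assms(1) a] .
  obtain N :: "'a umodule" and w where PN: "pres_by R m' n' b N w" using ex_pres_by[OF assms(1) b] .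
  note MD = pres_byD[OF PM] and ND = pres_byD[OF PN]
  interpret N: left_module R N by (rule ND)
  have fN: "ufp R N" using PN by (rule pres_by_fin_presented)
  let ?w = "restrict w {..<n'}"
  have Lw: "mat_app N n n' L ?w \<in> sols N m n a"
    using P'[OF fN] sub[OF fN] pres_by_sols[OF PN] by blast
  obtain \<alpha> where \<alpha>: "\<alpha> \<in> lin_hom R M N" "\<And>i. i < n \<Longrightarrow> \<alpha> (u i) = mat_app N n n' L ?w i"
    using pres_by_universal[OF PM ND(1) Lw] by blast
  interpret presentation_data R m n m' n' a b L M N \<alpha> u w
  proof (rule presentation_data.intro)
    show "left_module R M" "\<alpha> \<in> lin_hom R M N" "u \<in> {..<n} \<rightarrow> carrier M" by (rule MD \<alpha>)+
    fix X :: "'a umodule" assume X: "ufp R X"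
    then interpret X: left_module R X by (rule fin_presented_left_module)
    show rM: "represents R m n a M u X" by (rule pres_by_represents[OF PM X.left_module_axioms])
    show "represents R m' n' b N w X" by (rule pres_by_represents[OF PN X.left_module_axioms])
    fix k assume k: "k \<in> lin_hom R N X"
    have w: "?w \<in> tuples N n'" using ND(3) by (auto simp: tuples_def)
    have "tmap n (compose (carrier M) k \<alpha>) u = tmap n k (mat_app N n n' L ?w)"
      using MD(3) \<alpha>(2) by (auto simp: tmap_def compose_def fun_eq_iff)
    also have "\<dots> = mat_app X n n' L (tmap n' k ?w)"
      by (rule tmap_mat_app[OF k ND(1) X.left_module_axioms L w])
    also have "tmap n' k ?w = tmap n' k w" by (auto simp: tmap_def fun_eq_iff)
    finally show "tmap n (compose (carrier M) k \<alpha>) u = mat_app X n n' L (tmap n' k w)" .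
  qed
  have "tuple_functor R n (\<lambda>X. sols X m n a) (\<lambda>X. mat_app X n n' L ` sols X m' n' b) F p"
    using F P' by (simp add: tuple_functor_def)
  then have "presents R M N \<alpha> F" by (rule tuple_functor_presents)
  then show ?thesis
    unfolding fp_functors_def using tuple_functorD(1)[OF F] fN pres_by_fin_presented[OF PM]
    by (intro CollectI conjI bexI[of _ M] bexI[of _ N] exI[of _ \<alpha>]) simp_all
qed

section \<open>Tensor products\<close>

lemma (in comm_group) hom_finprod:
  assumes "comm_group H" "h \<in> hom G H" "finite A" "f \<in> A \<rightarrow> carrier G"
  shows "h (finprod G f A) = finprod H (\<lambda>i. h (f i)) A"
  using assms(3,4)
proof (induction A rule: finite_induct)
  interpret H: comm_group H by fact
  interpret h: group_hom G H h using assms(2) by unfold_locales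
  { case empty then show ?case by simp
  next
    case (insert x A) then show ?case by (simp add: Pi_iff)
  }
qed

definition pure_tensor ::
  "('a, 'e) ring_scheme \<Rightarrow> ('a, 'p) module \<Rightarrow> ('a, 'm) module \<Rightarrow> 'p \<Rightarrow> 'm \<Rightarrow> (('p \<times> 'm) \<Rightarrow>\<^sub>0 int) set"
  where "pure_tensor R A M x m = tensor_rel R A M #>\<^bsub>free_Abelian_group (carrier A \<times> carrier M)\<^esub> frag_of (x, m)"

locale tensor_product =
  fixes R :: "('a, 'e) ring_scheme" and A :: "('a, 'p) module" and M :: "('a, 'm) module"
  assumes lA: "left_module (opp R) A" and lM: "left_module R M"
begin

sublocale A: left_module "opp R" A by (rule lA)
sublocale M: left_module R M by (rule lM)

abbreviation "FG \<equiv> free_Abelian_group (carrier A \<times> carrier M)"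
abbreviation "TR \<equiv> tensor_rel R A M"
abbreviation "T \<equiv> tensor R A M"
abbreviation "pt \<equiv> pure_tensor R A M"

definition "tensor_gens =
  {frag_of (x \<oplus>\<^bsub>A\<^esub> y, m) - frag_of (x, m) - frag_of (y, m) | x y m.
        x \<in> carrier A \<and> y \<in> carrier A \<and> m \<in> carrier M} \<union>
     {frag_of (x, m \<oplus>\<^bsub>M\<^esub> n) - frag_of (x, m) - frag_of (x, n) | x m n.
        x \<in> carrier A \<and> m \<in> carrier M \<and> n \<in> carrier M} \<union>
     {frag_of (a \<odot>\<^bsub>A\<^esub> x, m) - frag_of (x, a \<odot>\<^bsub>M\<^esub> m) | a x m.
        a \<in> carrier R \<and> x \<in> carrier A \<and> m \<in> carrier M}"

lemma comm_group_FG: "comm_group FG" by (rule abelian_free_Abelian_group)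

lemma tensor_gens_carrier: "tensor_gens \<subseteq> carrier FG"
proof -
  have d: "p - q \<in> carrier FG" if "p \<in> carrier FG" "q \<in> carrier FG" for p q
    using that keys_diff[of p q] by auto
  have f: "frag_of (x, m) \<in> carrier FG" if "x \<in> carrier A" "m \<in> carrier M" for x m using that by simp
  show ?thesis unfolding tensor_gens_def
    by (safe; intro d f) (auto simp: M.smult_closed intro: A.smult_closed)
qed

lemma tensor_rel_eq: "TR = generate FG tensor_gens"
  unfolding tensor_rel_def tensor_gens_def ..

lemma subgroup_TR: "subgroup TR FG"
  unfolding tensor_rel_eq by (rule group.generate_is_subgroup[OF group_free_Abelian_group tensor_gens_carrier])

lemma normal_TR: "TR \<lhd> FG"
  by (rule comm_group.subgroup_imp_normal[OF comm_group_FG subgroup_TR])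

lemma comm_group_tensor: "comm_group T"
  unfolding tensor_def by (rule comm_group.abelian_FactGroup[OF comm_group_FG subgroup_TR])

sublocale TG: comm_group T by (rule comm_group_tensor)

definition "cls z = TR #>\<^bsub>FG\<^esub> z"

lemma cls_hom: "cls \<in> hom FG T"
  unfolding cls_def[abs_def] tensor_def by (rule normal.r_coset_hom_Mod[OF normal_TR])

lemma cls_surj: "cls ` carrier FG = carrier T"
  by (simp add: tensor_def carrier_FactGroup cls_def)

lemma cls_one_iff: "z \<in> carrier FG \<Longrightarrow> cls z = \<one>\<^bsub>T\<^esub> \<longleftrightarrow> z \<in> TR"
  unfolding cls_def tensor_def one_FactGroup
  using group.coset_join1[OF group_free_Abelian_group _ _ subgroup_TR] group.coset_join2[OF group_free_Abelian_group _ subgroup_TR] by blast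

lemma pt_cls: "pt x m = cls (frag_of (x, m))"
  by (simp add: pure_tensor_def cls_def)

lemma pt_closed: "x \<in> carrier A \<Longrightarrow> m \<in> carrier M \<Longrightarrow> pt x m \<in> carrier T"
  unfolding pt_cls by (rule hom_in_carrier[OF cls_hom]) simp

lemma cls_add: "z \<in> carrier FG \<Longrightarrow> w \<in> carrier FG \<Longrightarrow> cls (z + w) = cls z \<otimes>\<^bsub>T\<^esub> cls w"
  using hom_mult[OF cls_hom, of z w] by simp

lemma cls_gen: "e \<in> tensor_gens \<Longrightarrow> cls e = \<one>\<^bsub>T\<^esub>"
  using cls_one_iff[of e] tensor_gens_carrier generate.incl[of e tensor_gens FG] unfolding tensor_rel_eq by blast

lemma pt_add_left:
  assumes "x \<in> carrier A" "y \<in> carrier A" "m \<in> carrier M"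
  shows "pt (x \<oplus>\<^bsub>A\<^esub> y) m = pt x m \<otimes>\<^bsub>T\<^esub> pt y m"
proof -
  let ?e = "frag_of (x \<oplus>\<^bsub>A\<^esub> y, m) - frag_of (x, m) - frag_of (y, m)"
  have e: "?e \<in> tensor_gens" unfolding tensor_gens_def using assms by blast
  then have ec: "?e \<in> carrier FG" using tensor_gens_carrier by blast
  have f: "frag_of (x, m) \<in> carrier FG" "frag_of (y, m) \<in> carrier FG" using assms by auto
  have fs: "frag_of (x, m) + frag_of (y, m) \<in> carrier FG"
    using f group.subgroup_self[OF group_free_Abelian_group, of "carrier A \<times> carrier M", THEN subgroup.m_closed] by (metis mult_free_Abelian_group)
  have "pt (x \<oplus>\<^bsub>A\<^esub> y) m = cls (?e + (frag_of (x, m) + frag_of (y, m)))"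
    by (simp add: pt_cls)
  also have "\<dots> = cls ?e \<otimes>\<^bsub>T\<^esub> cls (frag_of (x, m) + frag_of (y, m))" by (rule cls_add[OF ec fs])
  also have "\<dots> = pt x m \<otimes>\<^bsub>T\<^esub> pt y m"
    using cls_gen[OF e] cls_add[OF f] pt_closed assms by (simp add: pt_cls)
  finally show ?thesis .
qed

lemma pt_add_right:
  assumes "x \<in> carrier A" "m \<in> carrier M" "n \<in> carrier M"
  shows "pt x (m \<oplus>\<^bsub>M\<^esub> n) = pt x m \<otimes>\<^bsub>T\<^esub> pt x n"
proof -
  let ?e = "frag_of (x, m \<oplus>\<^bsub>M\<^esub> n) - frag_of (x, m) - frag_of (x, n)"
  have e: "?e \<in> tensor_gens" unfolding tensor_gens_def using assms by blast
  then have ec: "?e \<in> carrier FG" using tensor_gens_carrier by blast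
  have f: "frag_of (x, m) \<in> carrier FG" "frag_of (x, n) \<in> carrier FG" using assms by auto
  have fs: "frag_of (x, m) + frag_of (x, n) \<in> carrier FG"
    using f group.subgroup_self[OF group_free_Abelian_group, of "carrier A \<times> carrier M", THEN subgroup.m_closed] by (metis mult_free_Abelian_group)
  have "pt x (m \<oplus>\<^bsub>M\<^esub> n) = cls (?e + (frag_of (x, m) + frag_of (x, n)))"
    by (simp add: pt_cls)
  also have "\<dots> = cls ?e \<otimes>\<^bsub>T\<^esub> cls (frag_of (x, m) + frag_of (x, n))" by (rule cls_add[OF ec fs])
  also have "\<dots> = pt x m \<otimes>\<^bsub>T\<^esub> pt x n"
    using cls_gen[OF e] cls_add[OF f] pt_closed assms by (simp add: pt_cls)
  finally show ?thesis .
qed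

lemma pt_balanced:
  assumes "a \<in> carrier R" "x \<in> carrier A" "m \<in> carrier M"
  shows "pt (a \<odot>\<^bsub>A\<^esub> x) m = pt x (a \<odot>\<^bsub>M\<^esub> m)"
proof -
  let ?e = "frag_of (a \<odot>\<^bsub>A\<^esub> x, m) - frag_of (x, a \<odot>\<^bsub>M\<^esub> m)"
  have e: "?e \<in> tensor_gens" unfolding tensor_gens_def using assms by blast
  then have ec: "?e \<in> carrier FG" using tensor_gens_carrier by blast
  have f: "frag_of (x, a \<odot>\<^bsub>M\<^esub> m) \<in> carrier FG" using assms by (auto intro: M.smult_closed)
  have "pt (a \<odot>\<^bsub>A\<^esub> x) m = cls (?e + frag_of (x, a \<odot>\<^bsub>M\<^esub> m))"
    by (simp add: pt_cls)
  also have "\<dots> = cls ?e \<otimes>\<^bsub>T\<^esub> cls (frag_of (x, a \<odot>\<^bsub>M\<^esub> m))" by (rule cls_add[OF ec f])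
  also have "\<dots> = pt x (a \<odot>\<^bsub>M\<^esub> m)"
    using cls_gen[OF e] pt_closed[of x "a \<odot>\<^bsub>M\<^esub> m"] assms by (simp add: pt_cls M.smult_closed)
  finally show ?thesis .
qed

lemma hom_tensor_eqI:
  assumes "group H" "h \<in> hom T H" "k \<in> hom T H"
    and e: "\<And>x m. x \<in> carrier A \<Longrightarrow> m \<in> carrier M \<Longrightarrow> h (pt x m) = k (pt x m)"
    and c: "c \<in> carrier T"
  shows "h c = k c"
proof -
  interpret H: group H by fact
  interpret h: group_hom T H h using assms(2) by unfold_locales
  interpret k: group_hom T H k using assms(3) by unfold_locales
  interpret F: group FG by simp
  interpret cl: group_hom FG T cls using cls_hom by unfold_locales
  obtain z where "z \<in> carrier FG" and zc: "c = cls z" using c cls_surj by blast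
  then have z: "Poly_Mapping.keys z \<subseteq> carrier A \<times> carrier M" by simp
  have "h (cls z) = k (cls z)" using z
  proof (rule free_Abelian_group_induct)
    show "h (cls 0) = k (cls 0)" using cl.hom_one by simp
  next
    fix x y assume xy: "Poly_Mapping.keys x \<subseteq> carrier A \<times> carrier M" "Poly_Mapping.keys y \<subseteq> carrier A \<times> carrier M"
      "h (cls x) = k (cls x)" "h (cls y) = k (cls y)"
    have "cls (x - y) = cls x \<otimes>\<^bsub>T\<^esub> inv\<^bsub>T\<^esub> cls y"
      using cl.hom_mult[of x "-y"] cl.hom_inv[of y] xy(1,2) by simp
    moreover have "cls x \<in> carrier T" "cls y \<in> carrier T" using xy(1,2) by simp_all
    ultimately show "h (cls (x - y)) = k (cls (x - y))" using xy(3,4) by simp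
  next
    fix p assume "p \<in> carrier A \<times> carrier M"
    then show "h (cls (frag_of p)) = k (cls (frag_of p))" using e by (auto simp: pt_cls)
  qed
  then show ?thesis using zc by simp
qed

lemma tensor_universal:
  assumes H: "comm_group H" and c: "\<And>x m. x \<in> carrier A \<Longrightarrow> m \<in> carrier M \<Longrightarrow> \<beta> x m \<in> carrier H"
    and l: "\<And>x y m. x \<in> carrier A \<Longrightarrow> y \<in> carrier A \<Longrightarrow> m \<in> carrier M \<Longrightarrow> \<beta> (x \<oplus>\<^bsub>A\<^esub> y) m = \<beta> x m \<otimes>\<^bsub>H\<^esub> \<beta> y m"
    and r: "\<And>x m n. x \<in> carrier A \<Longrightarrow> m \<in> carrier M \<Longrightarrow> n \<in> carrier M \<Longrightarrow> \<beta> x (m \<oplus>\<^bsub>M\<^esub> n) = \<beta> x m \<otimes>\<^bsub>H\<^esub> \<beta> x n"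
    and b: "\<And>a x m. a \<in> carrier R \<Longrightarrow> x \<in> carrier A \<Longrightarrow> m \<in> carrier M \<Longrightarrow> \<beta> (a \<odot>\<^bsub>A\<^esub> x) m = \<beta> x (a \<odot>\<^bsub>M\<^esub> m)"
  obtains h where "h \<in> hom T H" "\<And>x m. x \<in> carrier A \<Longrightarrow> m \<in> carrier M \<Longrightarrow> h (pt x m) = \<beta> x m"
proof -
  interpret H: comm_group H by fact
  interpret F: comm_group FG by (rule comm_group_FG)
  obtain g where g: "g \<in> hom FG H" "\<And>p. p \<in> carrier A \<times> carrier M \<Longrightarrow> g (frag_of p) = (\<lambda>(x, m). \<beta> x m) p"
    using H.free_Abelian_group_universal[of "\<lambda>(x, m). \<beta> x m" "carrier A \<times> carrier M"] c by (auto simp: image_subset_iff)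
  interpret g: group_hom FG H g using g(1) by unfold_locales
  have d: "g (p - q) = g p \<otimes>\<^bsub>H\<^esub> inv\<^bsub>H\<^esub> g q" "p - q \<in> carrier FG" if "p \<in> carrier FG" "q \<in> carrier FG" for p q
  proof -
    show "g (p - q) = g p \<otimes>\<^bsub>H\<^esub> inv\<^bsub>H\<^esub> g q" using g.hom_mult[of p "-q"] g.hom_inv[of q] that by simp
    show "p - q \<in> carrier FG" using that keys_diff[of p q] by auto
  qed
  have gf: "g (frag_of (x, m)) = \<beta> x m" "frag_of (x, m) \<in> carrier FG" if "x \<in> carrier A" "m \<in> carrier M" for x m
    using g(2)[of "(x, m)"] that by auto
  have "tensor_gens \<subseteq> kernel FG H g"
  proof
    fix e assume e: "e \<in> tensor_gens"
    then have ec: "e \<in> carrier FG" using tensor_gens_carrier by blast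
    have inv3: "(p \<otimes>\<^bsub>H\<^esub> q) \<otimes>\<^bsub>H\<^esub> inv\<^bsub>H\<^esub> p \<otimes>\<^bsub>H\<^esub> inv\<^bsub>H\<^esub> q = \<one>\<^bsub>H\<^esub>" if "p \<in> carrier H" "q \<in> carrier H" for p q
      using that by (metis H.inv_closed H.inv_solve_right' H.m_assoc H.m_closed H.m_comm H.r_inv)
    from e have "g e = \<one>\<^bsub>H\<^esub>" unfolding tensor_gens_def
    proof (elim UnE CollectE exE conjE)
      fix x y m assume 1: "x \<in> carrier A" "y \<in> carrier A" "m \<in> carrier M" "e = frag_of (x \<oplus>\<^bsub>A\<^esub> y, m) - frag_of (x, m) - frag_of (y, m)"
      then show ?thesis
        using d[OF d(2)[OF gf(2) gf(2)] gf(2), of "x \<oplus>\<^bsub>A\<^esub> y" m x m y m] d(1)[OF gf(2) gf(2), of "x \<oplus>\<^bsub>A\<^esub> y" m x m]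
          gf(1) l inv3[of "\<beta> x m" "\<beta> y m"] c by simp
    next
      fix x m n assume 2: "x \<in> carrier A" "m \<in> carrier M" "n \<in> carrier M" "e = frag_of (x, m \<oplus>\<^bsub>M\<^esub> n) - frag_of (x, m) - frag_of (x, n)"
      then show ?thesis
        using d[OF d(2)[OF gf(2) gf(2)] gf(2), of x "m \<oplus>\<^bsub>M\<^esub> n" x m x n] d(1)[OF gf(2) gf(2), of x "m \<oplus>\<^bsub>M\<^esub> n" x m]
          gf(1) r inv3[of "\<beta> x m" "\<beta> x n"] c by simp
    next
      fix a x m assume 3: "a \<in> carrier R" "x \<in> carrier A" "m \<in> carrier M" "e = frag_of (a \<odot>\<^bsub>A\<^esub> x, m) - frag_of (x, a \<odot>\<^bsub>M\<^esub> m)"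
      have "a \<odot>\<^bsub>A\<^esub> x \<in> carrier A" "a \<odot>\<^bsub>M\<^esub> m \<in> carrier M"
        using 3 A.smult_closed[of a x] M.smult_closed by auto
      then show ?thesis using 3 d(1)[OF gf(2) gf(2), of "a \<odot>\<^bsub>A\<^esub> x" m x "a \<odot>\<^bsub>M\<^esub> m"] gf(1) b c by simp
    qed
    then show "e \<in> kernel FG H g" using ec by (simp add: kernel_def)
  qed
  then have "TR \<subseteq> kernel FG H g"
    unfolding tensor_rel_eq by (rule F.generate_subgroup_incl) (rule g.subgroup_kernel)
  then have k: "g z = \<one>\<^bsub>H\<^esub>" if "z \<in> carrier FG" "cls z = \<one>\<^bsub>T\<^esub>" for z
    using that cls_one_iff[OF that(1)] by (auto simp: kernel_def)
  obtain h where h: "h \<in> hom T H \<inter> extensional (carrier T)" "\<And>x. x \<in> carrier FG \<Longrightarrow> h (cls x) = g x"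
    using hom_factor[OF F.is_group TG.is_group H.is_group cls_hom cls_surj g(1) k] by blast
  show thesis
  proof (rule that[of h])
    show "h \<in> hom T H" using h by simp
    show "h (pt x m) = \<beta> x m" if "x \<in> carrier A" "m \<in> carrier M" for x m
      unfolding pt_cls using h(2)[OF gf(2)[OF that]] gf(1)[OF that] by simp
  qed
qed

end

lemma tensor_map_props:
  assumes AM: "tensor_product R A M" and BN: "tensor_product R B N"
    and f: "restrict f (carrier A) \<in> lin_hom (opp R) A B" and g: "restrict g (carrier M) \<in> lin_hom R M N"
  shows tensor_map_hom: "tensor_map R A M B N f g \<in> hom (tensor R A M) (tensor R B N)"
    and tensor_map_pure: "x \<in> carrier A \<Longrightarrow> m \<in> carrier M \<Longrightarrow>
      tensor_map R A M B N f g (pure_tensor R A M x m) = pure_tensor R B N (f x) (g m)"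
    and tensor_map_extensional: "tensor_map R A M B N f g \<in> extensional (carrier (tensor R A M))"
proof -
  interpret X: tensor_product R A M by fact
  interpret Y: tensor_product R B N by fact
  define \<phi> where "\<phi> = frag_extend (\<lambda>(x, m). frag_of (f x, g m))"
  have fl: "f x \<in> carrier B" if "x \<in> carrier A" for x using lin_hom_closed[OF f that] that by simp
  have gl: "g x \<in> carrier N" if "x \<in> carrier M" for x using lin_hom_closed[OF g that] that by simp
  have \<phi>o: "\<phi> (frag_of (x, m)) = frag_of (f x, g m)" for x m by (simp add: \<phi>_def)
  have \<phi>c: "\<phi> z \<in> carrier Y.FG" if "z \<in> carrier X.FG" for z
  proof -
    have "Poly_Mapping.keys z \<subseteq> carrier A \<times> carrier M" using that by simp
    then have "Poly_Mapping.keys (\<phi> z) \<subseteq> carrier B \<times> carrier N"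
    proof (rule free_Abelian_group_induct)
      show "Poly_Mapping.keys (\<phi> 0) \<subseteq> carrier B \<times> carrier N" by (simp add: \<phi>_def)
      fix x y assume "Poly_Mapping.keys (\<phi> x) \<subseteq> carrier B \<times> carrier N" "Poly_Mapping.keys (\<phi> y) \<subseteq> carrier B \<times> carrier N"
      then show "Poly_Mapping.keys (\<phi> (x - y)) \<subseteq> carrier B \<times> carrier N"
        using keys_diff[of "\<phi> x" "\<phi> y"] by (auto simp: \<phi>_def frag_extend_diff)
    next
      fix p assume "p \<in> carrier A \<times> carrier M"
      then show "Poly_Mapping.keys (\<phi> (frag_of p)) \<subseteq> carrier B \<times> carrier N"
        using fl gl by (auto simp: \<phi>_def)
    qed
    then show ?thesis by simp
  qed
  have \<phi>h: "(\<lambda>z. Y.cls (\<phi> z)) \<in> hom X.FG Y.T"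
  proof (rule homI)
    fix z w assume zw: "z \<in> carrier X.FG" "w \<in> carrier X.FG"
    show "Y.cls (\<phi> (z \<otimes>\<^bsub>X.FG\<^esub> w)) = Y.cls (\<phi> z) \<otimes>\<^bsub>Y.T\<^esub> Y.cls (\<phi> w)"
      using Y.cls_add[OF \<phi>c[OF zw(1)] \<phi>c[OF zw(2)]] by (simp add: \<phi>_def frag_extend_add)
  qed (auto intro!: hom_in_carrier[OF Y.cls_hom] \<phi>c)
  have "\<exists>h. h \<in> hom X.T Y.T \<and> (\<forall>x\<in>carrier A. \<forall>m\<in>carrier M. h (X.pt x m) = Y.pt (f x) (g m))"
  proof -
    obtain h where "h \<in> hom X.T Y.T" "\<And>x m. x \<in> carrier A \<Longrightarrow> m \<in> carrier M \<Longrightarrow> h (X.pt x m) = Y.pt (f x) (g m)"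
    proof (rule X.tensor_universal[OF Y.comm_group_tensor, of "\<lambda>x m. Y.pt (f x) (g m)"])
      show "Y.pt (f x) (g m) \<in> carrier Y.T" if "x \<in> carrier A" "m \<in> carrier M" for x m
        using that fl gl by (intro Y.pt_closed) auto
      show "Y.pt (f (x \<oplus>\<^bsub>A\<^esub> y)) (g m) = Y.pt (f x) (g m) \<otimes>\<^bsub>Y.T\<^esub> Y.pt (f y) (g m)"
        if "x \<in> carrier A" "y \<in> carrier A" "m \<in> carrier M" for x y m
        using lin_hom_add[OF f that(1,2)] that Y.pt_add_left fl gl by simp
      show "Y.pt (f x) (g (m \<oplus>\<^bsub>M\<^esub> n)) = Y.pt (f x) (g m) \<otimes>\<^bsub>Y.T\<^esub> Y.pt (f x) (g n)"
        if "x \<in> carrier A" "m \<in> carrier M" "n \<in> carrier M" for x m n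
        using lin_hom_add[OF g that(2,3)] that Y.pt_add_right fl gl by simp
      show "Y.pt (f (a \<odot>\<^bsub>A\<^esub> x)) (g m) = Y.pt (f x) (g (a \<odot>\<^bsub>M\<^esub> m))"
        if "a \<in> carrier R" "x \<in> carrier A" "m \<in> carrier M" for a x m
        using lin_hom_smult[OF f, of a x] lin_hom_smult[OF g that(1,3)] that X.A.smult_closed[of a x] X.M.smult_closed[of a m]
          Y.pt_balanced[of a "f x" "g m"] fl gl by simp
    qed auto
    then show ?thesis by blast
  qed
  then obtain h where h: "h \<in> hom X.T Y.T" "\<And>x m. x \<in> carrier A \<Longrightarrow> m \<in> carrier M \<Longrightarrow> h (X.pt x m) = Y.pt (f x) (g m)"
    by blast
  have hcls: "h (X.cls z) = Y.cls (\<phi> z)" if z: "z \<in> carrier X.FG" for z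
  proof -
    interpret h: group_hom X.T Y.T h using h(1) by unfold_locales
    interpret FX: group X.FG by simp
    interpret c: group_hom X.FG X.T X.cls using X.cls_hom by unfold_locales
    interpret p: group_hom X.FG Y.T "\<lambda>z. Y.cls (\<phi> z)" using \<phi>h by unfold_locales
    have "Poly_Mapping.keys z \<subseteq> carrier A \<times> carrier M" using z by simp
    then show ?thesis
    proof (rule free_Abelian_group_induct)
      show "h (X.cls 0) = Y.cls (\<phi> 0)" using c.hom_one p.hom_one by simp
      fix x y assume xy: "Poly_Mapping.keys x \<subseteq> carrier A \<times> carrier M" "Poly_Mapping.keys y \<subseteq> carrier A \<times> carrier M"
        "h (X.cls x) = Y.cls (\<phi> x)" "h (X.cls y) = Y.cls (\<phi> y)"
      have "X.cls (x - y) = X.cls x \<otimes>\<^bsub>X.T\<^esub> inv\<^bsub>X.T\<^esub> X.cls y"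
        using c.hom_mult[of x "-y"] c.hom_inv[of y] xy(1,2) by simp
      moreover have "X.cls x \<in> carrier X.T" "X.cls y \<in> carrier X.T" using xy(1,2) by simp_all
      moreover have "Y.cls (\<phi> (x - y)) = Y.cls (\<phi> x) \<otimes>\<^bsub>Y.T\<^esub> inv\<^bsub>Y.T\<^esub> Y.cls (\<phi> y)"
        using p.hom_mult[of x "-y"] p.hom_inv[of y] xy(1,2) by simp
      ultimately show "h (X.cls (x - y)) = Y.cls (\<phi> (x - y))" using xy(3,4) by simp
    next
      fix p assume "p \<in> carrier A \<times> carrier M"
      then show "h (X.cls (frag_of p)) = Y.cls (\<phi> (frag_of p))" using h(2) by (auto simp: \<phi>o X.pt_cls Y.pt_cls)
    qed
  qed
  have TRi: "\<phi> z \<in> Y.TR" if "z \<in> X.TR" for z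
  proof -
    have zc: "z \<in> carrier X.FG" using that subgroup.subset[OF X.subgroup_TR] by blast
    interpret h: group_hom X.T Y.T h using h(1) by unfold_locales
    have "Y.cls (\<phi> z) = \<one>\<^bsub>Y.T\<^esub>" using hcls[OF zc] X.cls_one_iff[OF zc] that h.hom_one by simp
    then show ?thesis using Y.cls_one_iff[OF \<phi>c[OF zc]] by simp
  qed
  have tc: "tensor_map R A M B N f g (X.cls z) = Y.cls (\<phi> z)" if z: "z \<in> carrier X.FG" for z
  proof -
    have cz: "X.cls z \<in> carrier X.T" using X.cls_surj z by blast
    have "Y.TR <#>\<^bsub>Y.FG\<^esub> \<phi> ` X.cls z = Y.cls (\<phi> z)"
    proof (intro equalityI subsetI)
      fix v assume "v \<in> Y.TR <#>\<^bsub>Y.FG\<^esub> \<phi> ` X.cls z"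
      then obtain s t where st: "s \<in> Y.TR" "t \<in> X.TR" "v = s + \<phi> (t + z)"
        by (auto simp: set_mult_def X.cls_def r_coset_def)
      have "s + \<phi> t \<in> Y.TR" using subgroup.m_closed[OF Y.subgroup_TR st(1) TRi[OF st(2)]] by simp
      moreover have "v = (s + \<phi> t) + \<phi> z" using st(3) by (simp add: \<phi>_def frag_extend_add add.assoc)
      ultimately show "v \<in> Y.cls (\<phi> z)" by (auto simp: Y.cls_def r_coset_def)
    next
      fix v assume "v \<in> Y.cls (\<phi> z)"
      then obtain s where s: "s \<in> Y.TR" "v = s + \<phi> z" by (auto simp: Y.cls_def r_coset_def)
      have "0 \<in> X.TR" using subgroup.one_closed[OF X.subgroup_TR] by simp
      then have "z \<in> X.cls z" by (auto simp: X.cls_def r_coset_def intro: bexI[of _ 0])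
      then show "v \<in> Y.TR <#>\<^bsub>Y.FG\<^esub> \<phi> ` X.cls z" using s by (auto simp: set_mult_def)
    qed
    then show ?thesis using cz by (simp add: tensor_map_def \<phi>_def)
  qed
  have th: "tensor_map R A M B N f g c = h c" if "c \<in> carrier X.T" for c
  proof -
    obtain z where "z \<in> carrier X.FG" "c = X.cls z" using \<open>c \<in> carrier X.T\<close> X.cls_surj by blast
    then show ?thesis using tc hcls by simp
  qed
  show "tensor_map R A M B N f g \<in> hom (tensor R A M) (tensor R B N)"
    using hom_in_carrier[OF h(1)] hom_mult[OF h(1)] th by (intro homI) auto
  show "x \<in> carrier A \<Longrightarrow> m \<in> carrier M \<Longrightarrow>
      tensor_map R A M B N f g (pure_tensor R A M x m) = pure_tensor R B N (f x) (g m)"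
    using th[OF X.pt_closed] h(2) by simp
  show "tensor_map R A M B N f g \<in> extensional (carrier (tensor R A M))" by (simp add: tensor_map_def)
qed

lemma lin_hom_restrict: "f \<in> lin_hom R M N \<Longrightarrow> restrict f (carrier M) \<in> lin_hom R M N"
  using PiE_restrict[OF lin_hom_PiE, of f R M N] by simp

lemma restrict_id_lin_hom: "left_module R M \<Longrightarrow> restrict (\<lambda>x. x) (carrier M) \<in> lin_hom R M M"
  by (rule lin_hom_id)

section \<open>Extension of scalars\<close>

locale scalar_extension =
  fixes R :: "('r, 'e) ring_scheme" and S :: "('s, 'f) ring_scheme" and \<sigma> :: "'r \<Rightarrow> 's"
    and M :: "('r, 'm) module"
  assumes rR: "ring R" and rS: "ring S" and \<sigma>: "\<sigma> \<in> ring_hom R S" and lM: "left_module R M"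
begin

sublocale S: ring S by (rule rS)

lemma ring_hom_opp: "\<sigma> \<in> ring_hom (opp R) (opp S)"
  using \<sigma> by (auto simp: ring_hom_def)

lemma left_module_right_via: "left_module (opp R) (right_via S \<sigma>)"
  by (rule left_module_restrict_scalars[OF ring_opp[OF rR] ring_hom_opp left_module_regular[OF ring_opp[OF rS]]])

sublocale T: tensor_product R "right_via S \<sigma>" M
  by (rule tensor_product.intro[OF left_module_right_via lM])

abbreviation "SM \<equiv> extend_scalars R S \<sigma> M"

lemma SM_simps [simp]:
  "carrier SM = carrier T.T" "\<zero>\<^bsub>SM\<^esub> = \<one>\<^bsub>T.T\<^esub>" "ring.add SM = monoid.mult T.T"
  by (simp_all add: extend_scalars_def Let_def)

lemma left_mult_lin_hom:
  "s \<in> carrier S \<Longrightarrow> restrict (\<lambda>t. s \<otimes>\<^bsub>S\<^esub> t) (carrier (right_via S \<sigma>)) \<in> lin_hom (opp R) (right_via S \<sigma>) (right_via S \<sigma>)"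
  by (rule lin_homI) (auto simp: S.r_distr S.m_assoc ring_hom_closed[OF \<sigma>])

lemma
  assumes "s \<in> carrier S"
  shows SM_smult_hom: "(\<lambda>c. s \<odot>\<^bsub>SM\<^esub> c) \<in> hom T.T T.T"
    and SM_smult_pure: "t \<in> carrier S \<Longrightarrow> m \<in> carrier M \<Longrightarrow> s \<odot>\<^bsub>SM\<^esub> T.pt t m = T.pt (s \<otimes>\<^bsub>S\<^esub> t) m"
proof -
  note tm = tensor_map_props[OF T.tensor_product_axioms T.tensor_product_axioms left_mult_lin_hom[OF assms] restrict_id_lin_hom[OF lM]]
  have e: "s \<odot>\<^bsub>SM\<^esub> c = tensor_map R (right_via S \<sigma>) M (right_via S \<sigma>) M (\<lambda>t. s \<otimes>\<^bsub>S\<^esub> t) (\<lambda>m. m) c" for c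
    by (simp add: extend_scalars_def Let_def)
  show "(\<lambda>c. s \<odot>\<^bsub>SM\<^esub> c) \<in> hom T.T T.T" unfolding e using tm(1) .
  show "t \<in> carrier S \<Longrightarrow> m \<in> carrier M \<Longrightarrow> s \<odot>\<^bsub>SM\<^esub> T.pt t m = T.pt (s \<otimes>\<^bsub>S\<^esub> t) m"
    unfolding e using tm(2)[of t m] by simp
qed

lemma left_module_SM: "left_module S SM"
proof (intro left_module.intro left_module_axioms.intro rS)
  show "abelian_group SM"
    by (rule abelian_groupI) (auto simp: T.TG.m_ac intro: bexI[of _ "inv\<^bsub>T.T\<^esub> _"])
next
  fix a b x assume ab: "a \<in> carrier S" "b \<in> carrier S" and x: "x \<in> carrier SM"
  note ha = SM_smult_hom[OF ab(1)] and hb = SM_smult_hom[OF ab(2)]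
  have c: "a \<oplus>\<^bsub>S\<^esub> b \<in> carrier S" "a \<otimes>\<^bsub>S\<^esub> b \<in> carrier S" using ab by auto
  have "(\<lambda>x. (a \<odot>\<^bsub>SM\<^esub> x) \<otimes>\<^bsub>T.T\<^esub> (b \<odot>\<^bsub>SM\<^esub> x)) \<in> hom T.T T.T"
    using hom_in_carrier[OF ha] hom_in_carrier[OF hb] hom_mult[OF ha] hom_mult[OF hb]
    by (intro homI) (auto simp: T.TG.m_ac)
  then have "(a \<oplus>\<^bsub>S\<^esub> b) \<odot>\<^bsub>SM\<^esub> x = (a \<odot>\<^bsub>SM\<^esub> x) \<otimes>\<^bsub>T.T\<^esub> (b \<odot>\<^bsub>SM\<^esub> x)"
    by (rule T.hom_tensor_eqI[OF T.TG.is_group SM_smult_hom[OF c(1)]])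
      (use ab x c T.pt_add_left in \<open>auto simp: SM_smult_pure S.l_distr\<close>)
  then show "(a \<oplus>\<^bsub>S\<^esub> b) \<odot>\<^bsub>SM\<^esub> x = a \<odot>\<^bsub>SM\<^esub> x \<oplus>\<^bsub>SM\<^esub> b \<odot>\<^bsub>SM\<^esub> x" by simp
  have "(\<lambda>x. a \<odot>\<^bsub>SM\<^esub> (b \<odot>\<^bsub>SM\<^esub> x)) \<in> hom T.T T.T"
    using hom_in_carrier[OF ha] hom_in_carrier[OF hb] hom_mult[OF ha] hom_mult[OF hb]
    by (intro homI) auto
  then show "(a \<otimes>\<^bsub>S\<^esub> b) \<odot>\<^bsub>SM\<^esub> x = a \<odot>\<^bsub>SM\<^esub> (b \<odot>\<^bsub>SM\<^esub> x)"
    by (rule T.hom_tensor_eqI[OF T.TG.is_group SM_smult_hom[OF c(2)]])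
      (use ab x c in \<open>auto simp: SM_smult_pure S.m_assoc\<close>)
next
  fix x assume x: "x \<in> carrier SM"
  have "(\<lambda>x. x) \<in> hom T.T T.T" by (rule homI) auto
  then show "\<one>\<^bsub>S\<^esub> \<odot>\<^bsub>SM\<^esub> x = x"
    by (rule T.hom_tensor_eqI[OF T.TG.is_group SM_smult_hom[OF S.one_closed]])
      (use x in \<open>auto simp: SM_smult_pure\<close>)
next
  fix a x y assume "a \<in> carrier S" "x \<in> carrier SM" "y \<in> carrier SM"
  then show "a \<odot>\<^bsub>SM\<^esub> x \<in> carrier SM" "a \<odot>\<^bsub>SM\<^esub> (x \<oplus>\<^bsub>SM\<^esub> y) = a \<odot>\<^bsub>SM\<^esub> x \<oplus>\<^bsub>SM\<^esub> a \<odot>\<^bsub>SM\<^esub> y"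
    using hom_in_carrier[OF SM_smult_hom] hom_mult[OF SM_smult_hom] by auto
qed

definition "unit_map h = (\<lambda>m\<in>carrier M. h (T.pt \<one>\<^bsub>S\<^esub> m))"

lemma unit_map_lin_hom:
  assumes h: "h \<in> lin_hom S SM X" and X: "left_module S X"
  shows "unit_map h \<in> lin_hom R M (restrict_scalars \<sigma> X)"
    and "s \<in> carrier S \<Longrightarrow> m \<in> carrier M \<Longrightarrow> h (T.pt s m) = s \<odot>\<^bsub>X\<^esub> unit_map h m"
proof -
  interpret X: left_module S X by fact
  have p: "T.pt s m \<in> carrier SM" if "s \<in> carrier S" "m \<in> carrier M" for s m
    using T.pt_closed that by simp
  show *: "h (T.pt s m) = s \<odot>\<^bsub>X\<^esub> unit_map h m" if "s \<in> carrier S" "m \<in> carrier M" for s m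
    using lin_hom_smult[OF h that(1) p[OF S.one_closed that(2)]] SM_smult_pure[OF that(1) S.one_closed that(2)] that
    by (simp add: unit_map_def)
  show "unit_map h \<in> lin_hom R M (restrict_scalars \<sigma> X)"
  proof (rule lin_homI)
    show "unit_map h \<in> carrier M \<rightarrow>\<^sub>E carrier (restrict_scalars \<sigma> X)"
      using lin_hom_closed[OF h p[OF S.one_closed]] by (auto simp: unit_map_def)
    show "unit_map h (x \<oplus>\<^bsub>M\<^esub> y) = unit_map h x \<oplus>\<^bsub>restrict_scalars \<sigma> X\<^esub> unit_map h y"
      if "x \<in> carrier M" "y \<in> carrier M" for x y
      using that T.pt_add_right[of "\<one>\<^bsub>S\<^esub>" x y] lin_hom_add[OF h p[OF S.one_closed that(1)] p[OF S.one_closed that(2)]]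
      by (simp add: unit_map_def)
    show "unit_map h (a \<odot>\<^bsub>M\<^esub> x) = a \<odot>\<^bsub>restrict_scalars \<sigma> X\<^esub> unit_map h x"
      if "a \<in> carrier R" "x \<in> carrier M" for a x
    proof -
      have a: "\<sigma> a \<in> carrier S" using ring_hom_closed[OF \<sigma> that(1)] .
      have "T.pt \<one>\<^bsub>S\<^esub> (a \<odot>\<^bsub>M\<^esub> x) = T.pt (\<sigma> a) x"
        using T.pt_balanced[of a "\<one>\<^bsub>S\<^esub>" x] that a by simp
      then show ?thesis using *[OF a that(2)] that T.M.smult_closed[OF that] by (simp add: unit_map_def)
    qed
  qed
qed

lemma ex_extension_hom:
  assumes X: "left_module S X" and k: "k \<in> lin_hom R M (restrict_scalars \<sigma> X)"
  obtains h where "h \<in> lin_hom S SM X" "unit_map h = k"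
proof -
  interpret X: left_module S X by fact
  have kc: "k m \<in> carrier X" if "m \<in> carrier M" for m using lin_hom_closed[OF k that] by simp
  obtain h where h: "h \<in> hom T.T (add_monoid X)"
    "\<And>x m. x \<in> carrier (right_via S \<sigma>) \<Longrightarrow> m \<in> carrier M \<Longrightarrow> h (T.pt x m) = x \<odot>\<^bsub>X\<^esub> k m"
  proof (rule T.tensor_universal[OF X.a_comm_group, of "\<lambda>x m. x \<odot>\<^bsub>X\<^esub> k m"])
    show "x \<odot>\<^bsub>X\<^esub> k m \<in> carrier (add_monoid X)" if "x \<in> carrier (right_via S \<sigma>)" "m \<in> carrier M" for x m
      using that kc by (simp add: X.smult_closed)
    show "(x \<oplus>\<^bsub>right_via S \<sigma>\<^esub> y) \<odot>\<^bsub>X\<^esub> k m = (x \<odot>\<^bsub>X\<^esub> k m) \<otimes>\<^bsub>add_monoid X\<^esub> (y \<odot>\<^bsub>X\<^esub> k m)"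
      if "x \<in> carrier (right_via S \<sigma>)" "y \<in> carrier (right_via S \<sigma>)" "m \<in> carrier M" for x y m
      using that kc by (simp add: X.smult_l_distr)
    show "x \<odot>\<^bsub>X\<^esub> k (m \<oplus>\<^bsub>M\<^esub> n) = (x \<odot>\<^bsub>X\<^esub> k m) \<otimes>\<^bsub>add_monoid X\<^esub> (x \<odot>\<^bsub>X\<^esub> k n)"
      if "x \<in> carrier (right_via S \<sigma>)" "m \<in> carrier M" "n \<in> carrier M" for x m n
      using that kc lin_hom_add[OF k] by (simp add: X.smult_r_distr)
    show "(a \<odot>\<^bsub>right_via S \<sigma>\<^esub> x) \<odot>\<^bsub>X\<^esub> k m = x \<odot>\<^bsub>X\<^esub> k (a \<odot>\<^bsub>M\<^esub> m)"
      if "a \<in> carrier R" "x \<in> carrier (right_via S \<sigma>)" "m \<in> carrier M" for a x m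
      using that kc lin_hom_smult[OF k] ring_hom_closed[OF \<sigma>] by (simp add: X.smult_assoc)
  qed auto
  define h' where "h' = restrict h (carrier T.T)"
  have h'p: "h' (T.pt x m) = x \<odot>\<^bsub>X\<^esub> k m" if "x \<in> carrier S" "m \<in> carrier M" for x m
    using h(2)[of x m] T.pt_closed[of x m] that by (simp add: h'_def)
  have "h' \<in> lin_hom S SM X"
  proof (rule lin_homI)
    show "h' \<in> carrier SM \<rightarrow>\<^sub>E carrier X" using hom_in_carrier[OF h(1)] by (auto simp: h'_def)
    show "h' (x \<oplus>\<^bsub>SM\<^esub> y) = h' x \<oplus>\<^bsub>X\<^esub> h' y" if "x \<in> carrier SM" "y \<in> carrier SM" for x y
      using that hom_mult[OF h(1), of x y] by (simp add: h'_def)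
    show "h' (a \<odot>\<^bsub>SM\<^esub> c) = a \<odot>\<^bsub>X\<^esub> h' c" if a: "a \<in> carrier S" and c: "c \<in> carrier SM" for a c
    proof -
      note ha = SM_smult_hom[OF a]
      have 1: "(\<lambda>c. h (a \<odot>\<^bsub>SM\<^esub> c)) \<in> hom T.T (add_monoid X)"
        using hom_in_carrier[OF ha] hom_mult[OF ha] hom_in_carrier[OF h(1)] hom_mult[OF h(1)] by (intro homI) auto
      have 2: "(\<lambda>c. a \<odot>\<^bsub>X\<^esub> h c) \<in> hom T.T (add_monoid X)"
        using hom_in_carrier[OF h(1)] hom_mult[OF h(1)] a by (intro homI) (auto simp: X.smult_closed X.smult_r_distr)
      have "h (a \<odot>\<^bsub>SM\<^esub> c) = a \<odot>\<^bsub>X\<^esub> h c"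
        by (rule T.hom_tensor_eqI[OF X.a_group 1 2])
          (use a c h(2) kc SM_smult_pure[OF a] in \<open>auto simp: X.smult_assoc\<close>)
      then show ?thesis using c hom_in_carrier[OF ha, of c] by (simp add: h'_def)
    qed
  qed
  moreover have "unit_map h' = k"
  proof (rule extensionalityI[of _ "carrier M"])
    show "k \<in> extensional (carrier M)" using lin_hom_PiE[OF k] by (auto simp: PiE_def)
    show "unit_map h' m = k m" if "m \<in> carrier M" for m
      using that h'p[OF S.one_closed that] kc by (simp add: unit_map_def X.smult_one)
  qed (simp add: unit_map_def)
  ultimately show thesis by (rule that)
qed

lemma unit_map_inj:
  assumes "left_module S X" "h \<in> lin_hom S SM X" "k \<in> lin_hom S SM X" "unit_map h = unit_map k"
  shows "h = k"
proof (rule extensionalityI[of _ "carrier SM"])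
  interpret X: left_module S X by fact
  show "h \<in> extensional (carrier SM)" "k \<in> extensional (carrier SM)"
    using assms(2,3)[THEN lin_hom_PiE] by (auto simp: PiE_def)
  fix c assume c: "c \<in> carrier SM"
  have hm: "f \<in> hom T.T (add_monoid X)" if "f \<in> lin_hom S SM X" for f
    using lin_hom_closed[OF that] lin_hom_add[OF that] by (intro homI) auto
  show "h c = k c"
    by (rule T.hom_tensor_eqI[OF X.a_group hm[OF assms(2)] hm[OF assms(3)]])
      (use c unit_map_lin_hom(2)[OF assms(2,1)] unit_map_lin_hom(2)[OF assms(3,1)] assms(4) in auto)
qed

lemma sols_restrict_scalars:
  "sols (restrict_scalars \<sigma> X) m n a = sols X m n (\<lambda>i j. \<sigma> (a i j))"
  by (simp add: sols_def tuples_def lincomb_def finsum_def finprod_def)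

lemma represents_extend_scalars:
  assumes X: "left_module S X" and u: "u \<in> {..<n} \<rightarrow> carrier M"
    and r: "represents R m n a M u (restrict_scalars \<sigma> X)"
  shows "represents S m n (\<lambda>i j. \<sigma> (a i j)) SM (\<lambda>i. T.pt \<one>\<^bsub>S\<^esub> (u i)) X"
proof -
  have t: "tmap n h (\<lambda>i. T.pt \<one>\<^bsub>S\<^esub> (u i)) = tmap n (unit_map h) u" for h
    using u by (auto simp: tmap_def unit_map_def fun_eq_iff)
  have "bij_betw unit_map (lin_hom S SM X) (lin_hom R M (restrict_scalars \<sigma> X))"
  proof (rule bij_betw_imageI)
    show "inj_on unit_map (lin_hom S SM X)" using unit_map_inj[OF X] by (auto intro: inj_onI)
    show "unit_map ` lin_hom S SM X = lin_hom R M (restrict_scalars \<sigma> X)"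
    proof (intro equalityI subsetI)
      fix k assume "k \<in> lin_hom R M (restrict_scalars \<sigma> X)"
      then obtain h where "h \<in> lin_hom S SM X" "unit_map h = k" by (rule ex_extension_hom[OF X])
      then show "k \<in> unit_map ` lin_hom S SM X" by blast
    qed (use unit_map_lin_hom(1)[OF _ X] in auto)
  qed
  then have "bij_betw ((\<lambda>h. tmap n h u) \<circ> unit_map) (lin_hom S SM X) (sols (restrict_scalars \<sigma> X) m n a)"
    using r unfolding represents_def by (rule bij_betw_trans)
  then show ?thesis unfolding represents_def sols_restrict_scalars t comp_def .
qed

end

lemma
  assumes sM: "scalar_extension R S \<sigma> M" and sN: "scalar_extension R S \<sigma> N" and \<alpha>: "\<alpha> \<in> lin_hom R M N"
  shows extend_scalars_map_lin_hom:
      "extend_scalars_map R S \<sigma> M N \<alpha> \<in> lin_hom S (extend_scalars R S \<sigma> M) (extend_scalars R S \<sigma> N)"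
    and extend_scalars_map_pure: "s \<in> carrier S \<Longrightarrow> m \<in> carrier M \<Longrightarrow>
      extend_scalars_map R S \<sigma> M N \<alpha> (pure_tensor R (right_via S \<sigma>) M s m) = pure_tensor R (right_via S \<sigma>) N s (\<alpha> m)"
proof -
  interpret M: scalar_extension R S \<sigma> M by fact
  interpret N: scalar_extension R S \<sigma> N by fact
  note tm = tensor_map_props[OF M.T.tensor_product_axioms N.T.tensor_product_axioms
      restrict_id_lin_hom[OF M.left_module_right_via] lin_hom_restrict[OF \<alpha>], folded extend_scalars_map_def]
  let ?f = "extend_scalars_map R S \<sigma> M N \<alpha>"
  show p: "?f (M.T.pt s m) = N.T.pt s (\<alpha> m)" if "s \<in> carrier S" "m \<in> carrier M" for s m
    using tm(2)[of s m] that by simp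
  show "?f \<in> lin_hom S M.SM N.SM"
  proof (rule lin_homI)
    show "?f \<in> carrier M.SM \<rightarrow>\<^sub>E carrier N.SM"
      using hom_in_carrier[OF tm(1)] tm(3) by (auto simp: PiE_def)
    show "?f (x \<oplus>\<^bsub>M.SM\<^esub> y) = ?f x \<oplus>\<^bsub>N.SM\<^esub> ?f y" if "x \<in> carrier M.SM" "y \<in> carrier M.SM" for x y
      using hom_mult[OF tm(1)] that by simp
    fix a x assume a: "a \<in> carrier S" and x: "x \<in> carrier M.SM"
    note ha = M.SM_smult_hom[OF a] and ka = N.SM_smult_hom[OF a]
    have 1: "(\<lambda>x. ?f (a \<odot>\<^bsub>M.SM\<^esub> x)) \<in> hom M.T.T N.T.T"
      using hom_in_carrier[OF ha] hom_mult[OF ha] hom_in_carrier[OF tm(1)] hom_mult[OF tm(1)] by (intro homI) auto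
    have 2: "(\<lambda>x. a \<odot>\<^bsub>N.SM\<^esub> ?f x) \<in> hom M.T.T N.T.T"
      using hom_in_carrier[OF ka] hom_mult[OF ka] hom_in_carrier[OF tm(1)] hom_mult[OF tm(1)] by (intro homI) auto
    show "?f (a \<odot>\<^bsub>M.SM\<^esub> x) = a \<odot>\<^bsub>N.SM\<^esub> ?f x"
      by (rule M.T.hom_tensor_eqI[OF N.T.TG.is_group 1 2])
        (use a x p lin_hom_closed[OF \<alpha>] in \<open>auto simp: M.SM_smult_pure N.SM_smult_pure\<close>)
  qed
qed

lemma lincomb_restrict_scalars:
  "lincomb (restrict_scalars \<sigma> X) n c x = lincomb X n (\<lambda>j. \<sigma> (c j)) x"
  by (simp add: lincomb_def finsum_def finprod_def)

lemma extend_scalars_map_tuple: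
  assumes sM: "scalar_extension R S \<sigma> M" and sN: "scalar_extension R S \<sigma> N" and \<alpha>: "\<alpha> \<in> lin_hom R M N"
    and u: "u \<in> {..<n} \<rightarrow> carrier M" and w: "w \<in> {..<n'} \<rightarrow> carrier N" and L: "L \<in> UNIV \<rightarrow> UNIV \<rightarrow> carrier R"
    and \<alpha>u: "\<And>i. i < n \<Longrightarrow> \<alpha> (u i) = lincomb N n' (L i) w"
    and X: "left_module S X" and k: "k \<in> lin_hom S (extend_scalars R S \<sigma> N) X"
  shows "tmap n (compose (carrier (extend_scalars R S \<sigma> M)) k (extend_scalars_map R S \<sigma> M N \<alpha>))
      (\<lambda>i. pure_tensor R (right_via S \<sigma>) M \<one>\<^bsub>S\<^esub> (u i)) =
    mat_app X n n' (\<lambda>i j. \<sigma> (L i j)) (tmap n' k (\<lambda>i. pure_tensor R (right_via S \<sigma>) N \<one>\<^bsub>S\<^esub> (w i)))"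
proof -
  interpret M: scalar_extension R S \<sigma> M by fact
  interpret N: scalar_extension R S \<sigma> N by fact
  interpret X: left_module S X by fact
  note uh = N.unit_map_lin_hom(1)[OF k X]
  have rs: "left_module R (restrict_scalars \<sigma> X)"
    by (rule left_module_restrict_scalars[OF M.rR M.\<sigma> X])
  have uk: "k (N.T.pt \<one>\<^bsub>S\<^esub> m) = N.unit_map k m" if "m \<in> carrier N" for m
    using that by (simp add: N.unit_map_def)
  have ai: "\<alpha> (u i) \<in> carrier N" if "i < n" for i using lin_hom_closed[OF \<alpha>] u that by auto
  have "N.unit_map k (\<alpha> (u i)) = lincomb X n' (\<lambda>j. \<sigma> (L i j)) (tmap n' k (\<lambda>i. N.T.pt \<one>\<^bsub>S\<^esub> (w i)))" if i: "i < n" for i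
  proof -
    have Li: "L i \<in> UNIV \<rightarrow> carrier R" using L by auto
    have "N.unit_map k (\<alpha> (u i)) = lincomb (restrict_scalars \<sigma> X) n' (L i) (\<lambda>j. N.unit_map k (w j))"
      unfolding \<alpha>u[OF i] by (rule lincomb_lin_hom[OF uh N.lM rs Li w])
    also have "\<dots> = lincomb X n' (\<lambda>j. \<sigma> (L i j)) (\<lambda>j. N.unit_map k (w j))" by (rule lincomb_restrict_scalars)
    also have "\<dots> = lincomb X n' (\<lambda>j. \<sigma> (L i j)) (tmap n' k (\<lambda>i. N.T.pt \<one>\<^bsub>S\<^esub> (w i)))"
      by (rule X.lincomb_cong)
        (use Li w uk ring_hom_closed[OF M.\<sigma>] lin_hom_closed[OF uh] in \<open>auto simp: Pi_iff\<close>)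
    finally show ?thesis .
  qed
  then show ?thesis
    using u ai uk M.T.pt_closed extend_scalars_map_pure[OF sM sN \<alpha>]
    by (auto simp: tmap_def[of n] mat_app_def compose_def fun_eq_iff Pi_iff)
qed

section \<open>Free right modules and flatness\<close>

lemma ex_free_umodule:
  fixes T :: "('a, 'e) ring_scheme"
  assumes "ring T"
  obtains F :: "'a umodule" and \<rho> where "fin_presented T F" "\<rho> \<in> lin_hom T F (free_module T n)"
    "bij_betw \<rho> (carrier F) (tuples (regular_module T) n)"
proof -
  interpret T: ring T by fact
  interpret reg: left_module T "regular_module T" using assms by (rule left_module_regular)
  have lf: "left_module T (free_module T n)" using assms by (rule left_module_free)
  interpret fr: left_module T "free_module T n" by (rule lf)
  obtain F :: "'a umodule" and u where P: "pres_by T 0 n (\<lambda>_ _. \<zero>\<^bsub>T\<^esub>) F u"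
    by (rule ex_pres_by[OF assms, where a="\<lambda>_ _. \<zero>\<^bsub>T\<^esub>" and m=0 and n=n]) auto
  note PD = pres_byD[OF P]
  interpret F: left_module T F by (rule PD)
  let ?e = "\<lambda>i\<in>{..<n}. unit_tuple T n i"
  have e: "?e \<in> sols (free_module T n) 0 n (\<lambda>_ _. \<zero>\<^bsub>T\<^esub>)"
    using unit_tuple_closed[OF assms] by (auto simp: tuples_def[of "free_module T n"])
  obtain \<rho> where \<rho>: "\<rho> \<in> lin_hom T F (free_module T n)" "\<And>i. i < n \<Longrightarrow> \<rho> (u i) = ?e i"
    by (rule pres_by_universal[OF P lf e]) blast
  have \<rho>c: "\<rho> (lincomb F n c u) = restrict c {..<n}" if c: "c \<in> UNIV \<rightarrow> carrier T" for c
  proof -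
    have r: "restrict c {..<n} \<in> tuples (regular_module T) n" using c by (auto simp: tuples_def)
    have "\<rho> (lincomb F n c u) = lincomb (free_module T n) n c (\<lambda>j. \<rho> (u j))"
      by (rule lincomb_lin_hom[OF \<rho>(1) PD(1) lf c PD(3)])
    also have "\<dots> = lincomb (free_module T n) n (extend_zero T n (restrict c {..<n})) (unit_tuple T n)"
      by (rule fr.lincomb_cong) (use c \<rho>(2) unit_tuple_closed[OF assms] in auto)
    also have "\<dots> = restrict c {..<n}" by (rule free_module_expand[OF assms r, symmetric])
    finally show ?thesis .
  qed
  have "bij_betw \<rho> (carrier F) (tuples (regular_module T) n)"
  proof (rule bij_betw_imageI)
    show "inj_on \<rho> (carrier F)"
    proof (rule inj_onI)
      fix x y assume xy: "x \<in> carrier F" "y \<in> carrier F" "\<rho> x = \<rho> y"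
      obtain c d where c: "c \<in> UNIV \<rightarrow> carrier T" "x = lincomb F n c u" and d: "d \<in> UNIV \<rightarrow> carrier T" "y = lincomb F n d u"
        using PD(4) xy by meson
      have "restrict c {..<n} = restrict d {..<n}" using \<rho>c c d xy by simp
      then have "c j = d j" if "j < n" for j using that by (metis lessThan_iff restrict_apply')
      then have "lincomb F n c u = lincomb F n d u" by (intro F.lincomb_cong) (use c PD(3) in auto)
      then show "x = y" using c d by simp
    qed
    show "\<rho> ` carrier F = tuples (regular_module T) n"
    proof (intro equalityI subsetI)
      fix v assume v: "v \<in> tuples (regular_module T) n"
      have ev: "extend_zero T n v \<in> UNIV \<rightarrow> carrier T"
        using tuples_Pi[OF v] by (intro extend_zero_closed[OF assms]) simp
      have "restrict (extend_zero T n v) {..<n} = v"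
        by (rule tuples_eqI[of _ "regular_module T" n _ "regular_module T", OF _ v]) (use ev tuplesD[OF v] in \<open>auto simp: tuples_def Pi_iff\<close>)
      moreover have "lincomb F n (extend_zero T n v) u \<in> carrier F" using ev PD(3) by (rule F.lincomb_closed)
      ultimately show "v \<in> \<rho> ` carrier F" using \<rho>c[OF ev] by (metis imageI)
    qed (use lin_hom_closed[OF \<rho>(1)] in auto)
  qed
  then show thesis using pres_by_fin_presented[OF P] \<rho>(1) by (intro that)
qed

definition scaled_vector :: "('a, 'x) module \<Rightarrow> nat \<Rightarrow> (nat \<Rightarrow> 'a) \<Rightarrow> 'x \<Rightarrow> (nat \<Rightarrow> 'x)"
  where "scaled_vector X n v y = (\<lambda>i\<in>{..<n}. v i \<odot>\<^bsub>X\<^esub> y)"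

lemma scaled_vector_tuples:
  assumes "left_module S X" "v \<in> tuples (regular_module S) n" "y \<in> carrier X"
  shows "scaled_vector X n v y \<in> tuples X n"
proof -
  interpret X: left_module S X by fact
  show ?thesis using assms tuplesD[OF assms(2)] by (auto simp: scaled_vector_def tuples_def intro!: X.smult_closed)
qed

lemma mat_app_scaled_vector:
  assumes "left_module S X" "v \<in> tuples (regular_module S) n" "y \<in> carrier X" "a \<in> UNIV \<rightarrow> UNIV \<rightarrow> carrier S"
  shows "mat_app X m n a (scaled_vector X n v y) = scaled_vector X m (mat_app (regular_module S) m n a v) y"
proof -
  interpret X: left_module S X by fact
  have v: "v \<in> {..<n} \<rightarrow> carrier S" using tuples_Pi[OF assms(2)] by simp
  have "lincomb X n (a i) (scaled_vector X n v y) = lincomb (regular_module S) n (a i) v \<odot>\<^bsub>X\<^esub> y" for i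
  proof -
    have ai: "a i \<in> UNIV \<rightarrow> carrier S" using assms(4) by auto
    have "lincomb X n (a i) (scaled_vector X n v y) = lincomb X n (a i) (\<lambda>j. v j \<odot>\<^bsub>X\<^esub> y)"
      by (rule X.lincomb_cong)
        (use ai tuples_Pi[OF scaled_vector_tuples[OF assms(1-3)]] in \<open>auto simp: scaled_vector_def\<close>)
    then show ?thesis using X.lincomb_smult_vector[OF ai v assms(3)] by simp
  qed
  then show ?thesis by (auto simp: mat_app_def scaled_vector_def fun_eq_iff)
qed

locale free_right_module =
  fixes S :: "('s, 'f) ring_scheme" and n :: nat and F :: "'s umodule" and \<rho> :: "'s univ \<Rightarrow> nat \<Rightarrow> 's"
  assumes rS: "ring S" and fF: "fin_presented (opp S) F"
    and \<rho>: "\<rho> \<in> lin_hom (opp S) F (free_module (opp S) n)"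
    and bij: "bij_betw \<rho> (carrier F) (tuples (regular_module S) n)"
begin

sublocale S: ring S by (rule rS)
sublocale F: left_module "opp S" F by (rule fin_presented_left_module[OF fF])

lemma tuples_opp: "tuples (regular_module (opp S)) k = tuples (regular_module S) k"
  by (simp add: tuples_def)

lemma \<rho>_closed: "f \<in> carrier F \<Longrightarrow> \<rho> f \<in> tuples (regular_module S) n"
  using lin_hom_closed[OF \<rho>] by (simp add: tuples_opp)

lemma \<rho>_add: "f \<in> carrier F \<Longrightarrow> g \<in> carrier F \<Longrightarrow> \<rho> (f \<oplus>\<^bsub>F\<^esub> g) = tadd (regular_module S) n (\<rho> f) (\<rho> g)"
  using lin_hom_add[OF \<rho>] by (simp add: tadd_def)

lemma \<rho>_smult: "s \<in> carrier S \<Longrightarrow> f \<in> carrier F \<Longrightarrow> \<rho> (s \<odot>\<^bsub>F\<^esub> f) = tmap n (\<lambda>x. x \<otimes>\<^bsub>S\<^esub> s) (\<rho> f)"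
  using lin_hom_smult[OF \<rho>] by (simp add: free_module_smult)

definition "coord_inv v = inv_into (carrier F) \<rho> v"

lemma coord_inv:
  assumes "v \<in> tuples (regular_module S) n"
  shows "coord_inv v \<in> carrier F" "\<rho> (coord_inv v) = v"
proof -
  have "v \<in> \<rho> ` carrier F" using assms bij_betw_imp_surj_on[OF bij] by simp
  then show "coord_inv v \<in> carrier F" "\<rho> (coord_inv v) = v"
    unfolding coord_inv_def by (rule inv_into_into, rule f_inv_into_f)
qed

lemma coord_inv_\<rho>: "f \<in> carrier F \<Longrightarrow> coord_inv (\<rho> f) = f"
  unfolding coord_inv_def using inv_into_f_f[OF bij_betw_imp_inj_on[OF bij]] .

lemma \<rho>_inj: "f \<in> carrier F \<Longrightarrow> g \<in> carrier F \<Longrightarrow> \<rho> f = \<rho> g \<Longrightarrow> f = g"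
proof -
  assume f: "f \<in> carrier F" and g: "g \<in> carrier F" and e: "\<rho> f = \<rho> g"
  have "f = coord_inv (\<rho> f)" using coord_inv_\<rho>[OF f] ..
  also have "\<dots> = g" unfolding e using coord_inv_\<rho>[OF g] .
  finally show ?thesis .
qed

lemma tensor_product_F: "left_module S X \<Longrightarrow> tensor_product S F X"
  by (rule tensor_product.intro[OF F.left_module_axioms])

lemma ex_ev:
  assumes X: "left_module S X"
  shows "\<exists>h. h \<in> hom (tensor S F X) (tuple_group X n (tuples X n)) \<and>
    (\<forall>f\<in>carrier F. \<forall>x\<in>carrier X. h (pure_tensor S F X f x) = scaled_vector X n (\<rho> f) x)"
proof -
  interpret X: left_module S X by fact
  interpret T: tensor_product S F X using X by (rule tensor_product_F)
  note sv = scaled_vector_tuples[OF X]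
  have r: "\<rho> f i \<in> carrier S" if "f \<in> carrier F" "i < n" for f i using tuplesD[OF \<rho>_closed] that by auto
  obtain h where "h \<in> hom (tensor S F X) (tuple_group X n (tuples X n))"
    "\<And>f x. f \<in> carrier F \<Longrightarrow> x \<in> carrier X \<Longrightarrow> h (T.pt f x) = scaled_vector X n (\<rho> f) x"
  proof (rule T.tensor_universal[OF X.comm_group_tuples, of "\<lambda>f x. scaled_vector X n (\<rho> f) x"])
    show "scaled_vector X n (\<rho> f) x \<in> carrier (tuple_group X n (tuples X n))" if "f \<in> carrier F" "x \<in> carrier X" for f x
      using sv \<rho>_closed that by simp
    show "scaled_vector X n (\<rho> (f \<oplus>\<^bsub>F\<^esub> g)) x =
        scaled_vector X n (\<rho> f) x \<otimes>\<^bsub>tuple_group X n (tuples X n)\<^esub> scaled_vector X n (\<rho> g) x"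
      if "f \<in> carrier F" "g \<in> carrier F" "x \<in> carrier X" for f g x
      using that r by (auto simp: scaled_vector_def \<rho>_add tadd_def fun_eq_iff X.smult_l_distr)
    show "scaled_vector X n (\<rho> f) (x \<oplus>\<^bsub>X\<^esub> y) =
        scaled_vector X n (\<rho> f) x \<otimes>\<^bsub>tuple_group X n (tuples X n)\<^esub> scaled_vector X n (\<rho> f) y"
      if "f \<in> carrier F" "x \<in> carrier X" "y \<in> carrier X" for f x y
      using that r by (auto simp: scaled_vector_def tadd_def fun_eq_iff X.smult_r_distr)
    show "scaled_vector X n (\<rho> (s \<odot>\<^bsub>F\<^esub> f)) x = scaled_vector X n (\<rho> f) (s \<odot>\<^bsub>X\<^esub> x)"
      if "s \<in> carrier S" "f \<in> carrier F" "x \<in> carrier X" for s f x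
      using that r by (auto simp: scaled_vector_def \<rho>_smult tmap_def fun_eq_iff X.smult_assoc)
  qed auto
  then show ?thesis by blast
qed

definition ev :: "('s, 'x) module \<Rightarrow> (('s univ \<times> 'x) \<Rightarrow>\<^sub>0 int) set \<Rightarrow> (nat \<Rightarrow> 'x)"
  where "ev X = (SOME h. h \<in> hom (tensor S F X) (tuple_group X n (tuples X n)) \<and>
    (\<forall>f\<in>carrier F. \<forall>x\<in>carrier X. h (pure_tensor S F X f x) = scaled_vector X n (\<rho> f) x))"

lemma ev_hom: "left_module S X \<Longrightarrow> ev X \<in> hom (tensor S F X) (tuple_group X n (tuples X n))"
  unfolding ev_def by (rule someI_ex[OF ex_ev, THEN conjunct1])

lemma ev_pure: "left_module S X \<Longrightarrow> f \<in> carrier F \<Longrightarrow> x \<in> carrier X \<Longrightarrow>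
    ev X (pure_tensor S F X f x) = scaled_vector X n (\<rho> f) x"
  unfolding ev_def by (rule someI_ex[OF ex_ev, THEN conjunct2, rule_format])

definition tuple_tensor :: "('s, 'x) module \<Rightarrow> (nat \<Rightarrow> 'x) \<Rightarrow> (('s univ \<times> 'x) \<Rightarrow>\<^sub>0 int) set"
  where "tuple_tensor X x =
    finprod (tensor S F X) (\<lambda>i. pure_tensor S F X (coord_inv (unit_tuple S n i)) (x i)) {..<n}"

lemma unit: "unit_tuple S n i \<in> tuples (regular_module S) n"
  using unit_tuple_closed[OF rS] .

lemma tuple_tensor_hom:
  assumes X: "left_module S X"
  shows "tuple_tensor X \<in> hom (tuple_group X n (tuples X n)) (tensor S F X)"
proof -
  interpret X: left_module S X by fact
  interpret T: tensor_product S F X using X by (rule tensor_product_F)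
  have c: "T.pt (coord_inv (unit_tuple S n i)) (x i) \<in> carrier T.T" if "x \<in> tuples X n" "i < n" for x i
    using that by (intro T.pt_closed coord_inv unit) (auto intro: tuplesD)
  show ?thesis
  proof (rule homI)
    fix x assume "x \<in> carrier (tuple_group X n (tuples X n))"
    then show "tuple_tensor X x \<in> carrier (tensor S F X)"
      unfolding tuple_tensor_def by (intro T.TG.finprod_closed) (auto intro: c)
  next
    fix x y assume "x \<in> carrier (tuple_group X n (tuples X n))" "y \<in> carrier (tuple_group X n (tuples X n))"
    then have xy: "x \<in> tuples X n" "y \<in> tuples X n" by auto
    have "tuple_tensor X (tadd X n x y) =
        finprod T.T (\<lambda>i. T.pt (coord_inv (unit_tuple S n i)) (x i) \<otimes>\<^bsub>T.T\<^esub> T.pt (coord_inv (unit_tuple S n i)) (y i)) {..<n}"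
      unfolding tuple_tensor_def
      by (rule T.TG.finprod_cong') (use xy(1)[THEN tuplesD] xy(2)[THEN tuplesD] c[OF xy(1)] c[OF xy(2)] in \<open>auto simp: T.pt_add_right coord_inv unit\<close>)
    also have "\<dots> = tuple_tensor X x \<otimes>\<^bsub>T.T\<^esub> tuple_tensor X y"
      unfolding tuple_tensor_def by (rule T.TG.finprod_multf) (use xy c in auto)
    finally show "tuple_tensor X (x \<otimes>\<^bsub>tuple_group X n (tuples X n)\<^esub> y) = tuple_tensor X x \<otimes>\<^bsub>tensor S F X\<^esub> tuple_tensor X y"
      by simp
  qed
qed

lemma ev_tuple_tensor:
  assumes X: "left_module S X" and x: "x \<in> tuples X n"
  shows "ev X (tuple_tensor X x) = x"
proof (rule tuples_eqI[OF _ x])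
  interpret X: left_module S X by fact
  interpret T: tensor_product S F X using X by (rule tensor_product_F)
  note eh = ev_hom[OF X]
  have c: "T.pt (coord_inv (unit_tuple S n i)) (x i) \<in> carrier T.T" if "i < n" for i
    using that x by (intro T.pt_closed coord_inv unit) (auto intro: tuplesD)
  show "ev X (tuple_tensor X x) \<in> tuples X n"
    using hom_in_carrier[OF eh hom_in_carrier[OF tuple_tensor_hom[OF X]]] x by simp
  fix j assume j: "j < n"
  have h: "(\<lambda>t. ev X t j) \<in> hom T.T (add_monoid X)"
    using hom_in_carrier[OF eh] hom_mult[OF eh] j by (intro homI) (auto dest: tuplesD)
  have evj: "ev X (T.pt (coord_inv (unit_tuple S n i)) (x i)) j = unit_tuple S n i j \<odot>\<^bsub>X\<^esub> x i" if "i < n" for i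
    using j tuplesD[OF x that] coord_inv[OF unit] by (simp add: ev_pure[OF X] scaled_vector_def)
  have "ev X (tuple_tensor X x) j =
      finprod (add_monoid X) (\<lambda>i. ev X (T.pt (coord_inv (unit_tuple S n i)) (x i)) j) {..<n}"
    unfolding tuple_tensor_def by (rule T.TG.hom_finprod[OF X.a_comm_group h]) (use c in auto)
  also have "\<dots> = (\<Oplus>\<^bsub>X\<^esub>i\<in>{..<n}. if j = i then x i else \<zero>\<^bsub>X\<^esub>)"
    unfolding finsum_def[symmetric]
    by (rule X.M.finsum_cong')
      (use j tuplesD[OF x] evj in \<open>auto simp: unit_tuple_def X.smult_one\<close>)
  also have "\<dots> = x j" by (rule X.M.add.finprod_singleton) (use j tuples_Pi[OF x] in auto)
  finally show "ev X (tuple_tensor X x) j = x j" .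
qed

lemma tuple_tensor_ev:
  assumes X: "left_module S X" and t: "t \<in> carrier (tensor S F X)"
  shows "tuple_tensor X (ev X t) = t"
proof -
  interpret X: left_module S X by fact
  interpret T: tensor_product S F X using X by (rule tensor_product_F)
  note eh = ev_hom[OF X] and th = tuple_tensor_hom[OF X]
  have 1: "(\<lambda>t. tuple_tensor X (ev X t)) \<in> hom T.T T.T"
    using hom_in_carrier[OF eh] hom_mult[OF eh] hom_in_carrier[OF th] hom_mult[OF th] by (intro homI) auto
  have 2: "(\<lambda>t. t) \<in> hom T.T T.T" by (rule homI) auto
  show ?thesis
  proof (rule T.hom_tensor_eqI[OF T.TG.is_group 1 2 _ t])
    fix f x assume f: "f \<in> carrier F" and x: "x \<in> carrier X"
    have rf: "\<rho> f \<in> tuples (regular_module S) n" using \<rho>_closed f .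
    let ?e = "\<lambda>i. coord_inv (unit_tuple S n i)"
    have e: "?e i \<in> carrier F" for i using coord_inv(1) unit .
    have ez: "extend_zero S n (\<rho> f) \<in> UNIV \<rightarrow> carrier (opp S)"
      using extend_zero_closed[OF rS, of "\<rho> f" n] tuples_Pi[OF rf] by simp
    have se: "extend_zero S n (\<rho> f) i \<odot>\<^bsub>F\<^esub> ?e i \<in> carrier F" for i
      by (rule F.smult_closed) (use ez e in auto)
    have fe: "f = lincomb F n (extend_zero S n (\<rho> f)) ?e"
    proof (rule \<rho>_inj[OF f F.lincomb_closed[OF ez]])
      have "\<rho> (lincomb F n (extend_zero S n (\<rho> f)) ?e) =
          lincomb (free_module (opp S) n) n (extend_zero S n (\<rho> f)) (\<lambda>i. \<rho> (?e i))"
        by (rule lincomb_lin_hom[OF \<rho> F.left_module_axioms left_module_free[OF ring_opp[OF rS]] ez]) (use e in auto)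
      also have "(\<lambda>i. \<rho> (?e i)) = unit_tuple (opp S) n" using coord_inv(2)[OF unit] by (auto simp: unit_tuple_def fun_eq_iff)
      also have "extend_zero S n (\<rho> f) = extend_zero (opp S) n (\<rho> f)" by (simp add: extend_zero_def cong: if_cong)
      also have "lincomb (free_module (opp S) n) n \<dots> (unit_tuple (opp S) n) = \<rho> f"
        by (rule free_module_expand[OF ring_opp[OF rS], symmetric]) (use rf in \<open>simp add: tuples_opp\<close>)
      finally show "\<rho> f = \<rho> (lincomb F n (extend_zero S n (\<rho> f)) ?e)"
        by (simp add: extend_zero_def cong: if_cong)
    qed (use e in auto)
    have h: "(\<lambda>g. T.pt g x) \<in> hom (add_monoid F) T.T"
      using T.pt_closed T.pt_add_left x by (intro homI) auto
    have sx: "\<rho> f i \<odot>\<^bsub>X\<^esub> x \<in> carrier X" "\<rho> f i \<in> carrier S" if "i < n" for i using tuplesD[OF rf that] x by (auto intro: X.smult_closed)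
    have "T.pt f x = T.pt (lincomb F n (extend_zero S n (\<rho> f)) ?e) x" using fe by simp
    also have "\<dots> = finprod T.T (\<lambda>i. T.pt (extend_zero S n (\<rho> f) i \<odot>\<^bsub>F\<^esub> ?e i) x) {..<n}"
      unfolding lincomb_def finsum_def
      by (rule comm_group.hom_finprod[OF F.a_comm_group T.comm_group_tensor h]) (use se in auto)
    also have "\<dots> = tuple_tensor X (scaled_vector X n (\<rho> f) x)"
      unfolding tuple_tensor_def
      by (rule T.TG.finprod_cong') (use sx e x T.pt_closed in \<open>auto simp: scaled_vector_def T.pt_balanced\<close>)
    finally show "tuple_tensor X (ev X (T.pt f x)) = T.pt f x" using ev_pure[OF X f x] by simp
  qed
qed

lemma ev_inj:
  assumes "left_module S X" "t \<in> carrier (tensor S F X)" "t' \<in> carrier (tensor S F X)" "ev X t = ev X t'"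
  shows "t = t'"
proof -
  have "t = tuple_tensor X (ev X t)" using tuple_tensor_ev[OF assms(1,2)] ..
  also have "\<dots> = t'" unfolding assms(4) using tuple_tensor_ev[OF assms(1,3)] .
  finally show ?thesis .
qed

lemma ev_tensor_map:
  assumes X: "left_module S X" and Y: "left_module S Y" and f: "f \<in> lin_hom S X Y" and t: "t \<in> carrier (tensor S F X)"
  shows "ev Y (tensor_map S F X F Y (\<lambda>n. n) f t) = tmap n f (ev X t)"
proof -
  interpret Y: left_module S Y by fact
  interpret T: tensor_product S F X using X by (rule tensor_product_F)
  interpret U: tensor_product S F Y using Y by (rule tensor_product_F)
  note tm = tensor_map_props[OF T.tensor_product_axioms U.tensor_product_axioms
      restrict_id_lin_hom[OF F.left_module_axioms] lin_hom_restrict[OF f]]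
  note eh = ev_hom[OF X] and eh' = ev_hom[OF Y]
  interpret GY: comm_group "tuple_group Y n (tuples Y n)" by (rule Y.comm_group_tuples)
  have 1: "(\<lambda>t. ev Y (tensor_map S F X F Y (\<lambda>n. n) f t)) \<in> hom T.T (tuple_group Y n (tuples Y n))"
    using hom_in_carrier[OF eh'] hom_mult[OF eh'] hom_in_carrier[OF tm(1)] hom_mult[OF tm(1)] by (intro homI) auto
  have 2: "(\<lambda>t. tmap n f (ev X t)) \<in> hom T.T (tuple_group Y n (tuples Y n))"
    using hom_in_carrier[OF eh] hom_mult[OF eh] tmap_tuples[of f X Y _ n] lin_hom_closed[OF f] tmap_tadd[OF f]
    by (intro homI) auto
  show ?thesis
  proof (rule T.hom_tensor_eqI[OF GY.is_group 1 2 _ t])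
    fix g x assume gx: "g \<in> carrier F" "x \<in> carrier X"
    show "ev Y (tensor_map S F X F Y (\<lambda>n. n) f (T.pt g x)) = tmap n f (ev X (T.pt g x))"
      using gx tm(2)[OF gx] lin_hom_closed[OF f gx(2)] lin_hom_smult[OF f _ gx(2)] tuplesD[OF \<rho>_closed[OF gx(1)]]
      by (auto simp: ev_pure[OF X] ev_pure[OF Y] scaled_vector_def tmap_def fun_eq_iff)
  qed
qed

lemma tuple_functor_tensor:
  "tuple_functor S n (\<lambda>X. tuples X n) (\<lambda>X. {tzero X n}) (tensor_functor S F) tuple_tensor"
proof (rule tuple_functorI)
  show "natural_subgroup S n (\<lambda>X. tuples X n)"
    using natural_subgroup_sols[of "\<lambda>_ _. \<zero>\<^bsub>S\<^esub>" S n 0] by simp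
next
  fix X assume "ufp S X"
  then have X: "left_module S X" by (rule fin_presented_left_module)
  interpret X: left_module S X by fact
  interpret T: tensor_product S F X using X by (rule tensor_product_F)
  note th = tuple_tensor_hom[OF X] and eh = ev_hom[OF X]
  interpret G: comm_group "tuple_group X n (tuples X n)" by (rule X.comm_group_tuples)
  interpret h: group_hom "tuple_group X n (tuples X n)" T.T "tuple_tensor X" using th by unfold_locales
  show "comm_group (fObj (tensor_functor S F) X)" by (simp add: tensor_functor_def T.comm_group_tensor)
  show "tuple_tensor X \<in> hom (tuple_group X n (tuples X n)) (fObj (tensor_functor S F) X)"
    using th by (simp add: tensor_functor_def)
  show "tuple_tensor X ` tuples X n = carrier (fObj (tensor_functor S F) X)"
  proof (intro equalityI subsetI)
    fix t assume "t \<in> carrier (fObj (tensor_functor S F) X)"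
    then have t: "t \<in> carrier T.T" by (simp add: tensor_functor_def)
    then show "t \<in> tuple_tensor X ` tuples X n"
      using tuple_tensor_ev[OF X t] hom_in_carrier[OF eh t] by (metis imageI tuple_group_simps(1))
  qed (use hom_in_carrier[OF th] in \<open>auto simp: tensor_functor_def\<close>)
  fix x assume x: "x \<in> tuples X n"
  show "tuple_tensor X x = \<one>\<^bsub>fObj (tensor_functor S F) X\<^esub> \<longleftrightarrow> x \<in> {tzero X n}"
    using h.hom_one ev_tuple_tensor[OF X x] ev_tuple_tensor[OF X X.tzero_tuples] by (auto simp: tensor_functor_def)
next
  fix X Y f x assume "ufp S X" "ufp S Y" and f: "f \<in> lin_hom S X Y" and x: "x \<in> tuples X n"
  then have X: "left_module S X" and Y: "left_module S Y" by (auto intro: fin_presented_left_module)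
  note tm = tensor_map_props[OF tensor_product_F[OF X] tensor_product_F[OF Y]
      restrict_id_lin_hom[OF F.left_module_axioms] lin_hom_restrict[OF f]]
  have t: "tuple_tensor X x \<in> carrier (tensor S F X)" using hom_in_carrier[OF tuple_tensor_hom[OF X]] x by simp
  have fx: "tmap n f x \<in> tuples Y n" using x lin_hom_closed[OF f] by (intro tmap_tuples) auto
  show "fArr (tensor_functor S F) X Y f (tuple_tensor X x) = tuple_tensor Y (tmap n f x)"
    unfolding tensor_functor_def funct.simps
  proof (rule ev_inj[OF Y])
    show "tensor_map S F X F Y (\<lambda>n. n) f (tuple_tensor X x) \<in> carrier (tensor S F Y)"
      using hom_in_carrier[OF tm(1) t] .
    show "tuple_tensor Y (tmap n f x) \<in> carrier (tensor S F Y)"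
      using hom_in_carrier[OF tuple_tensor_hom[OF Y]] fx by simp
  qed (simp add: ev_tensor_map[OF X Y f t] ev_tuple_tensor[OF X x] ev_tuple_tensor[OF Y fx])
next
  fix X Y f
  show "fArr (tensor_functor S F) X Y f \<in> extensional (carrier (fObj (tensor_functor S F) X))"
    by (simp add: tensor_functor_def tensor_map_def)
qed

lemma tensor_functor_fp: "tensor_functor S F \<in> fp_functors S"
proof (rule tuple_functor_fp[OF rS, where n=n and m=0 and a="\<lambda>_ _. \<zero>\<^bsub>S\<^esub>" and b="\<lambda>_ _. \<zero>\<^bsub>S\<^esub>" and m'=0 and n'=0
      and L="\<lambda>_ _. \<zero>\<^bsub>S\<^esub>" and P'="\<lambda>X. {tzero X n}" and p=tuple_tensor])
  fix X assume "ufp S X"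
  then interpret X: left_module S X by (rule fin_presented_left_module)
  show "{tzero X n} \<subseteq> sols X 0 n (\<lambda>_ _. \<zero>\<^bsub>S\<^esub>)" using X.tzero_tuples by simp
  have "tuples X 0 = {\<lambda>_. undefined}" by (auto simp: tuples_def)
  then show "{tzero X n} = mat_app X n 0 (\<lambda>_ _. \<zero>\<^bsub>S\<^esub>) ` sols X 0 0 (\<lambda>_ _. \<zero>\<^bsub>S\<^esub>)"
    by (simp add: mat_app_def tzero_def)
qed (simp_all add: tuple_functor_tensor)

end

locale free_right_pair = F: free_right_module S n F \<rho> + G: free_right_module S m G \<tau>
  for S :: "('s, 'f) ring_scheme" and n F \<rho> m G \<tau> +
  fixes a :: "nat \<Rightarrow> nat \<Rightarrow> 's"
  assumes a: "a \<in> UNIV \<rightarrow> UNIV \<rightarrow> carrier S"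
begin

definition "mat_hom = (\<lambda>f\<in>carrier F. G.coord_inv (mat_app (regular_module S) m n a (\<rho> f)))"

lemma mat_app_closed: "f \<in> carrier F \<Longrightarrow> mat_app (regular_module S) m n a (\<rho> f) \<in> tuples (regular_module S) m"
  using left_module.mat_app_tuples[OF left_module_regular[OF F.rS] a F.\<rho>_closed] .

lemma \<tau>_mat_hom: "f \<in> carrier F \<Longrightarrow> \<tau> (mat_hom f) = mat_app (regular_module S) m n a (\<rho> f)"
  using G.coord_inv(2)[OF mat_app_closed] by (simp add: mat_hom_def)

lemma mat_hom_closed: "f \<in> carrier F \<Longrightarrow> mat_hom f \<in> carrier G"
  using G.coord_inv(1)[OF mat_app_closed] by (simp add: mat_hom_def)

lemma mat_hom_lin_hom: "mat_hom \<in> lin_hom (opp S) F G"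
proof (rule lin_homI)
  show "mat_hom \<in> carrier F \<rightarrow>\<^sub>E carrier G" using mat_hom_closed by (auto simp: mat_hom_def)
next
  interpret reg: left_module S "regular_module S" by (rule left_module_regular[OF F.rS])
  fix f g assume fg: "f \<in> carrier F" "g \<in> carrier F"
  then have s: "f \<oplus>\<^bsub>F\<^esub> g \<in> carrier F" by simp
  show "mat_hom (f \<oplus>\<^bsub>F\<^esub> g) = mat_hom f \<oplus>\<^bsub>G\<^esub> mat_hom g"
    by (rule G.\<rho>_inj) (use fg s mat_hom_closed in \<open>auto simp: \<tau>_mat_hom G.\<rho>_add F.\<rho>_add reg.mat_app_tadd[OF a] F.\<rho>_closed\<close>)
next
  interpret reg: left_module S "regular_module S" by (rule left_module_regular[OF F.rS])
  fix s f assume sf: "s \<in> carrier (opp S)" "f \<in> carrier F"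
  then have s: "s \<in> carrier S" "s \<odot>\<^bsub>F\<^esub> f \<in> carrier F" "s \<odot>\<^bsub>G\<^esub> mat_hom f \<in> carrier G"
    using F.F.smult_closed[OF sf] G.F.smult_closed[OF sf(1) mat_hom_closed[OF sf(2)]] by auto
  have e: "tmap k (\<lambda>x. x \<otimes>\<^bsub>S\<^esub> s) v = scaled_vector (regular_module S) k v s" for k v
    by (simp add: tmap_def scaled_vector_def)
  show "mat_hom (s \<odot>\<^bsub>F\<^esub> f) = s \<odot>\<^bsub>G\<^esub> mat_hom f"
  proof (rule G.\<rho>_inj[OF mat_hom_closed[OF s(2)] s(3)])
    show "\<tau> (mat_hom (s \<odot>\<^bsub>F\<^esub> f)) = \<tau> (s \<odot>\<^bsub>G\<^esub> mat_hom f)"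
      using mat_app_scaled_vector[OF left_module_regular[OF F.rS] F.\<rho>_closed[OF sf(2)], of s a m] s sf a
      by (simp add: \<tau>_mat_hom F.\<rho>_smult G.\<rho>_smult mat_hom_closed e)
  qed
qed

lemma ev_mat_hom:
  assumes X: "left_module S X" and t: "t \<in> carrier (tensor S F X)"
  shows "G.ev X (tensor_map S F X G X mat_hom (\<lambda>x. x) t) = mat_app X m n a (F.ev X t)"
proof -
  interpret X: left_module S X by fact
  interpret T: tensor_product S F X using X by (rule F.tensor_product_F)
  interpret U: tensor_product S G X using X by (rule G.tensor_product_F)
  note tm = tensor_map_props[OF T.tensor_product_axioms U.tensor_product_axioms
      lin_hom_restrict[OF mat_hom_lin_hom] restrict_id_lin_hom[OF X]]
  note eh = F.ev_hom[OF X] and eh' = G.ev_hom[OF X]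
  interpret GX: comm_group "tuple_group X m (tuples X m)" by (rule X.comm_group_tuples)
  have 1: "(\<lambda>t. G.ev X (tensor_map S F X G X mat_hom (\<lambda>x. x) t)) \<in> hom T.T (tuple_group X m (tuples X m))"
    using hom_in_carrier[OF eh'] hom_mult[OF eh'] hom_in_carrier[OF tm(1)] hom_mult[OF tm(1)] by (intro homI) auto
  have 2: "(\<lambda>t. mat_app X m n a (F.ev X t)) \<in> hom T.T (tuple_group X m (tuples X m))"
    using hom_in_carrier[OF eh] hom_mult[OF eh] X.mat_app_tuples[OF a] X.mat_app_tadd[OF a] by (intro homI) auto
  show ?thesis
  proof (rule T.hom_tensor_eqI[OF GX.is_group 1 2 _ t])
    fix g x assume gx: "g \<in> carrier F" "x \<in> carrier X"
    show "G.ev X (tensor_map S F X G X mat_hom (\<lambda>x. x) (T.pt g x)) = mat_app X m n a (F.ev X (T.pt g x))"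
      using gx tm(2)[OF gx] mat_hom_closed[OF gx(1)] mat_app_scaled_vector[OF X F.\<rho>_closed[OF gx(1)] gx(2) a]
      by (simp add: F.ev_pure[OF X] G.ev_pure[OF X] \<tau>_mat_hom)
  qed
qed

lemma tensor_map_mat_hom_closed:
  assumes "left_module S X" "t \<in> carrier (tensor S F X)"
  shows "tensor_map S F X G X mat_hom (\<lambda>x. x) t \<in> carrier (tensor S G X)"
  using hom_in_carrier[OF tensor_map_hom[OF F.tensor_product_F[OF assms(1)] G.tensor_product_F[OF assms(1)]
      lin_hom_restrict[OF mat_hom_lin_hom] restrict_id_lin_hom[OF assms(1)]]] assms(2) by blast

lemma tensor_map_mat_hom_tuple:
  assumes X: "left_module S X" and x: "x \<in> tuples X n"
  shows "tensor_map S F X G X mat_hom (\<lambda>x. x) (F.tuple_tensor X x) = G.tuple_tensor X (mat_app X m n a x)"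
proof (rule G.ev_inj[OF X])
  have t: "F.tuple_tensor X x \<in> carrier (tensor S F X)" using hom_in_carrier[OF F.tuple_tensor_hom[OF X]] x by simp
  have ax: "mat_app X m n a x \<in> tuples X m" by (rule left_module.mat_app_tuples[OF X a x])
  show "tensor_map S F X G X mat_hom (\<lambda>x. x) (F.tuple_tensor X x) \<in> carrier (tensor S G X)"
    by (rule tensor_map_mat_hom_closed[OF X t])
  show "G.tuple_tensor X (mat_app X m n a x) \<in> carrier (tensor S G X)"
    using hom_in_carrier[OF G.tuple_tensor_hom[OF X]] ax by simp
  show "G.ev X (tensor_map S F X G X mat_hom (\<lambda>x. x) (F.tuple_tensor X x)) = G.ev X (G.tuple_tensor X (mat_app X m n a x))"
    using ev_mat_hom[OF X t] F.ev_tuple_tensor[OF X x] G.ev_tuple_tensor[OF X ax] by simp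
qed

definition sol_span :: "('s, 'x) module \<Rightarrow> (nat \<Rightarrow> 'x) set"
  where "sol_span X = generate (tuple_group X n (tuples X n))
    {scaled_vector X n v y | v y. v \<in> sols (regular_module S) m n a \<and> y \<in> carrier X}"

lemma sol_span_gens:
  assumes "left_module S X"
  shows "{scaled_vector X n v y | v y. v \<in> sols (regular_module S) m n a \<and> y \<in> carrier X} \<subseteq> carrier (tuple_group X n (tuples X n))"
proof -
  have "scaled_vector X n v y \<in> tuples X n" if "v \<in> sols (regular_module S) m n a" "y \<in> carrier X" for v y
    using scaled_vector_tuples[OF assms sols_tuples[OF that(1)] that(2)] .
  then show ?thesis by auto
qed

lemma subgroup_sol_span:
  assumes "left_module S X"
  shows "subgroup (sol_span X) (tuple_group X n (tuples X n))"
proof -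
  interpret X: left_module S X by fact
  interpret GX: comm_group "tuple_group X n (tuples X n)" by (rule X.comm_group_tuples)
  show ?thesis unfolding sol_span_def by (rule GX.generate_is_subgroup[OF sol_span_gens[OF assms]])
qed

lemma sols_regular_iff: "f \<in> carrier F \<Longrightarrow> \<rho> f \<in> sols (regular_module S) m n a \<longleftrightarrow> mat_hom f = \<zero>\<^bsub>G\<^esub>"
proof -
  assume f: "f \<in> carrier F"
  interpret reg: left_module S "regular_module S" by (rule left_module_regular[OF F.rS])
  have z: "\<tau> \<zero>\<^bsub>G\<^esub> = tzero (regular_module S) m"
    using lin_hom_zero[OF G.\<rho> G.F.left_module_axioms left_module_free[OF ring_opp[OF F.rS]]] by (simp add: tzero_def)
  have "mat_hom f = \<zero>\<^bsub>G\<^esub> \<longleftrightarrow> \<tau> (mat_hom f) = tzero (regular_module S) m"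
    using G.\<rho>_inj[OF mat_hom_closed[OF f], of "\<zero>\<^bsub>G\<^esub>"] z by auto
  also have "\<dots> \<longleftrightarrow> \<rho> f \<in> sols (regular_module S) m n a"
    using F.\<rho>_closed[OF f] by (auto simp: \<tau>_mat_hom[OF f] mat_app_def tzero_def sols_def fun_eq_iff)
  finally show ?thesis by simp
qed

text \<open>With \<open>I\<close> the image of the matrix map, flatness makes \<open>I \<otimes> X \<rightarrow> S\<^sup>m \<otimes> X\<close> injective, and
  \<open>i \<otimes> y \<mapsto> v y\<close>, for any preimage \<open>v\<close> of \<open>i\<close>, is a well defined map from \<open>I \<otimes> X\<close> to
  \<open>X\<^sup>n\<close> modulo the span.\<close>

lemma flat_sols:
  assumes fl: "flat S X" and x: "x \<in> sols X m n a"
  shows "x \<in> sol_span X"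
proof -
  have X: "left_module S X" using fl by (simp add: flat_def)
  interpret X: left_module S X by (rule X)
  interpret T: tensor_product S F X using X by (rule F.tensor_product_F)
  interpret U: tensor_product S G X using X by (rule G.tensor_product_F)
  interpret GX: comm_group "tuple_group X n (tuples X n)" by (rule X.comm_group_tuples)
  let ?W = "sol_span X"
  note W = subgroup_sol_span[OF X]
  have mh: "mat_hom \<in> lin_hom (opp S) F G" by (rule mat_hom_lin_hom)
  define I where "I = mat_hom ` carrier F"
  have IG: "I \<subseteq> carrier G" using mat_hom_closed by (auto simp: I_def)
  have sub: "submodule I (opp S) G"
  proof (rule submodule.intro)
    have "group_hom (add_monoid F) (add_monoid G) mat_hom"
      by (intro group_hom.intro group_hom_axioms.intro F.F.a_group G.F.a_group homI)
        (use lin_hom_closed[OF mh] lin_hom_add[OF mh] in auto)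
    then show "subgroup I (add_monoid G)" unfolding I_def
      using group_hom.subgroup_img_is_subgroup[OF _ group.subgroup_self[OF F.F.a_group]] by fastforce
    show "submodule_axioms I (opp S) G"
    proof
      fix s g assume s: "s \<in> carrier (opp S)" and "g \<in> I"
      then obtain f where f: "f \<in> carrier F" "g = mat_hom f" by (auto simp: I_def)
      have "s \<odot>\<^bsub>G\<^esub> g = mat_hom (s \<odot>\<^bsub>F\<^esub> f)" using lin_hom_smult[OF mh s f(1)] f by simp
      then show "s \<odot>\<^bsub>G\<^esub> g \<in> I" using F.F.smult_closed[OF s f(1)] by (simp add: I_def)
    qed
  qed
  let ?I = "G\<lparr>carrier := I\<rparr>"
  have lI: "left_module (opp S) ?I" by (rule left_module_submodule[OF G.F.left_module_axioms sub])
  interpret V: tensor_product S ?I X by (rule tensor_product.intro[OF lI X])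
  let ?\<iota> = "\<lambda>g\<in>I. g"
  have \<iota>: "?\<iota> \<in> lin_hom (opp S) ?I G"
    by (rule lin_homI) (use IG V.A.M.a_closed V.A.smult_closed in auto)
  have mh': "mat_hom \<in> lin_hom (opp S) F ?I"
    using lin_hom_add[OF mh] lin_hom_smult[OF mh] lin_hom_PiE[OF mh] by (intro lin_homI) (auto simp: I_def PiE_def)
  note tI = tensor_map_props[OF V.tensor_product_axioms U.tensor_product_axioms lin_hom_restrict[OF \<iota>] restrict_id_lin_hom[OF X]]
  note tF = tensor_map_props[OF T.tensor_product_axioms V.tensor_product_axioms lin_hom_restrict[OF mh'] restrict_id_lin_hom[OF X]]
  note tG = tensor_map_props[OF T.tensor_product_axioms U.tensor_product_axioms lin_hom_restrict[OF mh] restrict_id_lin_hom[OF X]]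
  have inj: "inj_on (tensor_map S ?I X G X ?\<iota> (\<lambda>m. m)) (carrier V.T)"
    using fl \<iota> lI G.F.left_module_axioms unfolding flat_def by (auto simp: inj_on_def)
  let ?t = "F.tuple_tensor X x"
  have xt: "x \<in> tuples X n" using x by (rule sols_tuples)
  have t: "?t \<in> carrier T.T" using hom_in_carrier[OF F.tuple_tensor_hom[OF X]] xt by simp
  let ?s = "tensor_map S F X ?I X mat_hom (\<lambda>x. x) ?t"
  have s: "?s \<in> carrier V.T" using hom_in_carrier[OF tF(1) t] .
  have comp: "tensor_map S ?I X G X ?\<iota> (\<lambda>m. m) ?s = tensor_map S F X G X mat_hom (\<lambda>x. x) ?t"
  proof (rule T.hom_tensor_eqI[OF U.TG.is_group _ tG(1) _ t])
    show "(\<lambda>t. tensor_map S ?I X G X ?\<iota> (\<lambda>m. m) (tensor_map S F X ?I X mat_hom (\<lambda>x. x) t)) \<in> hom T.T U.T"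
      using hom_in_carrier[OF tF(1)] hom_mult[OF tF(1)] hom_in_carrier[OF tI(1)] hom_mult[OF tI(1)] by (intro homI) auto
    fix f y assume fy: "f \<in> carrier F" "y \<in> carrier X"
    then show "tensor_map S ?I X G X ?\<iota> (\<lambda>m. m) (tensor_map S F X ?I X mat_hom (\<lambda>x. x) (T.pt f y)) =
        tensor_map S F X G X mat_hom (\<lambda>x. x) (T.pt f y)"
      using tF(2)[OF fy] tG(2)[OF fy] tI(2)[of "mat_hom f" y] by (simp add: I_def)
  qed
  have "mat_app X m n a x = tzero X m" using x by (auto simp: sols_def mat_app_def tzero_def fun_eq_iff)
  then have "tensor_map S F X G X mat_hom (\<lambda>x. x) ?t = G.tuple_tensor X (tzero X m)"
    using tensor_map_mat_hom_tuple[OF X xt] by simp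
  also have "\<dots> = \<one>\<^bsub>U.T\<^esub>"
  proof -
    interpret GM: comm_group "tuple_group X m (tuples X m)" by (rule X.comm_group_tuples)
    interpret h: group_hom "tuple_group X m (tuples X m)" U.T "G.tuple_tensor X"
      using G.tuple_tensor_hom[OF X] by unfold_locales
    show ?thesis using h.hom_one by simp
  qed
  finally have "tensor_map S ?I X G X ?\<iota> (\<lambda>m. m) ?s = \<one>\<^bsub>U.T\<^esub>" using comp by simp
  moreover have "tensor_map S ?I X G X ?\<iota> (\<lambda>m. m) \<one>\<^bsub>V.T\<^esub> = \<one>\<^bsub>U.T\<^esub>"
    using hom_one[OF tI(1) V.TG.is_group U.TG.is_group] .
  ultimately have s1: "?s = \<one>\<^bsub>V.T\<^esub>" using inj_onD[OF inj _ s V.TG.one_closed] by simp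
  define pre where "pre i = inv_into (carrier F) mat_hom i" for i
  have pre: "pre i \<in> carrier F" "mat_hom (pre i) = i" if "i \<in> I" for i
    using inv_into_into[OF that[unfolded I_def]] f_inv_into_f[OF that[unfolded I_def]] by (auto simp: pre_def)
  define Q where "Q = tuple_group X n (tuples X n) Mod ?W"
  let ?c = "\<lambda>z. ?W #>\<^bsub>tuple_group X n (tuples X n)\<^esub> z"
  have Q: "comm_group Q" unfolding Q_def by (rule GX.abelian_FactGroup[OF W])
  have ch: "?c \<in> hom (tuple_group X n (tuples X n)) Q"
    unfolding Q_def by (rule normal.r_coset_hom_Mod[OF GX.subgroup_imp_normal[OF W]])
  have svt: "scaled_vector X n (\<rho> f) y \<in> tuples X n" if "f \<in> carrier F" "y \<in> carrier X" for f y
    using scaled_vector_tuples[OF X F.\<rho>_closed] that by simp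
  have r: "\<rho> f i \<in> carrier S" if "f \<in> carrier F" "i < n" for f i using tuplesD[OF F.\<rho>_closed] that by auto
  have sva: "scaled_vector X n (\<rho> (f \<oplus>\<^bsub>F\<^esub> g)) y = tadd X n (scaled_vector X n (\<rho> f) y) (scaled_vector X n (\<rho> g) y)"
    if "f \<in> carrier F" "g \<in> carrier F" "y \<in> carrier X" for f g y
    using that r by (auto simp: scaled_vector_def F.\<rho>_add tadd_def fun_eq_iff X.smult_l_distr)
  have cadd: "?c (tadd X n z w) = ?c z \<otimes>\<^bsub>Q\<^esub> ?c w" if "z \<in> tuples X n" "w \<in> tuples X n" for z w
    using hom_mult[OF ch, of z w] that by simp
  have cW: "?c z = \<one>\<^bsub>Q\<^esub>" if "z \<in> ?W" for z
    using GX.coset_join2[OF _ W that] subgroup.subset[OF W] that by (auto simp: Q_def)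
  have wd: "?c (scaled_vector X n (\<rho> f) y) = ?c (scaled_vector X n (\<rho> g) y)"
    if fg: "f \<in> carrier F" "g \<in> carrier F" "mat_hom f = mat_hom g" "y \<in> carrier X" for f g y
  proof -
    let ?d = "f \<oplus>\<^bsub>F\<^esub> (\<ominus>\<^bsub>F\<^esub> g)"
    have d: "?d \<in> carrier F" "f = ?d \<oplus>\<^bsub>F\<^esub> g" using fg by (auto simp: F.F.M.a_assoc F.F.M.l_neg)
    have "mat_hom ?d \<oplus>\<^bsub>G\<^esub> mat_hom g = mat_hom g"
      using lin_hom_add[OF mh d(1) fg(2)] d(2) fg(3) by simp
    then have "mat_hom ?d = \<zero>\<^bsub>G\<^esub>" using mat_hom_closed[OF d(1)] mat_hom_closed[OF fg(2)] by simp
    then have "\<rho> ?d \<in> sols (regular_module S) m n a" using sols_regular_iff[OF d(1)] by simp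
    then have dW: "scaled_vector X n (\<rho> ?d) y \<in> ?W" unfolding sol_span_def using fg(4) by (auto intro: generate.incl)
    have "scaled_vector X n (\<rho> f) y = tadd X n (scaled_vector X n (\<rho> ?d) y) (scaled_vector X n (\<rho> g) y)"
      using sva[OF d(1) fg(2,4)] d(2) by simp
    then have "?c (scaled_vector X n (\<rho> f) y) = \<one>\<^bsub>Q\<^esub> \<otimes>\<^bsub>Q\<^esub> ?c (scaled_vector X n (\<rho> g) y)"
      using cadd[OF svt[OF d(1) fg(4)] svt[OF fg(2,4)]] cW[OF dW] by simp
    also have "\<dots> = ?c (scaled_vector X n (\<rho> g) y)"
      by (rule monoid.l_one[OF group.is_monoid[OF comm_group.axioms(2)[OF Q]] hom_in_carrier[OF ch]])
        (use svt[OF fg(2,4)] in simp)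
    finally show ?thesis .
  qed
  obtain \<gamma> where \<gamma>: "\<gamma> \<in> hom V.T Q"
    "\<And>i y. i \<in> carrier ?I \<Longrightarrow> y \<in> carrier X \<Longrightarrow> \<gamma> (V.pt i y) = ?c (scaled_vector X n (\<rho> (pre i)) y)"
  proof (rule V.tensor_universal[OF Q, of "\<lambda>i y. ?c (scaled_vector X n (\<rho> (pre i)) y)"])
    show "?c (scaled_vector X n (\<rho> (pre i)) y) \<in> carrier Q" if "i \<in> carrier ?I" "y \<in> carrier X" for i y
      using hom_in_carrier[OF ch] svt[OF pre(1)] that by simp
    show "?c (scaled_vector X n (\<rho> (pre (i \<oplus>\<^bsub>?I\<^esub> j))) y) =
        ?c (scaled_vector X n (\<rho> (pre i)) y) \<otimes>\<^bsub>Q\<^esub> ?c (scaled_vector X n (\<rho> (pre j)) y)"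
      if ij: "i \<in> carrier ?I" "j \<in> carrier ?I" and y: "y \<in> carrier X" for i j y
    proof -
      have i: "i \<in> I" "j \<in> I" "i \<oplus>\<^bsub>G\<^esub> j \<in> I" using ij V.A.M.a_closed[of i j] by auto
      have p: "pre i \<oplus>\<^bsub>F\<^esub> pre j \<in> carrier F" using pre(1) i by simp
      have "mat_hom (pre (i \<oplus>\<^bsub>G\<^esub> j)) = mat_hom (pre i \<oplus>\<^bsub>F\<^esub> pre j)"
        using pre i lin_hom_add[OF mh] by simp
      then have "?c (scaled_vector X n (\<rho> (pre (i \<oplus>\<^bsub>G\<^esub> j))) y) = ?c (scaled_vector X n (\<rho> (pre i \<oplus>\<^bsub>F\<^esub> pre j)) y)"
        by (rule wd[OF pre(1)[OF i(3)] p _ y])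
      then show ?thesis using sva[OF pre(1)[OF i(1)] pre(1)[OF i(2)] y] cadd svt pre(1) i y by simp
    qed
    show "?c (scaled_vector X n (\<rho> (pre i)) (y \<oplus>\<^bsub>X\<^esub> z)) =
        ?c (scaled_vector X n (\<rho> (pre i)) y) \<otimes>\<^bsub>Q\<^esub> ?c (scaled_vector X n (\<rho> (pre i)) z)"
      if "i \<in> carrier ?I" "y \<in> carrier X" "z \<in> carrier X" for i y z
    proof -
      have "scaled_vector X n (\<rho> (pre i)) (y \<oplus>\<^bsub>X\<^esub> z) = tadd X n (scaled_vector X n (\<rho> (pre i)) y) (scaled_vector X n (\<rho> (pre i)) z)"
        using that pre(1) r by (auto simp: scaled_vector_def tadd_def fun_eq_iff X.smult_r_distr)
      then show ?thesis using cadd svt pre(1) that by simp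
    qed
    show "?c (scaled_vector X n (\<rho> (pre (b \<odot>\<^bsub>?I\<^esub> i))) y) = ?c (scaled_vector X n (\<rho> (pre i)) (b \<odot>\<^bsub>X\<^esub> y))"
      if "b \<in> carrier S" "i \<in> carrier ?I" "y \<in> carrier X" for b i y
    proof -
      have i: "i \<in> I" "b \<odot>\<^bsub>G\<^esub> i \<in> I" using that V.A.smult_closed[of b i] by auto
      have p: "b \<odot>\<^bsub>F\<^esub> pre i \<in> carrier F" using F.F.smult_closed[of b "pre i"] pre(1) i that by simp
      have "mat_hom (pre (b \<odot>\<^bsub>G\<^esub> i)) = mat_hom (b \<odot>\<^bsub>F\<^esub> pre i)"
        using pre i lin_hom_smult[OF mh, of b "pre i"] that by simp
      then have "?c (scaled_vector X n (\<rho> (pre (b \<odot>\<^bsub>G\<^esub> i))) y) = ?c (scaled_vector X n (\<rho> (b \<odot>\<^bsub>F\<^esub> pre i)) y)"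
        by (rule wd[OF pre(1)[OF i(2)] p _ that(3)])
      moreover have "scaled_vector X n (\<rho> (b \<odot>\<^bsub>F\<^esub> pre i)) y = scaled_vector X n (\<rho> (pre i)) (b \<odot>\<^bsub>X\<^esub> y)"
        using that i pre(1) r by (auto simp: scaled_vector_def F.\<rho>_smult tmap_def fun_eq_iff X.smult_assoc)
      ultimately show ?thesis by simp
    qed
  qed auto
  have "\<gamma> ?s = ?c (F.ev X ?t)"
  proof (rule T.hom_tensor_eqI[of Q "\<lambda>t. \<gamma> (tensor_map S F X ?I X mat_hom (\<lambda>x. x) t)" "\<lambda>t. ?c (F.ev X t)", OF _ _ _ _ t])
    show "group Q" using Q by (rule comm_group.axioms(2))
    show "(\<lambda>t. \<gamma> (tensor_map S F X ?I X mat_hom (\<lambda>x. x) t)) \<in> hom T.T Q"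
      using hom_in_carrier[OF tF(1)] hom_mult[OF tF(1)] hom_in_carrier[OF \<gamma>(1)] hom_mult[OF \<gamma>(1)] by (intro homI) auto
    show "(\<lambda>t. ?c (F.ev X t)) \<in> hom T.T Q"
    proof (rule homI)
      note eh = F.ev_hom[OF X]
      show "?c (F.ev X t) \<in> carrier Q" if "t \<in> carrier T.T" for t using hom_in_carrier[OF ch hom_in_carrier[OF eh that]] .
      show "?c (F.ev X (t \<otimes>\<^bsub>T.T\<^esub> t')) = ?c (F.ev X t) \<otimes>\<^bsub>Q\<^esub> ?c (F.ev X t')" if "t \<in> carrier T.T" "t' \<in> carrier T.T" for t t'
        using hom_mult[OF eh that] hom_mult[OF ch hom_in_carrier[OF eh that(1)] hom_in_carrier[OF eh that(2)]] by simp
    qed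
    fix f y assume fy: "f \<in> carrier F" "y \<in> carrier X"
    have fi: "mat_hom f \<in> I" using fy by (simp add: I_def)
    show "\<gamma> (tensor_map S F X ?I X mat_hom (\<lambda>x. x) (T.pt f y)) = ?c (F.ev X (T.pt f y))"
      using tF(2)[OF fy] \<gamma>(2)[of "mat_hom f" y] fi fy wd[OF pre(1)[OF fi] fy(1) pre(2)[OF fi] fy(2)] F.ev_pure[OF X fy] by simp
  qed
  then have "?c x = \<gamma> \<one>\<^bsub>V.T\<^esub>" using s1 F.ev_tuple_tensor[OF X xt] by simp
  also have "\<dots> = ?W" using hom_one[OF \<gamma>(1) V.TG.is_group comm_group.axioms(2)[OF Q]] by (simp add: Q_def)
  finally show "x \<in> ?W" using GX.coset_join1[OF _ _ W] xt by simp
qed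

end

section \<open>Kernels and cokernels of finitely presented modules\<close>

lemma ex_free_generator:
  fixes T :: "('a, 'e) ring_scheme"
  assumes "ring T"
  obtains F :: "'a umodule" and e where "fin_presented T F" "e \<in> carrier F"
    "\<And>(X :: 'a umodule) x. left_module T X \<Longrightarrow> x \<in> carrier X \<Longrightarrow> \<exists>h\<in>lin_hom T F X. h e = x"
    "\<And>(X :: 'a umodule) h k. left_module T X \<Longrightarrow> h \<in> lin_hom T F X \<Longrightarrow> k \<in> lin_hom T F X \<Longrightarrow> h e = k e \<Longrightarrow> h = k"
proof -
  interpret T: ring T by fact
  obtain F :: "'a umodule" and u where P: "pres_by T 0 1 (\<lambda>_ _. \<zero>\<^bsub>T\<^esub>) F u"
    by (rule ex_pres_by[OF assms, where a="\<lambda>_ _. \<zero>\<^bsub>T\<^esub>" and m=0 and n=1]) auto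
  show thesis
  proof (rule that[of F "u 0"])
    show "fin_presented T F" using P by (rule pres_by_fin_presented)
    show "u 0 \<in> carrier F" using pres_byD(3)[OF P] by auto
    fix X :: "'a umodule" and x assume X: "left_module T X" and x: "x \<in> carrier X"
    have "(\<lambda>i\<in>{..<1::nat}. x) \<in> sols X 0 1 (\<lambda>_ _. \<zero>\<^bsub>T\<^esub>)" using x by (simp add: tuples_def)
    then obtain h where "h \<in> lin_hom T F X" "\<And>i. i < 1 \<Longrightarrow> h (u i) = (\<lambda>i\<in>{..<1::nat}. x) i"
      using pres_by_universal[OF P X] by blast
    then show "\<exists>h\<in>lin_hom T F X. h (u 0) = x" by (intro bexI[of _ h]) auto
  next
    fix X :: "'a umodule" and h k assume *: "left_module T X" "h \<in> lin_hom T F X" "k \<in> lin_hom T F X" "h (u 0) = k (u 0)"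
    show "h = k" by (rule pres_by_hom_eqI[OF P *(1-3)]) (use *(4) in simp)
  qed
qed

lemma fp_mod_kernel:
  fixes A B D :: "'a umodule"
  assumes T: "ring T" and A: "fin_presented T A" and B: "fin_presented T B" and D: "fin_presented T D"
    and f: "f \<in> lin_hom T A B" and g: "g \<in> lin_hom T B D" and k: "cat_kernel (fp_mod T) A B D f g"
  shows "inj_on f (carrier A)" "b \<in> carrier B \<Longrightarrow> g b = \<zero>\<^bsub>D\<^esub> \<longleftrightarrow> b \<in> f ` carrier A"
proof -
  have lA: "left_module T A" and lB: "left_module T B" and lD: "left_module T D"
    using A B D by (auto intro: fin_presented_left_module)
  obtain F :: "'a umodule" and e where F: "fin_presented T F" and e: "e \<in> carrier F"
    and ex: "\<And>X x. left_module T X \<Longrightarrow> x \<in> carrier X \<Longrightarrow> \<exists>h\<in>lin_hom T F X. h e = (x :: 'a univ)"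
    and un: "\<And>X h k. left_module T X \<Longrightarrow> h \<in> lin_hom T F X \<Longrightarrow> k \<in> lin_hom T F X \<Longrightarrow> h e = (k e :: 'a univ) \<Longrightarrow> h = k"
    using ex_free_generator[OF T] by blast
  have lF: "left_module T F" using F by (rule fin_presented_left_module)
  have gf: "g (f a) = \<zero>\<^bsub>D\<^esub>" if "a \<in> carrier A" for a
  proof -
    have "compose (carrier A) g f = (\<lambda>x\<in>carrier A. \<zero>\<^bsub>D\<^esub>)" using k by (simp add: cat_kernel_def)
    from fun_cong[OF this, of a] show ?thesis using that by (simp add: compose_def)
  qed
  have uni: "\<exists>!u. u \<in> lin_hom T F A \<and> compose (carrier F) f u = t"
    if "t \<in> lin_hom T F B" "compose (carrier F) g t = (\<lambda>x\<in>carrier F. \<zero>\<^bsub>D\<^esub>)" for t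
    using k that F by (auto simp: cat_kernel_def)
  show "inj_on f (carrier A)"
  proof (rule inj_onI)
    fix a a' assume a: "a \<in> carrier A" "a' \<in> carrier A" "f a = f a'"
    obtain h where h: "h \<in> lin_hom T F A" "h e = a" using ex[OF lA a(1)] by auto
    obtain h' where h': "h' \<in> lin_hom T F A" "h' e = a'" using ex[OF lA a(2)] by auto
    note fh = lin_hom_compose[OF h(1) f lF] and fh' = lin_hom_compose[OF h'(1) f lF]
    have eq: "compose (carrier F) f h = compose (carrier F) f h'"
      by (rule un[OF lB fh fh']) (use h h' a e in \<open>simp add: compose_def\<close>)
    have "compose (carrier F) g (compose (carrier F) f h) = (\<lambda>x\<in>carrier F. \<zero>\<^bsub>D\<^esub>)"
      using gf lin_hom_closed[OF h(1)] by (auto simp: compose_def fun_eq_iff)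
    from uni[OF fh this] have "h = h'" using h(1) h'(1) eq by auto
    then show "a = a'" using h h' by simp
  qed
  show "b \<in> carrier B \<Longrightarrow> g b = \<zero>\<^bsub>D\<^esub> \<longleftrightarrow> b \<in> f ` carrier A"
  proof
    assume b: "b \<in> carrier B" "g b = \<zero>\<^bsub>D\<^esub>"
    obtain h where h: "h \<in> lin_hom T F B" "h e = b" using ex[OF lB b(1)] by auto
    have "compose (carrier F) g h = (\<lambda>x\<in>carrier F. \<zero>\<^bsub>D\<^esub>)"
      by (rule un[OF lD lin_hom_compose[OF h(1) g lF] lin_hom_const_zero[OF lF lD]]) (use h b e in \<open>simp add: compose_def\<close>)
    then obtain u where u: "u \<in> lin_hom T F A" "compose (carrier F) f u = h" using uni[OF h(1)] by blast
    have "b = f (u e)" using fun_cong[OF u(2), of e] h e by (simp add: compose_def)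
    then show "b \<in> f ` carrier A" using lin_hom_closed[OF u(1) e] by blast
  qed (use gf in auto)
qed

lemma cat_cokernel_epi:
  fixes A B D X :: "'a umodule"
  assumes B: "fin_presented T B" and D: "fin_presented T D" and X: "fin_presented T X"
    and g: "g \<in> lin_hom T B D" and f: "f \<in> lin_hom T A B" and A: "fin_presented T A"
    and k: "cat_cokernel (fp_mod T) A B D f g"
    and t: "t \<in> lin_hom T D X" "t' \<in> lin_hom T D X" and eq: "\<And>b. b \<in> carrier B \<Longrightarrow> t (g b) = t' (g b)"
  shows "t = t'"
proof -
  have lB: "left_module T B" and lA: "left_module T A" using A B by (auto intro: fin_presented_left_module)
  have gf: "g (f a) = \<zero>\<^bsub>D\<^esub>" if "a \<in> carrier A" for a
  proof -
    have "compose (carrier A) g f = (\<lambda>x\<in>carrier A. \<zero>\<^bsub>D\<^esub>)" using k by (simp add: cat_cokernel_def)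
    from fun_cong[OF this, of a] show ?thesis using that by (simp add: compose_def)
  qed
  have tg: "compose (carrier B) t g \<in> lin_hom T B X" using lin_hom_compose[OF g t(1) lB] .
  have "compose (carrier A) (compose (carrier B) t g) f = (\<lambda>x\<in>carrier A. \<zero>\<^bsub>X\<^esub>)"
    using gf lin_hom_closed[OF f] lin_hom_zero[OF t(1) fin_presented_left_module[OF D] fin_presented_left_module[OF X]]
    by (auto simp: compose_def fun_eq_iff)
  moreover have "\<forall>Y\<in>cObj (fp_mod T). \<forall>s\<in>lin_hom T B Y. compose (carrier A) s f = (\<lambda>x\<in>carrier A. \<zero>\<^bsub>Y\<^esub>) \<longrightarrow>
      (\<exists>!u. u \<in> lin_hom T D Y \<and> compose (carrier B) u g = s)"
    using k by (simp add: cat_cokernel_def)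
  moreover have "X \<in> cObj (fp_mod T)" using X by simp
  ultimately have "\<exists>!u. u \<in> lin_hom T D X \<and> compose (carrier B) u g = compose (carrier B) t g"
    using tg by blast
  moreover have "compose (carrier B) t' g = compose (carrier B) t g"
    using eq by (auto simp: compose_def fun_eq_iff)
  ultimately show ?thesis using t by auto
qed

text \<open>If \<open>D\<close> is generated by \<open>u\<close>, the cokernel of \<open>g\<close> is presented by the relations of \<open>u\<close>
  together with the images of the generators of \<open>B\<close>.\<close>

lemma cat_cokernel_surj:
  fixes A B D :: "'a umodule"
  assumes T: "ring T" and A: "fin_presented T A" and B: "fin_presented T B" and D: "fin_presented T D"
    and f: "f \<in> lin_hom T A B" and g: "g \<in> lin_hom T B D" and k: "cat_cokernel (fp_mod T) A B D f g"
  shows "g ` carrier B = carrier D"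
proof (intro equalityI subsetI)
  obtain m n a u where PD: "pres_by T m n a D u" using fin_presented_pres_by[OF D] .
  obtain m2 l c v where PB: "pres_by T m2 l c B v" using fin_presented_pres_by[OF B] .
  note D' = pres_byD[OF PD] and B' = pres_byD[OF PB]
  interpret D: left_module T D by (rule D')
  interpret B: left_module T B by (rule B')
  interpret T: ring T by fact
  have "\<exists>d\<in>UNIV \<rightarrow> carrier T. g (v j) = lincomb D n d u" if "j < l" for j
    using D'(4)[OF lin_hom_closed[OF g]] B'(3) that by auto
  then obtain d0 where d0: "\<And>j. j < l \<Longrightarrow> d0 j \<in> UNIV \<rightarrow> carrier T" "\<And>j. j < l \<Longrightarrow> g (v j) = lincomb D n (d0 j) u"
    by metis
  define a' where "a' i = (if i < m then a i else if i - m < l then d0 (i - m) else (\<lambda>_. \<zero>\<^bsub>T\<^esub>))" for i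
  have a': "a' \<in> UNIV \<rightarrow> UNIV \<rightarrow> carrier T"
    using D'(2) d0(1) by (auto simp: a'_def Pi_iff)
  obtain Q :: "'a umodule" and w where PQ: "pres_by T (m + l) n a' Q w" using ex_pres_by[OF T a'] .
  note Q' = pres_byD[OF PQ]
  interpret Q: left_module T Q by (rule Q')
  have fQ: "fin_presented T Q" using PQ by (rule pres_by_fin_presented)
  have w: "restrict w {..<n} \<in> sols Q (m + l) n a'" by (rule pres_by_sols[OF PQ])
  have "restrict w {..<n} \<in> sols Q m n a"
    unfolding sols_def
  proof (intro CollectI conjI allI impI)
    show "restrict w {..<n} \<in> tuples Q n" using w by (rule sols_tuples)
    fix i assume "i < m"
    then have "a' i = a i" "i < m + l" by (auto simp: a'_def)
    then show "lincomb Q n (a i) (restrict w {..<n}) = \<zero>\<^bsub>Q\<^esub>" using w by (auto simp: sols_def)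
  qed
  then obtain t where t: "t \<in> lin_hom T D Q" "\<And>i. i < n \<Longrightarrow> t (u i) = restrict w {..<n} i"
    using pres_by_universal[OF PD Q'(1)] by blast
  have tgv: "t (g (v j)) = \<zero>\<^bsub>Q\<^esub>" if j: "j < l" for j
  proof -
    have "t (g (v j)) = lincomb Q n (d0 j) (\<lambda>i. t (u i))"
      unfolding d0(2)[OF j] by (rule lincomb_lin_hom[OF t(1) D'(1) Q'(1) d0(1)[OF j] D'(3)])
    also have "\<dots> = lincomb Q n (a' (m + j)) (restrict w {..<n})"
      by (rule Q.lincomb_cong) (use d0(1)[OF j] t(2) j Q'(3) in \<open>auto simp: a'_def\<close>)
    also have "\<dots> = \<zero>\<^bsub>Q\<^esub>" using w j by (auto simp: sols_def)
    finally show ?thesis .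
  qed
  note zB = lin_hom_const_zero[OF B'(1) Q'(1)] and zD = lin_hom_const_zero[OF D'(1) Q'(1)]
  have tg0: "compose (carrier B) t g = (\<lambda>x\<in>carrier B. \<zero>\<^bsub>Q\<^esub>)"
    by (rule pres_by_hom_eqI[OF PB Q'(1) lin_hom_compose[OF g t(1) B'(1)] zB])
      (use tgv B'(3) in \<open>auto simp: compose_def\<close>)
  have tg: "t (g b) = \<zero>\<^bsub>Q\<^esub>" if b: "b \<in> carrier B" for b
    using fun_cong[OF tg0, of b] b by (simp add: compose_def)
  have t0: "t = (\<lambda>x\<in>carrier D. \<zero>\<^bsub>Q\<^esub>)"
    by (rule cat_cokernel_epi[OF B D fQ g f A k t(1) zD]) (use tg lin_hom_closed[OF g] in simp)
  have w0: "w i = \<zero>\<^bsub>Q\<^esub>" if "i < n" for i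
  proof -
    have ui: "u i \<in> carrier D" using D'(3) that by auto
    have "t (u i) = \<zero>\<^bsub>Q\<^esub>" unfolding t0 using ui by simp
    then show ?thesis using t(2)[OF that] that by simp
  qed
  have img: "\<exists>b\<in>carrier B. y = g b" if y: "y \<in> carrier D" for y
  proof -
    obtain c where c: "c \<in> UNIV \<rightarrow> carrier T" "y = lincomb D n c u" using D'(4)[OF y] by blast
    have "lincomb Q n c w = lincomb Q n c (\<lambda>_. \<zero>\<^bsub>Q\<^esub>)"
      by (rule Q.lincomb_cong) (use c w0 in auto)
    then have "lincomb Q n c w = \<zero>\<^bsub>Q\<^esub>" using Q.lincomb_zero_right[OF c(1)] by simp
    then obtain s where s: "s \<in> UNIV \<rightarrow> carrier T" "\<forall>j<n. c j = lincomb (regular_module T) (m + l) s (\<lambda>i. a' i j)"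
      using Q'(5)[OF c(1)] by blast
    have "lincomb D n c u = lincomb D n (\<lambda>j. lincomb (regular_module T) (m + l) s (\<lambda>i. a' i j)) u"
      by (rule D.lincomb_cong) (use c s D'(3) in auto)
    also have "\<dots> = lincomb D (m + l) s (\<lambda>i. lincomb D n (a' i) u)" by (rule D.lincomb_lincomb[OF s(1) a' D'(3)])
    finally have ys: "y = lincomb D (m + l) s (\<lambda>i. lincomb D n (a' i) u)" using c by simp
    define b where "b i = (if i < m then \<zero>\<^bsub>B\<^esub> else v (i - m))" for i
    have bc: "b \<in> {..<m + l} \<rightarrow> carrier B" using B'(3) by (auto simp: b_def Pi_iff)
    have gb: "lincomb D n (a' i) u = g (b i)" if i: "i < m + l" for i
    proof (cases "i < m")
      case True
      have "lincomb D n (a i) (restrict u {..<n}) = \<zero>\<^bsub>D\<^esub>" using pres_by_sols[OF PD] True by (auto simp: sols_def)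
      moreover have "lincomb D n (a i) (restrict u {..<n}) = lincomb D n (a i) u"
        by (rule D.lincomb_cong) (use D'(2,3) in auto)
      ultimately show ?thesis using True lin_hom_zero[OF g B'(1) D'(1)] by (simp add: a'_def b_def)
    next
      case False
      then have "i - m < l" using i by simp
      then show ?thesis using d0(2)[of "i - m"] False by (simp add: a'_def b_def)
    qed
    have "g (lincomb B (m + l) s b) = lincomb D (m + l) s (\<lambda>i. g (b i))"
      by (rule lincomb_lin_hom[OF g B'(1) D'(1) s(1) bc])
    also have "\<dots> = y" unfolding ys
      by (rule D.lincomb_cong) (use s gb bc lin_hom_closed[OF g] in \<open>auto simp: Pi_iff\<close>)
    finally show ?thesis using B.lincomb_closed[OF s(1) bc] by blast
  qed
  show "y \<in> g ` carrier B" if "y \<in> carrier D" for y using img[OF that] by blast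
  show "y \<in> carrier D" if "y \<in> g ` carrier B" for y using that lin_hom_closed[OF g] by auto
qed

lemma module_length_eq_0:
  fixes M :: "('a, 'b) module"
  assumes "left_module R M"
  shows "module_length R M = 0 \<longleftrightarrow> carrier M = {\<zero>\<^bsub>M\<^esub>}"
proof -
  interpret M: left_module R M by fact
  let ?N = "{n. \<exists>U :: nat \<Rightarrow> 'b set. (\<forall>i\<le>n. submodule (U i) R M) \<and> (\<forall>i<n. U i \<subset> U (Suc i))}"
  have "module_length R M = 0 \<longleftrightarrow> (\<forall>n\<in>?N. n = 0)"
    unfolding module_length_def le_zero_eq[symmetric] SUP_le_iff by (simp add: zero_enat_def)
  also have "\<dots> \<longleftrightarrow> carrier M = {\<zero>\<^bsub>M\<^esub>}"
  proof
    assume l: "\<forall>n\<in>?N. n = 0"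
    show "carrier M = {\<zero>\<^bsub>M\<^esub>}"
    proof (rule ccontr)
      assume ne: "carrier M \<noteq> {\<zero>\<^bsub>M\<^esub>}"
      have g: "group (add_monoid M)" by (rule M.a_group)
      have "submodule {\<zero>\<^bsub>M\<^esub>} R M" "submodule (carrier M) R M"
        using group.triv_subgroup[OF g] group.subgroup_self[OF g]
        by (auto intro!: submodule.intro submodule_axioms.intro M.smult_closed)
      then have "1 \<in> ?N"
        using ne by (intro CollectI exI[of _ "\<lambda>i. if i = 0 then {\<zero>\<^bsub>M\<^esub>} else carrier M"]) auto
      then show False using l by auto
    qed
  next
    assume c: "carrier M = {\<zero>\<^bsub>M\<^esub>}"
    have "U = {\<zero>\<^bsub>M\<^esub>}" if "submodule U R M" for U
    proof -
      interpret U: submodule U R M by fact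
      show ?thesis using U.subset U.one_closed c by auto
    qed
    note sub = this
    show "\<forall>n\<in>?N. n = 0"
    proof (intro ballI, rule ccontr)
      fix n assume "n \<in> ?N" and n: "n \<noteq> 0"
      then obtain U :: "nat \<Rightarrow> 'b set" where U: "\<forall>i\<le>n. submodule (U i) R M" "\<forall>i<n. U i \<subset> U (Suc i)" by blast
      have "U 0 = {\<zero>\<^bsub>M\<^esub>}" "U (Suc 0) = {\<zero>\<^bsub>M\<^esub>}" using sub U(1) n by simp_all
      moreover have "U 0 \<subset> U (Suc 0)" using U(2) n by simp
      ultimately show False by simp
    qed
  qed
  finally show ?thesis .
qed

section \<open>Covdefect on functors given by linear systems\<close>

lemma tensor_map_compose:
  assumes "tensor_product R A M" "tensor_product R B M" "tensor_product R D M"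
    and f: "f \<in> lin_hom (opp R) A B" and g: "g \<in> lin_hom (opp R) B D" and t: "t \<in> carrier (tensor R A M)"
  shows "tensor_map R B M D M g (\<lambda>m. m) (tensor_map R A M B M f (\<lambda>m. m) t) =
    tensor_map R A M D M (compose (carrier A) g f) (\<lambda>m. m) t"
proof -
  interpret A: tensor_product R A M by fact
  interpret B: tensor_product R B M by fact
  interpret D: tensor_product R D M by fact
  have h: "compose (carrier A) g f \<in> lin_hom (opp R) A D" by (rule lin_hom_compose[OF f g A.lA])
  note tf = tensor_map_props[OF assms(1,2) lin_hom_restrict[OF f] restrict_id_lin_hom[OF A.lM]]
  note tg = tensor_map_props[OF assms(2,3) lin_hom_restrict[OF g] restrict_id_lin_hom[OF A.lM]]
  note th = tensor_map_props[OF assms(1,3) lin_hom_restrict[OF h] restrict_id_lin_hom[OF A.lM]]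
  have 1: "(\<lambda>t. tensor_map R B M D M g (\<lambda>m. m) (tensor_map R A M B M f (\<lambda>m. m) t)) \<in> hom A.T D.T"
    using hom_in_carrier[OF tf(1)] hom_mult[OF tf(1)] hom_in_carrier[OF tg(1)] hom_mult[OF tg(1)] by (intro homI) auto
  show ?thesis
    by (rule A.hom_tensor_eqI[OF D.TG.is_group 1 th(1) _ t])
      (simp add: tf(2) tg(2) th(2) lin_hom_closed[OF f] compose_eq)
qed

lemma (in tensor_product) pt_zero_left: "m \<in> carrier M \<Longrightarrow> pt \<zero>\<^bsub>A\<^esub> m = \<one>\<^bsub>T\<^esub>"
  using pt_add_left[of "\<zero>\<^bsub>A\<^esub>" "\<zero>\<^bsub>A\<^esub>" m] pt_closed[of "\<zero>\<^bsub>A\<^esub>" m] by simp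

lemma tensor_map_const_zero:
  assumes "tensor_product R A M" "tensor_product R B M" "t \<in> carrier (tensor R A M)"
  shows "tensor_map R A M B M (\<lambda>x\<in>carrier A. \<zero>\<^bsub>B\<^esub>) (\<lambda>m. m) t = \<one>\<^bsub>tensor R B M\<^esub>"
proof -
  interpret A: tensor_product R A M by fact
  interpret B: tensor_product R B M by fact
  note z = lin_hom_const_zero[OF A.lA B.lA]
  note tz = tensor_map_props[OF assms(1,2) lin_hom_restrict[OF z] restrict_id_lin_hom[OF A.lM]]
  have 1: "(\<lambda>t. \<one>\<^bsub>B.T\<^esub>) \<in> hom A.T B.T" by (rule homI) auto
  show ?thesis
    by (rule A.hom_tensor_eqI[OF B.TG.is_group tz(1) 1 _ assms(3)]) (simp add: tz(2) B.pt_zero_left)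
qed

lemma tzero_image:
  "{tzero X n} = mat_app X n 0 L ` sols X 0 0 b" if "left_module S X" for X :: "('s, 'x) module"
proof -
  interpret X: left_module S X by fact
  have "tuples X 0 = {\<lambda>_. undefined}" by (auto simp: tuples_def)
  then show ?thesis by (simp add: mat_app_def tzero_def)
qed

lemma mat_app_eq_tzero_iff: "x \<in> tuples X n \<Longrightarrow> mat_app X m n a x = tzero X m \<longleftrightarrow> x \<in> sols X m n a"
  by (auto simp: mat_app_def tzero_def sols_def fun_eq_iff)

lemma scaled_vector_sols:
  assumes X: "left_module S X" and v: "v \<in> sols (regular_module S) m n a" and y: "y \<in> carrier X"
    and a: "a \<in> UNIV \<rightarrow> UNIV \<rightarrow> carrier S"
  shows "scaled_vector X n v y \<in> sols X m n a"
proof -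
  interpret X: left_module S X by fact
  note vt = sols_tuples[OF v]
  have "mat_app X m n a (scaled_vector X n v y) = scaled_vector X m (mat_app (regular_module S) m n a v) y"
    by (rule mat_app_scaled_vector[OF X vt y a])
  also have "mat_app (regular_module S) m n a v = tzero (regular_module S) m"
    using mat_app_eq_tzero_iff[OF vt] v by blast
  also have "scaled_vector X m (tzero (regular_module S) m) y = tzero X m"
    using y by (auto simp: scaled_vector_def tzero_def fun_eq_iff)
  finally show ?thesis using mat_app_eq_tzero_iff[OF scaled_vector_tuples[OF X vt y]] by blast
qed

locale covdefect =
  fixes S :: "('s, 'f) ring_scheme" and C :: "'s covdefect_functor" and \<theta> :: "'s umodule \<Rightarrow> 's umap"
  assumes ringS: "ring S" and exC: "exact_functor (fp_functor_cat S) (fp_mod (opp S)) C"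
    and \<theta>_iso: "\<And>N. fin_presented (opp S) N \<Longrightarrow> cat_iso (fp_mod (opp S)) (fObj C (tensor_functor S N)) N (\<theta> N)"
    and \<theta>_nat: "\<And>N N' f. fin_presented (opp S) N \<Longrightarrow> fin_presented (opp S) N' \<Longrightarrow> f \<in> lin_hom (opp S) N N' \<Longrightarrow>
      compose (carrier (fObj C (tensor_functor S N))) (\<theta> N') (fArr C (tensor_functor S N) (tensor_functor S N') (tensor_trans S N N' f)) =
      compose (carrier (fObj C (tensor_functor S N))) f (\<theta> N)"
begin

abbreviation "CO \<equiv> fObj C"
abbreviation "CA \<equiv> fArr C"

lemma ring_oppS: "ring (opp S)" by (rule ring_opp[OF ringS])

lemma CO_fp: "F \<in> fp_functors S \<Longrightarrow> fin_presented (opp S) (CO F)"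
  using exC by (simp add: exact_functor_def additive_functor_def)

lemma CO_left_module: "F \<in> fp_functors S \<Longrightarrow> left_module (opp S) (CO F)"
  by (rule fin_presented_left_module[OF CO_fp])

lemma CA_lin_hom: "F \<in> fp_functors S \<Longrightarrow> G \<in> fp_functors S \<Longrightarrow> \<eta> \<in> nat_trans S F G \<Longrightarrow> CA F G \<eta> \<in> lin_hom (opp S) (CO F) (CO G)"
  using exC by (simp add: exact_functor_def additive_functor_def)

definition "ncomp F \<zeta> \<eta> = (\<lambda>X\<in>cObj (fp_mod S). compose (carrier (fObj F X)) (\<zeta> X) (\<eta> X))"

lemma ncomp_apply: "fin_presented S X \<Longrightarrow> c \<in> carrier (fObj F X) \<Longrightarrow> ncomp F \<zeta> \<eta> X c = \<zeta> X (\<eta> X c)"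
  by (simp add: ncomp_def compose_def)

lemma ncomp_nat_trans: "F \<in> fp_functors S \<Longrightarrow> \<eta> \<in> nat_trans S F G \<Longrightarrow> \<zeta> \<in> nat_trans S G H \<Longrightarrow> ncomp F \<zeta> \<eta> \<in> nat_trans S F H"
  unfolding ncomp_def by (intro nat_trans_comp fp_functors_additive)

lemma CA_ncomp:
  "F \<in> fp_functors S \<Longrightarrow> G \<in> fp_functors S \<Longrightarrow> H \<in> fp_functors S \<Longrightarrow> \<eta> \<in> nat_trans S F G \<Longrightarrow> \<zeta> \<in> nat_trans S G H \<Longrightarrow>
    CA F H (ncomp F \<zeta> \<eta>) = compose (carrier (CO F)) (CA G H \<zeta>) (CA F G \<eta>)"
  using exC by (simp add: exact_functor_def additive_functor_def ncomp_def)

lemma CA_short_exact: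
  assumes "short_exact (fp_functor_cat S) F G H \<eta> \<zeta>"
  shows "inj_on (CA F G \<eta>) (carrier (CO F))"
    and "x \<in> carrier (CO G) \<Longrightarrow> CA G H \<zeta> x = \<zero>\<^bsub>CO H\<^esub> \<longleftrightarrow> x \<in> CA F G \<eta> ` carrier (CO F)"
    and "CA G H \<zeta> ` carrier (CO G) = carrier (CO H)"
    and "cat_cokernel (fp_mod (opp S)) (CO F) (CO G) (CO H) (CA F G \<eta>) (CA G H \<zeta>)"
    and "F \<in> fp_functors S" "G \<in> fp_functors S" "H \<in> fp_functors S" "\<eta> \<in> nat_trans S F G" "\<zeta> \<in> nat_trans S G H"
proof -
  show fp: "F \<in> fp_functors S" "G \<in> fp_functors S" "H \<in> fp_functors S" "\<eta> \<in> nat_trans S F G" "\<zeta> \<in> nat_trans S G H"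
    using assms by (auto simp: short_exact_def)
  have se: "short_exact (fp_mod (opp S)) (CO F) (CO G) (CO H) (CA F G \<eta>) (CA G H \<zeta>)"
    using exC assms by (simp add: exact_functor_def)
  then have k: "cat_kernel (fp_mod (opp S)) (CO F) (CO G) (CO H) (CA F G \<eta>) (CA G H \<zeta>)"
    and ck: "cat_cokernel (fp_mod (opp S)) (CO F) (CO G) (CO H) (CA F G \<eta>) (CA G H \<zeta>)"
    by (auto simp: short_exact_def)
  note o = CO_fp[OF fp(1)] CO_fp[OF fp(2)] CO_fp[OF fp(3)] CA_lin_hom[OF fp(1,2,4)] CA_lin_hom[OF fp(2,3,5)]
  show "inj_on (CA F G \<eta>) (carrier (CO F))"
    "x \<in> carrier (CO G) \<Longrightarrow> CA G H \<zeta> x = \<zero>\<^bsub>CO H\<^esub> \<longleftrightarrow> x \<in> CA F G \<eta> ` carrier (CO F)"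
    by (rule fp_mod_kernel[OF ring_oppS o k])+
  show "CA G H \<zeta> ` carrier (CO G) = carrier (CO H)" by (rule cat_cokernel_surj[OF ring_oppS o ck])
  show "cat_cokernel (fp_mod (opp S)) (CO F) (CO G) (CO H) (CA F G \<eta>) (CA G H \<zeta>)" by (rule ck)
qed

lemma \<theta>_lin_hom: "fin_presented (opp S) N \<Longrightarrow> \<theta> N \<in> lin_hom (opp S) (CO (tensor_functor S N)) N"
  using \<theta>_iso by (simp add: cat_iso_def)

lemma \<theta>_bij:
  assumes "fin_presented (opp S) N"
  shows "bij_betw (\<theta> N) (carrier (CO (tensor_functor S N))) (carrier N)"
proof -
  let ?A = "carrier (CO (tensor_functor S N))"
  obtain g where g: "g \<in> lin_hom (opp S) N (CO (tensor_functor S N))"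
    "compose ?A g (\<theta> N) = (\<lambda>x\<in>?A. x)" "compose (carrier N) (\<theta> N) g = (\<lambda>x\<in>carrier N. x)"
    using \<theta>_iso[OF assms] by (auto simp: cat_iso_def)
  have gt: "g (\<theta> N x) = x" if "x \<in> ?A" for x using fun_cong[OF g(2), of x] that by (simp add: compose_def)
  have tg: "\<theta> N (g y) = y" if "y \<in> carrier N" for y using fun_cong[OF g(3), of y] that by (simp add: compose_def)
  show ?thesis
    by (rule bij_betw_byWitness[of _ g])
      (use gt tg lin_hom_closed[OF g(1)] lin_hom_closed[OF \<theta>_lin_hom[OF assms]] in auto)
qed

lemma ex_solution_functor:
  fixes P P'
  assumes a: "a \<in> UNIV \<rightarrow> UNIV \<rightarrow> carrier S" and b: "b \<in> UNIV \<rightarrow> UNIV \<rightarrow> carrier S"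
    and L: "L \<in> UNIV \<rightarrow> UNIV \<rightarrow> carrier S"
    and sub: "\<And>X. fin_presented S X \<Longrightarrow> P' X \<subseteq> sols X m n a"
    and P': "\<And>X. fin_presented S X \<Longrightarrow> P' X = mat_app X n n' L ` sols X m' n' b"
  obtains F :: "('s, 's uval) mod_functor" and p where "tuple_functor S n (\<lambda>X. sols X m n a) P' F p" "F \<in> fp_functors S"
proof -
  have nP': "natural_subgroup S n P'"
    using natural_subgroup_mat_app[OF L natural_subgroup_sols[OF b], of n n' m'] P' unfolding natural_subgroup_def by simp
  obtain F :: "('s, 's uval) mod_functor" and p where F: "tuple_functor S n (\<lambda>X. sols X m n a) P' F p"
    using ex_tuple_functor[OF natural_subgroup_sols[OF a] nP' sub] by blast
  show thesis by (rule that[OF F tuple_functor_fp[OF ringS a b L sub P' F]])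
qed

lemma zero_mat: "(\<lambda>_ _. \<zero>\<^bsub>S\<^esub>) \<in> UNIV \<rightarrow> UNIV \<rightarrow> carrier S"
proof -
  interpret ring S by (rule ringS)
  show ?thesis by auto
qed

lemma delta_mat: "(\<lambda>i j. if j = i then \<one>\<^bsub>S\<^esub> else \<zero>\<^bsub>S\<^esub>) \<in> UNIV \<rightarrow> UNIV \<rightarrow> carrier S"
proof -
  interpret ring S by (rule ringS)
  show ?thesis by auto
qed

lemma ex_kernel_functor:
  assumes a: "a \<in> UNIV \<rightarrow> UNIV \<rightarrow> carrier S"
  obtains F :: "('s, 's uval) mod_functor" and p where
    "tuple_functor S n (\<lambda>X. sols X m n a) (\<lambda>X. {tzero X n}) F p" "F \<in> fp_functors S"
proof (rule ex_solution_functor[OF a zero_mat zero_mat, of "\<lambda>X. {tzero X n}" m n 0 0])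
  fix X assume X: "fin_presented S X"
  interpret X: left_module S X using X by (rule fin_presented_left_module)
  show "{tzero X n} \<subseteq> sols X m n a" using subgroup.one_closed[OF X.subgroup_sols[OF a, of m n]] by simp
  show "{tzero X n} = mat_app X n 0 (\<lambda>_ _. \<zero>\<^bsub>S\<^esub>) ` sols X 0 0 (\<lambda>_ _. \<zero>\<^bsub>S\<^esub>)"
    by (rule tzero_image[OF X.left_module_axioms])
qed (rule that)

lemma id_image: "left_module S X \<Longrightarrow> P \<subseteq> tuples X n \<Longrightarrow> mat_app X n n (\<lambda>i j. if j = i then \<one>\<^bsub>S\<^esub> else \<zero>\<^bsub>S\<^esub>) ` P = P"
proof -
  assume X: "left_module S X" and P: "P \<subseteq> tuples X n"
  have "mat_app X n n (\<lambda>i j. if j = i then \<one>\<^bsub>S\<^esub> else \<zero>\<^bsub>S\<^esub>) ` P = (\<lambda>x. x) ` P"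
    by (rule image_cong) (use left_module.mat_app_delta[OF X] P in auto)
  then show ?thesis by simp
qed

end

locale covdefect_pair = covdefect S C \<theta> + free_right_pair S n F \<rho> m G \<tau> a
  for S :: "('s, 'f) ring_scheme" and C \<theta> n F \<rho> m G \<tau> a
begin

text \<open>The copresentation \<open>0 \<rightarrow> V \<rightarrow> S\<^sup>n \<otimes> - \<rightarrow> S\<^sup>m \<otimes> -\<close> is sent to
  \<open>0 \<rightarrow> C V \<rightarrow> S\<^sup>n \<rightarrow> S\<^sup>m\<close>.\<close>

lemma covdefect_kernel:
  assumes V: "tuple_functor S n (\<lambda>X. sols X m n a) (\<lambda>X. {tzero X n}) V p" and Vfp: "V \<in> fp_functors S"
  obtains \<iota> where "\<iota> \<in> nat_trans S V (tensor_functor S F)"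
    "\<And>X x. fin_presented S X \<Longrightarrow> x \<in> sols X m n a \<Longrightarrow> \<iota> X (p X x) = F.tuple_tensor X x"
    "inj_on (\<lambda>x. \<theta> F (CA V (tensor_functor S F) \<iota> x)) (carrier (CO V))"
    "(\<lambda>x. \<theta> F (CA V (tensor_functor S F) \<iota> x)) ` carrier (CO V) = {f \<in> carrier F. \<rho> f \<in> sols (regular_module S) m n a}"
proof -
  let ?z = "\<lambda>_ _. \<zero>\<^bsub>S\<^esub>"
  let ?T = "tensor_functor S F" and ?U = "tensor_functor S G"
  note Tt = F.tuple_functor_tensor and Ut = G.tuple_functor_tensor
  note Tfp = F.tensor_functor_fp and Ufp = G.tensor_functor_fp
  have nt: "natural_subgroup S k (\<lambda>X. tuples X k)" for k using natural_subgroup_sols[OF zero_mat, of k 0] by simp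
  have ns: "natural_subgroup S n (\<lambda>X. sols X m n a)" by (rule natural_subgroup_sols[OF a])
  have st: "sols X m n a \<subseteq> tuples X n" for X :: "'s umodule" using sols_tuples by auto
  obtain I :: "('s, 's uval) mod_functor" and r where I: "tuple_functor S n (\<lambda>X. tuples X n) (\<lambda>X. sols X m n a) I r" and Ifp: "I \<in> fp_functors S"
  proof (rule ex_solution_functor[OF zero_mat a delta_mat, of "\<lambda>X. sols X m n a" 0 n n m])
    show "sols X m n a \<subseteq> sols X 0 n ?z" for X :: "'s umodule" using st by simp
    show "sols X m n a = mat_app X n n (\<lambda>i j. if j = i then \<one>\<^bsub>S\<^esub> else \<zero>\<^bsub>S\<^esub>) ` sols X m n a" if "fin_presented S X" for X :: "'s umodule"
      using id_image[OF fin_presented_left_module[OF that] st] ..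
  qed simp
  obtain Q :: "('s, 's uval) mod_functor" and s where Q: "tuple_functor S m (\<lambda>X. tuples X m) (\<lambda>X. mat_app X m n a ` tuples X n) Q s" and Qfp: "Q \<in> fp_functors S"
  proof (rule ex_solution_functor[OF zero_mat zero_mat a, of "\<lambda>X. mat_app X m n a ` tuples X n" 0 m n 0])
    show "mat_app X m n a ` tuples X n \<subseteq> sols X 0 m ?z" if "fin_presented S X" for X
      using left_module.mat_app_tuples[OF fin_presented_left_module[OF that] a] by auto
  qed auto
  obtain \<iota> \<zeta> where se1: "short_exact (fp_functor_cat S) V ?T I \<iota> \<zeta>"
    and \<iota>: "\<And>X x. fin_presented S X \<Longrightarrow> x \<in> sols X m n a \<Longrightarrow> \<iota> X (p X x) = F.tuple_tensor X x"
    and \<zeta>: "\<And>X x. fin_presented S X \<Longrightarrow> x \<in> tuples X n \<Longrightarrow> \<zeta> X (F.tuple_tensor X x) = r X x"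
    by (rule ex_short_exact[OF ns nt V Tt I Vfp Tfp Ifp, of "\<lambda>X x. x"]) (use st in auto)
  obtain \<eta> \<xi> where se2: "short_exact (fp_functor_cat S) I ?U Q \<eta> \<xi>"
    and \<eta>: "\<And>X x. fin_presented S X \<Longrightarrow> x \<in> tuples X n \<Longrightarrow> \<eta> X (r X x) = G.tuple_tensor X (mat_app X m n a x)"
  proof (rule ex_short_exact[OF nt nt I Ut Q Ifp Ufp Qfp, of "\<lambda>X x. mat_app X m n a x"])
    fix X :: "'s umodule" and x assume X: "fin_presented S X" and x: "x \<in> tuples X n"
    interpret X: left_module S X using X by (rule fin_presented_left_module)
    show "mat_app X m n a x \<in> tuples X m" by (rule X.mat_app_tuples[OF a x])
    show "mat_app X m n a x = tzero X m \<longleftrightarrow> x \<in> sols X m n a" by (rule mat_app_eq_tzero_iff[OF x])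
    show "mat_app X m n a (tadd X n x y) = tadd X m (mat_app X m n a x) (mat_app X m n a y)" if "y \<in> tuples X n" for y
      by (rule X.mat_app_tadd[OF a x that])
  next
    fix X Y :: "'s umodule" and f x assume X: "fin_presented S X" and Y: "fin_presented S Y"
      and "f \<in> lin_hom S X Y" "x \<in> tuples X n"
    then show "mat_app Y m n a (tmap n f x) = tmap m f (mat_app X m n a x)"
      using tmap_mat_app[of f S X Y a x n m] a by (simp add: fin_presented_left_module)
  qed auto
  note e1 = CA_short_exact[OF se1] and e2 = CA_short_exact[OF se2]
  have tt: "tensor_trans S F G mat_hom \<in> nat_trans S ?T ?U"
    "ncomp ?T \<eta> \<zeta> = tensor_trans S F G mat_hom"
  proof -
    have n: "ncomp ?T \<eta> \<zeta> \<in> nat_trans S ?T ?U" by (rule ncomp_nat_trans[OF Tfp e1(9) e2(8)])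
    show eq: "ncomp ?T \<eta> \<zeta> = tensor_trans S F G mat_hom"
    proof (rule extensionalityI)
      show "ncomp ?T \<eta> \<zeta> \<in> extensional (cObj (fp_mod S))" by (rule nat_transD(1)[OF n])
      show "tensor_trans S F G mat_hom \<in> extensional (cObj (fp_mod S))" by (simp add: tensor_trans_def)
      fix X assume "X \<in> cObj (fp_mod S)"
      then have X: "fin_presented S X" by simp
      then have lX: "left_module S X" by (rule fin_presented_left_module)
      have TX: "fObj ?T X = tensor S F X" by (simp add: tensor_functor_def)
      show "ncomp ?T \<eta> \<zeta> X = tensor_trans S F G mat_hom X"
      proof (rule extensionalityI[OF nat_transD(3)[OF n X]])
        show "tensor_trans S F G mat_hom X \<in> extensional (carrier (fObj ?T X))"
          using X by (simp add: tensor_trans_def TX tensor_map_def)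
        fix c assume c: "c \<in> carrier (fObj ?T X)"
        then obtain x where x: "x \<in> tuples X n" "c = F.tuple_tensor X x" using tuple_functorD(3)[OF Tt X] by blast
        show "ncomp ?T \<eta> \<zeta> X c = tensor_trans S F G mat_hom X c"
          using ncomp_apply[OF X c, of \<eta> \<zeta>] x \<zeta>[OF X x(1)] \<eta>[OF X x(1)] tensor_map_mat_hom_tuple[OF lX x(1)] X
          by (simp add: tensor_trans_def)
      qed
    qed
    show "tensor_trans S F G mat_hom \<in> nat_trans S ?T ?U" using n eq by simp
  qed
  have key: "mat_hom (\<theta> F y) = \<zero>\<^bsub>G\<^esub> \<longleftrightarrow> CA ?T I \<zeta> y = \<zero>\<^bsub>CO I\<^esub>" if y: "y \<in> carrier (CO ?T)" for y
  proof -
    have zy: "CA ?T I \<zeta> y \<in> carrier (CO I)" using lin_hom_closed[OF CA_lin_hom[OF Tfp Ifp e1(9)] y] .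
    have "mat_hom (\<theta> F y) = \<theta> G (CA ?T ?U (tensor_trans S F G mat_hom) y)"
      using fun_cong[OF \<theta>_nat[OF F.fF G.fF mat_hom_lin_hom], of y] y by (simp add: compose_def)
    also have "\<dots> = \<theta> G (CA I ?U \<eta> (CA ?T I \<zeta> y))"
      using CA_ncomp[OF Tfp Ifp Ufp e1(9) e2(8)] y tt(2) by (simp add: compose_def)
    finally have e: "mat_hom (\<theta> F y) = \<theta> G (CA I ?U \<eta> (CA ?T I \<zeta> y))" .
    have zI: "\<zero>\<^bsub>CO I\<^esub> \<in> carrier (CO I)"
      using CO_left_module[OF Ifp] by (intro abelian_monoid.zero_closed abelian_group.axioms(1) left_module.axioms(2))
    have h: "CA I ?U \<eta> \<zero>\<^bsub>CO I\<^esub> = \<zero>\<^bsub>CO ?U\<^esub>" "\<theta> G \<zero>\<^bsub>CO ?U\<^esub> = \<zero>\<^bsub>G\<^esub>"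
      by (rule lin_hom_zero[OF CA_lin_hom[OF Ifp Ufp e2(8)] CO_left_module[OF Ifp] CO_left_module[OF Ufp]])
        (rule lin_hom_zero[OF \<theta>_lin_hom[OF G.fF] CO_left_module[OF Ufp] G.F.left_module_axioms])
    have ij: "inj_on (\<lambda>z. \<theta> G (CA I ?U \<eta> z)) (carrier (CO I))"
      using comp_inj_on[OF e2(1) inj_on_subset[OF bij_betw_imp_inj_on[OF \<theta>_bij[OF G.fF]]]]
        lin_hom_closed[OF CA_lin_hom[OF Ifp Ufp e2(8)]] by (auto simp: comp_def)
    show ?thesis unfolding e using inj_onD[OF ij _ zy zI] h by auto
  qed
  show thesis
  proof (rule that[OF e1(8) \<iota>])
    have cl: "CA V ?T \<iota> x \<in> carrier (CO ?T)" if "x \<in> carrier (CO V)" for x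
      using lin_hom_closed[OF CA_lin_hom[OF Vfp Tfp e1(8)] that] .
    show "inj_on (\<lambda>x. \<theta> F (CA V ?T \<iota> x)) (carrier (CO V))"
      using comp_inj_on[OF e1(1) inj_on_subset[OF bij_betw_imp_inj_on[OF \<theta>_bij[OF F.fF]]]] cl by (auto simp: comp_def)
    have "{y \<in> carrier (CO ?T). mat_hom (\<theta> F y) = \<zero>\<^bsub>G\<^esub>} = CA V ?T \<iota> ` carrier (CO V)"
    proof (rule Set.set_eqI)
      fix y
      show "y \<in> {y \<in> carrier (CO ?T). mat_hom (\<theta> F y) = \<zero>\<^bsub>G\<^esub>} \<longleftrightarrow> y \<in> CA V ?T \<iota> ` carrier (CO V)"
      proof (cases "y \<in> carrier (CO ?T)")
        case True
        show ?thesis unfolding e1(2)[OF True, symmetric] key[OF True, symmetric] using True by blast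
      qed (use cl in blast)
    qed
    then have "(\<lambda>x. \<theta> F (CA V ?T \<iota> x)) ` carrier (CO V) = \<theta> F ` {y \<in> carrier (CO ?T). mat_hom (\<theta> F y) = \<zero>\<^bsub>G\<^esub>}"
      by (metis image_image)
    also have "\<dots> = {f \<in> carrier F. mat_hom f = \<zero>\<^bsub>G\<^esub>}"
      unfolding bij_betw_imp_surj_on[OF \<theta>_bij[OF F.fF], symmetric] by blast
    also have "\<dots> = {f \<in> carrier F. \<rho> f \<in> sols (regular_module S) m n a}" using sols_regular_iff by auto
    finally show "(\<lambda>x. \<theta> F (CA V ?T \<iota> x)) ` carrier (CO V) = {f \<in> carrier F. \<rho> f \<in> sols (regular_module S) m n a}" .
  qed
qed

end

section \<open>Detection of zero\<close>

definition stack :: "nat \<Rightarrow> (nat \<Rightarrow> nat \<Rightarrow> 'a) \<Rightarrow> (nat \<Rightarrow> nat \<Rightarrow> 'a) \<Rightarrow> nat \<Rightarrow> nat \<Rightarrow> 'a"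
  where "stack m a b = (\<lambda>i. if i < m then a i else b (i - m))"

lemma sols_stack:
  "sols X (m + k) n (stack m a b) = {x \<in> sols X m n a. mat_app X k n b x = tzero X k}"
proof -
  have "(\<forall>i<m + k. lincomb X n (stack m a b i) x = \<zero>\<^bsub>X\<^esub>) \<longleftrightarrow>
      (\<forall>i<m. lincomb X n (a i) x = \<zero>\<^bsub>X\<^esub>) \<and> (\<forall>i<k. lincomb X n (b i) x = \<zero>\<^bsub>X\<^esub>)" for x
  proof (intro iffI conjI allI impI)
    fix i assume *: "\<forall>i<m + k. lincomb X n (stack m a b i) x = \<zero>\<^bsub>X\<^esub>"
    show "lincomb X n (a i) x = \<zero>\<^bsub>X\<^esub>" if "i < m" using *[rule_format, of i] that by (simp add: stack_def)
    show "lincomb X n (b i) x = \<zero>\<^bsub>X\<^esub>" if "i < k" using *[rule_format, of "m + i"] that by (simp add: stack_def)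
  next
    fix i assume "(\<forall>i<m. lincomb X n (a i) x = \<zero>\<^bsub>X\<^esub>) \<and> (\<forall>i<k. lincomb X n (b i) x = \<zero>\<^bsub>X\<^esub>)" "i < m + k"
    then show "lincomb X n (stack m a b i) x = \<zero>\<^bsub>X\<^esub>" by (cases "i < m") (auto simp: stack_def)
  qed
  then show ?thesis by (auto simp: sols_def mat_app_def tzero_def fun_eq_iff)
qed

context covdefect
begin

lemma covdefect_zero_iff:
  fixes M :: "('s, 'm) module"
  assumes a: "a \<in> UNIV \<rightarrow> UNIV \<rightarrow> carrier S" and b: "b \<in> UNIV \<rightarrow> UNIV \<rightarrow> carrier S"
    and L: "L \<in> UNIV \<rightarrow> UNIV \<rightarrow> carrier S"
    and sub: "\<And>X :: 's umodule. fin_presented S X \<Longrightarrow> mat_app X n n' L ` sols X m' n' b \<subseteq> sols X m n a"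
    and H: "tuple_functor S n (\<lambda>X. sols X m n a) (\<lambda>X. mat_app X n n' L ` sols X m' n' b) H r"
    and Hfp: "H \<in> fp_functors S" and ff: "fp_faithfully_flat S M"
  shows "carrier (CO H) = {\<zero>\<^bsub>CO H\<^esub>} \<longleftrightarrow> sols M m n a \<subseteq> mat_app M n n' L ` sols M m' n' b"
proof -
  have fl: "flat S M" using ff by (simp add: fp_faithfully_flat_def)
  have lM: "left_module S M" using fl by (simp add: flat_def)
  interpret M: left_module S M by (rule lM)
  have tuo: "tuples (regular_module (opp S)) k = tuples (regular_module S) k" for k by (simp add: tuples_def)
  have exF: "\<exists>F \<rho>. free_right_module S k F \<rho>" for k
  proof -
    obtain F :: "'s umodule" and \<rho> where "fin_presented (opp S) F" "\<rho> \<in> lin_hom (opp S) F (free_module (opp S) k)"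
      "bij_betw \<rho> (carrier F) (tuples (regular_module (opp S)) k)" by (rule ex_free_umodule[OF ring_oppS])
    then show ?thesis using ringS tuo by (intro exI[of _ F] exI[of _ \<rho>] free_right_module.intro) auto
  qed
  obtain F \<rho> where F: "free_right_module S n F \<rho>" using exF by blast
  obtain G \<tau> where G: "free_right_module S m G \<tau>" using exF by blast
  obtain F' \<rho>' where F': "free_right_module S n' F' \<rho>'" using exF by blast
  obtain G' \<tau>' where G': "free_right_module S m' G' \<tau>'" using exF by blast
  interpret A: covdefect_pair S C \<theta> n F \<rho> m G \<tau> a
    using F G a covdefect_axioms by (intro covdefect_pair.intro free_right_pair.intro free_right_pair_axioms.intro)
  interpret B: covdefect_pair S C \<theta> n' F' \<rho>' m' G' \<tau>' b
    using F' G' b covdefect_axioms by (intro covdefect_pair.intro free_right_pair.intro free_right_pair_axioms.intro)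
  interpret L: free_right_pair S n' F' \<rho>' n F \<rho> L
    using F F' L by (intro free_right_pair.intro free_right_pair_axioms.intro)
  let ?T = "tensor_functor S F" and ?T' = "tensor_functor S F'"
  let ?s = "stack m' b L"
  have s: "?s \<in> UNIV \<rightarrow> UNIV \<rightarrow> carrier S" using b L by (auto simp: stack_def Pi_iff)
  have na: "natural_subgroup S n (\<lambda>X. sols X m n a)" and nb: "natural_subgroup S n' (\<lambda>X. sols X m' n' b)"
    and ns: "natural_subgroup S n' (\<lambda>X. sols X (m' + n) n' ?s)"
    by (intro natural_subgroup_sols a b s)+
  have sb: "sols X (m' + n) n' ?s \<subseteq> sols X m' n' b" for X :: "'s umodule" by (auto simp: sols_stack)
  obtain VA :: "('s, 's uval) mod_functor" and p where VA: "tuple_functor S n (\<lambda>X. sols X m n a) (\<lambda>X. {tzero X n}) VA p" and VAfp: "VA \<in> fp_functors S"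
    by (rule ex_kernel_functor[OF a, of n m])
  obtain VB :: "('s, 's uval) mod_functor" and p' where VB: "tuple_functor S n' (\<lambda>X. sols X m' n' b) (\<lambda>X. {tzero X n'}) VB p'" and VBfp: "VB \<in> fp_functors S"
    by (rule ex_kernel_functor[OF b, of n' m'])
  obtain N :: "('s, 's uval) mod_functor" and d where N: "tuple_functor S n' (\<lambda>X. sols X (m' + n) n' ?s) (\<lambda>X. {tzero X n'}) N d" and Nfp: "N \<in> fp_functors S"
    by (rule ex_kernel_functor[OF s, of n' "m' + n"])
  obtain K :: "('s, 's uval) mod_functor" and k where K: "tuple_functor S n' (\<lambda>X. sols X m' n' b) (\<lambda>X. sols X (m' + n) n' ?s) K k" and Kfp: "K \<in> fp_functors S"
  proof (rule ex_solution_functor[OF b s delta_mat, of "\<lambda>X. sols X (m' + n) n' ?s" m' n' n' "m' + n"])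
    show "sols X (m' + n) n' ?s \<subseteq> sols X m' n' b" for X :: "'s umodule" by (rule sb)
    show "sols X (m' + n) n' ?s = mat_app X n' n' (\<lambda>i j. if j = i then \<one>\<^bsub>S\<^esub> else \<zero>\<^bsub>S\<^esub>) ` sols X (m' + n) n' ?s"
      if "fin_presented S X" for X :: "'s umodule"
      by (rule id_image[OF fin_presented_left_module[OF that], symmetric]) (auto dest: sols_tuples)
  qed
  have tb: "x \<in> tuples X n'" if "x \<in> sols X m' n' b" for X :: "'s umodule" and x using that by (rule sols_tuples)
  obtain \<kappa> \<pi> where se4: "short_exact (fp_functor_cat S) K VA H \<kappa> \<pi>"
    and \<kappa>: "\<And>X x. fin_presented S X \<Longrightarrow> x \<in> sols X m' n' b \<Longrightarrow> \<kappa> X (k X x) = p X (mat_app X n n' L x)"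
  proof (rule ex_short_exact[OF nb na K VA H Kfp VAfp Hfp, of "\<lambda>X x. mat_app X n n' L x"])
    fix X :: "'s umodule" and x assume X: "fin_presented S X" and x: "x \<in> sols X m' n' b"
    interpret X: left_module S X using X by (rule fin_presented_left_module)
    show "mat_app X n n' L x \<in> sols X m n a" using sub[OF X] x by blast
    show "mat_app X n n' L x = tzero X n \<longleftrightarrow> x \<in> sols X (m' + n) n' ?s" using x by (simp add: sols_stack)
    show "mat_app X n n' L (tadd X n' x y) = tadd X n (mat_app X n n' L x) (mat_app X n n' L y)" if "y \<in> sols X m' n' b" for y
      by (rule X.mat_app_tadd[OF L tb[OF x] tb[OF that]])
  next
    fix X Y :: "'s umodule" and f x assume X: "fin_presented S X" and Y: "fin_presented S Y"
      and f: "f \<in> lin_hom S X Y" and x: "x \<in> sols X m' n' b"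
    show "mat_app Y n n' L (tmap n' f x) = tmap n f (mat_app X n n' L x)"
      by (rule tmap_mat_app[OF f fin_presented_left_module[OF X] fin_presented_left_module[OF Y] L tb[OF x], symmetric])
  qed auto
  obtain \<nu> \<epsilon> where se5: "short_exact (fp_functor_cat S) N VB K \<nu> \<epsilon>"
    and \<epsilon>: "\<And>X x. fin_presented S X \<Longrightarrow> x \<in> sols X m' n' b \<Longrightarrow> \<epsilon> X (p' X x) = k X x"
    by (rule ex_short_exact[OF ns nb N VB K Nfp VBfp Kfp, of "\<lambda>X x. x"]) (use sb in auto)
  note e4 = CA_short_exact[OF se4] and e5 = CA_short_exact[OF se5]
  define \<psi> where "\<psi> = ncomp VB \<kappa> \<epsilon>"
  have \<psi>n: "\<psi> \<in> nat_trans S VB VA" unfolding \<psi>_def by (rule ncomp_nat_trans[OF VBfp e5(9) e4(8)])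
  have \<psi>p: "\<psi> X (p' X x) = p X (mat_app X n n' L x)" if X: "fin_presented S X" and x: "x \<in> sols X m' n' b" for X x
  proof -
    have "p' X x \<in> carrier (fObj VB X)" using tuple_functorD(3)[OF VB X] x by blast
    then show ?thesis unfolding \<psi>_def using ncomp_apply[OF X, of "p' X x" VB \<kappa> \<epsilon>] \<epsilon>[OF X x] \<kappa>[OF X x] by simp
  qed
  have C\<psi>: "CA VB VA \<psi> = compose (carrier (CO VB)) (CA K VA \<kappa>) (CA VB K \<epsilon>)"
    unfolding \<psi>_def by (rule CA_ncomp[OF VBfp Kfp VAfp e5(9) e4(8)])
  obtain \<iota> where \<iota>n: "\<iota> \<in> nat_trans S VA ?T"
    and \<iota>: "\<And>X x. fin_presented S X \<Longrightarrow> x \<in> sols X m n a \<Longrightarrow> \<iota> X (p X x) = A.F.tuple_tensor X x"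
    and cAi: "inj_on (\<lambda>x. \<theta> F (CA VA ?T \<iota> x)) (carrier (CO VA))"
    and cAim: "(\<lambda>x. \<theta> F (CA VA ?T \<iota> x)) ` carrier (CO VA) = {f \<in> carrier F. \<rho> f \<in> sols (regular_module S) m n a}"
    by (rule A.covdefect_kernel[OF VA VAfp]) (rule that, assumption+)
  obtain \<iota>' where \<iota>n': "\<iota>' \<in> nat_trans S VB ?T'"
    and \<iota>': "\<And>X x. fin_presented S X \<Longrightarrow> x \<in> sols X m' n' b \<Longrightarrow> \<iota>' X (p' X x) = B.F.tuple_tensor X x"
    and cBim: "(\<lambda>x. \<theta> F' (CA VB ?T' \<iota>' x)) ` carrier (CO VB) = {f \<in> carrier F'. \<rho>' f \<in> sols (regular_module S) m' n' b}"
    by (rule B.covdefect_kernel[OF VB VBfp]) (rule that, assumption+)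
  note Tfp = A.F.tensor_functor_fp and Tfp' = B.F.tensor_functor_fp
  define cA where "cA = compose (carrier (CO VA)) (\<theta> F) (CA VA ?T \<iota>)"
  define cB where "cB = compose (carrier (CO VB)) (\<theta> F') (CA VB ?T' \<iota>')"
  note lVA = CO_left_module[OF VAfp] and lVB = CO_left_module[OF VBfp] and lH = CO_left_module[OF Hfp]
  have cAl: "cA \<in> lin_hom (opp S) (CO VA) F" unfolding cA_def
    by (rule lin_hom_compose[OF CA_lin_hom[OF VAfp Tfp \<iota>n] \<theta>_lin_hom[OF A.F.fF] lVA])
  have cBl: "cB \<in> lin_hom (opp S) (CO VB) F'" unfolding cB_def
    by (rule lin_hom_compose[OF CA_lin_hom[OF VBfp Tfp' \<iota>n'] \<theta>_lin_hom[OF B.F.fF] lVB])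
  have cAi: "inj_on cA (carrier (CO VA))" using cAi by (simp add: cA_def compose_def inj_on_def)
  have cAim: "cA ` carrier (CO VA) = {f \<in> carrier F. \<rho> f \<in> sols (regular_module S) m n a}"
    using cAim by (simp add: cA_def compose_def)
  have cBim: "cB ` carrier (CO VB) = {f \<in> carrier F'. \<rho>' f \<in> sols (regular_module S) m' n' b}"
    using cBim by (simp add: cB_def compose_def)
  define l where "l = CA VB VA \<psi>"
  have ll: "l \<in> lin_hom (opp S) (CO VB) (CO VA)" unfolding l_def by (rule CA_lin_hom[OF VBfp VAfp \<psi>n])
  have tt: "tensor_trans S F' F L.mat_hom \<in> nat_trans S ?T' ?T"
  proof (rule nat_transI)
    fix X :: "'s umodule" assume X: "fin_presented S X"
    note lX = fin_presented_left_module[OF X]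
    note tm = tensor_map_props[OF B.F.tensor_product_F[OF lX] A.F.tensor_product_F[OF lX] lin_hom_restrict[OF L.mat_hom_lin_hom] restrict_id_lin_hom[OF lX]]
    show "tensor_trans S F' F L.mat_hom X \<in> hom (fObj ?T' X) (fObj ?T X)"
      "tensor_trans S F' F L.mat_hom X \<in> extensional (carrier (fObj ?T' X))"
      using X tm(1,3) by (simp_all add: tensor_trans_def tensor_functor_def)
  next
    fix X Y :: "'s umodule" and f c assume X: "fin_presented S X" and Y: "fin_presented S Y" and f: "f \<in> lin_hom S X Y"
      and c: "c \<in> carrier (fObj ?T' X)"
    note lX = fin_presented_left_module[OF X] and lY = fin_presented_left_module[OF Y]
    obtain x where x: "x \<in> tuples X n'" "c = B.F.tuple_tensor X x" using c tuple_functorD(3)[OF B.F.tuple_functor_tensor X] by blast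
    have Lx: "mat_app X n n' L x \<in> tuples X n" by (rule left_module.mat_app_tuples[OF lX L x(1)])
    have fx: "tmap n' f x \<in> tuples Y n'" using x lin_hom_closed[OF f] by (intro tmap_tuples) auto
    show "tensor_trans S F' F L.mat_hom Y (fArr ?T' X Y f c) = fArr ?T X Y f (tensor_trans S F' F L.mat_hom X c)"
      using X Y x tuple_functorD(5)[OF B.F.tuple_functor_tensor X Y f x(1)] tuple_functorD(5)[OF A.F.tuple_functor_tensor X Y f Lx]
        L.tensor_map_mat_hom_tuple[OF lX x(1)] L.tensor_map_mat_hom_tuple[OF lY fx] tmap_mat_app[OF f lX lY L x(1), of n]
      by (simp add: tensor_trans_def)
  qed (simp add: tensor_trans_def)
  have sq: "ncomp VB \<iota> \<psi> = ncomp VB (tensor_trans S F' F L.mat_hom) \<iota>'"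
  proof (rule nat_trans_eqI[OF ncomp_nat_trans[OF VBfp \<psi>n \<iota>n] ncomp_nat_trans[OF VBfp \<iota>n' tt]])
    fix X :: "'s umodule" and c assume X: "fin_presented S X" and c: "c \<in> carrier (fObj VB X)"
    note lX = fin_presented_left_module[OF X]
    obtain x where x: "x \<in> sols X m' n' b" "c = p' X x" using c tuple_functorD(3)[OF VB X] by blast
    have Lx: "mat_app X n n' L x \<in> sols X m n a" using sub[OF X] x by blast
    show "ncomp VB \<iota> \<psi> X c = ncomp VB (tensor_trans S F' F L.mat_hom) \<iota>' X c"
      unfolding ncomp_apply[OF X c]
      using x \<psi>p[OF X x(1)] \<iota>[OF X Lx] \<iota>'[OF X x(1)] L.tensor_map_mat_hom_tuple[OF lX tb[OF x(1)]] X
      by (simp add: tensor_trans_def)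
  qed
  have cAl_eq: "cA (l y) = L.mat_hom (cB y)" if y: "y \<in> carrier (CO VB)" for y
  proof -
    have ly: "l y \<in> carrier (CO VA)" using lin_hom_closed[OF ll y] .
    have iy: "CA VB ?T' \<iota>' y \<in> carrier (CO ?T')" using lin_hom_closed[OF CA_lin_hom[OF VBfp Tfp' \<iota>n'] y] .
    have "CA VA ?T \<iota> (l y) = CA VB ?T (ncomp VB \<iota> \<psi>) y"
      unfolding CA_ncomp[OF VBfp VAfp Tfp \<psi>n \<iota>n] l_def using y by (simp add: compose_def)
    also have "\<dots> = CA ?T' ?T (tensor_trans S F' F L.mat_hom) (CA VB ?T' \<iota>' y)"
      unfolding sq CA_ncomp[OF VBfp Tfp' Tfp \<iota>n' tt] using y by (simp add: compose_def)
    also have "\<theta> F \<dots> = L.mat_hom (\<theta> F' (CA VB ?T' \<iota>' y))"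
      using fun_cong[OF \<theta>_nat[OF B.F.fF A.F.fF L.mat_hom_lin_hom], of "CA VB ?T' \<iota>' y"] iy by (simp add: compose_def)
    finally show ?thesis using y ly by (simp add: cA_def cB_def compose_def)
  qed
  define q where "q = CA VA H \<pi>"
  have ql: "q \<in> lin_hom (opp S) (CO VA) (CO H)" unfolding q_def by (rule CA_lin_hom[OF VAfp Hfp e4(9)])
  have lim: "l ` carrier (CO VB) = CA K VA \<kappa> ` carrier (CO K)"
    unfolding l_def C\<psi> e5(3)[symmetric] image_image by (auto simp: compose_def)
  have qker: "q y = \<zero>\<^bsub>CO H\<^esub> \<longleftrightarrow> y \<in> l ` carrier (CO VB)" if "y \<in> carrier (CO VA)" for y
    unfolding q_def lim using e4(2)[OF that] .
  interpret GM: comm_group "tuple_group M n (tuples M n)" by (rule M.comm_group_tuples)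
  interpret HO: left_module "opp S" "CO H" by (rule lH)
  show ?thesis
  proof
    assume z: "carrier (CO H) = {\<zero>\<^bsub>CO H\<^esub>}"
    have "A.sol_span M \<subseteq> mat_app M n n' L ` sols M m' n' b"
      unfolding A.sol_span_def
    proof (rule GM.generate_subgroup_incl[OF _ M.subgroup_mat_app_image[OF L M.subgroup_sols[OF b]]], rule subsetI)
      fix x assume "x \<in> {scaled_vector M n v y |v y. v \<in> sols (regular_module S) m n a \<and> y \<in> carrier M}"
      then obtain v y where v: "v \<in> sols (regular_module S) m n a" and y: "y \<in> carrier M" and x: "x = scaled_vector M n v y" by blast
      have "A.F.coord_inv v \<in> {f \<in> carrier F. \<rho> f \<in> sols (regular_module S) m n a}"
        using A.F.coord_inv[OF sols_tuples[OF v]] v by simp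
      then obtain c where c: "c \<in> carrier (CO VA)" "cA c = A.F.coord_inv v" unfolding cAim[symmetric] by blast
      have "q c = \<zero>\<^bsub>CO H\<^esub>" using lin_hom_closed[OF ql c(1)] z by simp
      then obtain d where d: "d \<in> carrier (CO VB)" "c = l d" using qker[OF c(1)] by blast
      have cBd: "cB d \<in> carrier F'" "\<rho>' (cB d) \<in> sols (regular_module S) m' n' b" using cBim d(1) by auto
      have "v = \<rho> (cA (l d))" using c d A.F.coord_inv(2)[OF sols_tuples[OF v]] by simp
      also have "\<dots> = mat_app (regular_module S) n n' L (\<rho>' (cB d))"
        unfolding cAl_eq[OF d(1)] by (rule L.\<tau>_mat_hom[OF cBd(1)])
      finally have "x = mat_app M n n' L (scaled_vector M n' (\<rho>' (cB d)) y)"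
        using x mat_app_scaled_vector[OF lM sols_tuples[OF cBd(2)] y L] by simp
      then show "x \<in> mat_app M n n' L ` sols M m' n' b" using scaled_vector_sols[OF lM cBd(2) y b] by blast
    qed
    then show "sols M m n a \<subseteq> mat_app M n n' L ` sols M m' n' b" using A.flat_sols[OF fl] by blast
  next
    assume z: "sols M m n a \<subseteq> mat_app M n n' L ` sols M m' n' b"
    have tVA: "tensor_product S (CO VA) M" and tVB: "tensor_product S (CO VB) M" and tH: "tensor_product S (CO H) M"
      by (intro tensor_product.intro lVA lVB lH lM)+
    have tF: "tensor_product S F M" and tF': "tensor_product S F' M"
      by (intro A.F.tensor_product_F B.F.tensor_product_F lM)+
    interpret tVA: tensor_product S "CO VA" M by (rule tVA)
    interpret tVB: tensor_product S "CO VB" M by (rule tVB)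
    interpret tH: tensor_product S "CO H" M by (rule tH)
    interpret tF: tensor_product S F M by (rule tF)
    let ?cA = "tensor_map S (CO VA) M F M cA (\<lambda>m. m)" and ?cB = "tensor_map S (CO VB) M F' M cB (\<lambda>m. m)"
    let ?l = "tensor_map S (CO VB) M (CO VA) M l (\<lambda>m. m)" and ?q = "tensor_map S (CO VA) M (CO H) M q (\<lambda>m. m)"
    let ?L = "tensor_map S F' M F M L.mat_hom (\<lambda>m. m)"
    note id = restrict_id_lin_hom[OF lM]
    note cAt = tensor_map_props[OF tVA tF lin_hom_restrict[OF cAl] id]
    note cBt = tensor_map_props[OF tVB tF' lin_hom_restrict[OF cBl] id]
    note lt = tensor_map_props[OF tVB tVA lin_hom_restrict[OF ll] id]
    note qt = tensor_map_props[OF tVA tH lin_hom_restrict[OF ql] id]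
    note Lt = tensor_map_props[OF tF' tF lin_hom_restrict[OF L.mat_hom_lin_hom] id]
    have inj: "inj_on ?cA (carrier tVA.T)"
      using fl cAl cAi lVA A.F.F.left_module_axioms unfolding flat_def by blast
    have comp: "?cA (?l t) = ?L (?cB t)" if t: "t \<in> carrier tVB.T" for t
    proof -
      have "compose (carrier (CO VB)) cA l = compose (carrier (CO VB)) L.mat_hom cB"
        using cAl_eq by (auto simp: compose_def fun_eq_iff)
      then show ?thesis
        using tensor_map_compose[OF tVB tVA tF ll cAl t] tensor_map_compose[OF tVB tF' tF cBl L.mat_hom_lin_hom t] by simp
    qed
    have span: "B.sol_span M \<subseteq> (\<lambda>t. B.F.ev M (?cB t)) ` carrier tVB.T"
      unfolding B.sol_span_def
    proof (rule group.generate_subgroup_incl)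
      interpret GM': comm_group "tuple_group M n' (tuples M n')" by (rule M.comm_group_tuples)
      note eh = B.F.ev_hom[OF lM]
      show "group (tuple_group M n' (tuples M n'))" by (rule GM'.is_group)
      have "group_hom tVB.T (tuple_group M n' (tuples M n')) (\<lambda>t. B.F.ev M (?cB t))"
        by (intro group_hom.intro group_hom_axioms.intro tVB.TG.is_group GM'.is_group homI)
          (use hom_in_carrier[OF cBt(1)] hom_mult[OF cBt(1)] hom_in_carrier[OF eh] hom_mult[OF eh] in auto)
      then show "subgroup ((\<lambda>t. B.F.ev M (?cB t)) ` carrier tVB.T) (tuple_group M n' (tuples M n'))"
        using group_hom.subgroup_img_is_subgroup[OF _ group.subgroup_self[OF tVB.TG.is_group]] by blast
      show "{scaled_vector M n' v y |v y. v \<in> sols (regular_module S) m' n' b \<and> y \<in> carrier M} \<subseteq> (\<lambda>t. B.F.ev M (?cB t)) ` carrier tVB.T"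
      proof
        fix x assume "x \<in> {scaled_vector M n' v y |v y. v \<in> sols (regular_module S) m' n' b \<and> y \<in> carrier M}"
        then obtain v y where v: "v \<in> sols (regular_module S) m' n' b" and y: "y \<in> carrier M" and x: "x = scaled_vector M n' v y" by blast
        have f: "B.F.coord_inv v \<in> {f \<in> carrier F'. \<rho>' f \<in> sols (regular_module S) m' n' b}"
          using B.F.coord_inv[OF sols_tuples[OF v]] v by simp
        then obtain c where c: "c \<in> carrier (CO VB)" "cB c = B.F.coord_inv v" unfolding cBim[symmetric] by blast
        have "B.F.ev M (?cB (tVB.pt c y)) = x"
          using cBt(2)[OF c(1) y] c f y B.F.ev_pure[OF lM, of "cB c" y] B.F.coord_inv(2)[OF sols_tuples[OF v]] x by simp
        then show "x \<in> (\<lambda>t. B.F.ev M (?cB t)) ` carrier tVB.T" using tVB.pt_closed[OF c(1) y] by blast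
      qed
    qed
    have q0: "?q (tVA.pt c y) = \<one>\<^bsub>tH.T\<^esub>" if c: "c \<in> carrier (CO VA)" and y: "y \<in> carrier M" for c y
    proof -
      have f: "cA c \<in> carrier F" "\<rho> (cA c) \<in> sols (regular_module S) m n a" using cAim c by auto
      have "scaled_vector M n (\<rho> (cA c)) y \<in> sols M m n a" by (rule scaled_vector_sols[OF lM f(2) y a])
      then obtain w where w: "w \<in> sols M m' n' b" "scaled_vector M n (\<rho> (cA c)) y = mat_app M n n' L w" using z by blast
      obtain t where t: "t \<in> carrier tVB.T" "w = B.F.ev M (?cB t)" using B.flat_sols[OF fl w(1)] span by blast
      have bt: "?cB t \<in> carrier (tensor S F' M)" using hom_in_carrier[OF cBt(1) t(1)] .
      have lt': "?l t \<in> carrier tVA.T" using hom_in_carrier[OF lt(1) t(1)] .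
      have pt: "tVA.pt c y \<in> carrier tVA.T" by (rule tVA.pt_closed[OF c y])
      have "A.F.ev M (?cA (tVA.pt c y)) = scaled_vector M n (\<rho> (cA c)) y"
        using cAt(2)[OF c y] A.F.ev_pure[OF lM f(1) y] by simp
      also have "\<dots> = A.F.ev M (?L (?cB t))" unfolding w(2) t(2) using L.ev_mat_hom[OF lM bt] by simp
      also have "\<dots> = A.F.ev M (?cA (?l t))" using comp[OF t(1)] by simp
      finally have "?cA (tVA.pt c y) = ?cA (?l t)"
        by (rule A.F.ev_inj[OF lM hom_in_carrier[OF cAt(1) pt] hom_in_carrier[OF cAt(1) lt']])
      then have e: "tVA.pt c y = ?l t" by (rule inj_onD[OF inj _ pt lt'])
      have "compose (carrier (CO VB)) q l = (\<lambda>x\<in>carrier (CO VB). \<zero>\<^bsub>CO H\<^esub>)"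
        using qker[OF lin_hom_closed[OF ll]] by (auto simp: compose_def fun_eq_iff)
      then have "?q (?l t) = \<one>\<^bsub>tH.T\<^esub>"
        using tensor_map_compose[OF tVB tVA tH ll ql t(1)] tensor_map_const_zero[OF tVB tH t(1)] by simp
      then show ?thesis by (simp add: e)
    qed
    let ?Z = "\<lambda>x\<in>carrier (CO VA). \<zero>\<^bsub>CO H\<^esub>"
    note zl = lin_hom_const_zero[OF lVA lH]
    note zt = tensor_map_props[OF tVA tH lin_hom_restrict[OF zl] id]
    have "?q = tensor_map S (CO VA) M (CO H) M ?Z (\<lambda>m. m)"
    proof (rule extensionalityI[OF qt(3) zt(3)])
      fix t assume t: "t \<in> carrier tVA.T"
      show "?q t = tensor_map S (CO VA) M (CO H) M ?Z (\<lambda>m. m) t"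
        by (rule tVA.hom_tensor_eqI[OF tH.TG.is_group qt(1) zt(1) _ t])
          (simp add: q0 tensor_map_const_zero[OF tVA tH tVA.pt_closed])
    qed
    then have q: "q = ?Z"
      using ff ql zl CO_fp[OF VAfp] CO_fp[OF Hfp] by (simp add: fp_faithfully_flat_def)
    have e0: "(\<lambda>x\<in>carrier (CO H). x) = (\<lambda>x\<in>carrier (CO H). \<zero>\<^bsub>CO H\<^esub>)"
    proof (rule cat_cokernel_epi[OF CO_fp[OF VAfp] CO_fp[OF Hfp] CO_fp[OF Hfp] ql CA_lin_hom[OF Kfp VAfp e4(8)] CO_fp[OF Kfp]
          e4(4)[folded q_def] lin_hom_id[OF lH] lin_hom_const_zero[OF lH lH]])
      fix c assume c: "c \<in> carrier (CO VA)"
      then have "q c = \<zero>\<^bsub>CO H\<^esub>" using fun_cong[OF q, of c] by simp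
      then show "(\<lambda>x\<in>carrier (CO H). x) (q c) = (\<lambda>x\<in>carrier (CO H). \<zero>\<^bsub>CO H\<^esub>) (q c)" by simp
    qed
    have "x = \<zero>\<^bsub>CO H\<^esub>" if "x \<in> carrier (CO H)" for x using fun_cong[OF e0, of x] that by simp
    then show "carrier (CO H) = {\<zero>\<^bsub>CO H\<^esub>}" using HO.M.zero_closed by blast
  qed
qed

end

lemma fp_faithfully_flat_regular:
  fixes S :: "('s, 'f) ring_scheme"
  assumes S: "ring S"
  shows "fp_faithfully_flat S (regular_module S)"
proof -
  interpret S: ring S by (rule S)
  let ?S = "regular_module S"
  have lS: "left_module S ?S" using S by (rule left_module_regular)
  have ex: "\<exists>\<mu>. \<mu> \<in> hom (tensor S A ?S) (add_monoid A) \<and> (\<forall>x\<in>carrier A. \<forall>s\<in>carrier S. \<mu> (pure_tensor S A ?S x s) = s \<odot>\<^bsub>A\<^esub> x)"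
    if A: "left_module (opp S) A" for A :: "'s umodule"
  proof -
    interpret A: left_module "opp S" A by fact
    interpret T: tensor_product S A ?S by (rule tensor_product.intro[OF A lS])
    obtain \<mu> where "\<mu> \<in> hom (tensor S A ?S) (add_monoid A)"
      "\<And>x s. x \<in> carrier A \<Longrightarrow> s \<in> carrier ?S \<Longrightarrow> \<mu> (T.pt x s) = s \<odot>\<^bsub>A\<^esub> x"
    proof (rule T.tensor_universal[OF A.a_comm_group, of "\<lambda>x s. s \<odot>\<^bsub>A\<^esub> x"])
      show "s \<odot>\<^bsub>A\<^esub> x \<in> carrier (add_monoid A)" if "x \<in> carrier A" "s \<in> carrier ?S" for x s
        using A.smult_closed[of s x] that by simp
      show "s \<odot>\<^bsub>A\<^esub> (x \<oplus>\<^bsub>A\<^esub> y) = (s \<odot>\<^bsub>A\<^esub> x) \<otimes>\<^bsub>add_monoid A\<^esub> (s \<odot>\<^bsub>A\<^esub> y)"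
        if "x \<in> carrier A" "y \<in> carrier A" "s \<in> carrier ?S" for x y s
        using A.smult_r_distr[of s x y] that by simp
      show "(s \<oplus>\<^bsub>?S\<^esub> t) \<odot>\<^bsub>A\<^esub> x = (s \<odot>\<^bsub>A\<^esub> x) \<otimes>\<^bsub>add_monoid A\<^esub> (t \<odot>\<^bsub>A\<^esub> x)"
        if "x \<in> carrier A" "s \<in> carrier ?S" "t \<in> carrier ?S" for x s t
        using A.smult_l_distr[of s t x] that by simp
      show "s \<odot>\<^bsub>A\<^esub> (r \<odot>\<^bsub>A\<^esub> x) = (r \<odot>\<^bsub>?S\<^esub> s) \<odot>\<^bsub>A\<^esub> x"
        if "r \<in> carrier S" "x \<in> carrier A" "s \<in> carrier ?S" for r x s
        using A.smult_assoc[of s r x] that by simp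
    qed auto
    then show ?thesis by auto
  qed
  define \<mu> where "\<mu> A = (SOME \<mu>. \<mu> \<in> hom (tensor S A ?S) (add_monoid A) \<and>
    (\<forall>x\<in>carrier A. \<forall>s\<in>carrier S. \<mu> (pure_tensor S A ?S x s) = s \<odot>\<^bsub>A\<^esub> x))" for A :: "'s umodule"
  have \<mu>: "\<mu> A \<in> hom (tensor S A ?S) (add_monoid A)"
    "\<And>x s. x \<in> carrier A \<Longrightarrow> s \<in> carrier S \<Longrightarrow> \<mu> A (pure_tensor S A ?S x s) = s \<odot>\<^bsub>A\<^esub> x"
    if "left_module (opp S) A" for A :: "'s umodule"
    using someI_ex[OF ex[OF that]] unfolding \<mu>_def[symmetric] by blast+
  have \<mu>i: "pure_tensor S A ?S (\<mu> A t) \<one>\<^bsub>S\<^esub> = t" if A: "left_module (opp S) A" and t: "t \<in> carrier (tensor S A ?S)" for A :: "'s umodule" and t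
  proof -
    interpret A: left_module "opp S" A by fact
    interpret T: tensor_product S A ?S by (rule tensor_product.intro[OF A lS])
    have 1: "(\<lambda>t. T.pt (\<mu> A t) \<one>\<^bsub>S\<^esub>) \<in> hom T.T T.T"
      using hom_in_carrier[OF \<mu>(1)[OF A]] hom_mult[OF \<mu>(1)[OF A]] T.pt_closed T.pt_add_left by (intro homI) auto
    have 2: "(\<lambda>t. t) \<in> hom T.T T.T" by (rule homI) auto
    show ?thesis
      by (rule T.hom_tensor_eqI[OF T.TG.is_group 1 2 _ t])
        (use T.pt_balanced in \<open>auto simp: \<mu>(2)[OF A]\<close>)
  qed
  have nat: "\<mu> B (tensor_map S A ?S B ?S f (\<lambda>m. m) t) = f (\<mu> A t)"
    if A: "left_module (opp S) A" and B: "left_module (opp S) B" and f: "f \<in> lin_hom (opp S) A B"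
      and t: "t \<in> carrier (tensor S A ?S)" for A B :: "'s umodule" and f t
  proof -
    interpret B: left_module "opp S" B by fact
    interpret T: tensor_product S A ?S by (rule tensor_product.intro[OF A lS])
    note tm = tensor_map_props[OF T.tensor_product_axioms tensor_product.intro[OF B lS] lin_hom_restrict[OF f] restrict_id_lin_hom[OF lS]]
    have 1: "(\<lambda>t. \<mu> B (tensor_map S A ?S B ?S f (\<lambda>m. m) t)) \<in> hom T.T (add_monoid B)"
      using hom_in_carrier[OF tm(1)] hom_mult[OF tm(1)] hom_in_carrier[OF \<mu>(1)[OF B]] hom_mult[OF \<mu>(1)[OF B]] by (intro homI) auto
    have 2: "(\<lambda>t. f (\<mu> A t)) \<in> hom T.T (add_monoid B)"
      using hom_in_carrier[OF \<mu>(1)[OF A]] hom_mult[OF \<mu>(1)[OF A]] lin_hom_closed[OF f] lin_hom_add[OF f] by (intro homI) auto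
    show ?thesis
      by (rule T.hom_tensor_eqI[OF B.a_group 1 2 _ t])
        (use lin_hom_closed[OF f] lin_hom_smult[OF f] in \<open>auto simp: \<mu>(2)[OF A] \<mu>(2)[OF B] tm(2)\<close>)
  qed
  have "flat S ?S"
    unfolding flat_def
  proof (intro conjI lS allI ballI impI inj_onI)
    fix A B :: "'s umodule" and f t t'
    assume f: "f \<in> lin_hom (opp S) A B" and AB: "left_module (opp S) A \<and> left_module (opp S) B \<and> inj_on f (carrier A)"
      and t: "t \<in> carrier (tensor S A ?S)" "t' \<in> carrier (tensor S A ?S)"
      and e: "tensor_map S A ?S B ?S f (\<lambda>m. m) t = tensor_map S A ?S B ?S f (\<lambda>m. m) t'"
    then have A: "left_module (opp S) A" and B: "left_module (opp S) B" and i: "inj_on f (carrier A)" by auto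
    have c: "\<mu> A t \<in> carrier A" "\<mu> A t' \<in> carrier A"
      using hom_in_carrier[OF \<mu>(1)[OF A] t(1)] hom_in_carrier[OF \<mu>(1)[OF A] t(2)] by simp_all
    have "f (\<mu> A t) = f (\<mu> A t')" using nat[OF A B f t(1)] nat[OF A B f t(2)] e by simp
    then have "\<mu> A t = \<mu> A t'" by (rule inj_onD[OF i _ c])
    then have "pure_tensor S A ?S (\<mu> A t) \<one>\<^bsub>S\<^esub> = pure_tensor S A ?S (\<mu> A t') \<one>\<^bsub>S\<^esub>" by simp
    then show "t = t'" unfolding \<mu>i[OF A t(1)] \<mu>i[OF A t(2)] .
  qed
  moreover have "f = g"
    if AB: "fin_presented (opp S) A" "fin_presented (opp S) B" and f: "f \<in> lin_hom (opp S) A B" and g: "g \<in> lin_hom (opp S) A B"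
      and e: "tensor_map S A ?S B ?S f (\<lambda>m. m) = tensor_map S A ?S B ?S g (\<lambda>m. m)" for A B :: "'s umodule" and f g
  proof (rule extensionalityI[of _ "carrier A"])
    have A: "left_module (opp S) A" and B: "left_module (opp S) B" using AB by (auto intro: fin_presented_left_module)
    interpret A: left_module "opp S" A by (rule A)
    interpret T: tensor_product S A ?S by (rule tensor_product.intro[OF A lS])
    show "f \<in> extensional (carrier A)" "g \<in> extensional (carrier A)"
      using lin_hom_PiE[OF f] lin_hom_PiE[OF g] by (auto simp: PiE_def)
    fix x assume x: "x \<in> carrier A"
    have t: "T.pt x \<one>\<^bsub>S\<^esub> \<in> carrier T.T" using T.pt_closed[of x "\<one>\<^bsub>S\<^esub>"] x by simp
    have "\<mu> A (T.pt x \<one>\<^bsub>S\<^esub>) = x" using \<mu>(2)[OF A x, of "\<one>\<^bsub>S\<^esub>"] A.smult_one[OF x] by simp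
    then show "f x = g x" using nat[OF A B f t] nat[OF A B g t] e by simp
  qed
  ultimately show ?thesis by (auto simp: fp_faithfully_flat_def)
qed

lemma comm_group_hom_group:
  assumes "left_module R M" "left_module R X"
  shows "comm_group (hom_group R M X)"
proof -
  interpret M: left_module R M by fact
  interpret X: left_module R X by fact
  have sm: "a \<odot>\<^bsub>X\<^esub> (\<ominus>\<^bsub>X\<^esub> x) = \<ominus>\<^bsub>X\<^esub> (a \<odot>\<^bsub>X\<^esub> x)" if "a \<in> carrier R" "x \<in> carrier X" for a x
  proof (rule X.M.minus_equality[symmetric])
    show "a \<odot>\<^bsub>X\<^esub> (\<ominus>\<^bsub>X\<^esub> x) \<oplus>\<^bsub>X\<^esub> a \<odot>\<^bsub>X\<^esub> x = \<zero>\<^bsub>X\<^esub>"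
      using X.smult_r_distr[of a "\<ominus>\<^bsub>X\<^esub> x" x] that by (simp add: X.M.l_neg)
  qed (use that in \<open>auto intro: X.smult_closed\<close>)
  show ?thesis
  proof (rule comm_groupI)
    fix f assume "f \<in> carrier (hom_group R M X)"
    then have f: "f \<in> lin_hom R M X" by (simp add: hom_group_def)
    have g: "(\<lambda>x\<in>carrier M. \<ominus>\<^bsub>X\<^esub> f x) \<in> lin_hom R M X"
      by (rule lin_homI)
        (auto simp: lin_hom_closed[OF f] lin_hom_add[OF f] lin_hom_smult[OF f] M.smult_closed sm X.M.minus_add X.M.a_comm)
    have "(\<lambda>x\<in>carrier M. \<ominus>\<^bsub>X\<^esub> f x) \<otimes>\<^bsub>hom_group R M X\<^esub> f = \<one>\<^bsub>hom_group R M X\<^esub>"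
      by (auto simp: hom_group_def fun_eq_iff lin_hom_closed[OF f] X.M.l_neg)
    then show "\<exists>g\<in>carrier (hom_group R M X). g \<otimes>\<^bsub>hom_group R M X\<^esub> f = \<one>\<^bsub>hom_group R M X\<^esub>"
      by (intro bexI[of _ "\<lambda>x\<in>carrier M. \<ominus>\<^bsub>X\<^esub> f x"]) (use g in \<open>simp_all add: hom_group_def\<close>)
  next
    fix f assume "f \<in> carrier (hom_group R M X)"
    then have f: "f \<in> lin_hom R M X" by (simp add: hom_group_def)
    show "\<one>\<^bsub>hom_group R M X\<^esub> \<otimes>\<^bsub>hom_group R M X\<^esub> f = f"
      using lin_hom_PiE[OF f] lin_hom_closed[OF f] by (auto simp: hom_group_def fun_eq_iff PiE_def extensional_def)
  next
    fix f g assume "f \<in> carrier (hom_group R M X)" "g \<in> carrier (hom_group R M X)"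
    then have f: "f \<in> lin_hom R M X" and g: "g \<in> lin_hom R M X" by (auto simp: hom_group_def)
    show "f \<otimes>\<^bsub>hom_group R M X\<^esub> g \<in> carrier (hom_group R M X)"
      using lin_hom_sum[OF assms f g] by (simp add: hom_group_def)
    show "f \<otimes>\<^bsub>hom_group R M X\<^esub> g = g \<otimes>\<^bsub>hom_group R M X\<^esub> f"
      by (auto simp: hom_group_def fun_eq_iff lin_hom_closed[OF f] lin_hom_closed[OF g] X.M.a_comm)
    fix h assume "h \<in> carrier (hom_group R M X)"
    then have h: "h \<in> lin_hom R M X" by (simp add: hom_group_def)
    show "f \<otimes>\<^bsub>hom_group R M X\<^esub> g \<otimes>\<^bsub>hom_group R M X\<^esub> h = f \<otimes>\<^bsub>hom_group R M X\<^esub> (g \<otimes>\<^bsub>hom_group R M X\<^esub> h)"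
      by (auto simp: hom_group_def fun_eq_iff lin_hom_closed[OF f] lin_hom_closed[OF g] lin_hom_closed[OF h] X.M.a_assoc)
  qed (use lin_hom_const_zero[OF assms] in \<open>auto simp: hom_group_def\<close>)
qed

lemma trivial_hom_quotient_iff:
  assumes M: "left_module R M" and N: "left_module R N" and X: "left_module R X" and \<alpha>: "\<alpha> \<in> lin_hom R M N"
  shows "trivial_group (hom_group R M X Mod hom_image R M N \<alpha> X) \<longleftrightarrow> lin_hom R M X \<subseteq> hom_image R M N \<alpha> X"
proof -
  interpret G: comm_group "hom_group R M X" by (rule comm_group_hom_group[OF M X])
  interpret H: comm_group "hom_group R N X" by (rule comm_group_hom_group[OF N X])
  let ?I = "hom_image R M N \<alpha> X"
  have "group_hom (hom_group R N X) (hom_group R M X) (\<lambda>h. compose (carrier M) h \<alpha>)"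
    by (intro group_hom.intro group_hom_axioms.intro G.is_group H.is_group homI)
      (use lin_hom_compose[OF \<alpha> _ M] lin_hom_closed[OF \<alpha>] in \<open>auto simp: hom_group_def compose_def fun_eq_iff\<close>)
  then have I: "subgroup ?I (hom_group R M X)"
    using group_hom.subgroup_img_is_subgroup[OF _ group.subgroup_self[OF H.is_group]]
    unfolding hom_image_def by (fastforce simp: hom_group_def)
  let ?Q = "hom_group R M X Mod ?I"
  interpret Q: comm_group ?Q by (rule G.abelian_FactGroup[OF I])
  have "trivial_group ?Q \<longleftrightarrow> (\<forall>h\<in>carrier (hom_group R M X). ?I #>\<^bsub>hom_group R M X\<^esub> h = ?I)"
    unfolding Q.trivial_group_subset carrier_FactGroup one_FactGroup by auto
  also have "\<dots> \<longleftrightarrow> carrier (hom_group R M X) \<subseteq> ?I"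
    using G.coset_join1[OF _ _ I] G.coset_join2[OF _ I] by blast
  finally show ?thesis by (simp add: hom_group_def)
qed

lemma presentation_of:
  assumes "\<G> \<in> fp_functors R"
  obtains M N \<alpha> where "presentation_of R \<G> = (M, N, \<alpha>)" "fin_presented R M" "fin_presented R N" "presents R M N \<alpha> \<G>"
proof -
  have "\<exists>x. case x of (M, N, \<alpha>) \<Rightarrow> M \<in> cObj (fp_mod R) \<and> N \<in> cObj (fp_mod R) \<and> presents R M N \<alpha> \<G>"
    using assms unfolding fp_functors_def by blast
  from someI_ex[OF this]
  have "case presentation_of R \<G> of (M, N, \<alpha>) \<Rightarrow> M \<in> cObj (fp_mod R) \<and> N \<in> cObj (fp_mod R) \<and> presents R M N \<alpha> \<G>"
    unfolding presentation_of_def .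
  then show thesis by (cases "presentation_of R \<G>") (auto intro: that)
qed

lemma (in covdefect) length_sigma_eq_0_iff:
  fixes R :: "('r, 'e) ring_scheme" and \<sigma> :: "'r \<Rightarrow> 's" and M :: "('s, 'm) module"
    and \<G> :: "('r, 'g) mod_functor"
  assumes R: "ring R" and \<sigma>: "\<sigma> \<in> ring_hom R S" and ff: "fp_faithfully_flat S M" and \<G>: "\<G> \<in> fp_functors R"
  shows "length_sigma R S \<sigma> C \<G> = 0 \<longleftrightarrow> trivial_group (fp_eval R \<G> (restrict_scalars \<sigma> M))"
proof -
  obtain A B \<alpha> where pr: "presentation_of R \<G> = (A, B, \<alpha>)" and A: "fin_presented R A" and B: "fin_presented R B"
    and ps: "presents R A B \<alpha> \<G>" using presentation_of[OF \<G>] .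
  have \<alpha>: "\<alpha> \<in> lin_hom R A B" using ps by (simp add: presents_def)
  obtain m n a u where PA: "pres_by R m n a A u" using fin_presented_pres_by[OF A] .
  obtain m' n' b w where PB: "pres_by R m' n' b B w" using fin_presented_pres_by[OF B] .
  note A' = pres_byD[OF PA] and B' = pres_byD[OF PB]
  interpret R: ring R by (rule R)
  have "\<exists>d\<in>UNIV \<rightarrow> carrier R. \<alpha> (u i) = lincomb B n' d w" if "i < n" for i
    using B'(4)[OF lin_hom_closed[OF \<alpha>]] A'(3) that by auto
  then obtain L0 where L0: "\<And>i. i < n \<Longrightarrow> L0 i \<in> UNIV \<rightarrow> carrier R" "\<And>i. i < n \<Longrightarrow> \<alpha> (u i) = lincomb B n' (L0 i) w" by metis
  define L where "L i = (if i < n then L0 i else (\<lambda>_. \<zero>\<^bsub>R\<^esub>))" for i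
  have L: "L \<in> UNIV \<rightarrow> UNIV \<rightarrow> carrier R" using L0(1) by (auto simp: L_def Pi_iff)
  have Lu: "\<alpha> (u i) = lincomb B n' (L i) w" if "i < n" for i using L0(2)[OF that] that by (simp add: L_def)
  have sm: "(\<lambda>i j. \<sigma> (c i j)) \<in> UNIV \<rightarrow> UNIV \<rightarrow> carrier S" if "c \<in> UNIV \<rightarrow> UNIV \<rightarrow> carrier R" for c :: "nat \<Rightarrow> nat \<Rightarrow> 'r"
    using that ring_hom_closed[OF \<sigma>] by auto
  have sA: "scalar_extension R S \<sigma> A" and sB: "scalar_extension R S \<sigma> B"
    by (intro scalar_extension.intro R ringS \<sigma> A' B')+
  interpret sA: scalar_extension R S \<sigma> A by (rule sA)
  interpret sB: scalar_extension R S \<sigma> B by (rule sB)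
  let ?\<sigma>a = "\<lambda>i j. \<sigma> (a i j)" and ?\<sigma>b = "\<lambda>i j. \<sigma> (b i j)" and ?\<sigma>L = "\<lambda>i j. \<sigma> (L i j)"
  interpret P: presentation_data S m n m' n' ?\<sigma>a ?\<sigma>b ?\<sigma>L sA.SM sB.SM "extend_scalars_map R S \<sigma> A B \<alpha>"
    "\<lambda>i. sA.T.pt \<one>\<^bsub>S\<^esub> (u i)" "\<lambda>i. sB.T.pt \<one>\<^bsub>S\<^esub> (w i)"
  proof (rule presentation_data.intro)
    show "left_module S sA.SM" by (rule sA.left_module_SM)
    show "extend_scalars_map R S \<sigma> A B \<alpha> \<in> lin_hom S sA.SM sB.SM" by (rule extend_scalars_map_lin_hom[OF sA sB \<alpha>])
    show "(\<lambda>i. sA.T.pt \<one>\<^bsub>S\<^esub> (u i)) \<in> {..<n} \<rightarrow> carrier sA.SM" using A'(3) sA.T.pt_closed by auto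
    fix X :: "'s umodule" assume "fin_presented S X"
    then have X: "left_module S X" by (rule fin_presented_left_module)
    have rX: "left_module R (restrict_scalars \<sigma> X)" by (rule left_module_restrict_scalars[OF R \<sigma> X])
    show "represents S m n ?\<sigma>a sA.SM (\<lambda>i. sA.T.pt \<one>\<^bsub>S\<^esub> (u i)) X"
      by (rule sA.represents_extend_scalars[OF X A'(3) pres_by_represents[OF PA rX]])
    show "represents S m' n' ?\<sigma>b sB.SM (\<lambda>i. sB.T.pt \<one>\<^bsub>S\<^esub> (w i)) X"
      by (rule sB.represents_extend_scalars[OF X B'(3) pres_by_represents[OF PB rX]])
    fix k assume k: "k \<in> lin_hom S sB.SM X"
    show "tmap n (compose (carrier sA.SM) k (extend_scalars_map R S \<sigma> A B \<alpha>)) (\<lambda>i. sA.T.pt \<one>\<^bsub>S\<^esub> (u i)) =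
        mat_app X n n' ?\<sigma>L (tmap n' k (\<lambda>i. sB.T.pt \<one>\<^bsub>S\<^esub> (w i)))"
      by (rule extend_scalars_map_tuple[OF sA sB \<alpha> A'(3) B'(3) L Lu X k])
  qed
  let ?Q = "\<lambda>X. mat_app X n n' ?\<sigma>L ` sols X m' n' ?\<sigma>b"
  obtain H0 :: "('s, 's uval) mod_functor" and p0 where H0: "tuple_functor S n (\<lambda>X. sols X m n ?\<sigma>a) ?Q H0 p0" and H0fp: "H0 \<in> fp_functors S"
    by (rule ex_solution_functor[OF sm[OF A'(2)] sm[OF B'(2)] sm[OF L] P.compose_sols(3)]) auto
  define H where "H = sigma_star R S \<sigma> \<G>"
  have "H \<in> fp_functors S \<and> presents S sA.SM sB.SM (extend_scalars_map R S \<sigma> A B \<alpha>) H"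
    unfolding H_def sigma_star_def pr prod.case
    by (rule someI[of _ H0]) (use H0fp P.tuple_functor_presents[OF H0] in simp)
  then have Hfp: "H \<in> fp_functors S" and Hpr: "presents S sA.SM sB.SM (extend_scalars_map R S \<sigma> A B \<alpha>) H" by auto
  obtain r where r: "tuple_functor S n (\<lambda>X. sols X m n ?\<sigma>a) ?Q H r" by (rule P.presents_tuple_functor[OF Hfp Hpr])
  have "length_sigma R S \<sigma> C \<G> = 0 \<longleftrightarrow> carrier (CO H) = {\<zero>\<^bsub>CO H\<^esub>}"
    unfolding length_sigma_def H_def[symmetric] by (rule module_length_eq_0[OF CO_left_module[OF Hfp]])
  also have "\<dots> \<longleftrightarrow> sols M m n ?\<sigma>a \<subseteq> mat_app M n n' ?\<sigma>L ` sols M m' n' ?\<sigma>b"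
    by (rule covdefect_zero_iff[OF sm[OF A'(2)] sm[OF B'(2)] sm[OF L] P.compose_sols(3) r Hfp ff])
  also have "\<dots> \<longleftrightarrow> lin_hom R A (restrict_scalars \<sigma> M) \<subseteq> hom_image R A B \<alpha> (restrict_scalars \<sigma> M)"
  proof -
    let ?X = "restrict_scalars \<sigma> M"
    have lM: "left_module S M" using ff by (simp add: fp_faithfully_flat_def flat_def)
    have X: "left_module R ?X" by (rule left_module_restrict_scalars[OF R \<sigma> lM])
    have eA: "sols M m n ?\<sigma>a = (\<lambda>h. tmap n h u) ` lin_hom R A ?X"
      using pres_by_represents[OF PA X] unfolding represents_def bij_betw_def sA.sols_restrict_scalars by simp
    have iA: "inj_on (\<lambda>h. tmap n h u) (lin_hom R A ?X)"
      using pres_by_represents[OF PA X] unfolding represents_def bij_betw_def by simp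
    have eB: "sols M m' n' ?\<sigma>b = (\<lambda>h. tmap n' h w) ` lin_hom R B ?X"
      using pres_by_represents[OF PB X] unfolding represents_def bij_betw_def sA.sols_restrict_scalars by simp
    have "mat_app M n n' ?\<sigma>L (tmap n' k w) = tmap n (compose (carrier A) k \<alpha>) u" if k: "k \<in> lin_hom R B ?X" for k
    proof -
      interpret M: left_module S M by (rule lM)
      have "lincomb M n' (?\<sigma>L i) (tmap n' k w) = k (\<alpha> (u i))" if i: "i < n" for i
      proof -
        have Li: "L i \<in> UNIV \<rightarrow> carrier R" using L by auto
        have "k (\<alpha> (u i)) = lincomb ?X n' (L i) (\<lambda>j. k (w j))"
          unfolding Lu[OF i] by (rule lincomb_lin_hom[OF k B'(1) X Li B'(3)])
        also have "\<dots> = lincomb M n' (?\<sigma>L i) (\<lambda>j. k (w j))" by (rule lincomb_restrict_scalars)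
        also have "\<dots> = lincomb M n' (?\<sigma>L i) (tmap n' k w)"
          by (rule M.lincomb_cong) (use sm[OF L] B'(3) lin_hom_closed[OF k] in \<open>auto simp: Pi_iff\<close>)
        finally show ?thesis by simp
      qed
      then show ?thesis using A'(3) by (auto simp: mat_app_def tmap_def[of n] compose_def fun_eq_iff)
    qed
    then have eI: "mat_app M n n' ?\<sigma>L ` sols M m' n' ?\<sigma>b = (\<lambda>h. tmap n h u) ` hom_image R A B \<alpha> ?X"
      unfolding eB hom_image_def image_image by (rule image_cong[OF refl])
    have "hom_image R A B \<alpha> ?X \<subseteq> lin_hom R A ?X"
      using lin_hom_compose[OF \<alpha> _ A'(1)] by (auto simp: hom_image_def)
    then show ?thesis unfolding eA eI using inj_on_image_mem_iff[OF iA] by blast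
  qed
  also have "\<dots> \<longleftrightarrow> trivial_group (fp_eval R \<G> (restrict_scalars \<sigma> M))"
  proof -
    have lM: "left_module S M" using ff by (simp add: fp_faithfully_flat_def flat_def)
    show ?thesis unfolding fp_eval_def pr prod.case
      by (rule trivial_hom_quotient_iff[OF A'(1) B'(1) left_module_restrict_scalars[OF R \<sigma> lM] \<alpha>, symmetric])
  qed
  finally show ?thesis .
qed

theorem theorem8p10:
  fixes R :: "('r, 'e) ring_scheme" and S :: "('s, 'f) ring_scheme" and \<sigma> :: "'r \<Rightarrow> 's"
    and Covdefect :: "'s covdefect_functor"
  assumes "ring R" and "right_artinian S" and "\<sigma> \<in> ring_hom R S"
    and "is_Covdefect S Covdefect"
  shows "(\<forall>M :: ('s, 'm) module. fp_faithfully_flat S M \<longrightarrow>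
        detects_zero_at R (length_sigma R S \<sigma> Covdefect :: ('r, 'g) mod_functor \<Rightarrow> enat)
          (restrict_scalars \<sigma> M)) \<and>
      detects_zero_at R (length_sigma R S \<sigma> Covdefect :: ('r, 'g) mod_functor \<Rightarrow> enat)
        (restrict_scalars \<sigma> (regular_module S))"
proof -
  have S: "ring S" using assms(2) by (simp add: right_artinian_def)
  obtain \<theta> where \<theta>: "\<forall>N\<in>cObj (right_fp_mod S). cat_iso (right_fp_mod S) (fObj Covdefect (tensor_functor S N)) N (\<theta> N)"
    "\<forall>N\<in>cObj (right_fp_mod S). \<forall>N'\<in>cObj (right_fp_mod S). \<forall>f\<in>cHom (right_fp_mod S) N N'.
        cComp (right_fp_mod S) (fObj Covdefect (tensor_functor S N)) (fObj Covdefect (tensor_functor S N')) N'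
          (\<theta> N') (fArr Covdefect (tensor_functor S N) (tensor_functor S N') (tensor_trans S N N' f)) =
        cComp (right_fp_mod S) (fObj Covdefect (tensor_functor S N)) N N' f (\<theta> N)"
    and ex: "exact_functor (fp_functor_cat S) (right_fp_mod S) Covdefect"
    using assms(4) unfolding is_Covdefect_def by blast
  have "covdefect S Covdefect \<theta>"
    using S ex \<theta> by (intro covdefect.intro) simp_all
  then interpret covdefect S Covdefect \<theta> .
  show ?thesis
    unfolding detects_zero_at_def
    by (intro conjI allI impI ballI length_sigma_eq_0_iff[OF assms(1,3)] fp_faithfully_flat_regular[OF S])
qed

end
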